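(* Let $H$ be a Hopf algebra with invertible antipode over a field $k$, $(\sigma,\delta)$ a modular pair in involution, $M=k_{(\sigma,\delta)}$ the associated one-dimensional stable anti-Yetter-Drinfeld module, and $A$ an $H$-module algebra with an invariant trace $\tau$, i.e. $\tau\in HC^0_{\rm Hopf}(A,k_{(\sigma,\delta)})$. Then the Connes-Moscovici characteristic map $\gamma\colon HC^p_{\rm Hopf}(H,k_{(\sigma,\delta)})\to HC^p(A)$ associated with $\tau$ agrees with the pairing $\smile\colon HC^p_{\rm Hopf}(C,M)\otimes HC^q_{\rm Hopf}(A,M)\to HC^{p+q}(A)$ for $C=H$, $M=k_{(\sigma,\delta)}$ and $q=0$; that is, $\gamma(\xi)=\xi\smile\tau$ for every $p\ge0$ and every $\xi\in HC^p_{\rm Hopf}(H,k_{(\sigma,\delta)})$.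
   Context: Conventions. $k$ is a field, tensor products are over $k$, Sweedler notation is used, $S$ is the antipode of $H$. An $H$-module algebra $A$ satisfies $h(a_1a_2)=(h_{(1)}a_1)(h_{(2)}a_2)$, $h1_A=\varepsilon(h)1_A$. $H$ is an $H$-module coalgebra by left multiplication, and it acts on $A$ by $\phi(h,a)=h(a)$ (this action is equivariant: $h\phi(c,a)=\phi(hc,a)$). $\sigma\in H$ is group-like, $\delta\colon H\to k$ is a character, and $k_{(\sigma,\delta)}=k$ with action $h\cdot1=\delta(h)$ and coaction $1\mapsto\sigma\otimes1$. That $(\sigma,\delta)$ is a modular pair in involution means that $k_{(\sigma,\delta)}$ is a stable anti-Yetter-Drinfeld (SAYD) module, where a left-left SAYD module $M$ satisfies $m_{(-1)}m_{(0)}=m$ and $(hm)_{(-1)}\otimes(hm)_{(0)}=h_{(1)}m_{(-1)}S^{-1}(h_{(3)})\otimes h_{(2)}m_{(0)}$. For an $H$-module coalgebra $C$, $T_n(C,M)=C^{\otimes n+1}\otimes M$ is para-cocyclic ($\tau_n$ invertible but $\tau_n^{n+1}=\mathrm{id}$ not required) with $\partial_0(c^0\otimes\cdots\otimes c^n\otimes m)=c^0_{(1)}\otimes c^0_{(2)}\otimes c^1\otimes\cdots\otimes m$, $\sigma_0(c^0\otimes\cdots\otimes c^n\otimes m)=c^0\otimes\varepsilon(c^1)c^2\otimes\cdots\otimes m$, $\tau_n(c^0\otimes\cdots\otimes c^n\otimes m)=c^1\otimes\cdots\otimes c^n\otimes m_{(-1)}c^0\otimes m_{(0)}$, $\partial_j=\tau_{n+1}^{-j}\partial_0\tau_n^j$,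 $\sigma_j=\tau_{n-1}^{-j}\sigma_0\tau_n^j$. $T_n(A,M)=A^{\otimes n+1}\otimes M$ is para-cyclic with $\partial_0(a_0\otimes\cdots\otimes a_n\otimes m)=a_0a_1\otimes a_2\otimes\cdots\otimes m$, $\sigma_0(a_0\otimes\cdots\otimes m)=a_0\otimes1_A\otimes a_1\otimes\cdots\otimes m$, $\tau_n(a_0\otimes\cdots\otimes a_n\otimes m)=S^{-1}(m_{(-1)})a_n\otimes a_0\otimes\cdots\otimes a_{n-1}\otimes m_{(0)}$, $\partial_j=\tau_{n-1}^j\partial_0\tau_n^{-j}$, $\sigma_j=\tau_{n+1}^j\sigma_0\tau_n^{-j}$. For $X=C$ or $A$: $J_\bullet(X,M)\subseteq T_\bullet(X,M)$ is the smallest para-(co)cyclic $k$-submodule and graded $H$-submodule (diagonal action $L_h$) containing all $[L_h,\tau_n^i](\Psi)+(\tau_n^{n+1}-\mathrm{id})(\Phi)$, $i\in\mathbb Z$; $Q_\bullet=T_\bullet/J_\bullet$; $C_\bullet(X,M)=k\otimes_HQ_\bullet(X,M)$. ${\rm Ext}_\Lambda$ is Yoneda Ext in (co)cyclic $k$-modules; $k_\bullet$ (resp. $k_\bullet^\vee$) is the cocyclic (resp. cyclic) module of the coalgebra (resp. algebra) $k$; $Cyc_\bullet(A)$ is the classical cyclic module of $A$. $HC^p_{\rm Hopf}(C,M)={\rm Ext}^p_\Lambda(k_\bullet,C_\bullet(C,M))$, $HC^q_{\rm Hopf}(A,M)={\rm Ext}^q_\Lambda(C_\bullet(A,M),k_\bullet^\vee)$,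 $HC^n(A)={\rm Ext}^n_\Lambda(Cyc_\bullet(A),k_\bullet^\vee)$. An element of $HC^0_{\rm Hopf}(A,k_{(\sigma,\delta)})$ is the same as a linear functional $\tau$ on $A\cong A\otimes k_{(\sigma,\delta)}$ which descends to $C_0(A,k_{(\sigma,\delta)})$ and satisfies $\tau\partial_0=\tau\partial_1$. Characteristic map. Every element of $C_n(H,k_{(\sigma,\delta)})\cong k\otimes_HT_n(H,k_{(\sigma,\delta)})$ is represented by a sum of elements $1\otimes h^1\otimes\cdots\otimes h^n\,(\otimes\,1)$. The map $\gamma$ is induced on cyclic cohomology by the morphism of cocyclic modules $C_\bullet(H,k_{(\sigma,\delta)})\to{\rm Hom}_k(Cyc_\bullet(A),k)$, $$\gamma_n(1\otimes h^1\otimes\cdots\otimes h^n)(a_0\otimes\cdots\otimes a_n)=\tau(a_0\,h^1(a_1)\cdots h^n(a_n)).$$ Pairing. For cocyclic $X_\bullet$ and cyclic $Y_\bullet$, ${\rm diag\,Hom}_k(X_\bullet,Y_\bullet)=\bigoplus_n{\rm Hom}_k(X_n,Y_n)$ is cyclic with $\partial_jf=\partial_j^Yf\partial_j^X$, $\sigma_jf=\sigma_j^Yf\sigma_j^X$, $\tau_nf=\tau_{n,Y}f\tau_{n,X}$; it is exact in both variables and ${\rm diag\,Hom}_k(k_\bullet,Y_\bullet)\cong Y_\bullet$. With $\alpha_\bullet\colon Cyc_\bullet(A)\to{\rm diag\,Hom}_k(C_\bullet(C,M),C_\bullet(A,M))$ the morphism of cyclic modules induced by $\alpha_n(a_0\otimes\cdots\otimes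 a_n)(c^0\otimes\cdots\otimes c^n\otimes m)=\phi(c^0,a_0)\otimes\cdots\otimes\phi(c^n,a_n)\otimes m$, and $\circ$ the Yoneda (splicing) product ${\rm Ext}^p_\Lambda(X,Y)\otimes{\rm Ext}^q_\Lambda(Y,Z)\to{\rm Ext}^{p+q}_\Lambda(X,Z)$, one sets $\xi\smile\nu={\rm Ext}^{p+q}_\Lambda(\alpha_\bullet,k_\bullet^\vee)({\rm diag\,Hom}_k(\xi,C_\bullet(A,M))\circ\nu)$. *)

theory Defs
  imports "HOL-Algebra.Module" "HOL-Algebra.AbelCoset"
begin

text \<open>
  Everything is relative to a ground field \<open>K\<close> (a HOL-Algebra ring record). A \<open>K\<close>-vector space is
  a \<open>module\<close> record over \<open>K\<close>; a \<open>K\<close>-algebra is such a record whose multiplicative fields are used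
  as well. For a bare vector space the fields \<open>mult\<close> and \<open>one\<close> are irrelevant.
\<close>

section \<open>Vector spaces\<close>

definition mk_module :: "'v set \<Rightarrow> 'v \<Rightarrow> ('v \<Rightarrow> 'v \<Rightarrow> 'v) \<Rightarrow> ('k \<Rightarrow> 'v \<Rightarrow> 'v) \<Rightarrow> ('k, 'v) module" where
  "mk_module C z a s =
     \<lparr>carrier = C, monoid.mult = (\<lambda>_ _. undefined), one = undefined, zero = z, add = a, smult = s\<rparr>"

definition self_module :: "'k ring \<Rightarrow> ('k, 'k) module" where
  "self_module K = \<lparr>carrier = carrier K, monoid.mult = mult K, one = one K, zero = zero K,
                    add = add K, smult = mult K\<rparr>"

definition lin_maps ::
  "'k ring \<Rightarrow> ('k, 'v, 'x) module_scheme \<Rightarrow> ('k, 'w, 'y) module_scheme \<Rightarrow> ('v \<Rightarrow> 'w) set" where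
  "lin_maps K V W =
     {f \<in> carrier V \<rightarrow> carrier W.
        (\<forall>x\<in>carrier V. \<forall>y\<in>carrier V. f (x \<oplus>\<^bsub>V\<^esub> y) = f x \<oplus>\<^bsub>W\<^esub> f y) \<and>
        (\<forall>c\<in>carrier K. \<forall>x\<in>carrier V. f (c \<odot>\<^bsub>V\<^esub> x) = c \<odot>\<^bsub>W\<^esub> f x)}"

definition bilin_maps ::
  "'k ring \<Rightarrow> ('k, 'u, 'x) module_scheme \<Rightarrow> ('k, 'v, 'y) module_scheme \<Rightarrow>
   ('k, 'w, 'z) module_scheme \<Rightarrow> ('u \<Rightarrow> 'v \<Rightarrow> 'w) set" where
  "bilin_maps K U V W =
     {b. (\<forall>u\<in>carrier U. b u \<in> lin_maps K V W) \<and>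
         (\<forall>v\<in>carrier V. (\<lambda>u. b u v) \<in> lin_maps K U W)}"

text \<open>\<open>Hom\<^sub>k(V, W)\<close>; its elements are \<open>undefined\<close> outside \<open>carrier V\<close>.\<close>

definition hom_module ::
  "'k ring \<Rightarrow> ('k, 'v, 'x) module_scheme \<Rightarrow> ('k, 'w, 'y) module_scheme \<Rightarrow> ('k, 'v \<Rightarrow> 'w) module" where
  "hom_module K V W =
     mk_module (lin_maps K V W \<inter> extensional (carrier V))
       (\<lambda>x\<in>carrier V. \<zero>\<^bsub>W\<^esub>)
       (\<lambda>f g. \<lambda>x\<in>carrier V. f x \<oplus>\<^bsub>W\<^esub> g x)
       (\<lambda>c f. \<lambda>x\<in>carrier V. c \<odot>\<^bsub>W\<^esub> f x)"

definition gen_submodule :: "'k ring \<Rightarrow> ('k, 'v) module \<Rightarrow> 'v set \<Rightarrow> 'v set" where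
  "gen_submodule K V S = \<Inter>{N. submodule N K V \<and> S \<subseteq> N}"

definition quot_module :: "('k, 'v) module \<Rightarrow> 'v set \<Rightarrow> ('k, 'v set) module" where
  "quot_module V N =
     mk_module (a_rcosets\<^bsub>V\<^esub> N) N (\<lambda>S T. S <+>\<^bsub>V\<^esub> T) (\<lambda>c S. \<Union>x\<in>S. N +>\<^bsub>V\<^esub> (c \<odot>\<^bsub>V\<^esub> x))"

text \<open>The map \<open>V/N \<rightarrow> W/N'\<close> induced by a map \<open>f : V \<rightarrow> W\<close>.\<close>

definition induced :: "('k, 'w) module \<Rightarrow> 'w set \<Rightarrow> ('v \<Rightarrow> 'w) \<Rightarrow> 'v set \<Rightarrow> 'w set" where
  "induced W N' f S = (\<Union>x\<in>S. N' +>\<^bsub>W\<^esub> f x)"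

definition sum_module :: "('k, 'v) module \<Rightarrow> ('k, 'w) module \<Rightarrow> ('k, 'v \<times> 'w) module" where
  "sum_module V W =
     mk_module (carrier V \<times> carrier W) (\<zero>\<^bsub>V\<^esub>, \<zero>\<^bsub>W\<^esub>)
       (\<lambda>(v, w) (v', w'). (v \<oplus>\<^bsub>V\<^esub> v', w \<oplus>\<^bsub>W\<^esub> w')) (\<lambda>c (v, w). (c \<odot>\<^bsub>V\<^esub> v, c \<odot>\<^bsub>W\<^esub> w))"

text \<open>Transport of structure along an injective relabelling of the elements.\<close>

definition relabel_module :: "('v \<Rightarrow> 'u) \<Rightarrow> ('k, 'v) module \<Rightarrow> ('k, 'u) module" where
  "relabel_module \<iota> V =
     mk_module (\<iota> ` carrier V) (\<iota> \<zero>\<^bsub>V\<^esub>) (\<lambda>x y. \<iota> (inv_into UNIV \<iota> x \<oplus>\<^bsub>V\<^esub> inv_into UNIV \<iota> y)) (\<lambda>c x. \<iota> (c \<odot>\<^bsub>V\<^esub> inv_into UNIV \<iota> x))"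

definition int_pow_map :: "('k, 'v) module \<Rightarrow> ('v \<Rightarrow> 'v) \<Rightarrow> int \<Rightarrow> 'v \<Rightarrow> 'v" where
  "int_pow_map V f i = (if 0 \<le> i then f ^^ nat i else inv_into (carrier V) f ^^ nat (- i))"


section \<open>Tensor products\<close>

text \<open>
  \<open>tens K n V W\<close> is \<open>V\<^sup>\<otimes>\<^sup>n \<otimes> W\<close>: the free \<open>K\<close>-module on the tuples \<open>(vs, w)\<close> with \<open>vs\<close> a list of length
  \<open>n\<close>, modulo the multilinearity relations. Hence \<open>tens K 1 V W\<close> is \<open>V \<otimes> W\<close>.
\<close>

type_synonym ('k, 'v, 'w) tensor = "('v list \<times> 'w \<Rightarrow> 'k) set"

definition free_module :: "'k ring \<Rightarrow> 's set \<Rightarrow> ('k, 's \<Rightarrow> 'k) module" where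
  "free_module K S =
     mk_module {f. (\<forall>s. f s \<in> carrier K) \<and> finite {s. f s \<noteq> \<zero>\<^bsub>K\<^esub>} \<and> {s. f s \<noteq> \<zero>\<^bsub>K\<^esub>} \<subseteq> S}
       (\<lambda>s. \<zero>\<^bsub>K\<^esub>) (\<lambda>f g s. f s \<oplus>\<^bsub>K\<^esub> g s) (\<lambda>c f s. c \<otimes>\<^bsub>K\<^esub> f s)"

definition free_gen :: "'k ring \<Rightarrow> 's \<Rightarrow> 's \<Rightarrow> 'k" where
  "free_gen K s = (\<lambda>t. if t = s then \<one>\<^bsub>K\<^esub> else \<zero>\<^bsub>K\<^esub>)"

definition tens_index ::
  "nat \<Rightarrow> ('k, 'v, 'x) module_scheme \<Rightarrow> ('k, 'w, 'y) module_scheme \<Rightarrow> ('v list \<times> 'w) set" where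
  "tens_index n V W = {(vs, w). length vs = n \<and> set vs \<subseteq> carrier V \<and> w \<in> carrier W}"

abbreviation tens_free ::
  "'k ring \<Rightarrow> nat \<Rightarrow> ('k, 'v, 'x) module_scheme \<Rightarrow> ('k, 'w, 'y) module_scheme \<Rightarrow>
   ('k, 'v list \<times> 'w \<Rightarrow> 'k) module" where
  "tens_free K n V W \<equiv> free_module K (tens_index n V W)"

definition tens_rels ::
  "'k ring \<Rightarrow> nat \<Rightarrow> ('k, 'v, 'x) module_scheme \<Rightarrow> ('k, 'w, 'y) module_scheme \<Rightarrow>
   ('v list \<times> 'w \<Rightarrow> 'k) set" where
  "tens_rels K n V W =
     (let F = tens_free K n V W; e = free_gen K in
        {(e (vs[i := x \<oplus>\<^bsub>V\<^esub> y], w) \<ominus>\<^bsub>F\<^esub> e (vs[i := x], w)) \<ominus>\<^bsub>F\<^esub> e (vs[i := y], w) | vs w i x y.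
           (vs, w) \<in> tens_index n V W \<and> i < n \<and> x \<in> carrier V \<and> y \<in> carrier V} \<union>
        {e (vs[i := c \<odot>\<^bsub>V\<^esub> x], w) \<ominus>\<^bsub>F\<^esub> (c \<odot>\<^bsub>F\<^esub> e (vs[i := x], w)) | vs w i c x.
           (vs, w) \<in> tens_index n V W \<and> i < n \<and> c \<in> carrier K \<and> x \<in> carrier V} \<union>
        {(e (vs, x \<oplus>\<^bsub>W\<^esub> y) \<ominus>\<^bsub>F\<^esub> e (vs, x)) \<ominus>\<^bsub>F\<^esub> e (vs, y) | vs x y.
           (vs, x) \<in> tens_index n V W \<and> (vs, y) \<in> tens_index n V W} \<union>
        {e (vs, c \<odot>\<^bsub>W\<^esub> x) \<ominus>\<^bsub>F\<^esub> (c \<odot>\<^bsub>F\<^esub> e (vs, x)) | vs c x.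
           (vs, x) \<in> tens_index n V W \<and> c \<in> carrier K})"

definition tens_ker ::
  "'k ring \<Rightarrow> nat \<Rightarrow> ('k, 'v, 'x) module_scheme \<Rightarrow> ('k, 'w, 'y) module_scheme \<Rightarrow>
   ('v list \<times> 'w \<Rightarrow> 'k) set" where
  "tens_ker K n V W = gen_submodule K (tens_free K n V W) (tens_rels K n V W)"

definition tens ::
  "'k ring \<Rightarrow> nat \<Rightarrow> ('k, 'v, 'x) module_scheme \<Rightarrow> ('k, 'w, 'y) module_scheme \<Rightarrow>
   ('k, ('k, 'v, 'w) tensor) module" where
  "tens K n V W = quot_module (tens_free K n V W) (tens_ker K n V W)"

text \<open>The pure tensor \<open>v\<^sub>1 \<otimes> \<dots> \<otimes> v\<^sub>n \<otimes> w\<close>.\<close>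

definition tprod ::
  "'k ring \<Rightarrow> ('k, 'v, 'x) module_scheme \<Rightarrow> ('k, 'w, 'y) module_scheme \<Rightarrow> 'v list \<Rightarrow> 'w \<Rightarrow>
   ('k, 'v, 'w) tensor" where
  "tprod K V W vs w =
     tens_ker K (length vs) V W +>\<^bsub>tens_free K (length vs) V W\<^esub> free_gen K (vs, w)"

text \<open>
  The linear map \<open>V\<^sup>\<otimes>\<^sup>n \<otimes> W \<rightarrow> U\<close> determined by a multilinear \<open>f\<close>: a representing formal linear
  combination of tuples is evaluated through \<open>f\<close>. For \<open>n = 1\<close> this expresses Sweedler sums:
  \<open>sweedler K U f (\<Delta> h)\<close> is the sum of the \<open>f h\<^sub>(\<^sub>1\<^sub>) h\<^sub>(\<^sub>2\<^sub>)\<close>.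
\<close>

definition tlift ::
  "'k ring \<Rightarrow> ('k, 'u, 'x) module_scheme \<Rightarrow> ('v list \<Rightarrow> 'w \<Rightarrow> 'u) \<Rightarrow> ('k, 'v, 'w) tensor \<Rightarrow> 'u" where
  "tlift K U f t =
     (let p = (SOME p. p \<in> t)
      in \<Oplus>\<^bsub>U\<^esub>s\<in>{s. p s \<noteq> \<zero>\<^bsub>K\<^esub>}. p s \<odot>\<^bsub>U\<^esub> f (fst s) (snd s))"

definition sweedler ::
  "'k ring \<Rightarrow> ('k, 'u, 'x) module_scheme \<Rightarrow> ('v \<Rightarrow> 'w \<Rightarrow> 'u) \<Rightarrow> ('k, 'v, 'w) tensor \<Rightarrow> 'u" where
  "sweedler K U f t = tlift K U (\<lambda>vs w. f (hd vs) w) t"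


section \<open>Hopf algebras, module algebras, SAYD modules\<close>

record ('k, 'c) coalg = "('k, 'c) module" +
  comult :: "'c \<Rightarrow> ('k, 'c, 'c) tensor"
  counit :: "'c \<Rightarrow> 'k"

record ('k, 'h) hopf = "('k, 'h) coalg" +
  antipode :: "'h \<Rightarrow> 'h"

text \<open>A left \<open>H\<close>-module and left \<open>H\<close>-comodule on one vector space.\<close>

record ('k, 'h, 'm) hmodcomod = "('k, 'm) module" +
  hact :: "'h \<Rightarrow> 'm \<Rightarrow> 'm"
  coact :: "'m \<Rightarrow> ('k, 'h, 'm) tensor"

definition k_algebra :: "'k ring \<Rightarrow> ('k, 'a, 'x) module_scheme \<Rightarrow> bool" where
  "k_algebra K A \<longleftrightarrow>
     field K \<and> ring A \<and> module K A \<and> monoid.mult A \<in> bilin_maps K A A A"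

definition coalgebra :: "'k ring \<Rightarrow> ('k, 'c, 'x) coalg_scheme \<Rightarrow> bool" where
  "coalgebra K C \<longleftrightarrow>
     field K \<and> module K C \<and>
     comult C \<in> lin_maps K C (tens K 1 C C) \<and>
     counit C \<in> lin_maps K C (self_module K) \<and>
     (\<forall>c\<in>carrier C.
        sweedler K (tens K 2 C C)
          (\<lambda>x y. sweedler K (tens K 2 C C) (\<lambda>y1 y2. tprod K C C [x, y1] y2) (comult C y)) (comult C c)
        = sweedler K (tens K 2 C C)
          (\<lambda>x y. sweedler K (tens K 2 C C) (\<lambda>x1 x2. tprod K C C [x1, x2] y) (comult C x)) (comult C c)) \<and>
     (\<forall>c\<in>carrier C. sweedler K C (\<lambda>x y. counit C x \<odot>\<^bsub>C\<^esub> y) (comult C c) = c) \<and>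
     (\<forall>c\<in>carrier C. sweedler K C (\<lambda>x y. counit C y \<odot>\<^bsub>C\<^esub> x) (comult C c) = c)"

text \<open>Algebra maps \<open>H \<rightarrow> k\<close>.\<close>

definition character :: "'k ring \<Rightarrow> ('k, 'h, 'x) module_scheme \<Rightarrow> ('h \<Rightarrow> 'k) \<Rightarrow> bool" where
  "character K H \<delta> \<longleftrightarrow>
     \<delta> \<in> lin_maps K H (self_module K) \<and> \<delta> \<one>\<^bsub>H\<^esub> = \<one>\<^bsub>K\<^esub> \<and>
     (\<forall>g\<in>carrier H. \<forall>h\<in>carrier H. \<delta> (g \<otimes>\<^bsub>H\<^esub> h) = \<delta> g \<otimes>\<^bsub>K\<^esub> \<delta> h)"

definition hopf_algebra :: "'k ring \<Rightarrow> ('k, 'h) hopf \<Rightarrow> bool" where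
  "hopf_algebra K H \<longleftrightarrow>
     k_algebra K H \<and> coalgebra K H \<and> character K H (counit H) \<and>
     comult H \<one>\<^bsub>H\<^esub> = tprod K H H [\<one>\<^bsub>H\<^esub>] \<one>\<^bsub>H\<^esub> \<and>
     (\<forall>g\<in>carrier H. \<forall>h\<in>carrier H.
        comult H (g \<otimes>\<^bsub>H\<^esub> h) =
        sweedler K (tens K 1 H H)
          (\<lambda>g1 g2. sweedler K (tens K 1 H H)
             (\<lambda>h1 h2. tprod K H H [g1 \<otimes>\<^bsub>H\<^esub> h1] (g2 \<otimes>\<^bsub>H\<^esub> h2)) (comult H h)) (comult H g)) \<and>
     antipode H \<in> lin_maps K H H \<and>
     (\<forall>h\<in>carrier H.
        sweedler K H (\<lambda>x y. antipode H x \<otimes>\<^bsub>H\<^esub> y) (comult H h) = counit H h \<odot>\<^bsub>H\<^esub> \<one>\<^bsub>H\<^esub> \<and>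
        sweedler K H (\<lambda>x y. x \<otimes>\<^bsub>H\<^esub> antipode H y) (comult H h) = counit H h \<odot>\<^bsub>H\<^esub> \<one>\<^bsub>H\<^esub>)"

definition antipode_inv :: "('k, 'h) hopf \<Rightarrow> 'h \<Rightarrow> 'h" where
  "antipode_inv H = inv_into (carrier H) (antipode H)"

definition group_like :: "'k ring \<Rightarrow> ('k, 'h) hopf \<Rightarrow> 'h \<Rightarrow> bool" where
  "group_like K H \<sigma> \<longleftrightarrow>
     \<sigma> \<in> carrier H \<and> comult H \<sigma> = tprod K H H [\<sigma>] \<sigma> \<and> counit H \<sigma> = \<one>\<^bsub>K\<^esub>"

definition left_module ::
  "'k ring \<Rightarrow> ('k, 'h) hopf \<Rightarrow> ('k, 'm, 'x) module_scheme \<Rightarrow> ('h \<Rightarrow> 'm \<Rightarrow> 'm) \<Rightarrow> bool" where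
  "left_module K H M act \<longleftrightarrow>
     module K M \<and> act \<in> bilin_maps K H M M \<and>
     (\<forall>x\<in>carrier M. act \<one>\<^bsub>H\<^esub> x = x) \<and>
     (\<forall>g\<in>carrier H. \<forall>h\<in>carrier H. \<forall>x\<in>carrier M. act (g \<otimes>\<^bsub>H\<^esub> h) x = act g (act h x))"

definition module_algebra ::
  "'k ring \<Rightarrow> ('k, 'h) hopf \<Rightarrow> ('k, 'a) module \<Rightarrow> ('h \<Rightarrow> 'a \<Rightarrow> 'a) \<Rightarrow> bool" where
  "module_algebra K H A act \<longleftrightarrow>
     k_algebra K A \<and> left_module K H A act \<and>
     (\<forall>h\<in>carrier H. \<forall>a\<in>carrier A. \<forall>b\<in>carrier A.
        act h (a \<otimes>\<^bsub>A\<^esub> b) = sweedler K A (\<lambda>x y. act x a \<otimes>\<^bsub>A\<^esub> act y b) (comult H h)) \<and>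
     (\<forall>h\<in>carrier H. act h \<one>\<^bsub>A\<^esub> = counit H h \<odot>\<^bsub>A\<^esub> \<one>\<^bsub>A\<^esub>)"

text \<open>\<open>iter_comult K H n h\<close> is \<open>h\<^sub>(\<^sub>1\<^sub>) \<otimes> \<dots> \<otimes> h\<^sub>(\<^sub>n\<^sub>+\<^sub>1\<^sub>)\<close> in \<open>H\<^sup>\<otimes>\<^sup>n \<otimes> H\<close>.\<close>

fun iter_comult :: "'k ring \<Rightarrow> ('k, 'h) hopf \<Rightarrow> nat \<Rightarrow> 'h \<Rightarrow> ('k, 'h, 'h) tensor" where
  "iter_comult K H 0 h = tprod K H H [] h"
| "iter_comult K H (Suc n) h =
     sweedler K (tens K (Suc n) H H)
       (\<lambda>x y. tlift K (tens K (Suc n) H H) (\<lambda>xs z. tprod K H H (x # xs) z) (iter_comult K H n y))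
       (comult H h)"

definition left_comodule :: "'k ring \<Rightarrow> ('k, 'h) hopf \<Rightarrow> ('k, 'h, 'm) hmodcomod \<Rightarrow> bool" where
  "left_comodule K H M \<longleftrightarrow>
     module K M \<and> coact M \<in> lin_maps K M (tens K 1 H M) \<and>
     (\<forall>m\<in>carrier M.
        sweedler K (tens K 2 H M)
          (\<lambda>x m0. sweedler K (tens K 2 H M) (\<lambda>x1 x2. tprod K H M [x1, x2] m0) (comult H x)) (coact M m)
        = sweedler K (tens K 2 H M)
          (\<lambda>x m0. sweedler K (tens K 2 H M) (\<lambda>y m1. tprod K H M [x, y] m1) (coact M m0)) (coact M m)) \<and>
     (\<forall>m\<in>carrier M. sweedler K M (\<lambda>x m0. counit H x \<odot>\<^bsub>M\<^esub> m0) (coact M m) = m)"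

definition SAYD :: "'k ring \<Rightarrow> ('k, 'h) hopf \<Rightarrow> ('k, 'h, 'm) hmodcomod \<Rightarrow> bool" where
  "SAYD K H M \<longleftrightarrow>
     left_module K H M (hact M) \<and> left_comodule K H M \<and>
     (\<forall>m\<in>carrier M. sweedler K M (\<lambda>x m0. hact M x m0) (coact M m) = m) \<and>
     (\<forall>h\<in>carrier H. \<forall>m\<in>carrier M.
        coact M (hact M h m) =
        tlift K (tens K 1 H M)
          (\<lambda>hs h3. sweedler K (tens K 1 H M)
             (\<lambda>x m0. tprod K H M [hs ! 0 \<otimes>\<^bsub>H\<^esub> x \<otimes>\<^bsub>H\<^esub> antipode_inv H h3] (hact M (hs ! 1) m0))
             (coact M m))
          (iter_comult K H 2 h))"

definition k_sigma_delta :: "'k ring \<Rightarrow> ('k, 'h) hopf \<Rightarrow> 'h \<Rightarrow> ('h \<Rightarrow> 'k) \<Rightarrow> ('k, 'h, 'k) hmodcomod" where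
  "k_sigma_delta K H \<sigma> \<delta> =
     module.extend (self_module K)
       \<lparr>hact = (\<lambda>h m. \<delta> h \<otimes>\<^bsub>K\<^esub> m), coact = (\<lambda>m. tprod K H (self_module K) [\<sigma>] m)\<rparr>"

definition modular_pair_in_involution ::
  "'k ring \<Rightarrow> ('k, 'h) hopf \<Rightarrow> 'h \<Rightarrow> ('h \<Rightarrow> 'k) \<Rightarrow> bool" where
  "modular_pair_in_involution K H \<sigma> \<delta> \<longleftrightarrow>
     group_like K H \<sigma> \<and> character K H \<delta> \<and> SAYD K H (k_sigma_delta K H \<sigma> \<delta>)"


section \<open>Cyclic and cocyclic modules\<close>

text \<open>
  One record serves cyclic and cocyclic modules. All operators are indexed by the degree of their
  \<^emph>\<open>source\<close>: \<open>face X n j\<close> is \<open>\<partial>\<^sub>j\<close> on \<open>X\<^sub>n\<close>, \<open>degen X n j\<close> is \<open>\<sigma>\<^sub>j\<close> on \<open>X\<^sub>n\<close>, \<open>cyc X n\<close> is \<open>\<tau>\<^sub>n\<close>.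
  \<open>face_ok\<close> and \<open>degen_ok\<close> describe the existing indices.
\<close>

datatype variance = Cyclic | Cocyclic

record ('k, 'v) cmod =
  comp :: "nat \<Rightarrow> ('k, 'v) module"
  face :: "nat \<Rightarrow> nat \<Rightarrow> 'v \<Rightarrow> 'v"
  degen :: "nat \<Rightarrow> nat \<Rightarrow> 'v \<Rightarrow> 'v"
  cyc :: "nat \<Rightarrow> 'v \<Rightarrow> 'v"

fun face_deg :: "variance \<Rightarrow> nat \<Rightarrow> nat" where
  "face_deg Cyclic n = n - 1"
| "face_deg Cocyclic n = Suc n"

fun degen_deg :: "variance \<Rightarrow> nat \<Rightarrow> nat" where
  "degen_deg Cyclic n = Suc n"
| "degen_deg Cocyclic n = n - 1"

fun face_ok :: "variance \<Rightarrow> nat \<Rightarrow> nat \<Rightarrow> bool" where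
  "face_ok Cyclic n j \<longleftrightarrow> 1 \<le> n \<and> j \<le> n"
| "face_ok Cocyclic n j \<longleftrightarrow> j \<le> Suc n"

fun degen_ok :: "variance \<Rightarrow> nat \<Rightarrow> nat \<Rightarrow> bool" where
  "degen_ok Cyclic n j \<longleftrightarrow> j \<le> n"
| "degen_ok Cocyclic n j \<longleftrightarrow> j < n"

fun cyclic_relations :: "variance \<Rightarrow> ('k, 'v) cmod \<Rightarrow> bool" where
  "cyclic_relations Cyclic X \<longleftrightarrow>
     (\<forall>n. \<forall>x\<in>carrier (comp X n).
        (\<forall>i j. 2 \<le> n \<and> i < j \<and> j \<le> n \<longrightarrow>
           face X (n - 1) i (face X n j x) = face X (n - 1) (j - 1) (face X n i x)) \<and>
        (\<forall>i j. i \<le> j \<and> j \<le> n \<longrightarrow>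
           degen X (Suc n) i (degen X n j x) = degen X (Suc n) (Suc j) (degen X n i x)) \<and>
        (\<forall>i j. j \<le> n \<and> i \<le> Suc n \<longrightarrow>
           face X (Suc n) i (degen X n j x) =
             (if i < j then degen X (n - 1) (j - 1) (face X n i x)
              else if i = j \<or> i = Suc j then x
              else degen X (n - 1) j (face X n (i - 1) x))) \<and>
        (\<forall>i. 1 \<le> i \<and> i \<le> n \<longrightarrow> face X n i (cyc X n x) = cyc X (n - 1) (face X n (i - 1) x)) \<and>
        (1 \<le> n \<longrightarrow> face X n 0 (cyc X n x) = face X n n x) \<and>
        (\<forall>i. 1 \<le> i \<and> i \<le> n \<longrightarrow> degen X n i (cyc X n x) = cyc X (Suc n) (degen X n (i - 1) x)) \<and>
        degen X n 0 (cyc X n x) = cyc X (Suc n) (cyc X (Suc n) (degen X n n x)) \<and>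
        (cyc X n ^^ Suc n) x = x)"
| "cyclic_relations Cocyclic X \<longleftrightarrow>
     (\<forall>n. \<forall>x\<in>carrier (comp X n).
        (\<forall>i j. i < j \<and> j \<le> n + 2 \<longrightarrow>
           face X (Suc n) j (face X n i x) = face X (Suc n) i (face X n (j - 1) x)) \<and>
        (\<forall>i j. i \<le> j \<and> Suc j < n \<longrightarrow>
           degen X (n - 1) j (degen X n i x) = degen X (n - 1) i (degen X n (Suc j) x)) \<and>
        (\<forall>i j. j \<le> n \<and> i \<le> Suc n \<longrightarrow>
           degen X (Suc n) j (face X n i x) =
             (if i < j then face X (n - 1) i (degen X n (j - 1) x)
              else if i = j \<or> i = Suc j then x
              else face X (n - 1) (i - 1) (degen X n j x))) \<and>
        (\<forall>i. 1 \<le> i \<and> i \<le> Suc n \<longrightarrow> cyc X (Suc n) (face X n i x) = face X n (i - 1) (cyc X n x)) \<and>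
        cyc X (Suc n) (face X n 0 x) = face X n (Suc n) x \<and>
        (\<forall>i. 1 \<le> i \<and> i < n \<longrightarrow> cyc X (n - 1) (degen X n i x) = degen X n (i - 1) (cyc X n x)) \<and>
        (1 \<le> n \<longrightarrow> cyc X (n - 1) (degen X n 0 x) = degen X n (n - 1) (cyc X n (cyc X n x))) \<and>
        (cyc X n ^^ Suc n) x = x)"

definition cyclic_module :: "'k ring \<Rightarrow> variance \<Rightarrow> ('k, 'v) cmod \<Rightarrow> bool" where
  "cyclic_module K v X \<longleftrightarrow>
     (\<forall>n. module K (comp X n)) \<and>
     (\<forall>n j. face_ok v n j \<longrightarrow> face X n j \<in> lin_maps K (comp X n) (comp X (face_deg v n))) \<and>
     (\<forall>n j. degen_ok v n j \<longrightarrow> degen X n j \<in> lin_maps K (comp X n) (comp X (degen_deg v n))) \<and>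
     (\<forall>n. cyc X n \<in> lin_maps K (comp X n) (comp X n)) \<and>
     cyclic_relations v X"

definition cmod_hom ::
  "'k ring \<Rightarrow> variance \<Rightarrow> ('k, 'v) cmod \<Rightarrow> ('k, 'w) cmod \<Rightarrow> (nat \<Rightarrow> 'v \<Rightarrow> 'w) set" where
  "cmod_hom K v X Y =
     {f. (\<forall>n. f n \<in> lin_maps K (comp X n) (comp Y n)) \<and>
         (\<forall>n j. face_ok v n j \<longrightarrow>
            (\<forall>x\<in>carrier (comp X n). f (face_deg v n) (face X n j x) = face Y n j (f n x))) \<and>
         (\<forall>n j. degen_ok v n j \<longrightarrow>
            (\<forall>x\<in>carrier (comp X n). f (degen_deg v n) (degen X n j x) = degen Y n j (f n x))) \<and>
         (\<forall>n. \<forall>x\<in>carrier (comp X n). f n (cyc X n x) = cyc Y n (f n x))}"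

text \<open>
  \<open>k\<^sub>\<bullet>\<close> and its dual: \<open>k\<^sup>\<otimes>\<^sup>n\<^sup>+\<^sup>1\<close> is identified with \<open>k\<close>, and all structure maps become the identity.
\<close>

definition const_cmod :: "'k ring \<Rightarrow> ('k, 'k) cmod" where
  "const_cmod K =
     \<lparr>comp = (\<lambda>n. self_module K), face = (\<lambda>n j x. x), degen = (\<lambda>n j x. x), cyc = (\<lambda>n x. x)\<rparr>"

definition cmod_relabel :: "('v \<Rightarrow> 'u) \<Rightarrow> ('k, 'v) cmod \<Rightarrow> ('k, 'u) cmod" where
  "cmod_relabel \<iota> X =
     \<lparr>comp = (\<lambda>n. relabel_module \<iota> (comp X n)),
      face = (\<lambda>n j x. \<iota> (face X n j (inv_into UNIV \<iota> x))),
      degen = (\<lambda>n j x. \<iota> (degen X n j (inv_into UNIV \<iota> x))),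
      cyc = (\<lambda>n x. \<iota> (cyc X n (inv_into UNIV \<iota> x)))\<rparr>"

definition cmod_quot :: "variance \<Rightarrow> ('k, 'v) cmod \<Rightarrow> (nat \<Rightarrow> 'v set) \<Rightarrow> ('k, 'v set) cmod" where
  "cmod_quot v X N =
     \<lparr>comp = (\<lambda>n. quot_module (comp X n) (N n)),
      face = (\<lambda>n j. induced (comp X (face_deg v n)) (N (face_deg v n)) (face X n j)),
      degen = (\<lambda>n j. induced (comp X (degen_deg v n)) (N (degen_deg v n)) (degen X n j)),
      cyc = (\<lambda>n. induced (comp X n) (N n) (cyc X n))\<rparr>"

definition cmod_sum :: "('k, 'v) cmod \<Rightarrow> ('k, 'w) cmod \<Rightarrow> ('k, 'v \<times> 'w) cmod" where
  "cmod_sum X Y =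
     \<lparr>comp = (\<lambda>n. sum_module (comp X n) (comp Y n)),
      face = (\<lambda>n j. map_prod (face X n j) (face Y n j)),
      degen = (\<lambda>n j. map_prod (degen X n j) (degen Y n j)),
      cyc = (\<lambda>n. map_prod (cyc X n) (cyc Y n))\<rparr>"

text \<open>Pull-back of \<open>r : F \<rightarrow> Y \<leftarrow> X : f\<close>, and push-out of \<open>g : Z \<leftarrow> Y \<rightarrow> E : i\<close>.\<close>

definition cmod_pullback ::
  "('k, 'w) cmod \<Rightarrow> ('k, 'x) cmod \<Rightarrow> (nat \<Rightarrow> 'w \<Rightarrow> 'y) \<Rightarrow> (nat \<Rightarrow> 'x \<Rightarrow> 'y) \<Rightarrow> ('k, 'w \<times> 'x) cmod" where
  "cmod_pullback F X r f =
     (cmod_sum F X)\<lparr>comp :=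
        (\<lambda>n. (comp (cmod_sum F X) n)\<lparr>carrier :=
           {(w, x). w \<in> carrier (comp F n) \<and> x \<in> carrier (comp X n) \<and> r n w = f n x}\<rparr>)\<rparr>"

definition pushout_rel ::
  "('k, 'y) cmod \<Rightarrow> ('k, 'e) cmod \<Rightarrow> (nat \<Rightarrow> 'y \<Rightarrow> 'z) \<Rightarrow> (nat \<Rightarrow> 'y \<Rightarrow> 'e) \<Rightarrow> nat \<Rightarrow> ('z \<times> 'e) set" where
  "pushout_rel Y E g i n = (\<lambda>y. (g n y, \<ominus>\<^bsub>comp E n\<^esub> i n y)) ` carrier (comp Y n)"

definition cmod_pushout ::
  "variance \<Rightarrow> ('k, 'y) cmod \<Rightarrow> ('k, 'z) cmod \<Rightarrow> ('k, 'e) cmod \<Rightarrow> (nat \<Rightarrow> 'y \<Rightarrow> 'z) \<Rightarrow> (nat \<Rightarrow> 'y \<Rightarrow> 'e) \<Rightarrow>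
   ('k, ('z \<times> 'e) set) cmod" where
  "cmod_pushout v Y Z E g i = cmod_quot v (cmod_sum Z E) (pushout_rel Y E g i)"

text \<open>The cocyclic module \<open>Hom\<^sub>k(X\<^sub>\<bullet>, k)\<close> of a cyclic module \<open>X\<^sub>\<bullet>\<close>.\<close>

definition dual_cmod :: "'k ring \<Rightarrow> ('k, 'x) cmod \<Rightarrow> ('k, 'x \<Rightarrow> 'k) cmod" where
  "dual_cmod K X =
     \<lparr>comp = (\<lambda>n. hom_module K (comp X n) (self_module K)),
      face = (\<lambda>n j f. \<lambda>x\<in>carrier (comp X (Suc n)). f (face X (Suc n) j x)),
      degen = (\<lambda>n j f. \<lambda>x\<in>carrier (comp X (n - 1)). f (degen X (n - 1) j x)),
      cyc = (\<lambda>n f. \<lambda>x\<in>carrier (comp X n). f (cyc X n x))\<rparr>"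

text \<open>The cyclic module \<open>diag Hom\<^sub>k(X\<^sub>\<bullet>, Y\<^sub>\<bullet>)\<close> of a cocyclic \<open>X\<^sub>\<bullet>\<close> and a cyclic \<open>Y\<^sub>\<bullet>\<close>.\<close>

definition diag_hom :: "'k ring \<Rightarrow> ('k, 'x) cmod \<Rightarrow> ('k, 'y) cmod \<Rightarrow> ('k, 'x \<Rightarrow> 'y) cmod" where
  "diag_hom K X Y =
     \<lparr>comp = (\<lambda>n. hom_module K (comp X n) (comp Y n)),
      face = (\<lambda>n j f. \<lambda>x\<in>carrier (comp X (n - 1)). face Y n j (f (face X (n - 1) j x))),
      degen = (\<lambda>n j f. \<lambda>x\<in>carrier (comp X (Suc n)). degen Y n j (f (degen X (Suc n) j x))),
      cyc = (\<lambda>n f. \<lambda>x\<in>carrier (comp X n). cyc Y n (f (cyc X n x)))\<rparr>"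


section \<open>Yoneda Ext\<close>

text \<open>
  Representatives of elements of \<open>Ext\<^sup>p(X, Y)\<close>: for \<open>p = 0\<close> a morphism \<open>X \<rightarrow> Y\<close>; for \<open>p \<ge> 1\<close>
  (\<open>YSeq p E i d q\<close>) an exact sequence
  \<open>0 \<rightarrow> Y \<rightarrow> E\<^sub>0 \<rightarrow> \<dots> \<rightarrow> E\<^sub>p\<^sub>-\<^sub>1 \<rightarrow> X \<rightarrow> 0\<close> with maps \<open>i : Y \<rightarrow> E\<^sub>0\<close>, \<open>d j : E\<^sub>j \<rightarrow> E\<^sub>j\<^sub>+\<^sub>1\<close>, \<open>q : E\<^sub>p\<^sub>-\<^sub>1 \<rightarrow> X\<close>.
  The type variable \<open>'e\<close> is the universe holding the elements of the middle terms.
\<close>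

datatype ('k, 'x, 'y, 'e) yext =
    YHom "nat \<Rightarrow> 'x \<Rightarrow> 'y"
  | YSeq nat "nat \<Rightarrow> ('k, 'e) cmod" "nat \<Rightarrow> 'y \<Rightarrow> 'e" "nat \<Rightarrow> nat \<Rightarrow> 'e \<Rightarrow> 'e" "nat \<Rightarrow> 'e \<Rightarrow> 'x"

fun yext_exact ::
  "('k, 'x) cmod \<Rightarrow> ('k, 'y) cmod \<Rightarrow> nat \<Rightarrow> (nat \<Rightarrow> ('k, 'e) cmod) \<Rightarrow>
   (nat \<Rightarrow> 'y \<Rightarrow> 'e) \<Rightarrow> (nat \<Rightarrow> nat \<Rightarrow> 'e \<Rightarrow> 'e) \<Rightarrow> (nat \<Rightarrow> 'e \<Rightarrow> 'x) \<Rightarrow> bool" where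
  "yext_exact X Y p E i d q \<longleftrightarrow>
     (\<forall>n. inj_on (i n) (carrier (comp Y n)) \<and>
          q n ` carrier (comp (E (p - 1)) n) = carrier (comp X n) \<and>
          (\<forall>j<p.
             (if j = 0 then i n ` carrier (comp Y n) else d (j - 1) n ` carrier (comp (E (j - 1)) n)) =
             {x \<in> carrier (comp (E j) n).
                if Suc j = p then q n x = \<zero>\<^bsub>comp X n\<^esub> else d j n x = \<zero>\<^bsub>comp (E (Suc j)) n\<^esub>}))"

fun yext_ok ::
  "'k ring \<Rightarrow> variance \<Rightarrow> nat \<Rightarrow> ('k, 'x) cmod \<Rightarrow> ('k, 'y) cmod \<Rightarrow> ('k, 'x, 'y, 'e) yext \<Rightarrow> bool" where
  "yext_ok K v p X Y (YHom f) \<longleftrightarrow>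
     p = 0 \<and> cyclic_module K v X \<and> cyclic_module K v Y \<and> f \<in> cmod_hom K v X Y"
| "yext_ok K v p X Y (YSeq m E i d q) \<longleftrightarrow>
     0 < p \<and> m = p \<and> cyclic_module K v X \<and> cyclic_module K v Y \<and>
     (\<forall>j<p. cyclic_module K v (E j)) \<and>
     i \<in> cmod_hom K v Y (E 0) \<and>
     (\<forall>j. Suc j < p \<longrightarrow> d j \<in> cmod_hom K v (E j) (E (Suc j))) \<and>
     q \<in> cmod_hom K v (E (p - 1)) X \<and>
     yext_exact X Y p E i d q"

text \<open>Morphisms of sequences that are the identity on \<open>X\<close> and \<open>Y\<close>.\<close>

fun yext_step ::
  "'k ring \<Rightarrow> variance \<Rightarrow> ('k, 'x) cmod \<Rightarrow> ('k, 'y) cmod \<Rightarrow>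
   ('k, 'x, 'y, 'e) yext \<Rightarrow> ('k, 'x, 'y, 'e) yext \<Rightarrow> bool" where
  "yext_step K v X Y (YHom f) (YHom f') \<longleftrightarrow> (\<forall>n. \<forall>x\<in>carrier (comp X n). f n x = f' n x)"
| "yext_step K v X Y (YSeq p E i d q) (YSeq p' E' i' d' q') \<longleftrightarrow>
     p' = p \<and>
     (\<exists>g. (\<forall>j<p. g j \<in> cmod_hom K v (E j) (E' j)) \<and>
          (\<forall>n. \<forall>y\<in>carrier (comp Y n). g 0 n (i n y) = i' n y) \<and>
          (\<forall>j n. Suc j < p \<longrightarrow>
             (\<forall>x\<in>carrier (comp (E j) n). g (Suc j) n (d j n x) = d' j n (g j n x))) \<and>
          (\<forall>n. \<forall>x\<in>carrier (comp (E (p - 1)) n). q' n (g (p - 1) n x) = q n x))"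
| "yext_step K v X Y _ _ \<longleftrightarrow> False"

definition yext_equiv ::
  "'k ring \<Rightarrow> variance \<Rightarrow> nat \<Rightarrow> ('k, 'x) cmod \<Rightarrow> ('k, 'y) cmod \<Rightarrow> ('k, 'x, 'y, 'e) yext rel" where
  "yext_equiv K v p X Y =
     (let S = {e. yext_ok K v p X Y e};
          R = {(e, e'). e \<in> S \<and> e' \<in> S \<and> yext_step K v X Y e e'}
      in (R \<union> R\<inverse>)\<^sup>* \<inter> S \<times> S)"

definition Ext ::
  "'k ring \<Rightarrow> variance \<Rightarrow> nat \<Rightarrow> ('k, 'x) cmod \<Rightarrow> ('k, 'y) cmod \<Rightarrow> ('k, 'x, 'y, 'e) yext set set" where
  "Ext K v p X Y = {e. yext_ok K v p X Y e} // yext_equiv K v p X Y"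

text \<open>
  Yoneda product of \<open>e \<in> Ext\<^sup>p(X, Y)\<close> and \<open>f \<in> Ext\<^sup>q(Y, Z)\<close> on representatives: composition, push-out
  along \<open>f\<close>, pull-back along \<open>e\<close>, or splicing. In particular functoriality of Ext in either variable
  is the product with a \<open>YHom\<close>. The middle terms of the product lie in the universe \<open>yuniv\<close>.
\<close>

datatype ('x, 'z, 'e, 'w) yuniv =
    InE (unE: 'e) | InW (unW: 'w) | InPull (unPull: "'w \<times> 'x") | InPush (unPush: "('z \<times> 'e) set")

fun e_part :: "('x, 'z, 'e, 'w) yuniv \<Rightarrow> 'e" where
  "e_part (InPush S) = snd (SOME s. s \<in> S)"
| "e_part u = unE u"

fun w_part :: "('x, 'z, 'e, 'w) yuniv \<Rightarrow> 'w" where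
  "w_part (InPull s) = fst s"
| "w_part u = unW u"

fun yprod ::
  "variance \<Rightarrow> ('k, 'x) cmod \<Rightarrow> ('k, 'y) cmod \<Rightarrow> ('k, 'z) cmod \<Rightarrow>
   ('k, 'x, 'y, 'e) yext \<Rightarrow> ('k, 'y, 'z, 'w) yext \<Rightarrow> ('k, 'x, 'z, ('x, 'z, 'e, 'w) yuniv) yext" where
  "yprod v X Y Z (YHom f) (YHom g) = YHom (\<lambda>n x. g n (f n x))"
| "yprod v X Y Z (YSeq p E i d r) (YHom g) =
     YSeq p
       (\<lambda>j. if j = 0 then cmod_relabel InPush (cmod_pushout v Y Z (E 0) g i)
            else cmod_relabel InE (E j))
       (\<lambda>n z. InPush (pushout_rel Y (E 0) g i n
                       +>\<^bsub>sum_module (comp Z n) (comp (E 0) n)\<^esub> (z, \<zero>\<^bsub>comp (E 0) n\<^esub>)))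
       (\<lambda>j n u. InE (d j n (e_part u)))
       (\<lambda>n u. r n (e_part u))"
| "yprod v X Y Z (YHom f) (YSeq q F i d r) =
     (let tag = (\<lambda>j n w. if Suc j = q then InPull (w, \<zero>\<^bsub>comp X n\<^esub>) else InW w) in
      YSeq q
       (\<lambda>j. if Suc j = q then cmod_relabel InPull (cmod_pullback (F j) X r f)
            else cmod_relabel InW (F j))
       (\<lambda>n z. tag 0 n (i n z))
       (\<lambda>j n u. tag (Suc j) n (d j n (w_part u)))
       (\<lambda>n u. snd (unPull u)))"
| "yprod v X Y Z (YSeq p E i d r) (YSeq q F i' d' r') =
     YSeq (p + q)
       (\<lambda>j. if j < q then cmod_relabel InW (F j) else cmod_relabel InE (E (j - q)))
       (\<lambda>n z. InW (i' n z))
       (\<lambda>j n u. if Suc j < q then InW (d' j n (w_part u))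
                else if Suc j = q then InE (i n (r' n (w_part u)))
                else InE (d (j - q) n (e_part u)))
       (\<lambda>n u. r n (e_part u))"

text \<open>
  The exact contravariant functor \<open>diag Hom\<^sub>k(-, Y\<^sub>\<bullet>)\<close> on representatives:
  \<open>Ext\<^sup>p(X, W) \<rightarrow> Ext\<^sup>p(diag Hom(W, Y), diag Hom(X, Y))\<close>; it reverses the order of the terms.
\<close>

definition precomp :: "('k, 'x) cmod \<Rightarrow> (nat \<Rightarrow> 'x \<Rightarrow> 'w) \<Rightarrow> nat \<Rightarrow> ('w \<Rightarrow> 'y) \<Rightarrow> 'x \<Rightarrow> 'y" where
  "precomp X f n g = (\<lambda>x\<in>carrier (comp X n). g (f n x))"

fun diag_hom_ext ::
  "'k ring \<Rightarrow> ('k, 'x) cmod \<Rightarrow> ('k, 'w) cmod \<Rightarrow> ('k, 'y) cmod \<Rightarrow>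
   ('k, 'x, 'w, 'e) yext \<Rightarrow> ('k, 'w \<Rightarrow> 'y, 'x \<Rightarrow> 'y, 'e \<Rightarrow> 'y) yext" where
  "diag_hom_ext K X W Y (YHom f) = YHom (precomp X f)"
| "diag_hom_ext K X W Y (YSeq p E i d q) =
     YSeq p (\<lambda>j. diag_hom K (E (p - 1 - j)) Y)
       (precomp (E (p - 1)) q)
       (\<lambda>j. precomp (E (p - 2 - j)) (d (p - 2 - j)))
       (precomp W i)"

text \<open>
  Ext is independent of the universe as soon as the latter is large enough. Representatives are moved
  to another universe along an injection.
\<close>

fun yext_relabel :: "('e \<Rightarrow> 'u) \<Rightarrow> ('k, 'x, 'y, 'e) yext \<Rightarrow> ('k, 'x, 'y, 'u) yext" where
  "yext_relabel \<iota> (YHom f) = YHom f"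
| "yext_relabel \<iota> (YSeq p E i d q) =
     YSeq p (\<lambda>j. cmod_relabel \<iota> (E j)) (\<lambda>n y. \<iota> (i n y)) (\<lambda>j n u. \<iota> (d j n (inv_into UNIV \<iota> u)))
       (\<lambda>n u. q n (inv_into UNIV \<iota> u))"


section \<open>The para-(co)cyclic modules and Hopf-cyclic cohomology\<close>

text \<open>The diagonal action \<open>L\<^sub>h\<close> on \<open>V\<^sup>\<otimes>\<^sup>n\<^sup>+\<^sup>1 \<otimes> M\<close>.\<close>

definition diag_act ::
  "'k ring \<Rightarrow> ('k, 'h) hopf \<Rightarrow> ('k, 'v, 'x) module_scheme \<Rightarrow> ('h \<Rightarrow> 'v \<Rightarrow> 'v) \<Rightarrow>
   ('k, 'h, 'm) hmodcomod \<Rightarrow> nat \<Rightarrow> 'h \<Rightarrow> ('k, 'v, 'm) tensor \<Rightarrow> ('k, 'v, 'm) tensor" where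
  "diag_act K H V act M n h =
     tlift K (tens K (Suc n) V M)
       (\<lambda>vs m. tlift K (tens K (Suc n) V M)
          (\<lambda>hs h'. tprod K V M (map2 act hs vs) (hact M h' m)) (iter_comult K H (Suc n) h))"

text \<open>\<open>T\<^sub>\<bullet>(C, M)\<close> for an \<open>H\<close>-module coalgebra \<open>C\<close>.\<close>

definition T_coalg_cyc ::
  "'k ring \<Rightarrow> ('k, 'c, 'x) coalg_scheme \<Rightarrow> ('h \<Rightarrow> 'c \<Rightarrow> 'c) \<Rightarrow> ('k, 'h, 'm) hmodcomod \<Rightarrow>
   nat \<Rightarrow> ('k, 'c, 'm) tensor \<Rightarrow> ('k, 'c, 'm) tensor" where
  "T_coalg_cyc K C act M n =
     tlift K (tens K (Suc n) C M)
       (\<lambda>cs m. sweedler K (tens K (Suc n) C M) (\<lambda>x m0. tprod K C M (tl cs @ [act x (hd cs)]) m0) (coact M m))"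

definition T_coalg_face0 ::
  "'k ring \<Rightarrow> ('k, 'c, 'x) coalg_scheme \<Rightarrow> ('k, 'h, 'm) hmodcomod \<Rightarrow>
   nat \<Rightarrow> ('k, 'c, 'm) tensor \<Rightarrow> ('k, 'c, 'm) tensor" where
  "T_coalg_face0 K C M n =
     tlift K (tens K (n + 2) C M)
       (\<lambda>cs m. sweedler K (tens K (n + 2) C M) (\<lambda>x y. tprod K C M (x # y # tl cs) m) (comult C (hd cs)))"

definition T_coalg_degen0 ::
  "'k ring \<Rightarrow> ('k, 'c, 'x) coalg_scheme \<Rightarrow> ('k, 'h, 'm) hmodcomod \<Rightarrow>
   nat \<Rightarrow> ('k, 'c, 'm) tensor \<Rightarrow> ('k, 'c, 'm) tensor" where
  "T_coalg_degen0 K C M n =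
     tlift K (tens K n C M)
       (\<lambda>cs m. counit C (cs ! 1) \<odot>\<^bsub>tens K n C M\<^esub> tprod K C M (hd cs # drop 2 cs) m)"

definition T_coalg ::
  "'k ring \<Rightarrow> ('k, 'c, 'x) coalg_scheme \<Rightarrow> ('h \<Rightarrow> 'c \<Rightarrow> 'c) \<Rightarrow> ('k, 'h, 'm) hmodcomod \<Rightarrow>
   ('k, ('k, 'c, 'm) tensor) cmod" where
  "T_coalg K C act M =
     (let V = (\<lambda>n. tens K (Suc n) C M);
          pow = (\<lambda>n. int_pow_map (V n) (T_coalg_cyc K C act M n))
      in \<lparr>comp = V,
          face = (\<lambda>n j. pow (Suc n) (- int j) \<circ> T_coalg_face0 K C M n \<circ> pow n (int j)),
          degen = (\<lambda>n j. pow (n - 1) (- int j) \<circ> T_coalg_degen0 K C M n \<circ> pow n (int j)),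
          cyc = T_coalg_cyc K C act M\<rparr>)"

text \<open>\<open>T\<^sub>\<bullet>(A, M)\<close> for an \<open>H\<close>-module algebra \<open>A\<close>.\<close>

definition T_alg_cyc ::
  "'k ring \<Rightarrow> ('k, 'h) hopf \<Rightarrow> ('k, 'a) module \<Rightarrow> ('h \<Rightarrow> 'a \<Rightarrow> 'a) \<Rightarrow> ('k, 'h, 'm) hmodcomod \<Rightarrow>
   nat \<Rightarrow> ('k, 'a, 'm) tensor \<Rightarrow> ('k, 'a, 'm) tensor" where
  "T_alg_cyc K H A act M n =
     tlift K (tens K (Suc n) A M)
       (\<lambda>as m. sweedler K (tens K (Suc n) A M)
          (\<lambda>x m0. tprod K A M (act (antipode_inv H x) (last as) # butlast as) m0) (coact M m))"

definition T_alg_face0 ::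
  "'k ring \<Rightarrow> ('k, 'a) module \<Rightarrow> ('k, 'h, 'm) hmodcomod \<Rightarrow>
   nat \<Rightarrow> ('k, 'a, 'm) tensor \<Rightarrow> ('k, 'a, 'm) tensor" where
  "T_alg_face0 K A M n =
     tlift K (tens K n A M) (\<lambda>as m. tprod K A M ((as ! 0 \<otimes>\<^bsub>A\<^esub> as ! 1) # drop 2 as) m)"

definition T_alg_degen0 ::
  "'k ring \<Rightarrow> ('k, 'a) module \<Rightarrow> ('k, 'h, 'm) hmodcomod \<Rightarrow>
   nat \<Rightarrow> ('k, 'a, 'm) tensor \<Rightarrow> ('k, 'a, 'm) tensor" where
  "T_alg_degen0 K A M n =
     tlift K (tens K (n + 2) A M) (\<lambda>as m. tprod K A M (hd as # \<one>\<^bsub>A\<^esub> # tl as) m)"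

definition T_alg ::
  "'k ring \<Rightarrow> ('k, 'h) hopf \<Rightarrow> ('k, 'a) module \<Rightarrow> ('h \<Rightarrow> 'a \<Rightarrow> 'a) \<Rightarrow> ('k, 'h, 'm) hmodcomod \<Rightarrow>
   ('k, ('k, 'a, 'm) tensor) cmod" where
  "T_alg K H A act M =
     (let V = (\<lambda>n. tens K (Suc n) A M);
          pow = (\<lambda>n. int_pow_map (V n) (T_alg_cyc K H A act M n))
      in \<lparr>comp = V,
          face = (\<lambda>n j. pow (n - 1) (int j) \<circ> T_alg_face0 K A M n \<circ> pow n (- int j)),
          degen = (\<lambda>n j. pow (Suc n) (int j) \<circ> T_alg_degen0 K A M n \<circ> pow n (- int j)),
          cyc = T_alg_cyc K H A act M\<rparr>)"

text \<open>
  \<open>J\<^sub>\<bullet> \<subseteq> T\<^sub>\<bullet>\<close>, for a para-(co)cyclic \<open>T\<close> with graded \<open>H\<close>-action \<open>L n h\<close>.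
\<close>

definition para_submodule ::
  "'k ring \<Rightarrow> variance \<Rightarrow> ('k, 'h) hopf \<Rightarrow> ('k, 't) cmod \<Rightarrow> (nat \<Rightarrow> 'h \<Rightarrow> 't \<Rightarrow> 't) \<Rightarrow>
   (nat \<Rightarrow> 't set) \<Rightarrow> bool" where
  "para_submodule K v H T L N \<longleftrightarrow>
     (\<forall>n. submodule (N n) K (comp T n)) \<and>
     (\<forall>n j. face_ok v n j \<longrightarrow> face T n j ` N n \<subseteq> N (face_deg v n)) \<and>
     (\<forall>n j. degen_ok v n j \<longrightarrow> degen T n j ` N n \<subseteq> N (degen_deg v n)) \<and>
     (\<forall>n. cyc T n ` N n \<subseteq> N n \<and> inv_into (carrier (comp T n)) (cyc T n) ` N n \<subseteq> N n) \<and>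
     (\<forall>n. \<forall>h\<in>carrier H. L n h ` N n \<subseteq> N n)"

definition J_gens ::
  "('k, 'h) hopf \<Rightarrow> ('k, 't) cmod \<Rightarrow> (nat \<Rightarrow> 'h \<Rightarrow> 't \<Rightarrow> 't) \<Rightarrow> nat \<Rightarrow> 't set" where
  "J_gens H T L n =
     {(L n h (int_pow_map (comp T n) (cyc T n) i \<Psi>) \<ominus>\<^bsub>comp T n\<^esub> int_pow_map (comp T n) (cyc T n) i (L n h \<Psi>))
        \<oplus>\<^bsub>comp T n\<^esub> ((cyc T n ^^ Suc n) \<Phi> \<ominus>\<^bsub>comp T n\<^esub> \<Phi>) | h i \<Psi> \<Phi>.
        h \<in> carrier H \<and> \<Psi> \<in> carrier (comp T n) \<and> \<Phi> \<in> carrier (comp T n)}"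

definition J_sub ::
  "'k ring \<Rightarrow> variance \<Rightarrow> ('k, 'h) hopf \<Rightarrow> ('k, 't) cmod \<Rightarrow> (nat \<Rightarrow> 'h \<Rightarrow> 't \<Rightarrow> 't) \<Rightarrow> nat \<Rightarrow> 't set" where
  "J_sub K v H T L n = \<Inter>{N n | N. para_submodule K v H T L N \<and> (\<forall>k. J_gens H T L k \<subseteq> N k)}"

abbreviation Q_quot ::
  "'k ring \<Rightarrow> variance \<Rightarrow> ('k, 'h) hopf \<Rightarrow> ('k, 't) cmod \<Rightarrow> (nat \<Rightarrow> 'h \<Rightarrow> 't \<Rightarrow> 't) \<Rightarrow> ('k, 't set) cmod" where
  "Q_quot K v H T L \<equiv> cmod_quot v T (J_sub K v H T L)"

text \<open>\<open>k \<otimes>\<^sub>H Q\<^sub>n\<close> (with \<open>H\<close> acting on \<open>k\<close> through \<open>\<epsilon>\<close>) is \<open>Q\<^sub>n\<close> modulo the span of all \<open>h q - \<epsilon>(h) q\<close>.\<close>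

definition coinv_ker ::
  "'k ring \<Rightarrow> variance \<Rightarrow> ('k, 'h) hopf \<Rightarrow> ('k, 't) cmod \<Rightarrow> (nat \<Rightarrow> 'h \<Rightarrow> 't \<Rightarrow> 't) \<Rightarrow> nat \<Rightarrow> 't set set" where
  "coinv_ker K v H T L n =
     (let Q = comp (Q_quot K v H T L) n in
      gen_submodule K Q
        {induced (comp T n) (J_sub K v H T L n) (L n h) S \<ominus>\<^bsub>Q\<^esub> (counit H h \<odot>\<^bsub>Q\<^esub> S) | h S.
           h \<in> carrier H \<and> S \<in> carrier Q})"

definition hopf_quot ::
  "'k ring \<Rightarrow> variance \<Rightarrow> ('k, 'h) hopf \<Rightarrow> ('k, 't) cmod \<Rightarrow> (nat \<Rightarrow> 'h \<Rightarrow> 't \<Rightarrow> 't) \<Rightarrow>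
   ('k, 't set set) cmod" where
  "hopf_quot K v H T L = cmod_quot v (Q_quot K v H T L) (coinv_ker K v H T L)"

definition hopf_class ::
  "'k ring \<Rightarrow> variance \<Rightarrow> ('k, 'h) hopf \<Rightarrow> ('k, 't) cmod \<Rightarrow> (nat \<Rightarrow> 'h \<Rightarrow> 't \<Rightarrow> 't) \<Rightarrow>
   nat \<Rightarrow> 't \<Rightarrow> 't set set" where
  "hopf_class K v H T L n x =
     coinv_ker K v H T L n +>\<^bsub>comp (Q_quot K v H T L) n\<^esub> (J_sub K v H T L n +>\<^bsub>comp T n\<^esub> x)"

definition C_coalg ::
  "'k ring \<Rightarrow> ('k, 'h) hopf \<Rightarrow> ('k, 'c, 'x) coalg_scheme \<Rightarrow> ('h \<Rightarrow> 'c \<Rightarrow> 'c) \<Rightarrow> ('k, 'h, 'm) hmodcomod \<Rightarrow>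
   ('k, ('k, 'c, 'm) tensor set set) cmod" where
  "C_coalg K H C act M = hopf_quot K Cocyclic H (T_coalg K C act M) (diag_act K H C act M)"

definition C_alg ::
  "'k ring \<Rightarrow> ('k, 'h) hopf \<Rightarrow> ('k, 'a) module \<Rightarrow> ('h \<Rightarrow> 'a \<Rightarrow> 'a) \<Rightarrow> ('k, 'h, 'm) hmodcomod \<Rightarrow>
   ('k, ('k, 'a, 'm) tensor set set) cmod" where
  "C_alg K H A act M = hopf_quot K Cyclic H (T_alg K H A act M) (diag_act K H A act M)"

text \<open>The classical cyclic module of an algebra; \<open>A\<^sup>\<otimes>\<^sup>n\<^sup>+\<^sup>1\<close> is \<open>tens K n A A\<close>.\<close>

definition tprod_list :: "'k ring \<Rightarrow> ('k, 'a) module \<Rightarrow> 'a list \<Rightarrow> ('k, 'a, 'a) tensor" where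
  "tprod_list K A as = tprod K A A (butlast as) (last as)"

definition tlift_list ::
  "'k ring \<Rightarrow> ('k, 'u) module \<Rightarrow> ('a list \<Rightarrow> 'u) \<Rightarrow> ('k, 'a, 'a) tensor \<Rightarrow> 'u" where
  "tlift_list K U f = tlift K U (\<lambda>as a. f (as @ [a]))"

definition Cyc :: "'k ring \<Rightarrow> ('k, 'a) module \<Rightarrow> ('k, ('k, 'a, 'a) tensor) cmod" where
  "Cyc K A =
     (let V = (\<lambda>n. tens K n A A)
      in \<lparr>comp = V,
          face = (\<lambda>n j. tlift_list K (V (n - 1))
            (\<lambda>as. if j < n then tprod_list K A (take j as @ [as ! j \<otimes>\<^bsub>A\<^esub> as ! Suc j] @ drop (j + 2) as)
                  else tprod_list K A ((last as \<otimes>\<^bsub>A\<^esub> hd as) # tl (butlast as)))),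
          degen = (\<lambda>n j. tlift_list K (V (Suc n))
            (\<lambda>as. tprod_list K A (take (Suc j) as @ [\<one>\<^bsub>A\<^esub>] @ drop (Suc j) as))),
          cyc = (\<lambda>n. tlift_list K (V n) (\<lambda>as. tprod_list K A (last as # butlast as)))\<rparr>)"

definition HC_Hopf_coalg ::
  "'k ring \<Rightarrow> ('k, 'h) hopf \<Rightarrow> ('k, 'c, 'x) coalg_scheme \<Rightarrow> ('h \<Rightarrow> 'c \<Rightarrow> 'c) \<Rightarrow> ('k, 'h, 'm) hmodcomod \<Rightarrow>
   nat \<Rightarrow> ('k, 'k, ('k, 'c, 'm) tensor set set, 'e) yext set set" where
  "HC_Hopf_coalg K H C act M p = Ext K Cocyclic p (const_cmod K) (C_coalg K H C act M)"

definition HC_Hopf_alg ::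
  "'k ring \<Rightarrow> ('k, 'h) hopf \<Rightarrow> ('k, 'a) module \<Rightarrow> ('h \<Rightarrow> 'a \<Rightarrow> 'a) \<Rightarrow> ('k, 'h, 'm) hmodcomod \<Rightarrow>
   nat \<Rightarrow> ('k, ('k, 'a, 'm) tensor set set, 'k, 'e) yext set set" where
  "HC_Hopf_alg K H A act M q = Ext K Cyclic q (C_alg K H A act M) (const_cmod K)"

text \<open>The element of \<open>HC\<^sup>n(A) = Ext\<^sup>n(Cyc\<^sub>\<bullet>(A), k\<^sub>\<bullet>\<^sup>\<or>)\<close> represented by a sequence.\<close>

definition HC_class ::
  "'k ring \<Rightarrow> ('k, 'a) module \<Rightarrow> nat \<Rightarrow> ('k, ('k, 'a, 'a) tensor, 'k, 'u) yext \<Rightarrow>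
   ('k, ('k, 'a, 'a) tensor, 'k, 'u) yext set" where
  "HC_class K A n e = yext_equiv K Cyclic n (Cyc K A) (const_cmod K) `` {e}"


section \<open>The pairing\<close>

definition alpha_T ::
  "'k ring \<Rightarrow> ('k, 'a) module \<Rightarrow> ('c \<Rightarrow> 'a \<Rightarrow> 'a) \<Rightarrow> ('k, 'h, 'm) hmodcomod \<Rightarrow>
   nat \<Rightarrow> ('k, 'a, 'a) tensor \<Rightarrow> ('k, 'c, 'm) tensor \<Rightarrow> ('k, 'a, 'm) tensor" where
  "alpha_T K A \<phi> M n t x =
     tlift_list K (tens K (Suc n) A M)
       (\<lambda>as. tlift K (tens K (Suc n) A M) (\<lambda>cs m. tprod K A M (map2 \<phi> cs as) m) x) t"

definition alpha ::
  "'k ring \<Rightarrow> ('k, 'h) hopf \<Rightarrow> ('k, 'c, 'x) coalg_scheme \<Rightarrow> ('h \<Rightarrow> 'c \<Rightarrow> 'c) \<Rightarrow>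
   ('k, 'a) module \<Rightarrow> ('h \<Rightarrow> 'a \<Rightarrow> 'a) \<Rightarrow> ('c \<Rightarrow> 'a \<Rightarrow> 'a) \<Rightarrow> ('k, 'h, 'm) hmodcomod \<Rightarrow>
   nat \<Rightarrow> ('k, 'a, 'a) tensor \<Rightarrow> ('k, 'c, 'm) tensor set set \<Rightarrow> ('k, 'a, 'm) tensor set set" where
  "alpha K H C actC A actA \<phi> M n t =
     (let T = T_alg K H A actA M; L = diag_act K H A actA M in
      (\<lambda>S\<in>carrier (comp (C_coalg K H C actC M) n).
        induced (comp (Q_quot K Cyclic H T L) n) (coinv_ker K Cyclic H T L n)
          (induced (comp T n) (J_sub K Cyclic H T L n) (alpha_T K A \<phi> M n t)) S))"

text \<open>The isomorphism \<open>diag Hom\<^sub>k(k\<^sub>\<bullet>, Y\<^sub>\<bullet>) \<rightarrow> Y\<^sub>\<bullet>\<close>.\<close>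

definition eval_one :: "'k ring \<Rightarrow> nat \<Rightarrow> ('k \<Rightarrow> 'y) \<Rightarrow> 'y" where
  "eval_one K n f = f \<one>\<^bsub>K\<^esub>"

text \<open>
  \<open>\<xi> \<smile> \<nu>\<close> for \<open>\<xi> \<in> HC\<^sup>p\<^sub>H\<^sub>o\<^sub>p\<^sub>f(C, M)\<close>, \<open>\<nu> \<in> HC\<^sup>q\<^sub>H\<^sub>o\<^sub>p\<^sub>f(A, M)\<close>, first on representatives, then on classes;
  \<open>\<iota>\<close> is an injection into the universe in which \<open>HC\<^sup>p\<^sup>+\<^sup>q(A)\<close> is formed. (A \<open>YHom\<close> has no middle
  terms; its universe is set to \<open>unit\<close>.)
\<close>

definition cup_rep where
  "cup_rep K H C actC A actA \<phi> M e f =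
     (let X = C_coalg K H C actC M; Y = C_alg K H A actA M; k = const_cmod K in
      yprod Cyclic (Cyc K A) (diag_hom K X Y) k
        (YHom (alpha K H C actC A actA \<phi> M) :: (_, _, _, unit) yext)
        (yprod Cyclic (diag_hom K X Y) Y k
          (yprod Cyclic (diag_hom K X Y) (diag_hom K k Y) Y
            (diag_hom_ext K k X Y e)
            (YHom (eval_one K) :: (_, _, _, unit) yext))
          f))"

definition cup where
  "cup \<iota> K H C actC A actA \<phi> M p q \<xi> \<nu> =
     (\<Union>e\<in>\<xi>. \<Union>f\<in>\<nu>.
        HC_class K A (p + q) (yext_relabel \<iota> (cup_rep K H C actC A actA \<phi> M e f)))"


section \<open>The characteristic map\<close>

text \<open>
  The functional on \<open>A \<cong> A \<otimes> k\<^sub>(\<^sub>\<sigma>\<^sub>,\<^sub>\<delta>\<^sub>)\<close> given by an element of degree \<open>0\<close>: the value at \<open>a\<close> of the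
  component \<open>f\<^sub>0\<close> of the underlying morphism \<open>f : C\<^sub>\<bullet>(A, k\<^sub>(\<^sub>\<sigma>\<^sub>,\<^sub>\<delta>\<^sub>)) \<rightarrow> k\<^sub>\<bullet>\<^sup>\<or>\<close>.
\<close>

definition trace_functional ::
  "'k ring \<Rightarrow> ('k, 'h) hopf \<Rightarrow> ('k, 'a) module \<Rightarrow> ('h \<Rightarrow> 'a \<Rightarrow> 'a) \<Rightarrow> ('k, 'h, 'k) hmodcomod \<Rightarrow>
   ('k, ('k, 'a, 'k) tensor set set, 'k, 'w) yext set \<Rightarrow> 'a \<Rightarrow> 'k" where
  "trace_functional K H A act M \<tau> a =
     (SOME c. \<exists>f. YHom f \<in> \<tau> \<and>
        c = f 0 (hopf_class K Cyclic H (T_alg K H A act M) (diag_act K H A act M) 0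
                  (tprod K A M [a] \<one>\<^bsub>K\<^esub>)))"

definition char_morphism ::
  "'k ring \<Rightarrow> ('k, 'h) hopf \<Rightarrow> ('k, 'a) module \<Rightarrow> ('h \<Rightarrow> 'a \<Rightarrow> 'a) \<Rightarrow> ('k, 'h, 'k) hmodcomod \<Rightarrow>
   ('k, ('k, 'a, 'k) tensor set set, 'k, 'w) yext set \<Rightarrow>
   nat \<Rightarrow> ('k, 'h, 'k) tensor set set \<Rightarrow> ('k, 'a, 'a) tensor \<Rightarrow> 'k" where
  "char_morphism K H A act M \<tau> =
     (SOME \<gamma>. \<gamma> \<in> cmod_hom K Cocyclic (C_coalg K H H (mult H) M) (dual_cmod K (Cyc K A)) \<and>
        (\<forall>hs as. set hs \<subseteq> carrier H \<and> set as \<subseteq> carrier A \<and> length as = Suc (length hs) \<longrightarrow>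
           \<gamma> (length hs)
             (hopf_class K Cocyclic H (T_coalg K H (mult H) M) (diag_act K H H (mult H) M) (length hs)
               (tprod K H M (\<one>\<^bsub>H\<^esub> # hs) \<one>\<^bsub>K\<^esub>))
             (tprod_list K A as)
           = trace_functional K H A act M \<tau> (foldl (mult A) (hd as) (map2 act hs (tl as)))))"

text \<open>
  \<open>\<gamma>(\<xi>)\<close>: the push-forward of \<open>\<xi>\<close> along the characteristic morphism lies in
  \<open>Ext\<^sup>p(k\<^sub>\<bullet>, Hom\<^sub>k(Cyc\<^sub>\<bullet>(A), k))\<close>, which is identified with \<open>Ext\<^sup>p(Cyc\<^sub>\<bullet>(A), k\<^sub>\<bullet>\<^sup>\<or>)\<close> by the duality
  \<open>Hom\<^sub>k(-, k) = diag Hom\<^sub>k(-, k\<^sub>\<bullet>\<^sup>\<or>)\<close> followed by pull-back along \<open>Cyc\<^sub>\<bullet>(A) \<rightarrow> Cyc\<^sub>\<bullet>(A)\<^sup>\<or>\<^sup>\<or>\<close>.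
\<close>

definition bidual_map :: "'k ring \<Rightarrow> ('k, 'x) cmod \<Rightarrow> nat \<Rightarrow> 'x \<Rightarrow> ('x \<Rightarrow> 'k) \<Rightarrow> 'k" where
  "bidual_map K X n x = (\<lambda>f\<in>carrier (comp (dual_cmod K X) n). f x)"

definition char_map_rep where
  "char_map_rep K H A act M \<tau> e =
     (let X = C_coalg K H H (mult H) M; D = dual_cmod K (Cyc K A); k = const_cmod K in
      yprod Cyclic (Cyc K A) (diag_hom K D k) k
        (YHom (bidual_map K (Cyc K A)) :: (_, _, _, unit) yext)
        (yprod Cyclic (diag_hom K D k) (diag_hom K k k) k
          (diag_hom_ext K k D k
            (yprod Cocyclic k X D e
              (YHom (char_morphism K H A act M \<tau>) :: (_, _, _, unit) yext)))
          (YHom (eval_one K) :: (_, _, _, unit) yext)))"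

definition char_map where
  "char_map \<iota> K H A act M \<tau> p \<xi> =
     (\<Union>e\<in>\<xi>. HC_class K A p (yext_relabel \<iota> (char_map_rep K H A act M \<tau> e)))"

end

theory Submission
 imports Defs
begin

text \<open>Splicing with \<open>\<tau>\<close> in degree 0 is push-forward along \<open>t \<in> \<tau>\<close>, so both \<open>\<gamma>(\<xi>)\<close> and \<open>\<xi> \<smile> \<tau>\<close>
 are the image of \<open>Hom(\<xi>, k)\<close> under pull-back along a morphism from the cyclic module of \<open>A\<close>. For \<open>\<xi> \<smile> \<tau>\<close>
 this is \<open>a \<mapsto> t \<circ> \<alpha>(a)\<close>; it equals \<open>\<gamma>\<close> since both agree on the classes of \<open>1 \<otimes> h\<^sup>1 \<otimes> \<dots> \<otimes> h\<^sup>n\<close>,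
 which span the coinvariants.\<close>

text \<open>That \<open>C_coalg\<close> and \<open>C_alg\<close> are (co)cyclic modules is read off
  from \<xi> and \<tau>, whose representatives carry this information in \<open>yext_ok\<close>. For
  \<alpha> to descend to the quotients it must send J to J, but J is an intersection of all
  submodules closed under the operators and gives no hold on its elements. On the Hopf algebra side
  J is therefore bounded by the plain span of its defining relations, which turns out to be closed
  under every operator: comultiplication or counit, moved past a power of the rotation, becomes an
  equivariant operator on another tensor slot. Because \<open>S\<^sup>-\<^sup>1(\<sigma>)\<close>
  inverts \<sigma>, the cyclic operators on the two sides are the rotation by \<sigma> and the
  inverse of such a rotation, so \<alpha> can be compared with powers of one kind of operator. On
  the Ext side the two representatives live in different universes; both map to a third sequence,
  which has to be embedded into the given universe before the classes can be compared. The
  characteristic morphism is defined by a choice operator, so its existence is at stake as well as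
  its uniqueness; the witness is the transpose of t \<circ> \<alpha>.\<close>

abbreviation (input) in_carrier (infix ":>" 50) where "x :> V \<equiv> x \<in> carrier V"
abbreviation (input) in_carriers (infix ":>*" 50) where "xs :>* V \<equiv> set xs \<subseteq> carrier V"
abbreviation (input) el where "el X n \<equiv> carrier (comp X n)"
abbreviation (input) add_of ("_ +[_] _" [65, 0, 66] 65) where "x +[V] y \<equiv> add V x y"
abbreviation (input) minus_of ("_ -[_] _" [65, 0, 66] 65) where "x -[V] y \<equiv> a_minus V x y"
abbreviation (input) neg_of ("-[_] _" [0, 81] 80) where "-[V] x \<equiv> a_inv V x"
abbreviation (input) smult_of ("_ *[_] _" [70, 0, 71] 70) where "c *[V] x \<equiv> smult V c x"
abbreviation (input) mult_of ("_ **[_] _" [70, 0, 71] 70) where "x **[V] y \<equiv> monoid.mult V x y"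
abbreviation (input) zero_of ("0[_]") where "0[V] \<equiv> zero V"
abbreviation (input) one_of ("1[_]") where "1[V] \<equiv> one V"
abbreviation (input) cyc_mod where "cyc_mod \<equiv> cyclic_module"
abbreviation (input) bilin where "bilin \<equiv> bilin_maps"
abbreviation (input) lin where "lin \<equiv> lin_maps"
abbreviation (input) coset_of ("_ +>[_] _" [60, 0, 61] 60) where "N +>[V] x \<equiv> a_r_coset V N x"

section \<open>Linear maps, submodules and quotient modules\<close>

lemma (in abelian_group) diff_eq_iff:
 assumes "a :> G" "b :> G" "c :> G"
 shows "a \<ominus> b = c \<longleftrightarrow> a = c \<oplus> b"
proof
 assume "a \<ominus> b = c"
 hence "c \<oplus> b = a \<oplus> (\<ominus> b \<oplus> b)" using assms by(simp add: minus_eq flip: a_assoc)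
 thus "a = c \<oplus> b" using assms by(simp add: l_neg)
next
 assume "a = c \<oplus> b"
 thus "a \<ominus> b = c" using assms by(simp add: minus_eq a_assoc r_neg)
qed

lemma module_zero_closed: "module K V ==> 0[V] :> V"
 by(simp add: module_def abelian_group_def abelian_monoid.zero_closed)

lemma lin_mapsI:
 assumes "!!x. x :> V ==> f x :> W"
  and "!!x y. x :> V ==> y :> V ==> f (x +[V] y) = f x +[W] f y"
  and "!!c x. c :> K ==> x :> V ==> f (c *[V] x) = c *[W] f x"
 shows "f : lin K V W" using assms unfolding lin_maps_def by auto

lemma lin_cl: "f : lin K V W ==> x :> V ==> f x :> W"
 and lin_add: "f : lin K V W ==> x :> V ==> y :> V ==> f (x +[V] y) = f x +[W] f y"
 and lin_smult: "f : lin K V W ==> c :> K ==> x :> V ==> f (c *[V] x) = c *[W] f x"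
 unfolding lin_maps_def by auto

lemma lin_zero:
 assumes "module K V" "module K W" "f : lin K V W"
 shows "f 0[V] = 0[W]"
proof -
 interpret V: module K V by fact
 interpret W: module K W by fact
 have "f (0[K] *[V] 0[V]) = 0[K] *[W] f 0[V]" by(rule lin_smult[OF assms(3)]) simp_all
 thus ?thesis using lin_cl[OF assms(3)] by simp
qed

lemma lin_neg:
 assumes "module K V" "module K W" "f : lin K V W" "x :> V"
 shows "f (-[V] x) = -[W] f x"
proof -
 interpret V: module K V by fact
 interpret W: module K W by fact
 have "f (-[V] x) +[W] f x = 0[W]"
  using assms lin_add[OF assms(3), of "-[V] x" x] lin_zero[OF assms(1-3)] by(simp add: V.l_neg)
 thus ?thesis using assms lin_cl[OF assms(3)] by(simp add: W.minus_equality)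
qed

lemma lin_minus:
 assumes "module K V" "module K W" "f : lin K V W" "x :> V" "y :> V"
 shows "f (x -[V] y) = f x -[W] f y"
proof -
 interpret V: module K V by fact
 show ?thesis using assms by(simp add: a_minus_def lin_add lin_neg)
qed

lemma lin_comp: "f : lin K V W ==> g : lin K W U ==> (%x. g (f x)) : lin K V U"
 by(intro lin_mapsI) (simp_all add: lin_cl[of f K V W] lin_cl[of g K W U]
  lin_add[of f K V W] lin_add[of g K W U] lin_smult[of f K V W] lin_smult[of g K W U])

lemma lin_cong:
 assumes "module K V" "f : lin K V W" "!!x. x :> V ==> f x = g x"
 shows "g : lin K V W"
proof -
 interpret V: module K V by fact
 show ?thesis using lin_cl[OF assms(2)] lin_add[OF assms(2)] lin_smult[OF assms(2)]
  by(intro lin_mapsI) (simp_all flip: assms(3))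
qed

lemma lin_id: "(%x. x) : lin K V V" unfolding lin_maps_def by auto

lemma lin_zero_map: "module K W ==> (%x. 0[W]) : lin K V W"
 and lin_add_map: "module K W ==> f : lin K V W ==> g : lin K V W ==>
  (%x. f x +[W] g x) : lin K V W"
 and lin_smult_map: "module K W ==> c :> K ==> f : lin K V W ==> (%x. c *[W] f x) : lin K V W"
proof -
 assume "module K W"
 then interpret W: module K W .
 show "(%x. 0[W]) : lin K V W" by(auto intro: lin_mapsI)
 show "(%x. f x +[W] g x) : lin K V W" if "f : lin K V W" "g : lin K V W"
  using that lin_cl[OF that(1)] lin_cl[OF that(2)]
  by(intro lin_mapsI) (auto simp: lin_add lin_smult W.a_ac W.smult_r_distr)
 show "(%x. c *[W] f x) : lin K V W" if "c :> K" "f : lin K V W" using that lin_cl[OF that(2)]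
  by(intro lin_mapsI) (auto simp: lin_add lin_smult W.smult_r_distr simp flip: W.smult_assoc1,
  simp add: W.R.m_comm)
qed

lemma lin_smult_left:
 assumes "module K W" "f : lin K V (self_module K)" "w :> W"
 shows "(%x. f x *[W] w) : lin K V W"
proof -
 interpret W: module K W by fact
 show ?thesis using assms(2,3) lin_cl[OF assms(2)] lin_add[OF assms(2)] lin_smult[OF assms(2)]
  by(intro lin_mapsI) (auto simp: self_module_def W.smult_l_distr W.smult_assoc1)
qed

text \<open>The target is a bare record of operations; each axiom, including the existence of
  negatives, is pulled back to preimages under f. Quotients and relabelled copies obtain their
  module structure this way.\<close>

lemma module_image:
 assumes "module K V" "f ` carrier V = carrier W"
  and add: "!!x y. x :> V ==> y :> V ==> f (x +[V] y) = f x +[W] f y"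
  and smult: "!!c x. c :> K ==> x :> V ==> f (c *[V] x) = c *[W] f x"
  and zero: "f 0[V] = 0[W]"
 shows "module K W"
proof -
 interpret V: module K V by fact
 have ex: "\<exists>x\<in>carrier V. w = f x" if "w :> W" for w using that assms(2) by auto
 have cl: "f x :> W" if "x :> V" for x using that assms(2) by auto
 show ?thesis
 proof(rule moduleI)
  show "cring K" ..
  show "abelian_group W"
  proof(rule abelian_groupI)
  fix x y assume "x :> W" "y :> W"
  thus "x +[W] y :> W" by(auto dest!: ex simp: cl simp flip: add)
  next
  show "0[W] :> W" using cl[OF V.zero_closed] by(simp add: zero)
  next
  fix x y z assume "x :> W" "y :> W" "z :> W"
  thus "x +[W] y +[W] z = x +[W] (y +[W] z)" by(auto dest!: ex simp flip: add simp: V.a_assoc)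
  next
  fix x y assume "x :> W" "y :> W"
  thus "x +[W] y = y +[W] x" by(auto dest!: ex simp flip: add simp: V.a_comm)
  next
  fix x assume "x :> W"
  thus "0[W] +[W] x = x" by(auto dest!: ex simp flip: add zero)
  next
  fix x assume "x :> W"
  then obtain v where v: "v :> V" "x = f v" using ex by blast
  hence "f (-[V] v) +[W] x = 0[W]" by(simp add: V.l_neg zero flip: add)
  thus "\<exists>y\<in>carrier W. y +[W] x = 0[W]" using v cl by blast
  qed
 next
  fix a x assume "a :> K" "x :> W"
  thus "a *[W] x :> W" by(auto dest!: ex simp: cl simp flip: smult)
 next
  fix a b x assume "a :> K" "b :> K" "x :> W"
  thus "(a +[K] b) *[W] x = a *[W] x +[W] b *[W] x"
  by(auto dest!: ex simp flip: smult add simp: V.smult_l_distr)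
 next
  fix a x y assume "a :> K" "x :> W" "y :> W"
  thus "a *[W] (x +[W] y) = a *[W] x +[W] a *[W] y"
  by(auto dest!: ex simp flip: smult add simp: V.smult_r_distr)
 next
  fix a b x assume "a :> K" "b :> K" "x :> W"
  thus "(a **[K] b) *[W] x = a *[W] (b *[W] x)"
  by(auto dest!: ex simp flip: smult add simp: V.smult_assoc1)
 next
  fix x assume "x :> W"
  thus "1[K] *[W] x = x" by(auto dest!: ex simp flip: smult add)
 qed
qed

lemma self_module_sel [simp]:
 "carrier (self_module K) = carrier K" "add (self_module K) = add K"
 "zero (self_module K) = zero K" "smult (self_module K) = mult K" by(simp_all add: self_module_def)

lemma mk_module_sel [simp]:
 "carrier (mk_module C z a s) = C" "add (mk_module C z a s) = a"
 "zero (mk_module C z a s) = z" "smult (mk_module C z a s) = s" by(simp_all add: mk_module_def)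

lemma module_self: "cring K ==> module K (self_module K)"
proof -
 assume "cring K"
 then interpret cring K .
 show ?thesis by(intro moduleI abelian_groupI `cring K`)
  (auto simp: a_ac l_distr r_distr m_assoc intro!: bexI[where x="-[K] _"] l_neg)
qed

lemma submodule_mem:
 assumes "module K V" "submodule N K V"
 shows "N <= carrier V" "0[V] : N" "!!x. x : N ==> -[V] x : N"
  "!!x y. x : N ==> y : N ==> x +[V] y : N" "!!x y. x : N ==> y : N ==> x -[V] y : N"
  "!!c x. c :> K ==> x : N ==> c *[V] x : N"
proof -
 interpret V: module K V by fact
 note E = V.submoduleE[OF assms(2)]
 show "N <= carrier V" "!!x. x : N ==> -[V] x : N"
  "!!x y. x : N ==> y : N ==> x +[V] y : N" "!!c x. c :> K ==> x : N ==> c *[V] x : N"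
  using E by auto
 show "!!x y. x : N ==> y : N ==> x -[V] y : N" using E by(simp add: a_minus_def)
 obtain x where "x : N" using E(2) by auto
 thus "0[V] : N" using E(1) E(4)[of "0[K]" x] by auto
qed

lemma submodule_abelian_subgroup:
 assumes "module K V" "submodule N K V"
 shows "abelian_subgroup N V"
proof -
 interpret V: module K V by fact
 interpret N: submodule N K V by fact
 show ?thesis by(rule abelian_subgroupI3) (auto intro!: additive_subgroup.intro N.subgroup_axioms V.abelian_group_axioms)
qed


lemma coset_mem_iff:
 assumes "module K V" "submodule N K V" "x :> V" "y :> V"
 shows "y : N +>[V] x \<longleftrightarrow> y -[V] x : N"
proof -
 interpret N: abelian_subgroup N V by(rule submodule_abelian_subgroup[OF assms(1,2)])
 show ?thesis using assms by(simp add: N.a_rcos_module a_minus_def)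
qed

lemma coset_eq_iff:
 assumes "module K V" "submodule N K V" "x :> V" "y :> V"
 shows "N +>[V] x = N +>[V] y \<longleftrightarrow> x -[V] y : N"
proof -
 interpret N: abelian_subgroup N V by(rule submodule_abelian_subgroup[OF assms(1,2)])
 have "x : N +>[V] y" if "N +>[V] x = N +>[V] y" using N.a_rcos_self[OF assms(3)] that by simp
 moreover have "N +>[V] x = N +>[V] y" if "x : N +>[V] y"
  using N.a_repr_independence'[OF that assms(4)] by simp
 ultimately show ?thesis using coset_mem_iff[OF assms(1,2,4,3)] by blast
qed

lemma coset_self:
 assumes "module K V" "submodule N K V" "x :> V"
 shows "x : N +>[V] x"
proof -
 interpret N: abelian_subgroup N V by(rule submodule_abelian_subgroup[OF assms(1,2)])
 show ?thesis by(rule N.a_rcos_self[OF assms(3)])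
qed

lemma coset_subset:
 assumes "module K V" "submodule N K V" "x :> V" "y : N +>[V] x"
 shows "y :> V"
proof -
 interpret N: abelian_subgroup N V by(rule submodule_abelian_subgroup[OF assms(1,2)])
 show ?thesis by(rule N.a_elemrcos_carrier[OF assms(3,4)])
qed

lemma coset_zero:
 assumes "module K V" "submodule N K V"
 shows "N +>[V] 0[V] = N"
proof -
 interpret N: abelian_subgroup N V by(rule submodule_abelian_subgroup[OF assms])
 show ?thesis by(rule N.a_rcos_const) (simp add: submodule_mem[OF assms])
qed

lemma quot_carrier: "carrier (quot_module V N) = (%x. N +>[V] x) ` carrier V"
 by(auto simp: quot_module_def A_RCOSETS_def')

lemma quot_carrierE:
 assumes "S :> quot_module V N"
 obtains x where "x :> V" "S = N +>[V] x" using assms by(auto simp: quot_carrier)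

lemma quot_add:
 assumes "module K V" "submodule N K V" "x :> V" "y :> V"
 shows "(N +>[V] x) +[quot_module V N] (N +>[V] y) = N +>[V] (x +[V] y)"
proof -
 interpret N: abelian_subgroup N V by(rule submodule_abelian_subgroup[OF assms(1,2)])
 show ?thesis using assms(3,4) by(simp add: quot_module_def N.a_rcos_sum)
qed

text \<open>Two representatives of a coset differ by an element of N, so their images differ by an
  element of N'. The union in \<open>induced\<close> thus runs over one coset, repeated.\<close>

lemma induced_coset:
 assumes V: "module K V" "submodule N K V" and W: "module K W" "submodule N' K W"
  and f: "f : lin K V W" "f ` N <= N'" and x: "x :> V"
 shows "induced W N' f (N +>[V] x) = N' +>[W] f x"
proof -
 have "N' +>[W] f y = N' +>[W] f x" if "y : N +>[V] x" for y
 proof -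
  have y: "y :> V" using that coset_subset[OF V x] by blast
  have "f y -[W] f x : N'"
  using that f x y coset_mem_iff[OF V x y] by(auto simp flip: lin_minus[OF V(1) W(1) f(1)])
  thus ?thesis using coset_eq_iff[OF W] lin_cl[OF f(1)] x y by blast
 qed
 thus ?thesis using coset_self[OF V x] unfolding induced_def by blast
qed

lemma quot_smult:
 fixes K :: "'k ring"
 assumes V: "module K V" "submodule N K V" and "c :> K" "x :> V"
 shows "c *[quot_module V N] (N +>[V] x) = N +>[V] (c *[V] x)"
proof -
 \<comment> \<open>The scalar multiplication of \<open>quot_module\<close> unfolds to
   \<open>induced\<close> for multiplication by c, so well-definedness is the general fact about
   induced maps.\<close>
 have "induced V N (%x. c *[V] x) (N +>[V] x) = N +>[V] (c *[V] x)"
  using assms submodule_mem(6)[OF V assms(3)]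
  by(intro induced_coset[OF V V] lin_smult_map lin_id V) auto
 thus ?thesis by(simp add: induced_def quot_module_def)
qed

lemma quot_zero: "0[quot_module V N] = N" by(simp add: quot_module_def)

lemma module_quot:
 fixes K :: "'k ring"
 assumes "module K V" "submodule N K V"
 shows "module K (quot_module V N)" by(rule module_image[OF assms(1), where f="%x. N +>[V] x"])
  (use assms in \<open>auto simp: quot_carrier quot_add quot_smult quot_zero coset_zero\<close>)

lemma coset_lin:
 assumes "module K V" "submodule N K V"
 shows "(%x. N +>[V] x) : lin K V (quot_module V N)"
 using assms by(intro lin_mapsI) (auto simp: quot_carrier quot_add quot_smult)

lemma induced_lin:
 assumes V: "module K V" "submodule N K V" and W: "module K W" "submodule N' K W"
  and f: "f : lin K V W" "f ` N <= N'"
 shows "induced W N' f : lin K (quot_module V N) (quot_module W N')"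
proof -
 interpret V: module K V by fact
 note lin = lin_comp[OF f(1) coset_lin[OF W]]
 show ?thesis by(rule lin_mapsI)
  (auto elim!: quot_carrierE simp: quot_add[OF V] quot_smult[OF V] induced_coset[OF V W f]
  lin_add[OF lin] lin_smult[OF lin] lin_cl[OF lin])
qed

text \<open>The union defining \<^const>\<open>induced\<close> contains the coset of every \<open>f x\<close>, so it is that coset as
 soon as it is a coset at all.\<close>

lemma induced_eq_if_coset:
 assumes V: "module K V" "submodule N K V" and W: "module K W" "submodule N' K W"
  and "induced W N' f (N +>[V] x) :> quot_module W N'" "x :> V" "f x :> W"
 shows "induced W N' f (N +>[V] x) = N' +>[W] f x"
proof -
 obtain w where w: "w :> W" "induced W N' f (N +>[V] x) = N' +>[W] w"
  using assms(5) by(rule quot_carrierE)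
 have "f x : induced W N' f (N +>[V] x)"
  unfolding induced_def using coset_self[OF V assms(6)] coset_self[OF W assms(7)] by blast
 thus ?thesis using w assms(7) coset_mem_iff[OF W w(1) assms(7)] coset_eq_iff[OF W assms(7) w(1)] by simp
qed

lemma submodule_Inter:
 assumes "module K V" "\<N> ~= {}" "!!N. N : \<N> ==> submodule N K V"
 shows "submodule (\<Inter>\<N>) K V"
proof -
 interpret V: module K V by fact
 note mem = submodule_mem[OF assms(1,3)]
 show ?thesis
 proof(rule V.submoduleI)
  show "\<Inter>\<N> <= carrier V" using assms(2) mem(1) by blast
 qed (auto intro: mem)
qed

lemma gen_submodule:
 assumes "module K V" "S <= carrier V"
 shows "submodule (gen_submodule K V S) K V" unfolding gen_submodule_def
 using assms(2) module.carrier_is_submodule[OF assms(1)] by(intro submodule_Inter[OF assms(1)]) auto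

lemma gen_submodule_incl: "S <= gen_submodule K V S" unfolding gen_submodule_def by blast

lemma gen_submodule_least: "submodule N K V ==> S <= N ==> gen_submodule K V S <= N"
 unfolding gen_submodule_def by blast

lemma submodule_vimage:
 assumes V: "module K V" and W: "module K W" and f: "f : lin K V W" and N: "submodule N K W"
 shows "submodule {x \<in> carrier V. f x : N} K V"
proof -
 interpret V: module K V by fact
 show ?thesis by(rule V.submoduleI)
  (auto simp: lin_zero[OF V W f] lin_neg[OF V W f] lin_add[OF f] lin_smult[OF f]
  intro: submodule_mem(2-6)[OF W N])
qed

lemma submodule_zero: "module K V ==> submodule {0[V]} K V"
proof -
 assume "module K V"
 then interpret V: module K V .
 show ?thesis by(rule V.submoduleI) auto
qed

lemma submodule_image:
 assumes V: "module K V" and W: "module K W" and f: "f : lin K V W"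
 shows "submodule (f ` carrier V) K W"
proof -
 interpret V: module K V by fact
 interpret W: module K W by fact
 show ?thesis
 proof(rule W.submoduleI)
  show "f ` carrier V <= carrier W" using lin_cl[OF f] by blast
  show "0[W] : f ` carrier V" using lin_zero[OF V W f] V.zero_closed by force
  show "-[W] a : f ` carrier V" if "a : f ` carrier V" for a
  proof -
  obtain x where x: "x :> V" "a = f x" using \<open>a : f ` carrier V\<close> by blast
  show ?thesis by(rule image_eqI[of _ _ "-[V] x"]) (use x in \<open>simp_all add: lin_neg[OF V W f]\<close>)
  qed
  show "a +[W] b : f ` carrier V" if ab: "a : f ` carrier V" "b : f ` carrier V" for a b
  proof -
  obtain x y where x: "x :> V" "a = f x" "y :> V" "b = f y" using ab by blast
  show ?thesis by(rule image_eqI[of _ _ "x +[V] y"]) (use x in \<open>simp_all add: lin_add[OF f]\<close>)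
  qed
  show "c *[W] a : f ` carrier V" if c: "c :> K" "a : f ` carrier V" for a c
  proof -
  obtain x where x: "x :> V" "a = f x" using c by blast
  show ?thesis by(rule image_eqI[of _ _ "c *[V] x"]) (use x c in \<open>simp_all add: lin_smult[OF f]\<close>)
  qed
 qed
qed

text \<open>The preimage of N is a submodule containing S, hence contains everything that S
  generates. Later proofs that a map respects tensor relations, coinvariants or the relations of J
  reduce to generators through this.\<close>

lemma gen_submodule_image:
 assumes V: "module K V" and W: "module K W" and f: "f : lin K V W" and N: "submodule N K W"
  and S: "S <= carrier V" "f ` S <= N"
 shows "f ` gen_submodule K V S <= N"
 using gen_submodule_least[OF submodule_vimage[OF V W f N], of S] S by auto

subsection \<open>Linear maps over a field\<close>

text \<open>Zorn's lemma gives N maximal among the submodules meeting U only in zero. For w outside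
  N, maximality makes N + Kw meet U in some nonzero u = n + c w. Here c \<noteq> 0, since otherwise
  u would lie in U and in N, and dividing u - n by c exhibits w as an element of U + N.\<close>

lemma complement_exists:
 assumes K: "field K" and W: "module K W" and U: "submodule U K W"
 obtains N where "submodule N K W" "U \<inter> N = {0[W]}"
  "!!w. w :> W ==> \<exists>u\<in>U. \<exists>n\<in>N. w = u +[W] n"
proof -
 interpret K: field K by fact
 interpret W: module K W by fact
 note Um = submodule_mem[OF W U]
 define \<A> where "\<A> = {N. submodule N K W & U \<inter> N = {0[W]}}"
 have "\<exists>M\<in>\<A>. ALL X:\<A>. M <= X --> X = M"
 proof(rule subset_Zorn_nonempty)
  show "\<A> ~= {}" using submodule_zero[OF W] Um unfolding \<A>_def by blast
 next
  fix \<C> assume ne: "\<C> ~= {}" and chain: "subset.chain \<A> \<C>"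
  hence "\<C> <= \<A>" by(simp add: subset.chain_def)
  hence mem: "submodule N K W" "U \<inter> N = {0[W]}" if "N : \<C>" for N
  using that unfolding \<A>_def by blast+
  have two: "\<exists>P\<in>\<C>. N <= P & N' <= P" if "N : \<C>" "N' : \<C>" for N N'
  proof -
  have "N <= N' \<or> N' <= N" using subset_chain_def chain that by metis
  thus ?thesis using that by blast
  qed
  note sm = submodule_mem[OF W mem(1)]
  have "submodule (\<Union>\<C>) K W"
  proof(rule W.submoduleI)
  show "\<Union>\<C> <= carrier W" using sm(1) by blast
  show "0[W] : \<Union>\<C>" using sm(2) ne by blast
  show "-[W] a : \<Union>\<C>" if "a : \<Union>\<C>" for a using that by(auto intro: sm(3))
  show "a +[W] b : \<Union>\<C>" if ab: "a : \<Union>\<C>" "b : \<Union>\<C>" for a b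
  proof -
  obtain P where "P : \<C>" "a : P" "b : P" using ab two by(meson UnionE subsetD)
  thus ?thesis by(auto intro: sm(4))
  qed
  show "c *[W] a : \<Union>\<C>" if "c :> K" "a : \<Union>\<C>" for a c using that by(auto intro: sm(6))
  qed
  thus "\<Union>\<C> : \<A>" using mem(2) ne unfolding \<A>_def by blast
 qed
 then obtain N where NA: "N : \<A>" and NM: "ALL X:\<A>. N <= X --> X = N" by(elim bexE)
 have N: "submodule N K W" "U \<inter> N = {0[W]}" using NA by(simp_all add: \<A>_def)
 have max: "X = N" if "submodule X K W" "U \<inter> X = {0[W]}" "N <= X" for X
  using NM that by(simp add: \<A>_def)
 note Nm = submodule_mem[OF W N(1)]
 have "\<exists>u\<in>U. \<exists>n\<in>N. w = u +[W] n" if w: "w :> W" for w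
 proof(cases "w : N")
  case True
  thus ?thesis using Um(2) w by(intro bexI[of _ "0[W]"] bexI[of _ w]) auto
 next
  case False
  define X where "X = (%(n, c). n +[W] c *[W] w) ` (N \<times> carrier K)"
  have Nc: "n :> W" if "n : N" for n using that Nm(1) by blast
  have XI: "n +[W] c *[W] w : X" if "n : N" "c :> K" for n c using that unfolding X_def by force
  have "submodule X K W"
  proof(rule W.submoduleI)
  show "X <= carrier W" using Nm(1) w unfolding X_def by auto
  show "0[W] : X" using XI[OF Nm(2) K.zero_closed] w by simp
  show "-[W] a : X" if aX: "a : X" for a
  proof -
  obtain n c where "a = n +[W] c *[W] w" "n : N" "c :> K" using aX unfolding X_def by auto
  thus ?thesis using XI[OF Nm(3)[of n], of "-[K] c"] w Nc
  by(simp add: W.minus_add W.smult_l_minus)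
  qed
  show "a +[W] b : X" if aX: "a : X" "b : X" for a b
  proof -
  obtain n c m d where "a = n +[W] c *[W] w" "n : N" "c :> K"
  "b = m +[W] d *[W] w" "m : N" "d :> K" using aX unfolding X_def by auto
  thus ?thesis using XI[OF Nm(4)[of n m], of "c +[K] d"] w Nc by(simp add: W.smult_l_distr W.a_ac)
  qed
  show "b *[W] a : X" if aX: "b :> K" "a : X" for a b
  proof -
  obtain n c where "a = n +[W] c *[W] w" "n : N" "c :> K" using aX unfolding X_def by auto
  thus ?thesis using XI[OF Nm(6)[of b n], of "b **[K] c"] w Nc aX(1)
  by(simp add: W.smult_r_distr W.smult_assoc1)
  qed
  qed
  moreover have "N <= X"
  proof
  fix n assume "n : N"
  thus "n : X" using XI[of n "0[K]"] Nc[of n] w by simp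
  qed
  moreover have "w : X" using XI[OF Nm(2) K.one_closed] w by simp
  ultimately have "U \<inter> X ~= {0[W]}" using max[of X] False by auto
  moreover have "0[W] : U \<inter> X" using Um(2) XI[OF Nm(2) K.zero_closed] w by simp
  ultimately obtain u where u: "u : U" "u : X" "u ~= 0[W]" by auto
  then obtain n c where n: "n : N" and c: "c :> K" and un: "u = n +[W] c *[W] w"
  unfolding X_def by auto
  have c0: "c ~= 0[K]"
  proof
  assume "c = 0[K]"
  hence "u = n" using un w n Nc by simp
  thus False using u n N(2) by blast
  qed
  hence ci: "inv\<^bsub>K\<^esub> c :> K" "inv\<^bsub>K\<^esub> c **[K] c = 1[K]" using c K.field_Units by(simp_all add: K.Units_l_inv)
  have "inv\<^bsub>K\<^esub> c *[W] (u -[W] n) = w"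
  proof -
  have "u -[W] n = c *[W] w" unfolding un using Nc[OF n] c w
  by(subst W.diff_eq_iff) (auto simp: W.a_comm)
  thus ?thesis using ci c w by(simp flip: W.smult_assoc1)
  qed
  hence "w = inv\<^bsub>K\<^esub> c *[W] u +[W] inv\<^bsub>K\<^esub> c *[W] (-[W] n)"
  using ci(1) subsetD[OF Um(1) u(1)] Nc[OF n] by(simp add: W.minus_eq W.smult_r_distr)
  thus ?thesis using Um(6)[OF ci(1) u(1)] Nm(6)[OF ci(1) Nm(3)[OF n]] by(intro bexI)
 qed
 thus ?thesis using that[of N] N by simp
qed

text \<open>Vector spaces are injective: g factors over the image of f because it vanishes on the
  kernel, and the factor is extended by zero to a complement N of the image. The extension is made
  \<open>extensional\<close> so that it is an element of \<open>hom_module\<close>.\<close>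

lemma lin_extend:
 assumes K: "field K" and M: "module K V" "module K W" "module K U"
  and f: "f : lin K V W" and g: "g : lin K V U"
  and ker: "!!x. x :> V ==> f x = 0[W] ==> g x = 0[U]"
 shows "\<exists>h\<in>lin K W U. h : extensional (carrier W) & (ALL x:carrier V. h (f x) = g x)"
proof -
 interpret V: module K V by fact
 interpret W: module K W by fact
 interpret U: module K U by fact
 obtain N where N: "submodule N K W" "f ` carrier V \<inter> N = {0[W]}"
  "!!w. w :> W ==> \<exists>u\<in>f ` carrier V. \<exists>n\<in>N. w = u +[W] n"
  by(rule complement_exists[OF K M(2) submodule_image[OF M(1,2) f]]) blast
 note Nm = submodule_mem[OF M(2) N(1)]
 note fc [simp] = lin_cl[OF f] lin_cl[OF g]
 have Nc [simp]: "n :> W" if "n : N" for n using that Nm(1) by blast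
 \<comment> \<open>The component in N is determined, but v only up to the kernel of f, where g
   vanishes. This makes the choice of v in the definition of h harmless.\<close>
 have uniq: "g v = g v'" if "v :> V" "v' :> V" "n : N" "n' : N" "f v +[W] n = f v' +[W] n'"
  for v v' n n'
 proof -
  have "f v = (n' +[W] f v') -[W] n"
  using that W.diff_eq_iff[of "n' +[W] f v'" n "f v"] by(auto simp: W.a_comm)
  hence "f (v -[V] v') = n' -[W] n" using that W.diff_eq_iff[of "f v" "f v'" "n' -[W] n"]
  by(simp add: lin_minus[OF M(1,2) f] W.minus_eq W.a_ac)
  moreover have "f (v -[V] v') : f ` carrier V" using that by(intro imageI) simp
  ultimately have "f (v -[V] v') : f ` carrier V \<inter> N" using that Nm(5) by simp
  hence "g (v -[V] v') = 0[U]" using N(2) ker that by simp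
  hence "g v -[U] g v' = 0[U]" using that by(simp add: lin_minus[OF M(1,3) g])
  thus ?thesis using that by(simp add: U.diff_eq_iff)
 qed
 define h where "h = (\<lambda>w\<in>carrier W. g (SOME v. v :> V & (\<exists>n\<in>N. w = f v +[W] n)))"
 have h: "h (f v +[W] n) = g v" if "v :> V" "n : N" for v n
 proof -
  let ?P = "%v'. v' :> V & (\<exists>n'\<in>N. f v +[W] n = f v' +[W] n')"
  have "?P (SOME v'. ?P v')" by(rule someI[of ?P v]) (use that in blast)
  then obtain v' n' where v': "v' = (SOME v'. ?P v')" "v' :> V" "n' : N"
  "f v +[W] n = f v' +[W] n'" by blast
  have "f v +[W] n :> W" using that by simp
  hence "h (f v +[W] n) = g v'" unfolding h_def v'(1) by(rule restrict_apply')
  also have "g v' = g v" by(rule uniq[OF v'(2) that(1) v'(3) that(2) v'(4)[symmetric]])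
  finally show ?thesis .
 qed
 have ex: "\<exists>v\<in>carrier V. \<exists>n\<in>N. w = f v +[W] n" if "w :> W" for w
  using N(3)[OF that] by auto
 have "h : lin K W U"
 proof(rule lin_mapsI)
  show "h w :> U" if "w :> W" for w
  proof -
  obtain v n where "v :> V" "n : N" "w = f v +[W] n" using ex[OF `w :> W`] by blast
  thus ?thesis by(simp add: h)
  qed
 next
  fix x y assume "x :> W" "y :> W"
  then obtain v n v' n' where v: "v :> V" "n : N" "x = f v +[W] n"
  "v' :> V" "n' : N" "y = f v' +[W] n'" by(auto dest!: ex)
  hence "x +[W] y = f (v +[V] v') +[W] (n +[W] n')" by(simp add: lin_add[OF f] W.a_ac)
  thus "h (x +[W] y) = h x +[U] h y" using v Nm by(simp add: h lin_add[OF g])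
 next
  fix c x assume c: "c :> K" and "x :> W"
  then obtain v n where v: "v :> V" "n : N" "x = f v +[W] n" by(auto dest!: ex)
  hence "c *[W] x = f (c *[V] v) +[W] c *[W] n"
  using c by(simp add: lin_smult[OF f] W.smult_r_distr)
  thus "h (c *[W] x) = c *[U] h x" using v c Nm by(simp add: h lin_smult[OF g])
 qed
 moreover have "h (f v) = g v" if "v :> V" for v using h[OF that Nm(2)] that by simp
 moreover have "h : extensional (carrier W)" unfolding h_def by simp
 ultimately show ?thesis by blast
qed

subsection \<open>Spaces of linear maps\<close>

lemma hom_carrier: "carrier (hom_module K V W) = lin K V W \<inter> extensional (carrier V)"
 by(simp add: hom_module_def)

lemma hom_eqI:
 assumes "f :> hom_module K V W" "g :> hom_module K V W"
  "!!x. x :> V ==> f x = g x"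
 shows "f = g" using assms by(auto simp: hom_carrier intro: extensionalityI)

lemma hom_add: "x :> V ==> (f +[hom_module K V W] g) x = f x +[W] g x"
 and hom_smult: "x :> V ==> (c *[hom_module K V W] f) x = c *[W] f x"
 and hom_zero: "x :> V ==> 0[hom_module K V W] x = 0[W]" by(simp_all add: hom_module_def)

lemma restrict_hom:
 assumes "module K V" "f : lin K V W"
 shows "restrict f (carrier V) :> hom_module K V W"
 using lin_cong[OF assms, of "restrict f (carrier V)"] by(simp add: hom_carrier)

lemma module_hom:
 assumes V: "module K V" and W: "module K W"
 shows "module K (hom_module K V W)"
proof -
 interpret V: module K V by fact
 interpret W: module K W by fact
 let ?H = "hom_module K V W"
 have cl: "f x :> W" if "f :> ?H" "x :> V" for f x using that by(auto simp: hom_carrier lin_cl)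
 have addc: "f +[?H] g :> ?H" if "f :> ?H" "g :> ?H" for f g
  using restrict_hom[OF V lin_add_map[OF W, of f V g]] that by(simp add: hom_carrier) (simp add: hom_module_def)
 have smc: "c *[?H] f :> ?H" if "f :> ?H" "c :> K" for f c
  using restrict_hom[OF V lin_smult_map[OF W, of c f V]] that by(simp add: hom_carrier) (simp add: hom_module_def)
 have zc: "0[?H] :> ?H"
  using restrict_hom[OF V lin_zero_map[OF W, of V]] by(simp add: hom_carrier) (simp add: hom_module_def)
 have sumE: "(f +[?H] g) x = f x +[W] g x" "(c *[?H] f) x = c *[W] f x"
  "0[?H] x = 0[W]" if "x :> V" for f g c x using that by(simp_all add: hom_add hom_smult hom_zero)
 note eqI = hom_eqI[where K=K and V=V and W=W]
 show ?thesis
 proof(rule moduleI)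
  show "cring K" ..
  show "abelian_group ?H"
  proof(rule abelian_groupI)
  show "\<exists>y\<in>carrier ?H. y +[?H] x = 0[?H]" if "x :> ?H" for x
  proof(rule bexI)
  show c: "(-[K] 1[K]) *[?H] x :> ?H" using that by(simp add: smc)
  show "(-[K] 1[K]) *[?H] x +[?H] x = 0[?H]"
  by(rule eqI[OF addc[OF c that] zc]) (use that in \<open>simp add: sumE cl W.smult_l_minus W.l_neg\<close>)
  qed
  show "x +[?H] y +[?H] z = x +[?H] (y +[?H] z)"
  if "x :> ?H" "y :> ?H" "z :> ?H" for x y z
  by(rule eqI) (use that in \<open>simp_all add: addc sumE cl W.a_assoc\<close>)
  show "x +[?H] y = y +[?H] x" if "x :> ?H" "y :> ?H" for x y
  by(rule eqI) (use that in \<open>simp_all add: addc sumE cl W.a_comm\<close>)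
  show "0[?H] +[?H] x = x" if "x :> ?H" for x
  by(rule eqI) (use that in \<open>simp_all add: addc zc sumE cl\<close>)
  qed (simp_all add: addc zc)
  show "a *[?H] x :> ?H" if "a :> K" "x :> ?H" for a x using that by(simp add: smc)
  show "(a +[K] b) *[?H] x = a *[?H] x +[?H] b *[?H] x"
  if "a :> K" "b :> K" "x :> ?H" for a b x
  by(rule eqI) (use that in \<open>simp_all add: addc smc sumE cl W.smult_l_distr\<close>)
  show "a *[?H] (x +[?H] y) = a *[?H] x +[?H] a *[?H] y"
  if "a :> K" "x :> ?H" "y :> ?H" for a x y
  by(rule eqI) (use that in \<open>simp_all add: addc smc sumE cl W.smult_r_distr\<close>)
  show "(a **[K] b) *[?H] x = a *[?H] (b *[?H] x)"
  if "a :> K" "b :> K" "x :> ?H" for a b x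
  by(rule eqI) (use that in \<open>simp_all add: smc sumE cl W.smult_assoc1\<close>)
  show "1[K] *[?H] x = x" if "x :> ?H" for x
  by(rule eqI) (use that in \<open>simp_all add: smc sumE cl\<close>)
 qed
qed

lemma hom_eval_lin:
 assumes "x :> V"
 shows "(%f. f x) : lin K (hom_module K V W) W"
 by(rule lin_mapsI) (use assms in \<open>simp_all add: hom_add hom_smult\<close>,
  use assms lin_cl[of _ K V W] in \<open>auto simp: hom_carrier\<close>)

subsection \<open>Free modules\<close>

lemma module_free:
 fixes K :: "'k ring"
 assumes "cring K"
 shows "module K (free_module K S)"
proof -
 interpret K: cring K by fact
 let ?F = "free_module K S"
 have sup: "{s. f s +[K] g s ~= 0[K]} <= {s. f s ~= 0[K]} \<union> {s. g s ~= 0[K]}" for f g by auto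
 have supm: "{s. c **[K] f s ~= 0[K]} <= {s. f s ~= 0[K]}" if "c :> K" for f c using that by auto
 have addc: "f +[?F] g :> ?F" if "f :> ?F" "g :> ?F" for f g
 proof -
  have "finite {s. f s +[K] g s ~= 0[K]}"
  by(rule finite_subset[OF sup]) (use that in \<open>simp add: free_module_def\<close>)
  moreover have "{s. f s +[K] g s ~= 0[K]} <= S"
  by(rule order_trans[OF sup]) (use that in \<open>simp add: free_module_def\<close>)
  ultimately show ?thesis using that by(simp add: free_module_def)
 qed
 have smc: "c *[?F] f :> ?F" if "f :> ?F" "c :> K" for f c
 proof -
  have "finite {s. c **[K] f s ~= 0[K]}"
  by(rule finite_subset[OF supm]) (use that in \<open>simp_all add: free_module_def\<close>)
  moreover have "{s. c **[K] f s ~= 0[K]} <= S"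
  by(rule order_trans[OF supm]) (use that in \<open>simp_all add: free_module_def\<close>)
  ultimately show ?thesis using that by(simp add: free_module_def)
 qed
 have cl: "f s :> K" if "f :> ?F" for f s using that by(simp add: free_module_def)
 have sel: "(f +[?F] g) = (%s. f s +[K] g s)" "c *[?F] f = (%s. c **[K] f s)" "0[?F] = (%s. 0[K])" for f g c
  by(simp_all add: free_module_def)
 have zc: "0[?F] :> ?F" by(simp add: free_module_def)
 show ?thesis
 proof(rule moduleI)
  show "cring K" by fact
  show "abelian_group ?F"
  proof(rule abelian_groupI)
  show "\<exists>y\<in>carrier ?F. y +[?F] x = 0[?F]" if "x :> ?F" for x
  proof(rule bexI)
  show "(-[K] 1[K]) *[?F] x :> ?F" by(rule smc[OF that]) simp
  show "(-[K] 1[K]) *[?F] x +[?F] x = 0[?F]" using that by(simp add: sel cl K.l_minus K.l_neg)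
  qed
  qed (simp_all add: addc zc, simp_all add: sel cl K.a_ac)
 qed (simp_all add: smc, simp_all add: sel cl K.l_distr K.r_distr K.m_assoc)
qed

lemma free_gen_carrier: "cring K ==> s : S ==> free_gen K s :> free_module K S"
proof -
 assume "cring K" "s : S"
 then interpret K: cring K by simp
 have "{t. free_gen K s t ~= 0[K]} <= {s}" by(auto simp: free_gen_def)
 thus ?thesis using `s : S` finite_subset[of _ "{s}"]
  by(auto simp: free_module_def) (simp add: free_gen_def)
qed

text \<open>Induction on a finite set containing the support: resetting the value at one index b to
  zero shrinks the support, and p is recovered by adding \<open>p b\<close> times the generator at
  b.\<close>

lemma free_induct [consumes 2, case_names zero gen add smult]:
 fixes p :: "'s => 'k"
 assumes K: "cring K" and p: "p :> free_module K S"
  and zero: "P 0[free_module K S]" and gen: "!!s. s : S ==> P (free_gen K s)"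
  and add: "!!p q. p :> free_module K S ==> q :> free_module K S ==> P p ==> P q ==>
  P (p +[free_module K S] q)"
  and smult: "!!c p. c :> K ==> p :> free_module K S ==> P p ==> P (c *[free_module K S] p)"
 shows "P p"
proof -
 interpret K: cring K by fact
 interpret F: module K "free_module K S" by(rule module_free[OF K])
 have "ALL p:carrier (free_module K S). {s. p s ~= 0[K]} <= B --> P p" if "finite B" "B <= S" for B
  using that
 proof(induction B rule: finite_induct)
  case empty
  show ?case
  proof(intro ballI impI)
  fix p :: "'s => 'k" assume "{s. p s ~= 0[K]} <= {}"
  hence "p = 0[free_module K S]" by(auto simp: free_module_def)
  thus "P p" using zero by simp
  qed
 next
  case (insert b B)
  show ?case
  proof(intro ballI impI)
  fix p assume p: "p :> free_module K S" "{s. p s ~= 0[K]} <= insert b B"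
  have pc: "p s :> K" for s using p(1) by(simp add: free_module_def)
  define q where "q = p(b := 0[K])"
  have sub: "{s. q s ~= 0[K]} <= {s. p s ~= 0[K]}" "{s. q s ~= 0[K]} <= B"
  using p(2) unfolding q_def by auto
  have qc: "q :> free_module K S"
  using p(1) finite_subset[OF sub(1)] sub(1) pc by(auto simp: free_module_def) (simp add: q_def)
  have "p = q +[free_module K S] p b *[free_module K S] free_gen K b"
  using pc by(auto simp: free_module_def q_def free_gen_def)
  moreover have "P q" using insert qc sub(2) by blast
  moreover have "P (p b *[free_module K S] free_gen K b)"
  using insert.prems pc by(intro smult gen free_gen_carrier K) auto
  ultimately show "P p"
  using add[OF qc, of "p b *[free_module K S] free_gen K b"] pc insert.prems free_gen_carrier[OF K, of b S]
  by simp
  qed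
 qed
 from this[of "{s. p s ~= 0[K]}"] show ?thesis using p by(simp add: free_module_def)
qed

text \<open>The sum that \<open>tlift\<close> computes from its chosen representative, isolated as a
  function of the representative so that its linearity can be stated.\<close>

definition free_eval :: "'k ring => ('k, 'u, 'x) module_scheme => ('s => 'u) => ('s => 'k) => 'u" where
 "free_eval K U f p = (\<Oplus>\<^bsub>U\<^esub>s\<in>{s. p s ~= 0[K]}. p s *[U] f s)"

lemma free_eval:
 assumes U: "module K U" and f: "!!s. s : S ==> f s :> U"
 shows "free_eval K U f : lin K (free_module K S) U" (is ?lin)
  and "1[K] ~= 0[K] ==> s : S ==> free_eval K U f (free_gen K s) = f s"
proof -
 interpret U: module K U by fact
 have pc: "p s :> K" "finite {s. p s ~= 0[K]}" "{s. p s ~= 0[K]} <= S"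
  if "p :> free_module K S" for p s using that by(simp_all add: free_module_def)
 \<comment> \<open>Supports vary with p, so sums are compared over a common finite superset B, where
   the additional summands vanish.\<close>
 have big: "free_eval K U f p = (\<Oplus>\<^bsub>U\<^esub>s\<in>B. p s *[U] f s)"
  if "p :> free_module K S" "finite B" "B <= S" "{s. p s ~= 0[K]} <= B" for p B
  unfolding free_eval_def by(rule U.add.finprod_mono_neutral_cong_left[folded finsum_def])
  (use that pc f in \<open>auto simp: Pi_iff intro!: U.smult_closed f\<close>)
 show ?lin
 proof(rule lin_mapsI)
  show "free_eval K U f p :> U" if "p :> free_module K S" for p
  unfolding free_eval_def using pc[OF that] f by(intro U.finsum_closed) auto
 next
  fix p q assume pq: "p :> free_module K S" "q :> free_module K S"
  define B where "B = {s. p s ~= 0[K]} \<union> {s. q s ~= 0[K]}"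
  have B: "finite B" "B <= S" using pc[OF pq(1)] pc[OF pq(2)] unfolding B_def by auto
  have fB: "s : B ==> f s :> U" for s using B f by auto
  have pq': "p +[free_module K S] q :> free_module K S"
  using module_free[OF U.R.is_cring, of S] pq by(simp add: module_def abelian_group.axioms abelian_monoid.a_closed)
  have sel: "(p +[free_module K S] q) s = p s +[K] q s" for s by(simp add: free_module_def)
  have "free_eval K U f (p +[free_module K S] q) = (\<Oplus>\<^bsub>U\<^esub>s\<in>B. (p s +[K] q s) *[U] f s)"
  by(subst big[OF pq' B]) (auto simp: B_def sel)
  also have "... = (\<Oplus>\<^bsub>U\<^esub>s\<in>B. p s *[U] f s +[U] q s *[U] f s)"
  by(rule U.finsum_cong') (use fB pc(1)[OF pq(1)] pc(1)[OF pq(2)] in \<open>auto simp: U.smult_l_distr\<close>)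
  also have "... = (\<Oplus>\<^bsub>U\<^esub>s\<in>B. p s *[U] f s) +[U] (\<Oplus>\<^bsub>U\<^esub>s\<in>B. q s *[U] f s)"
  by(rule U.finsum_addf) (use fB pc(1)[OF pq(1)] pc(1)[OF pq(2)] in auto)
  also have "... = free_eval K U f p +[U] free_eval K U f q"
  by(subst (1 2) big[OF _ B]) (auto simp: pq B_def)
  finally show "free_eval K U f (p +[free_module K S] q) = free_eval K U f p +[U] free_eval K U f q" .
 next
  fix c p assume c: "c :> K" and p: "p :> free_module K S"
  define B where "B = {s. p s ~= 0[K]}"
  have B: "finite B" "B <= S" using pc[OF p] unfolding B_def by auto
  have fB: "s : B ==> f s :> U" for s using B f by auto
  have p': "c *[free_module K S] p :> free_module K S"
  using module.smult_closed[OF module_free[OF U.R.is_cring, of S] c p] .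
  have sel: "(c *[free_module K S] p) s = c **[K] p s" for s by(simp add: free_module_def)
  have "free_eval K U f (c *[free_module K S] p) = (\<Oplus>\<^bsub>U\<^esub>s\<in>B. (c **[K] p s) *[U] f s)"
  by(subst big[OF p' B]) (auto simp: B_def sel c)
  also have "... = (\<Oplus>\<^bsub>U\<^esub>s\<in>B. c *[U] (p s *[U] f s))"
  by(rule U.finsum_cong') (use fB pc(1)[OF p] c in \<open>auto simp: U.smult_assoc1\<close>)
  also have "... = c *[U] (\<Oplus>\<^bsub>U\<^esub>s\<in>B. p s *[U] f s)"
  by(rule U.finsum_smult_ldistr[symmetric]) (use fB pc(1)[OF p] c B in auto)
  finally show "free_eval K U f (c *[free_module K S] p) = c *[U] free_eval K U f p"
  by(simp add: free_eval_def B_def)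
 qed
 show "free_eval K U f (free_gen K s) = f s" if "1[K] ~= 0[K]" "s : S"
 proof -
  \<comment> \<open>Here 1 \<noteq> 0 matters: it makes the support of a generator the singleton of
    s rather than empty.\<close>
  have "{t. free_gen K s t ~= 0[K]} = {s}" using that(1) by(auto simp: free_gen_def)
  thus ?thesis using f[OF that(2)] unfolding free_eval_def by(simp add: free_gen_def)
 qed
qed

subsection \<open>Multilinear maps\<close>

text \<open>The varying slot is marked by splitting the list as \<open>xs @ v # ys\<close>, which
  suits induction from either end of the list. The companion \<open>mlin2\<close> keeps the last
  argument apart, since \<open>tens\<close> allows it to come from a different space.\<close>

definition mlin :: "'k ring => nat => ('k, 'v, 'x) module_scheme => ('k, 'u, 'y) module_scheme =>
  ('v list => 'u) => bool" where
 "mlin K m V U f \<longleftrightarrow> (ALL vs. length vs = m & vs :>* V --> f vs :> U) \<and>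
  (ALL xs ys. xs :>* V & ys :>* V & length xs + Suc (length ys) = m -->
  (%v. f (xs @ v # ys)) : lin K V U)"

definition mlin2 :: "'k ring => nat => ('k, 'v, 'x) module_scheme => ('k, 'w, 'z) module_scheme =>
  ('k, 'u, 'y) module_scheme => ('v list => 'w => 'u) => bool" where
 "mlin2 K n V W U f \<longleftrightarrow> (ALL w:carrier W. mlin K n V U (%vs. f vs w)) \<and>
  (ALL vs. length vs = n & vs :>* V --> f vs : lin K W U)"

lemma mlinI:
 assumes "!!vs. length vs = m ==> vs :>* V ==> f vs :> U"
  and "!!xs ys. xs :>* V ==> ys :>* V ==> length xs + Suc (length ys) = m ==>
  (%v. f (xs @ v # ys)) : lin K V U"
 shows "mlin K m V U f" using assms unfolding mlin_def by blast

lemma mlin_closed: "mlin K m V U f ==> length vs = m ==> vs :>* V ==> f vs :> U"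
 and mlin_slot: "mlin K m V U f ==> xs :>* V ==> ys :>* V ==>
  length xs + Suc (length ys) = m ==> (%v. f (xs @ v # ys)) : lin K V U"
 unfolding mlin_def by blast+

lemma mlin_head: "mlin K (Suc m) V U f ==> length vs = m ==> vs :>* V ==>
  (%v. f (v # vs)) : lin K V U" using mlin_slot[of K "Suc m" V U f "[]" vs] by simp

lemma mlin_tail:
 assumes "mlin K (Suc m) V U f" "v :> V"
 shows "mlin K m V U (%vs. f (v # vs))"
proof(rule mlinI)
 show "f (v # vs) :> U" if "length vs = m" "vs :>* V" for vs
  using that assms(2) mlin_closed[OF assms(1), of "v # vs"] by simp
 show "(%va. f (v # xs @ va # ys)) : lin K V U"
  if "xs :>* V" "ys :>* V" "length xs + Suc (length ys) = m" for xs ys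
  using mlin_slot[OF assms(1), of "v # xs" ys] that assms(2) by simp
qed

lemma mlin_0: "f [] :> U ==> mlin K 0 V U f" by(rule mlinI) auto

lemma mlin_ConsI:
 assumes "!!v. v :> V ==> mlin K m V U (%vs. f (v # vs))"
  and "!!vs. length vs = m ==> vs :>* V ==> (%v. f (v # vs)) : lin K V U"
 shows "mlin K (Suc m) V U f"
proof(rule mlinI)
 show "f vs :> U" if "length vs = Suc m" "vs :>* V" for vs
  using that assms(1) by(cases vs) (auto dest: mlin_closed)
 show "(%v. f (xs @ v # ys)) : lin K V U"
  if "xs :>* V" "ys :>* V" "length xs + Suc (length ys) = Suc m" for xs ys
 proof(cases xs)
  case Nil
  thus ?thesis using assms(2)[of ys] that by simp
 next
  case (Cons x xs')
  thus ?thesis using mlin_slot[OF assms(1)[of x], of xs' ys] that by simp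
 qed
qed

lemma mlin_snocI:
 assumes "!!v. v :> V ==> mlin K m V U (%vs. f (vs @ [v]))"
  and "!!vs. length vs = m ==> vs :>* V ==> (%v. f (vs @ [v])) : lin K V U"
 shows "mlin K (Suc m) V U f"
proof(rule mlinI)
 show "f vs :> U" if "length vs = Suc m" "vs :>* V" for vs
  using that mlin_closed[OF assms(1), of "last vs" "butlast vs"] by(cases vs rule: rev_cases) auto
 show "(%v. f (xs @ v # ys)) : lin K V U"
  if "xs :>* V" "ys :>* V" "length xs + Suc (length ys) = Suc m" for xs ys
 proof(cases ys rule: rev_cases)
  case Nil
  thus ?thesis using assms(2)[of xs] that by simp
 next
  case (snoc ys' y)
  thus ?thesis using mlin_slot[OF assms(1)[of y], of xs ys'] that by simp
 qed
qed

lemma mlin_last: "mlin K (Suc m) V U f ==> length vs = m ==> vs :>* V ==>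
  (%v. f (vs @ [v])) : lin K V U" using mlin_slot[of K "Suc m" V U f vs "[]"] by simp

lemma mlin_init:
 assumes "mlin K (Suc m) V U f" "v :> V"
 shows "mlin K m V U (%vs. f (vs @ [v]))"
proof(rule mlinI)
 show "f (vs @ [v]) :> U" if "length vs = m" "vs :>* V" for vs
  using that assms(2) mlin_closed[OF assms(1), of "vs @ [v]"] by simp
 show "(%va. f ((xs @ va # ys) @ [v])) : lin K V U"
  if "xs :>* V" "ys :>* V" "length xs + Suc (length ys) = m" for xs ys
  using mlin_slot[OF assms(1), of xs "ys @ [v]"] that assms(2) by simp
qed

lemma mlin_comp:
 assumes "mlin K m V U f" "g : lin K U U'"
 shows "mlin K m V U' (%vs. g (f vs))"
proof(rule mlinI)
 show "g (f vs) :> U'" if "length vs = m" "vs :>* V" for vs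
  using lin_cl[OF assms(2) mlin_closed[OF assms(1) that]] .
 show "(%v. g (f (xs @ v # ys))) : lin K V U'"
  if "xs :>* V" "ys :>* V" "length xs + Suc (length ys) = m" for xs ys
  using lin_comp[OF mlin_slot[OF assms(1) that] assms(2)] .
qed

lemma mlin_cong:
 assumes "module K V" "mlin K m V U f" "!!vs. length vs = m ==> vs :>* V ==> f vs = g vs"
 shows "mlin K m V U g"
proof(rule mlinI)
 show "g vs :> U" if "length vs = m" "vs :>* V" for vs
  using mlin_closed[OF assms(2) that] assms(3)[OF that] by simp
 show "(%v. g (xs @ v # ys)) : lin K V U"
  if "xs :>* V" "ys :>* V" "length xs + Suc (length ys) = m" for xs ys
  by(rule lin_cong[OF assms(1) mlin_slot[OF assms(2) that]]) (use that assms(3) in auto)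
qed

text \<open>Each slot is preceded by its own linear map, given by the entry of \<open>as\<close> at
  that position. With b an action this covers both the dependence on acting elements and, after a
  flip, the dependence on the elements acted upon.\<close>

lemma mlin_map2:
 assumes f: "mlin K m V U f" and l: "length as = m" and P: "!!a. a : set as ==> (%h. b h a) : lin K H V"
 shows "mlin K m H U (%hs. f (map2 b hs as))"
proof(rule mlinI)
 have cl: "(map2 b hs as') :>* V" if "hs :>* H" "set as' <= set as" for hs as'
 proof
  fix x assume "x : set (map2 b hs as')"
  then obtain h a where ha: "(h, a) : set (zip hs as')" "x = b h a" by auto
  have "h : set hs" "a : set as'" using set_zip_leftD[OF ha(1)] set_zip_rightD[OF ha(1)] by simp_all
  hence "h :> H" "a : set as" using that by auto
  thus "x :> V" using ha(2) lin_cl[OF P] by simp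
 qed
 show "f (map2 b hs as) :> U" if "length hs = m" "hs :>* H" for hs
  using mlin_closed[OF f _ cl] that l by simp
 show "(%h. f (map2 b (xs @ h # ys) as)) : lin K H U"
  if xy: "xs :>* H" "ys :>* H" "length xs + Suc (length ys) = m" for xs ys
 proof -
  obtain as1 a as2 where as: "as = as1 @ a # as2" "length as1 = length xs"
  proof
  have "length xs < length as" using l xy(3) by simp
  thus "as = take (length xs) as @ as ! length xs # drop (Suc (length xs)) as"
  "length (take (length xs) as) = length xs" by(simp_all add: id_take_nth_drop[symmetric])
  qed
  have "length as2 = length ys" using as l xy(3) by simp
  hence eq: "map2 b (xs @ h # ys) as = map2 b xs as1 @ b h a # map2 b ys as2" for h using as by simp
  have "(%v. f (map2 b xs as1 @ v # map2 b ys as2)) : lin K V U"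
  proof(rule mlin_slot[OF f])
  show "(map2 b xs as1) :>* V" by(rule cl[OF xy(1)]) (auto simp: as(1))
  show "(map2 b ys as2) :>* V" by(rule cl[OF xy(2)]) (auto simp: as(1))
  show "length (map2 b xs as1) + Suc (length (map2 b ys as2)) = m"
  using xy(3) as(2) `length as2 = length ys` by simp
  qed
  moreover have "(%h. b h a) : lin K H V" by(rule P) (simp add: as(1))
  ultimately have "(%h. f (map2 b xs as1 @ b h a # map2 b ys as2)) : lin K H U" by(rule lin_comp[rotated])
  thus ?thesis unfolding eq .
 qed
qed

lemma mlin2I:
 assumes "!!w. w :> W ==> mlin K n V U (%vs. f vs w)"
  and "!!vs. length vs = n ==> vs :>* V ==> f vs : lin K W U"
 shows "mlin2 K n V W U f" using assms unfolding mlin2_def by blast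

lemma mlin2_1: "mlin2 K n V W U f ==> w :> W ==> mlin K n V U (%vs. f vs w)"
 and mlin2_2: "mlin2 K n V W U f ==> length vs = n ==> vs :>* V ==> f vs : lin K W U"
 unfolding mlin2_def by blast+

lemma mlin2_closed: "mlin2 K n V W U f ==> length vs = n ==> vs :>* V ==> w :> W ==> f vs w :> U"
 by(rule lin_cl[OF mlin2_2])

lemma mlin2_comp: "mlin2 K n V W U f ==> g : lin K U U' ==> mlin2 K n V W U' (%vs w. g (f vs w))"
 by(rule mlin2I) (rule mlin_comp[OF mlin2_1] lin_comp[OF mlin2_2]; assumption)+

lemma mlin2_tail:
 assumes f: "mlin2 K (Suc n) V W U f" and v: "v :> V"
 shows "mlin2 K n V W U (%vs w. f (v # vs) w)"
proof(rule mlin2I)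
 show "mlin K n V U (%vs. f (v # vs) w)" if "w :> W" for w
  by(rule mlin_tail[OF mlin2_1[OF f that] v])
 show "f (v # vs) : lin K W U" if "length vs = n" "vs :>* V" for vs
  by(rule mlin2_2[OF f]) (use that v in simp_all)
qed

text \<open>A bridge for \<open>Cyc\<close>, where a tensor power of A is encoded as
  \<open>tens K n A A\<close>: the separate last factor and the n listed ones are there treated as a
  single list.\<close>

lemma mlin2_snoc_iff:
 "mlin2 K n V V U (%vs v. f (vs @ [v])) \<longleftrightarrow> mlin K (Suc n) V U f"
proof
 assume *: "mlin2 K n V V U (%vs v. f (vs @ [v]))"
 show "mlin K (Suc n) V U f" by(rule mlin_snocI) (simp_all add: mlin2_1[OF *] mlin2_2[OF *])
next
 assume *: "mlin K (Suc n) V U f"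
 show "mlin2 K n V V U (%vs v. f (vs @ [v]))"
  by(rule mlin2I) (simp_all add: mlin_init[OF *] mlin_last[OF *])
qed

lemma mlin2_bilin:
 assumes f: "!!v. v :> V ==> f v : lin K W U" "!!w. w :> W ==> (%v. f v w) : lin K V U"
 shows "mlin2 K 1 V W U (%vs w. f (hd vs) w)"
proof(rule mlin2I)
 show "mlin K 1 V U (%vs. f (hd vs) w)" if "w :> W" for w unfolding One_nat_def
 proof(rule mlin_ConsI)
  show "mlin K 0 V U (%vs. f (hd (v # vs)) w)" if "v :> V" for v
  using lin_cl[OF f(1)[OF that] `w :> W`] by(simp add: mlin_0)
  show "(%v. f (hd (v # vs)) w) : lin K V U" for vs using f(2)[OF `w :> W`] by simp
 qed
 show "f (hd vs) : lin K W U" if "length vs = 1" "vs :>* V" for vs using that f(1) by(cases vs) auto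
qed

subsection \<open>Tensor products\<close>

locale tensor =
 fixes K :: "'k ring" and V :: "('k, 'v, 'x) module_scheme" and W :: "('k, 'w, 'y) module_scheme"
 assumes field_K: "field K" and module_V: "module K V" and module_W: "module K W"
begin

sublocale K: field K by(rule field_K)

lemma module_tens_free: "module K (tens_free K n V W)" by(rule module_free[OF K.is_cring])

lemma tens_index_iff: "(vs, w) : tens_index n V W \<longleftrightarrow> length vs = n & vs :>* V & w :> W"
 by(simp add: tens_index_def)

lemma gen_carrier: "length vs = n ==> vs :>* V ==> w :> W ==>
  free_gen K (vs, w) :> tens_free K n V W"
 by(rule free_gen_carrier[OF K.is_cring]) (simp add: tens_index_iff)

lemma free_minus_closed:
 "x :> tens_free K n V W ==> y :> tens_free K n V W ==>
  x -[tens_free K n V W] y :> tens_free K n V W"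
 using module_tens_free[of n] by(simp add: module_def abelian_group.minus_closed)

lemma tens_relsI:
 "(vs, w) : tens_index n V W ==> i < n ==> x :> V ==> y :> V ==>
  (free_gen K (vs[i := x +[V] y], w) -[tens_free K n V W] free_gen K (vs[i := x], w))
  -[tens_free K n V W] free_gen K (vs[i := y], w) : tens_rels K n V W"
 "(vs, w) : tens_index n V W ==> i < n ==> c :> K ==> x :> V ==>
  free_gen K (vs[i := c *[V] x], w) -[tens_free K n V W]
  (c *[tens_free K n V W] free_gen K (vs[i := x], w)) : tens_rels K n V W"
 "(vs, x') : tens_index n V W ==> (vs, y') : tens_index n V W ==>
  (free_gen K (vs, x' +[W] y') -[tens_free K n V W] free_gen K (vs, x'))
  -[tens_free K n V W] free_gen K (vs, y') : tens_rels K n V W"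
 "(vs, x') : tens_index n V W ==> c :> K ==> free_gen K (vs, c *[W] x') -[tens_free K n V W]
  (c *[tens_free K n V W] free_gen K (vs, x')) : tens_rels K n V W" unfolding tens_rels_def Let_def
 subgoal by(rule UnI1, rule UnI1, rule UnI1, rule CollectI)
  (rule exI[of _ vs], rule exI[of _ w], rule exI[of _ i], rule exI[of _ x], rule exI[of _ y], intro conjI refl; assumption)
 subgoal by(rule UnI1, rule UnI1, rule UnI2, rule CollectI)
  (rule exI[of _ vs], rule exI[of _ w], rule exI[of _ i], rule exI[of _ c], rule exI[of _ x], intro conjI refl; assumption)
 subgoal by(rule UnI1, rule UnI2, rule CollectI)
  (rule exI[of _ vs], rule exI[of _ x'], rule exI[of _ y'], intro conjI refl; assumption)
 subgoal by(rule UnI2, rule CollectI)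
  (rule exI[of _ vs], rule exI[of _ c], rule exI[of _ x'], intro conjI refl; assumption)
 done

lemma tens_rels_carrier: "tens_rels K n V W <= carrier (tens_free K n V W)"
proof -
 interpret V: module K V by(rule module_V)
 interpret W: module K W by(rule module_W)
 interpret F: module K "tens_free K n V W" by(rule module_tens_free)
 show ?thesis unfolding tens_rels_def Let_def
  by(auto simp: tens_index_iff intro!: free_minus_closed gen_carrier module.smult_closed[OF module_tens_free]
  dest!: set_update_subset_insert[THEN subsetD])
qed

lemma tens_ker_submodule: "submodule (tens_ker K n V W) K (tens_free K n V W)"
 unfolding tens_ker_def by(rule gen_submodule[OF module_tens_free tens_rels_carrier])

lemma mtens: "module K (tens K n V W)"
 unfolding tens_def by(rule module_quot[OF module_tens_free tens_ker_submodule])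

lemma tprod_closed:
 assumes "length vs = n" "vs :>* V" "w :> W"
 shows "tprod K V W vs w :> tens K n V W"
 unfolding tprod_def tens_def quot_carrier using assms gen_carrier by auto

lemma update_append: "i < length vs ==> vs[i := x] = take i vs @ x # drop (Suc i) vs"
 by(rule upd_conv_take_nth_drop)

text \<open>Every relation in \<open>tens_rels\<close> says that two formal combinations have the
  same coset. \<open>step_add\<close> and \<open>step_smult\<close> turn the two shapes of relation
  into equations between pure tensors.\<close>

lemma tprod_mlin2: "mlin2 K n V W (tens K n V W) (tprod K V W)"
proof -
 interpret V: module K V by(rule module_V)
 interpret W: module K W by(rule module_W)
 interpret F: module K "tens_free K n V W" by(rule module_tens_free)
 let ?N = "tens_ker K n V W"
 note Q = module_tens_free tens_ker_submodule
 have inN: "r : tens_rels K n V W ==> r : ?N" for r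
  unfolding tens_ker_def by(rule subsetD[OF gen_submodule_incl])
 have step_add: "tprod K V W vs w = tprod K V W vs1 w1 +[tens K n V W] tprod K V W vs2 w2"
  if r: "(free_gen K (vs, w) -[tens_free K n V W] free_gen K (vs1, w1)) -[tens_free K n V W] free_gen K (vs2, w2) : tens_rels K n V W"
  and c: "(vs, w) : tens_index n V W" "(vs1, w1) : tens_index n V W" "(vs2, w2) : tens_index n V W"
  for vs w vs1 w1 vs2 w2
 proof -
  have g: "free_gen K (vs, w) :> tens_free K n V W" "free_gen K (vs1, w1) :> tens_free K n V W"
  "free_gen K (vs2, w2) :> tens_free K n V W" using c by(simp_all add: gen_carrier tens_index_iff)
  let ?a = "free_gen K (vs, w)" and ?b = "free_gen K (vs1, w1)" and ?c = "free_gen K (vs2, w2)"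
  have "?a -[tens_free K n V W] (?b +[tens_free K n V W] ?c) = (?a -[tens_free K n V W] ?b) -[tens_free K n V W] ?c"
  unfolding a_minus_def using g by(simp only: F.minus_add F.a_assoc F.a_inv_closed)
  hence "?N +>[tens_free K n V W] ?a = ?N +>[tens_free K n V W] (?b +[tens_free K n V W] ?c)"
  using inN[OF r] coset_eq_iff[OF Q g(1) F.a_closed[OF g(2,3)]] by(simp only:)
  also have "... = (?N +>[tens_free K n V W] ?b) +[tens K n V W] (?N +>[tens_free K n V W] ?c)"
  unfolding tens_def by(rule quot_add[OF Q g(2,3), symmetric])
  finally show ?thesis unfolding tprod_def using c by(simp only: tens_index_iff)
 qed
 have step_smult: "tprod K V W vs w = c *[tens K n V W] tprod K V W vs1 w1"
  if r: "free_gen K (vs, w) -[tens_free K n V W] (c *[tens_free K n V W] free_gen K (vs1, w1)) : tens_rels K n V W"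
  and c: "(vs, w) : tens_index n V W" "(vs1, w1) : tens_index n V W" "c :> K"
  for vs w vs1 w1 c
 proof -
  have g: "free_gen K (vs, w) :> tens_free K n V W" "free_gen K (vs1, w1) :> tens_free K n V W"
  using c by(simp_all add: gen_carrier tens_index_iff)
  have "?N +>[tens_free K n V W] free_gen K (vs, w) = ?N +>[tens_free K n V W] (c *[tens_free K n V W] free_gen K (vs1, w1))"
  using inN[OF r] coset_eq_iff[OF Q g(1) F.smult_closed[OF c(3) g(2)]] by(simp only:)
  also have "... = c *[tens K n V W] (?N +>[tens_free K n V W] free_gen K (vs1, w1))"
  unfolding tens_def by(rule quot_smult[OF Q c(3) g(2), symmetric])
  finally show ?thesis unfolding tprod_def using c by(simp only: tens_index_iff)
 qed
 show ?thesis
 proof(rule mlin2I)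
  fix w assume w: "w :> W"
  show "mlin K n V (tens K n V W) (%vs. tprod K V W vs w)"
  proof(rule mlinI)
  show "tprod K V W vs w :> tens K n V W" if "length vs = n" "vs :>* V" for vs
  using that w by(rule tprod_closed)
  fix xs ys assume xy: "xs :>* V" "ys :>* V" "length xs + Suc (length ys) = n"
  show "(%v. tprod K V W (xs @ v # ys) w) : lin K V (tens K n V W)"
  proof(rule lin_mapsI)
  show "tprod K V W (xs @ x # ys) w :> tens K n V W" if "x :> V" for x
  using that xy w by(intro tprod_closed) auto
  show "tprod K V W (xs @ (x +[V] y) # ys) w = tprod K V W (xs @ x # ys) w +[tens K n V W] tprod K V W (xs @ y # ys) w"
  if "x :> V" "y :> V" for x y
  proof(rule step_add)
  show "(free_gen K (xs @ (x +[V] y) # ys, w) -[tens_free K n V W] free_gen K (xs @ x # ys, w))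
  -[tens_free K n V W] free_gen K (xs @ y # ys, w) : tens_rels K n V W"
  using tens_relsI(1)[of "xs @ x # ys" w n "length xs" x y] that xy w by(simp add: tens_index_iff)
  qed (use that xy w in \<open>auto simp: tens_index_iff\<close>)
  show "tprod K V W (xs @ (c *[V] x) # ys) w = c *[tens K n V W] tprod K V W (xs @ x # ys) w"
  if "c :> K" "x :> V" for c x
  proof(rule step_smult)
  show "free_gen K (xs @ (c *[V] x) # ys, w) -[tens_free K n V W] (c *[tens_free K n V W] free_gen K (xs @ x # ys, w))
  : tens_rels K n V W"
  using tens_relsI(2)[of "xs @ x # ys" w n "length xs" c x] that xy w by(simp add: tens_index_iff)
  qed (use that xy w in \<open>auto simp: tens_index_iff\<close>)
  qed
  qed
 next
  fix vs assume vs: "length vs = n" "vs :>* V"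
  show "tprod K V W vs : lin K W (tens K n V W)"
  proof(rule lin_mapsI)
  show "tprod K V W vs w :> tens K n V W" if "w :> W" for w using vs that by(rule tprod_closed)
  show "tprod K V W vs (x +[W] y) = tprod K V W vs x +[tens K n V W] tprod K V W vs y"
  if "x :> W" "y :> W" for x y
  proof(rule step_add)
  show "(free_gen K (vs, x +[W] y) -[tens_free K n V W] free_gen K (vs, x))
  -[tens_free K n V W] free_gen K (vs, y) : tens_rels K n V W"
  by(rule tens_relsI(3)) (use that vs in \<open>auto simp: tens_index_iff\<close>)
  qed (use that vs in \<open>auto simp: tens_index_iff\<close>)
  show "tprod K V W vs (c *[W] x) = c *[tens K n V W] tprod K V W vs x"
  if "c :> K" "x :> W" for c x
  proof(rule step_smult)
  show "free_gen K (vs, c *[W] x) -[tens_free K n V W] (c *[tens_free K n V W] free_gen K (vs, x))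
  : tens_rels K n V W"
  by(rule tens_relsI(4)) (use that vs in \<open>auto simp: tens_index_iff\<close>)
  qed (use that vs in \<open>auto simp: tens_index_iff\<close>)
  qed
 qed
qed

lemma tens_induct [consumes 1, case_names tprod add smult]:
 assumes t: "t :> tens K n V W"
  and gen: "!!vs w. length vs = n ==> vs :>* V ==> w :> W ==> P (tprod K V W vs w)"
  and add: "!!x y. x :> tens K n V W ==> y :> tens K n V W ==> P x ==> P y ==>
  P (x +[tens K n V W] y)"
  and smult: "!!c x. c :> K ==> x :> tens K n V W ==> P x ==> P (c *[tens K n V W] x)"
  and zero: "P 0[tens K n V W]"
 shows "P t"
proof -
 note Q = module_tens_free tens_ker_submodule
 let ?c = "%p. tens_ker K n V W +>[tens_free K n V W] p"
 obtain p where p: "p :> tens_free K n V W" "t = ?c p"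
  using t unfolding tens_def by(rule quot_carrierE)
 have cc: "?c q :> tens K n V W" if "q :> tens_free K n V W" for q
  using that by(simp add: tens_def quot_carrier)
 have "P (?c p)" using K.is_cring p(1)
 proof(induction rule: free_induct)
  case zero
  thus ?case using assms(5) by(simp add: coset_zero[OF Q] tens_def quot_zero)
 next
  case (gen s)
  thus ?case using assms(2)[of "fst s" "snd s"] by(cases s) (simp add: tens_index_iff tprod_def)
 next
  case (add p q)
  thus ?case using assms(3)[OF cc cc, of p q] by(simp add: tens_def quot_add[OF Q])
 next
  case (smult c p)
  thus ?case using assms(4)[OF _ cc, of c p] by(simp add: tens_def quot_smult[OF Q])
 qed
 thus ?thesis using p by simp
qed

lemma tens_ext:
 assumes U: "module K U" and F: "F : lin K (tens K n V W) U" and G: "G : lin K (tens K n V W) U"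
  and eq: "!!vs w. length vs = n ==> vs :>* V ==> w :> W ==>
  F (tprod K V W vs w) = G (tprod K V W vs w)"
  and t: "t :> tens K n V W"
 shows "F t = G t" using t
proof(induction rule: tens_induct)
 case (add x y)
 thus ?case by(simp add: lin_add[OF F] lin_add[OF G])
next
 case (smult c x)
 thus ?case by(simp add: lin_smult[OF F] lin_smult[OF G])
qed (simp_all add: eq lin_zero[OF mtens U F] lin_zero[OF mtens U G])

text \<open>Multilinearity of f makes the evaluation vanish on each of the four families of
  relations, hence on the submodule they generate. The value of \<open>tlift\<close> is therefore
  independent of the representative it picks.\<close>

lemma tlift_coset:
 assumes U: "module K U" and f: "mlin2 K n V W U f" and p: "p :> tens_free K n V W"
 shows "tlift K U f (tens_ker K n V W +>[tens_free K n V W] p) = free_eval K U (%(vs, w). f vs w) p"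
proof -
 interpret V: module K V by(rule module_V)
 interpret W: module K W by(rule module_W)
 interpret U: module K U by fact
 interpret F: module K "tens_free K n V W" by(rule module_tens_free)
 note Q = module_tens_free tens_ker_submodule
 let ?ev = "free_eval K U (%(vs, w). f vs w)"
 have fc: "(%(vs, w). f vs w) s :> U" if "s : tens_index n V W" for s
  using that mlin2_closed[OF f] by(cases s) (simp add: tens_index_iff)
 note ev = free_eval[where S="tens_index n V W", OF U fc, simplified]
 have ev_gen: "?ev (free_gen K (vs, w)) = f vs w" if "length vs = n" "vs :>* V" "w :> W" for vs w
  using ev(2)[where s="(vs, w)"] that by(simp add: tens_index_iff)
 have fcl: "f vs w :> U" if "length vs = n" "vs :>* V" "w :> W" for vs w
  using that by(rule mlin2_closed[OF f])
 have up: "(vs[i := x]) :>* V" if "vs :>* V" "x :> V" for vs i x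
  using that set_update_subset_insert[of vs i x] by auto
 have slot: "(%v. f (vs[i := v]) w) : lin K V U"
  if "length vs = n" "vs :>* V" "w :> W" "i < n" for vs w i
  using mlin_slot[OF mlin2_1[OF f that(3)], of "take i vs" "drop (Suc i) vs"] that
  by(simp add: update_append) (meson order_trans set_take_subset set_drop_subset)
 have gm: "?ev (x -[tens_free K n V W] y) = ?ev x -[U] ?ev y"
  if "x :> tens_free K n V W" "y :> tens_free K n V W" for x y
  by(rule lin_minus[OF module_tens_free U ev(1) that])
 have rel: "?ev r = 0[U]" if "r : tens_rels K n V W" for r
  using that unfolding tens_rels_def Let_def
 proof(elim UnE CollectE exE conjE)
  fix vs w i x y
  assume *: "r = (free_gen K (vs[i := x +[V] y], w) -[tens_free K n V W] free_gen K (vs[i := x], w))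
  -[tens_free K n V W] free_gen K (vs[i := y], w)" "(vs, w) : tens_index n V W" "i < n" "x :> V" "y :> V"
  thus ?thesis using lin_add[OF slot[of vs w i], of x y]
  by(simp add: gm gen_carrier F.minus_closed ev_gen up tens_index_iff fcl U.diff_eq_iff U.minus_closed)
  (simp add: U.diff_eq_iff fcl up U.a_comm)
 next
  fix vs w i c x
  assume *: "r = free_gen K (vs[i := c *[V] x], w) -[tens_free K n V W] (c *[tens_free K n V W] free_gen K (vs[i := x], w))"
  "(vs, w) : tens_index n V W" "i < n" "c :> K" "x :> V"
  thus ?thesis using lin_smult[OF slot[of vs w i], of c x]
  by(simp add: gm gen_carrier ev_gen up tens_index_iff fcl U.diff_eq_iff lin_smult[OF ev(1)])
 next
  fix vs x y
  assume *: "r = (free_gen K (vs, x +[W] y) -[tens_free K n V W] free_gen K (vs, x))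
  -[tens_free K n V W] free_gen K (vs, y)" "(vs, x) : tens_index n V W" "(vs, y) : tens_index n V W"
  thus ?thesis using lin_add[OF mlin2_2[OF f, of vs], of x y]
  by(simp add: gm gen_carrier F.minus_closed ev_gen tens_index_iff fcl U.diff_eq_iff U.minus_closed)
  (simp add: U.diff_eq_iff fcl U.a_comm)
 next
  fix vs c x
  assume *: "r = free_gen K (vs, c *[W] x) -[tens_free K n V W] (c *[tens_free K n V W] free_gen K (vs, x))"
  "(vs, x) : tens_index n V W" "c :> K"
  thus ?thesis using lin_smult[OF mlin2_2[OF f, of vs], of c x]
  by(simp add: gm gen_carrier ev_gen tens_index_iff fcl U.diff_eq_iff lin_smult[OF ev(1)])
 qed
 have ker: "?ev r = 0[U]" if "r : tens_ker K n V W" for r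
 proof -
  have "?ev ` tens_rels K n V W <= {0[U]}" using rel by auto
  from gen_submodule_image[OF module_tens_free U ev(1) submodule_zero[OF U] tens_rels_carrier this]
  show ?thesis using that unfolding tens_ker_def by auto
 qed
 let ?S = "tens_ker K n V W +>[tens_free K n V W] p"
 \<comment> \<open>The representative chosen inside \<open>tlift\<close> need not be p; it differs
   from p by an element of the kernel, on which the evaluation is zero.\<close>
 define q where "q = (SOME q. q : ?S)"
 have qS: "q : ?S" unfolding q_def by(rule someI[of "%q. q : ?S"]) (rule coset_self[OF Q p])
 have qc: "q :> tens_free K n V W" by(rule coset_subset[OF Q p qS])
 hence q: "q :> tens_free K n V W" "q -[tens_free K n V W] p : tens_ker K n V W"
  using coset_mem_iff[OF Q p qc] qS by simp_all
 hence "?ev q -[U] ?ev p = 0[U]" using ker[OF q(2)] gm[OF q(1) p] by simp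
 hence "?ev q = ?ev p" using lin_cl[OF ev(1)] p q by(simp add: U.diff_eq_iff)
 thus ?thesis unfolding tlift_def free_eval_def q_def[symmetric] Let_def by(simp add: split_def)
qed

lemma tlift_lin:
 assumes U: "module K U" and f: "mlin2 K n V W U f"
 shows "tlift K U f : lin K (tens K n V W) U"
proof -
 note Q = module_tens_free tens_ker_submodule
 have fc: "(%(vs, w). f vs w) s :> U" if "s : tens_index n V W" for s
  using that mlin2_closed[OF f] by(cases s) (simp add: tens_index_iff)
 note ev = free_eval(1)[where S="tens_index n V W", OF U fc]
 interpret F: module K "tens_free K n V W" by(rule module_tens_free)
 show ?thesis unfolding tens_def by(rule lin_mapsI)
  (auto elim!: quot_carrierE simp: quot_add[OF Q] quot_smult[OF Q] tlift_coset[OF U f] lin_add[OF ev]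
  lin_smult[OF ev] lin_cl[OF ev])
qed

lemma tlift_tprod:
 assumes U: "module K U" and f: "mlin2 K n V W U f" and vs: "length vs = n" "vs :>* V" "w :> W"
 shows "tlift K U f (tprod K V W vs w) = f vs w"
proof -
 have fc: "(%(vs, w). f vs w) s :> U" if "s : tens_index n V W" for s
  using that mlin2_closed[OF f] by(cases s) (simp add: tens_index_iff)
 show ?thesis unfolding tprod_def vs(1)
  using tlift_coset[OF U f gen_carrier[OF vs]] free_eval(2)[where S="tens_index n V W" and s="(vs, w)", OF U fc K.one_not_zero] vs
  by(simp add: tens_index_iff)
qed

lemma lin_tlift:
 assumes U: "module K U" "module K U'" and F: "F : lin K U U'" and f: "mlin2 K n V W U f"
  and t: "t :> tens K n V W"
 shows "F (tlift K U f t) = tlift K U' (%vs w. F (f vs w)) t"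
 by(rule tens_ext[OF U(2) lin_comp[OF tlift_lin[OF U(1) f] F] tlift_lin[OF U(2) mlin2_comp[OF f F]] _ t])
  (simp add: tlift_tprod[OF U(1) f] tlift_tprod[OF U(2) mlin2_comp[OF f F]])

lemma tlift_cong:
 assumes U: "module K U" and f: "mlin2 K n V W U f" and g: "mlin2 K n V W U g"
  and eq: "!!vs w. length vs = n ==> vs :>* V ==> w :> W ==> f vs w = g vs w"
  and t: "t :> tens K n V W"
 shows "tlift K U f t = tlift K U g t"
 by(rule tens_ext[OF U tlift_lin[OF U f] tlift_lin[OF U g] _ t])
  (simp add: tlift_tprod[OF U f] tlift_tprod[OF U g] eq)

text \<open>For each parameter \<open>tlift\<close> evaluates a chosen representative, but linearity
  in the parameter is best seen on pure tensors: both sides are linear in t and agree there.\<close>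

lemma tlift_param_lin:
 assumes U: "module K U" and f: "!!p. p :> P ==> mlin2 K n V W U (f p)"
  and lin: "!!vs w. length vs = n ==> vs :>* V ==> w :> W ==> (%p. f p vs w) : lin K P U"
  and P: "module K P" and t: "t :> tens K n V W"
 shows "(%p. tlift K U (f p) t) : lin K P U"
proof -
 interpret P: module K P by fact
 note L = tlift_lin[OF U f] and T = tlift_tprod[OF U f]
 show ?thesis
 proof(rule lin_mapsI)
  show "tlift K U (f p) t :> U" if "p :> P" for p using lin_cl[OF L[OF that] t] .
  show "tlift K U (f (p +[P] q)) t = tlift K U (f p) t +[U] tlift K U (f q) t"
  if "p :> P" "q :> P" for p q
  by(rule tens_ext[OF U L lin_add_map[OF U L L] _ t]) (use that in \<open>simp_all add: T lin_add[OF lin]\<close>)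
  show "tlift K U (f (c *[P] p)) t = c *[U] tlift K U (f p) t"
  if "c :> K" "p :> P" for c p
  by(rule tens_ext[OF U L lin_smult_map[OF U _ L] _ t]) (use that in \<open>simp_all add: T lin_smult[OF lin]\<close>)
 qed
qed

lemma tlift_param_mlin:
 assumes U: "module K U" and f: "!!ps. length ps = m ==> ps :>* P ==> mlin2 K n V W U (f ps)"
  and lin: "!!vs w. length vs = n ==> vs :>* V ==> w :> W ==> mlin K m P U (%p. f p vs w)"
  and P: "module K P" and t: "t :> tens K n V W"
 shows "mlin K m P U (%ps. tlift K U (f ps) t)"
proof(rule mlinI)
 show "tlift K U (f ps) t :> U" if "length ps = m" "ps :>* P" for ps
  using lin_cl[OF tlift_lin[OF U f[OF that]] t] .
 show "(%p. tlift K U (f (xs @ p # ys)) t) : lin K P U"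
  if "xs :>* P" "ys :>* P" "length xs + Suc (length ys) = m" for xs ys
  by(rule tlift_param_lin[OF U f _ P t]) (use that in \<open>auto intro: mlin_slot[OF lin]\<close>)
qed

end

text \<open>Fubini for iterated lifts. Both orders are linear in s, so s may be taken to be a pure
  tensor, where the lift over s becomes an evaluation. The second conclusion provides the
  multilinearity without which the outer lift has no meaning.\<close>

lemma tlift_commute:
 assumes T: "tensor K V W" "tensor K V' W'" and U: "module K U"
  and f1: "!!vs w. length vs = n ==> vs :>* V ==> w :> W ==> mlin2 K m V' W' U (f vs w)"
  and f2: "!!vs w. length vs = m ==> vs :>* V' ==> w :> W' ==> mlin2 K n V W U (%xs y. f xs y vs w)"
  and t: "t :> tens K n V W" and s: "s :> tens K m V' W'"
 shows "tlift K U (%vs w. tlift K U (f vs w) s) t = tlift K U (%vs' w'. tlift K U (%vs w. f vs w vs' w') t) s"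
  and "mlin2 K n V W U (%vs w. tlift K U (f vs w) s)"
proof -
 interpret T: tensor K V W by fact
 interpret T': tensor K V' W' by fact
 have m: "mlin2 K n V W U (%vs w. tlift K U (f vs w) s)" if s: "s :> tens K m V' W'" for s
 proof(rule mlin2I)
  show "mlin K n V U (%vs. tlift K U (f vs w) s)" if "w :> W" for w
  by(rule T'.tlift_param_mlin[OF U f1 _ T.module_V s]) (use that in \<open>auto intro: mlin2_1[OF f2]\<close>)
  show "(%w. tlift K U (f vs w) s) : lin K W U" if "length vs = n" "vs :>* V" for vs
  by(rule T'.tlift_param_lin[OF U f1 _ T.module_W s]) (use that in \<open>auto intro: mlin2_2[OF f2]\<close>)
 qed
 have m': "mlin2 K m V' W' U (%vs' w'. tlift K U (%vs w. f vs w vs' w') t)"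
 proof(rule mlin2I)
  show "mlin K m V' U (%vs'. tlift K U (%vs w. f vs w vs' w') t)" if "w' :> W'" for w'
  by(rule T.tlift_param_mlin[OF U f2 _ T'.module_V t]) (use that in \<open>auto intro: mlin2_1[OF f1]\<close>)
  show "(%w'. tlift K U (%vs w. f vs w vs' w') t) : lin K W' U" if "length vs' = m" "vs' :>* V'" for vs'
  by(rule T.tlift_param_lin[OF U f2 _ T'.module_W t]) (use that in \<open>auto intro: mlin2_2[OF f1]\<close>)
 qed
 have "(%s. tlift K U (%vs w. tlift K U (f vs w) s) t) : lin K (tens K m V' W') U"
  by(rule T.tlift_param_lin[OF U m _ T'.mtens t]) (use T'.tlift_lin[OF U f1] in auto)
 moreover have "tlift K U (%vs w. tlift K U (f vs w) (tprod K V' W' vs' w')) t =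
  tlift K U (%vs' w'. tlift K U (%vs w. f vs w vs' w') t) (tprod K V' W' vs' w')"
  if v: "length vs' = m" "vs' :>* V'" "w' :> W'" for vs' w'
 proof -
  have "tlift K U (%vs w. tlift K U (f vs w) (tprod K V' W' vs' w')) t = tlift K U (%vs w. f vs w vs' w') t"
  by(rule T.tlift_cong[OF U m[OF T'.tprod_closed[OF v]] f2[OF v] _ t])
  (simp add: T'.tlift_tprod[OF U f1 v])
  thus ?thesis by(simp add: T'.tlift_tprod[OF U m' v])
 qed
 ultimately show "tlift K U (%vs w. tlift K U (f vs w) s) t =
  tlift K U (%vs' w'. tlift K U (%vs w. f vs w vs' w') t) s"
  by(rule T'.tens_ext[OF U _ T'.tlift_lin[OF U m'] _ s])
 show "mlin2 K n V W U (%vs w. tlift K U (f vs w) s)" by(rule m[OF s])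
qed

subsection \<open>Cyclic and cocyclic modules\<close>

lemma cyclicD:
 assumes "cyc_mod K v X"
 shows "module K (comp X n)"
  and "face_ok v n j ==> face X n j : lin K (comp X n) (comp X (face_deg v n))"
  and "degen_ok v n j ==> degen X n j : lin K (comp X n) (comp X (degen_deg v n))"
  and "cyc X n : lin K (comp X n) (comp X n)"
  and "cyclic_relations v X" using assms unfolding cyclic_module_def by simp_all

lemma cyclicI:
 assumes "!!n. module K (comp X n)"
  and "!!n j. face_ok v n j ==> face X n j : lin K (comp X n) (comp X (face_deg v n))"
  and "!!n j. degen_ok v n j ==> degen X n j : lin K (comp X n) (comp X (degen_deg v n))"
  and "!!n. cyc X n : lin K (comp X n) (comp X n)"
  and "cyclic_relations v X"
 shows "cyc_mod K v X" using assms unfolding cyclic_module_def by simp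

lemma cmod_homI:
 assumes "!!n. f n : lin K (comp X n) (comp Y n)"
  and "!!n j x. face_ok v n j ==> x :> comp X n ==> f (face_deg v n) (face X n j x) = face Y n j (f n x)"
  and "!!n j x. degen_ok v n j ==> x :> comp X n ==> f (degen_deg v n) (degen X n j x) = degen Y n j (f n x)"
  and "!!n x. x :> comp X n ==> f n (cyc X n x) = cyc Y n (f n x)"
 shows "f : cmod_hom K v X Y" using assms unfolding cmod_hom_def by simp

lemma cmod_homD:
 assumes "f : cmod_hom K v X Y"
 shows "f n : lin K (comp X n) (comp Y n)"
  and "face_ok v n j ==> x :> comp X n ==> f (face_deg v n) (face X n j x) = face Y n j (f n x)"
  and "degen_ok v n j ==> x :> comp X n ==> f (degen_deg v n) (degen X n j x) = degen Y n j (f n x)"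
  and "x :> comp X n ==> f n (cyc X n x) = cyc Y n (f n x)"
 using assms unfolding cmod_hom_def by simp_all

lemma cmod_closed: "f : cmod_hom K v X Y ==> x :> comp X n ==> f n x :> comp Y n"
 by(rule lin_cl[OF cmod_homD(1)])

lemma cmod_hom_comp:
 assumes f: "f : cmod_hom K v X Y" and g: "g : cmod_hom K v Y Z"
 shows "(%n x. g n (f n x)) : cmod_hom K v X Z" by(rule cmod_homI)
  (simp_all add: lin_comp[OF cmod_homD(1)[OF f] cmod_homD(1)[OF g]] cmod_homD(2-4)[OF f] cmod_homD(2-4)[OF g]
  cmod_closed[OF f])

lemma cmod_hom_id: "(%n x. x) : cmod_hom K v X X" by(rule cmod_homI) (simp_all add: lin_id)

lemma cmod_hom_zero:
 "cyc_mod K v X ==> cyc_mod K v Y ==> f : cmod_hom K v X Y ==> f n 0[comp X n] = 0[comp Y n]"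
 by(rule lin_zero[OF cyclicD(1) cyclicD(1) cmod_homD(1)])

lemma face_closed: "cyc_mod K v X ==> face_ok v n j ==> x :> comp X n ==>
  face X n j x :> comp X (face_deg v n)"
 and degen_closed: "cyc_mod K v X ==> degen_ok v n j ==> x :> comp X n ==>
  degen X n j x :> comp X (degen_deg v n)"
 and cyc_closed: "cyc_mod K v X ==> x :> comp X n ==> cyc X n x :> comp X n"
 by(rule lin_cl[OF cyclicD(2)] lin_cl[OF cyclicD(3)] lin_cl[OF cyclicD(4)]; assumption)+

lemma cyclic_relD:
 assumes "cyclic_relations Cyclic X" "x :> comp X n"
 shows "2 <= n ==> i < j ==> j <= n ==> face X (n - 1) i (face X n j x) = face X (n - 1) (j - 1) (face X n i x)"
  and "i <= j ==> j <= n ==> degen X (Suc n) i (degen X n j x) = degen X (Suc n) (Suc j) (degen X n i x)"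
  and "j <= n ==> i < j ==> face X (Suc n) i (degen X n j x) = degen X (n - 1) (j - 1) (face X n i x)"
  and "j <= n ==> i = j \<or> i = Suc j ==> face X (Suc n) i (degen X n j x) = x"
  and "j <= n ==> i <= Suc n ==> Suc j < i ==> face X (Suc n) i (degen X n j x) = degen X (n - 1) j (face X n (i - 1) x)"
  and "1 <= i ==> i <= n ==> face X n i (cyc X n x) = cyc X (n - 1) (face X n (i - 1) x)"
  and "1 <= n ==> face X n 0 (cyc X n x) = face X n n x"
  and "1 <= i ==> i <= n ==> degen X n i (cyc X n x) = cyc X (Suc n) (degen X n (i - 1) x)"
  and "degen X n 0 (cyc X n x) = cyc X (Suc n) (cyc X (Suc n) (degen X n n x))"
  and "(cyc X n ^^ Suc n) x = x"
 supply R = bspec[OF spec[OF assms(1)[unfolded cyclic_relations.simps]] assms(2)]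
 subgoal using R by simp
 subgoal using R by simp
 subgoal using R by simp
 subgoal using R by(elim disjE) (simp_all del: funpow.simps)
 subgoal using R by simp
 subgoal using R by simp
 subgoal using R by simp
 subgoal using R by simp
 subgoal using R by simp
 subgoal using R by(simp del: funpow.simps)
 done

lemma cyclic_relI:
 assumes "!!n i j x. x :> comp X n ==> 2 <= n ==> i < j ==> j <= n ==>
  face X (n - 1) i (face X n j x) = face X (n - 1) (j - 1) (face X n i x)"
  and "!!n i j x. x :> comp X n ==> i <= j ==> j <= n ==>
  degen X (Suc n) i (degen X n j x) = degen X (Suc n) (Suc j) (degen X n i x)"
  and "!!n i j x. x :> comp X n ==> j <= n ==> i < j ==>
  face X (Suc n) i (degen X n j x) = degen X (n - 1) (j - 1) (face X n i x)"
  and "!!n i j x. x :> comp X n ==> j <= n ==> i = j \<or> i = Suc j ==> face X (Suc n) i (degen X n j x) = x"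
  and "!!n i j x. x :> comp X n ==> j <= n ==> i <= Suc n ==> Suc j < i ==>
  face X (Suc n) i (degen X n j x) = degen X (n - 1) j (face X n (i - 1) x)"
  and "!!n i x. x :> comp X n ==> 1 <= i ==> i <= n ==> face X n i (cyc X n x) = cyc X (n - 1) (face X n (i - 1) x)"
  and "!!n x. x :> comp X n ==> 1 <= n ==> face X n 0 (cyc X n x) = face X n n x"
  and "!!n i x. x :> comp X n ==> 1 <= i ==> i <= n ==> degen X n i (cyc X n x) = cyc X (Suc n) (degen X n (i - 1) x)"
  and "!!n x. x :> comp X n ==> degen X n 0 (cyc X n x) = cyc X (Suc n) (cyc X (Suc n) (degen X n n x))"
  and "!!n x. x :> comp X n ==> (cyc X n ^^ Suc n) x = x"
 shows "cyclic_relations Cyclic X" unfolding cyclic_relations.simps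
 using assms by(auto simp del: funpow.simps)

lemma cocyclic_relD:
 assumes "cyclic_relations Cocyclic X" "x :> comp X n"
 shows "i < j ==> j <= n + 2 ==> face X (Suc n) j (face X n i x) = face X (Suc n) i (face X n (j - 1) x)"
  and "i <= j ==> Suc j < n ==> degen X (n - 1) j (degen X n i x) = degen X (n - 1) i (degen X n (Suc j) x)"
  and "j <= n ==> i < j ==> degen X (Suc n) j (face X n i x) = face X (n - 1) i (degen X n (j - 1) x)"
  and "j <= n ==> i = j \<or> i = Suc j ==> degen X (Suc n) j (face X n i x) = x"
  and "j <= n ==> i <= Suc n ==> Suc j < i ==> degen X (Suc n) j (face X n i x) = face X (n - 1) (i - 1) (degen X n j x)"
  and "1 <= i ==> i <= Suc n ==> cyc X (Suc n) (face X n i x) = face X n (i - 1) (cyc X n x)"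
  and "cyc X (Suc n) (face X n 0 x) = face X n (Suc n) x"
  and "1 <= i ==> i < n ==> cyc X (n - 1) (degen X n i x) = degen X n (i - 1) (cyc X n x)"
  and "1 <= n ==> cyc X (n - 1) (degen X n 0 x) = degen X n (n - 1) (cyc X n (cyc X n x))"
  and "(cyc X n ^^ Suc n) x = x"
 supply R = bspec[OF spec[OF assms(1)[unfolded cyclic_relations.simps]] assms(2)]
 subgoal using R by simp
 subgoal using R by simp
 subgoal using R by simp
 subgoal using R by(elim disjE) (simp_all del: funpow.simps)
 subgoal using R by simp
 subgoal using R by simp
 subgoal using R by simp
 subgoal using R by simp
 subgoal using R by simp
 subgoal using R by(simp del: funpow.simps)
 done

lemma cocyclic_relI:
 assumes "!!n i j x. x :> comp X n ==> i < j ==> j <= n + 2 ==>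
  face X (Suc n) j (face X n i x) = face X (Suc n) i (face X n (j - 1) x)"
  and "!!n i j x. x :> comp X n ==> i <= j ==> Suc j < n ==>
  degen X (n - 1) j (degen X n i x) = degen X (n - 1) i (degen X n (Suc j) x)"
  and "!!n i j x. x :> comp X n ==> j <= n ==> i < j ==>
  degen X (Suc n) j (face X n i x) = face X (n - 1) i (degen X n (j - 1) x)"
  and "!!n i j x. x :> comp X n ==> j <= n ==> i = j \<or> i = Suc j ==> degen X (Suc n) j (face X n i x) = x"
  and "!!n i j x. x :> comp X n ==> j <= n ==> i <= Suc n ==> Suc j < i ==>
  degen X (Suc n) j (face X n i x) = face X (n - 1) (i - 1) (degen X n j x)"
  and "!!n i x. x :> comp X n ==> 1 <= i ==> i <= Suc n ==> cyc X (Suc n) (face X n i x) = face X n (i - 1) (cyc X n x)"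
  and "!!n x. x :> comp X n ==> cyc X (Suc n) (face X n 0 x) = face X n (Suc n) x"
  and "!!n i x. x :> comp X n ==> 1 <= i ==> i < n ==> cyc X (n - 1) (degen X n i x) = degen X n (i - 1) (cyc X n x)"
  and "!!n x. x :> comp X n ==> 1 <= n ==> cyc X (n - 1) (degen X n 0 x) = degen X n (n - 1) (cyc X n (cyc X n x))"
  and "!!n x. x :> comp X n ==> (cyc X n ^^ Suc n) x = x"
 shows "cyclic_relations Cocyclic X" unfolding cyclic_relations.simps
 using assms by(auto simp del: funpow.simps)

lemma funpow_hom:
 assumes "!!x. x : A ==> t x : A" "!!x. x : A ==> f (t x) = t' (f x)" "x : A"
 shows "(t' ^^ k) (f x) = f ((t ^^ k) x)" "(t ^^ k) x : A"
proof(induction k)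
 case 0
 { case 1 show ?case by simp next case 2 show ?case using assms(3) by simp }
next
 case (Suc k)
 { case 1 show ?case using Suc assms(2) by simp next case 2 show ?case using Suc assms(1) by simp }
qed

text \<open>Every operator and relation of Y is read off from preimages in X. The zero of Y is a
  separate hypothesis because Y is only a record of operations here. Quotients and relabelled copies
  are the intended instances.\<close>

lemma cyclic_image:
 assumes X: "cyc_mod K v X" and f: "f : cmod_hom K v X Y"
  and onto: "!!n. el Y n <= f n ` el X n"
  and zero: "!!n. f n 0[comp X n] = 0[comp Y n]"
 shows "cyc_mod K v Y"
proof -
 note hom = cmod_homD[OF f]
 note cl = cmod_closed[OF f]
 have ex: "\<exists>x\<in>el X n. y = f n x" if "y :> comp Y n" for n y
  using subsetD[OF onto that] by auto
 have mod: "module K (comp Y n)" for n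
 proof(rule module_image[OF cyclicD(1)[OF X], where f="f n"])
  show "f n ` el X n = el Y n" using onto cl by auto
 qed (simp_all add: lin_add[OF hom(1)] lin_smult[OF hom(1)] zero)
 \<comment> \<open>An operator of Y that is covered by a linear operator of X is itself linear,
   because f is onto and additive.\<close>
 have push: "h : lin K (comp Y n) (comp Y m)"
  if h0: "h0 : lin K (comp X n) (comp X m)" and h: "!!x. x :> comp X n ==> h (f n x) = f m (h0 x)" for h h0 n m
 proof -
  interpret X: module K "comp X n" by(rule cyclicD(1)[OF X])
  show ?thesis by(rule lin_mapsI)
  (auto dest!: ex simp: h lin_cl[OF h0] cl simp flip: lin_add[OF hom(1)] lin_smult[OF hom(1)],
  simp_all add: h lin_add[OF h0] lin_smult[OF h0] lin_add[OF hom(1)] lin_smult[OF hom(1)] lin_cl[OF h0])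
 qed
 note F = hom(2)[symmetric] and D = hom(3)[symmetric] and T = hom(4)[symmetric]
 note XC = face_closed[OF X] degen_closed[OF X] cyc_closed[OF X]
 show ?thesis
 proof(rule cyclicI)
  show "face Y n j : lin K (comp Y n) (comp Y (face_deg v n))" if "face_ok v n j" for n j
  by(rule push[OF cyclicD(2)[OF X that] F[OF that]])
  show "degen Y n j : lin K (comp Y n) (comp Y (degen_deg v n))" if "degen_ok v n j" for n j
  by(rule push[OF cyclicD(3)[OF X that] D[OF that]])
  show "cyc Y n : lin K (comp Y n) (comp Y n)" for n by(rule push[OF cyclicD(4)[OF X] T])
  have TP: "(cyc Y n ^^ k) (f n x) = f n ((cyc X n ^^ k) x)" if "x :> comp X n" for n k x
  by(rule funpow_hom(1)[where A="el X n"]) (use that hom(4) XC in auto)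
  show "cyclic_relations v Y"
  proof(cases v)
  case Cyclic
  note R = cyclic_relD[OF cyclicD(5)[OF X, unfolded Cyclic]]
  note F = F[unfolded Cyclic, simplified] and D = D[unfolded Cyclic, simplified] and XC = XC[unfolded Cyclic, simplified]
  show ?thesis unfolding Cyclic
  proof(rule cyclic_relI)
  fix n i j y assume y: "y :> comp Y n"
  then obtain x where x: "x :> comp X n" "y = f n x" using ex by blast
  show "face Y (n - 1) i (face Y n j y) = face Y (n - 1) (j - 1) (face Y n i y)" if "2 <= n" "i < j" "j <= n"
  proof -
  obtain m where m: "n = Suc (Suc m)" using `2 <= n` by(cases n; cases "n - 1") auto
  show ?thesis using R(1)[OF x(1) that] XC(1)[of n i x] XC(1)[of n j x] x that unfolding m by(simp add: F)
  qed
  show "degen Y (Suc n) i (degen Y n j y) = degen Y (Suc n) (Suc j) (degen Y n i y)" if "i <= j" "j <= n"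
  using R(2)[OF x(1) that] x that by(simp add: D XC)
  show "face Y (Suc n) i (degen Y n j y) = degen Y (n - 1) (j - 1) (face Y n i y)" if "j <= n" "i < j"
  using R(3)[OF x(1) that] x that XC(1)[of n i x] by(cases n) (simp_all add: F D XC)
  show "face Y (Suc n) i (degen Y n j y) = y" if "j <= n" "i = j \<or> i = Suc j"
  using R(4)[OF x(1) that] x that by(auto simp: F D XC)
  show "face Y (Suc n) i (degen Y n j y) = degen Y (n - 1) j (face Y n (i - 1) y)" if "j <= n" "i <= Suc n" "Suc j < i"
  using R(5)[OF x(1) that] x that XC(1)[of n "i - 1" x] by(cases n) (simp_all add: F D XC)
  show "face Y n i (cyc Y n y) = cyc Y (n - 1) (face Y n (i - 1) y)" if "1 <= i" "i <= n"
  using R(6)[OF x(1) that] x that by(simp add: F T XC)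
  show "face Y n 0 (cyc Y n y) = face Y n n y" if "1 <= n"
  using R(7)[OF x(1) that] x that by(simp add: F T XC)
  show "degen Y n i (cyc Y n y) = cyc Y (Suc n) (degen Y n (i - 1) y)" if "1 <= i" "i <= n"
  using R(8)[OF x(1) that] x that by(simp add: D T XC)
  show "degen Y n 0 (cyc Y n y) = cyc Y (Suc n) (cyc Y (Suc n) (degen Y n n y))"
  using R(9)[OF x(1)] x by(simp add: D T XC)
  show "(cyc Y n ^^ Suc n) y = y" using R(10)[OF x(1)] x by(simp add: TP del: funpow.simps)
  qed
  next
  case Cocyclic
  note R = cocyclic_relD[OF cyclicD(5)[OF X, unfolded Cocyclic]]
  note F = F[unfolded Cocyclic, simplified] and D = D[unfolded Cocyclic, simplified] and XC = XC[unfolded Cocyclic, simplified]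
  show ?thesis unfolding Cocyclic
  proof(rule cocyclic_relI)
  fix n i j y assume y: "y :> comp Y n"
  then obtain x where x: "x :> comp X n" "y = f n x" using ex by blast
  show "face Y (Suc n) j (face Y n i y) = face Y (Suc n) i (face Y n (j - 1) y)" if "i < j" "j <= n + 2"
  using R(1)[OF x(1) that] x that by(simp add: F XC)
  show "degen Y (n - 1) j (degen Y n i y) = degen Y (n - 1) i (degen Y n (Suc j) y)" if "i <= j" "Suc j < n"
  using R(2)[OF x(1) that] x that by(simp add: D XC)
  show "degen Y (Suc n) j (face Y n i y) = face Y (n - 1) i (degen Y n (j - 1) y)" if "j <= n" "i < j"
  using R(3)[OF x(1) that] x that XC(2)[of "j - 1" n x] by(cases n) (simp_all add: F D XC)
  show "degen Y (Suc n) j (face Y n i y) = y" if "j <= n" "i = j \<or> i = Suc j"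
  using R(4)[OF x(1) that] x that by(auto simp: F D XC)
  show "degen Y (Suc n) j (face Y n i y) = face Y (n - 1) (i - 1) (degen Y n j y)" if "j <= n" "i <= Suc n" "Suc j < i"
  using R(5)[OF x(1) that] x that XC(2)[of j n x] by(cases n) (simp_all add: F D XC)
  show "cyc Y (Suc n) (face Y n i y) = face Y n (i - 1) (cyc Y n y)" if "1 <= i" "i <= Suc n"
  using R(6)[OF x(1) that] x that by(simp add: F T XC)
  show "cyc Y (Suc n) (face Y n 0 y) = face Y n (Suc n) y"
  using R(7)[OF x(1)] x by(simp add: F T XC)
  show "cyc Y (n - 1) (degen Y n i y) = degen Y n (i - 1) (cyc Y n y)" if "1 <= i" "i < n"
  using R(8)[OF x(1) that] x that by(simp add: D T XC)
  show "cyc Y (n - 1) (degen Y n 0 y) = degen Y n (n - 1) (cyc Y n (cyc Y n y))" if "1 <= n"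
  using R(9)[OF x(1) that] x that by(simp add: D T XC)
  show "(cyc Y n ^^ Suc n) y = y" using R(10)[OF x(1)] x by(simp add: TP del: funpow.simps)
  qed
  qed
 qed (rule mod)
qed

text \<open>Since q is onto, h' is controlled by its values on images under q; linearity and
  compatibility with the operators then come from h. Maps out of quotients, push-outs and relabelled
  modules are obtained by exhibiting h.\<close>

lemma hom_from_epi:
 assumes X: "cyc_mod K v X" and q: "q : cmod_hom K v X X'"
  and onto: "!!n. el X' n <= q n ` el X n"
  and h: "h : cmod_hom K v X Y" and eq: "!!n x. x :> comp X n ==> h' n (q n x) = h n x"
 shows "h' : cmod_hom K v X' Y"
proof -
 have ex: "\<exists>x\<in>el X n. y = q n x" if "y :> comp X' n" for n y
  using subsetD[OF onto that] by auto
 note hq = cmod_homD[OF q] and hh = cmod_homD[OF h]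
 note XC = face_closed[OF X] degen_closed[OF X] cyc_closed[OF X]
 show ?thesis
 proof(rule cmod_homI)
  fix n
  interpret X: module K "comp X n" by(rule cyclicD(1)[OF X])
  show "h' n : lin K (comp X' n) (comp Y n)" by(rule lin_mapsI)
  (auto dest!: ex simp: eq cmod_closed[OF h] simp flip: lin_add[OF hq(1)] lin_smult[OF hq(1)],
  simp_all add: lin_add[OF hh(1)] lin_smult[OF hh(1)] eq lin_add[OF hq(1)] lin_smult[OF hq(1)])
 next
  fix n j y assume "face_ok v n j" "y :> comp X' n"
  thus "h' (face_deg v n) (face X' n j y) = face Y n j (h' n y)"
  by(auto dest!: ex simp: eq simp flip: hq(2)) (simp add: eq XC hh(2))
 next
  fix n j y assume "degen_ok v n j" "y :> comp X' n"
  thus "h' (degen_deg v n) (degen X' n j y) = degen Y n j (h' n y)"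
  by(auto dest!: ex simp: eq simp flip: hq(3)) (simp add: eq XC hh(3))
 next
  fix n y assume "y :> comp X' n"
  thus "h' n (cyc X' n y) = cyc Y n (h' n y)"
  by(auto dest!: ex simp: eq simp flip: hq(4)) (simp add: eq XC hh(4))
 qed
qed

text \<open>Relabelling along a map that is injective on the carriers only.\<close>

definition cmod_rel :: "('v => 'u) => ('u => 'v) => ('k, 'v) cmod => ('k, 'u) cmod" where
 "cmod_rel io r X = \<lparr>comp = (%n. mk_module (io ` el X n) (io 0[comp X n])
  (%x y. io (r x +[comp X n] r y)) (%c x. io (c *[comp X n] r x))),
  face = (%n j x. io (face X n j (r x))), degen = (%n j x. io (degen X n j (r x))),
  cyc = (%n x. io (cyc X n (r x)))\<rparr>"

lemma cmod_relabel_eq: "cmod_relabel io X = cmod_rel io (inv_into UNIV io) X"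
 by(simp add: cmod_relabel_def cmod_rel_def relabel_module_def)

lemma cmod_rel_carrier: "el (cmod_rel io r X) n = io ` el X n"
 and cmod_rel_zero: "0[comp (cmod_rel io r X) n] = io 0[comp X n]" by(simp_all add: cmod_rel_def)

lemma cmod_rel:
 assumes X: "cyc_mod K v X" and r: "!!n x. x :> comp X n ==> r (io x) = x"
 shows "(%n. io) : cmod_hom K v X (cmod_rel io r X)" and "cyc_mod K v (cmod_rel io r X)"
  and "(%n. r) : cmod_hom K v (cmod_rel io r X) X"
proof -
 show *: "(%n. io) : cmod_hom K v X (cmod_rel io r X)"
  by(rule cmod_homI, rule lin_mapsI) (simp_all add: cmod_rel_def r)
 show "cyc_mod K v (cmod_rel io r X)"
  by(rule cyclic_image[OF X *]) (simp_all add: cmod_rel_carrier cmod_rel_zero)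
 show "(%n. r) : cmod_hom K v (cmod_rel io r X) X"
  by(rule hom_from_epi[OF X * _ cmod_hom_id]) (simp_all add: cmod_rel_carrier r)
qed

lemma cmod_quot:
 assumes X: "cyc_mod K v X" and N: "!!n. submodule (N n) K (comp X n)"
  and "!!n j. face_ok v n j ==> face X n j ` N n <= N (face_deg v n)"
  and "!!n j. degen_ok v n j ==> degen X n j ` N n <= N (degen_deg v n)"
  and "!!n. cyc X n ` N n <= N n"
 shows "(%n x. N n +>[comp X n] x) : cmod_hom K v X (cmod_quot v X N)"
  and "cyc_mod K v (cmod_quot v X N)"
proof -
 note M = cyclicD(1)[OF X] N
 have comp: "comp (cmod_quot v X N) n = quot_module (comp X n) (N n)" for n by(simp add: cmod_quot_def)
 show *: "(%n x. N n +>[comp X n] x) : cmod_hom K v X (cmod_quot v X N)"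
 proof(rule cmod_homI)
  show "(%x. N n +>[comp X n] x) : lin K (comp X n) (comp (cmod_quot v X N) n)" for n
  unfolding comp by(rule coset_lin[OF M])
 next
  fix n j x assume "face_ok v n j" "x :> comp X n"
  thus "N (face_deg v n) +>[comp X (face_deg v n)] face X n j x = face (cmod_quot v X N) n j (N n +>[comp X n] x)"
  using induced_coset[OF M M cyclicD(2)[OF X] assms(3)] by(simp add: cmod_quot_def)
 next
  fix n j x assume "degen_ok v n j" "x :> comp X n"
  thus "N (degen_deg v n) +>[comp X (degen_deg v n)] degen X n j x = degen (cmod_quot v X N) n j (N n +>[comp X n] x)"
  using induced_coset[OF M M cyclicD(3)[OF X] assms(4)] by(simp add: cmod_quot_def)
 next
  fix n x assume "x :> comp X n"
  thus "N n +>[comp X n] cyc X n x = cyc (cmod_quot v X N) n (N n +>[comp X n] x)"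
  using induced_coset[OF M M cyclicD(4)[OF X] assms(5)] by(simp add: cmod_quot_def)
 qed
 show "cyc_mod K v (cmod_quot v X N)"
  by(rule cyclic_image[OF X *]) (simp_all add: comp quot_carrier quot_zero coset_zero[OF M])
qed

lemma sum_module_sel [simp]:
 "carrier (sum_module V W) = carrier V \<times> carrier W"
 "(v, w) +[sum_module V W] (v', w') = (v +[V] v', w +[W] w')"
 "c *[sum_module V W] (v, w) = (c *[V] v, c *[W] w)"
 "0[sum_module V W] = (0[V], 0[W])" by(simp_all add: sum_module_def)

lemma module_sum:
 assumes "module K V" "module K W"
 shows "module K (sum_module V W)"
proof -
 interpret V: module K V by fact
 interpret W: module K W by fact
 show ?thesis
 proof(rule moduleI)
  show "cring K" ..
  show "abelian_group (sum_module V W)"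
  proof(rule abelian_groupI)
  fix x assume "x :> sum_module V W"
  then obtain a b where x: "x = (a, b)" "a :> V" "b :> W" by auto
  show "\<exists>y\<in>carrier (sum_module V W). y +[sum_module V W] x = 0[sum_module V W]"
  by(rule bexI[of _ "(-[V] a, -[W] b)"]) (use x in \<open>simp_all add: V.l_neg W.l_neg\<close>)
  qed (auto simp: V.a_ac W.a_ac)
 qed (auto simp: V.smult_l_distr W.smult_l_distr V.smult_r_distr W.smult_r_distr V.smult_assoc1 W.smult_assoc1)
qed

lemma sum_neg:
 assumes "module K V" "module K W" "v :> V" "w :> W"
 shows "-[sum_module V W] (v, w) = (-[V] v, -[W] w)"
proof -
 interpret V: module K V by fact
 interpret W: module K W by fact
 interpret S: module K "sum_module V W" by(rule module_sum[OF assms(1,2)])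
 show ?thesis by(rule S.minus_equality) (use assms in \<open>simp_all add: V.l_neg W.l_neg\<close>)
qed

lemma lin_map_prod:
 assumes f: "f : lin K V W" and g: "g : lin K V' W'"
 shows "map_prod f g : lin K (sum_module V V') (sum_module W W')"
 by(rule lin_mapsI) (auto simp: lin_cl[OF f] lin_cl[OF g] lin_add[OF f] lin_add[OF g]
  lin_smult[OF f] lin_smult[OF g])

lemma cyclic_sum:
 assumes X: "cyc_mod K v X" and Y: "cyc_mod K v Y"
 shows "cyc_mod K v (cmod_sum X Y)"
proof -
 have sel: "comp (cmod_sum X Y) n = sum_module (comp X n) (comp Y n)"
  "face (cmod_sum X Y) n j = map_prod (face X n j) (face Y n j)"
  "degen (cmod_sum X Y) n j = map_prod (degen X n j) (degen Y n j)"
  "cyc (cmod_sum X Y) n = map_prod (cyc X n) (cyc Y n)" for n j by(simp_all add: cmod_sum_def)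
 have pow: "(map_prod (cyc X n) (cyc Y n) ^^ k) (x, y) = ((cyc X n ^^ k) x, (cyc Y n ^^ k) y)" for n k x y
  by(induction k) simp_all
 show ?thesis
 proof(rule cyclicI)
  show "module K (comp (cmod_sum X Y) n)" for n
  unfolding sel by(rule module_sum[OF cyclicD(1)[OF X] cyclicD(1)[OF Y]])
  show "cyclic_relations v (cmod_sum X Y)"
  proof(cases v)
  case Cyclic
  note R = cyclic_relD[OF cyclicD(5)[OF X, unfolded Cyclic]] cyclic_relD[OF cyclicD(5)[OF Y, unfolded Cyclic]]
  show ?thesis unfolding Cyclic
  by(rule cyclic_relI) (auto simp only: sel sum_module_sel mem_Times_iff split_paired_all map_prod_simp pow fst_conv snd_conv
  intro!: prod.inject[THEN iffD2] conjI R)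
  next
  case Cocyclic
  note R = cocyclic_relD[OF cyclicD(5)[OF X, unfolded Cocyclic]] cocyclic_relD[OF cyclicD(5)[OF Y, unfolded Cocyclic]]
  show ?thesis unfolding Cocyclic
  by(rule cocyclic_relI) (auto simp only: sel sum_module_sel mem_Times_iff split_paired_all map_prod_simp pow fst_conv snd_conv
  intro!: prod.inject[THEN iffD2] conjI R)
  qed
 qed (simp_all add: sel lin_map_prod cyclicD[OF X] cyclicD[OF Y])
qed

text \<open>Phrased as a record update of the carriers, which is how \<open>cmod_pullback\<close>
  cuts a submodule out of a direct sum.\<close>

lemma cyclic_sub:
 assumes X: "cyc_mod K v X" and C: "!!n. submodule (C n) K (comp X n)"
  and F: "!!n j. face_ok v n j ==> face X n j ` C n <= C (face_deg v n)"
  and D: "!!n j. degen_ok v n j ==> degen X n j ` C n <= C (degen_deg v n)"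
  and T: "!!n. cyc X n ` C n <= C n"
 shows "cyc_mod K v (X\<lparr>comp := %n. (comp X n)\<lparr>carrier := C n\<rparr>\<rparr>)" (is "cyc_mod K v ?S")
proof -
 have CX: "x :> comp X n" if "x : C n" for n x
  using submodule_mem(1)[OF cyclicD(1)[OF X] C] that by auto
 have lin: "f : lin K ((comp X n)\<lparr>carrier := C n\<rparr>) ((comp X m)\<lparr>carrier := C m\<rparr>)"
  if f: "f : lin K (comp X n) (comp X m)" "f ` C n <= C m" for f n m
  by(rule lin_mapsI) (use f(2) CX in \<open>auto simp: lin_add[OF f(1)] lin_smult[OF f(1)]\<close>)
 have sel: "comp ?S n = (comp X n)\<lparr>carrier := C n\<rparr>" "face ?S = face X" "degen ?S = degen X" "cyc ?S = cyc X"
  "carrier ((comp X n)\<lparr>carrier := C n\<rparr>) = C n" for n by simp_all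
 show ?thesis
 proof(rule cyclicI)
  show "module K (comp ?S n)" for n
  using submodule.submodule_is_module[OF C cyclicD(1)[OF X]] by simp
  show "cyclic_relations v ?S"
  proof(cases v)
  case Cyclic
  note R = cyclic_relD[OF cyclicD(5)[OF X, unfolded Cyclic]]
  show ?thesis unfolding Cyclic
  by(rule cyclic_relI) (unfold sel, (rule R; (rule CX)?; assumption)+)
  next
  case Cocyclic
  note R = cocyclic_relD[OF cyclicD(5)[OF X, unfolded Cocyclic]]
  show ?thesis unfolding Cocyclic
  by(rule cocyclic_relI) (unfold sel, (rule R; (rule CX)?; assumption)+)
  qed
 qed (simp_all add: lin cyclicD[OF X] F D T)
qed

subsection \<open>The cyclic modules of linear maps\<close>

text \<open>The operators of \<open>diag_hom\<close> and \<open>dual_cmod\<close>, as well as pre-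
  and postcomposition, all have this two-sided form, so their linearity is proved once.\<close>

lemma hom_sandwich:
 assumes V': "module K V'" and a: "a : lin K V' V" and b: "b : lin K W W'"
 shows "(%f. \<lambda>x\<in>carrier V'. b (f (a x))) : lin K (hom_module K V W) (hom_module K V' W')"
proof(rule lin_mapsI)
 interpret V': module K V' by fact
 note ac = lin_cl[OF a]
 have fc: "f (a x) :> W" if "f :> hom_module K V W" "x :> V'" for f x
  using that ac lin_cl[of f K V W] by(simp add: hom_carrier)
 show c: "(\<lambda>x\<in>carrier V'. b (f (a x))) :> hom_module K V' W'" if "f :> hom_module K V W" for f
  using that lin_comp[OF lin_comp[OF a, of f W] b] by(intro restrict_hom[OF V']) (simp add: hom_carrier)
 show "(\<lambda>x\<in>carrier V'. b ((f +[hom_module K V W] g) (a x))) =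
  (\<lambda>x\<in>carrier V'. b (f (a x))) +[hom_module K V' W'] (\<lambda>x\<in>carrier V'. b (g (a x)))"
  if "f :> hom_module K V W" "g :> hom_module K V W" for f g
  using that by(auto simp: fun_eq_iff hom_add ac lin_add[OF b] fc) (simp add: hom_module_def)
 show "(\<lambda>x\<in>carrier V'. b ((c *[hom_module K V W] f) (a x))) =
  c *[hom_module K V' W'] (\<lambda>x\<in>carrier V'. b (f (a x)))"
  if "c :> K" "f :> hom_module K V W" for f c
  using that by(auto simp: fun_eq_iff hom_smult ac lin_smult[OF b] fc) (simp add: hom_module_def)
qed

lemma dh_sel:
 "comp (diag_hom K X Y) n = hom_module K (comp X n) (comp Y n)"
 "face (diag_hom K X Y) n j = (%f. \<lambda>x\<in>el X (n - 1). face Y n j (f (face X (n - 1) j x)))"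
 "degen (diag_hom K X Y) n j = (%f. \<lambda>x\<in>el X (Suc n). degen Y n j (f (degen X (Suc n) j x)))"
 "cyc (diag_hom K X Y) n = (%f. \<lambda>x\<in>el X n. cyc Y n (f (cyc X n x)))"
 by(simp_all add: diag_hom_def)

lemma hom_app: "f :> hom_module K V W ==> x :> V ==> f x :> W"
 using lin_cl[of f K V W] by(simp add: hom_carrier)

text \<open>An operator acts by f \<mapsto> b f a. Composing two of them composes the b in the same
  order and the a in the opposite order, so each cyclic relation is the cyclic relation of Y on the
  left together with the matching cocyclic relation of X on the right.\<close>

lemma diag_hom_cyclic:
 assumes X: "cyc_mod K Cocyclic X" and Y: "cyc_mod K Cyclic Y"
 shows "cyc_mod K Cyclic (diag_hom K X Y)" (is "cyc_mod K Cyclic ?Z")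
proof -
 note MX = cyclicD(1)[OF X] and MY = cyclicD(1)[OF Y]
 have FX: "face X n j : lin K (comp X n) (comp X (Suc n))" if "j <= Suc n" for n j
  using cyclicD(2)[OF X, of n j] that by simp
 have DX: "degen X (Suc n) j : lin K (comp X (Suc n)) (comp X n)" if "j <= n" for n j
  using cyclicD(3)[OF X, of "Suc n" j] that by simp
 note TX = cyclicD(4)[OF X]
 have FY: "face Y n j : lin K (comp Y n) (comp Y (n - 1))" if "1 <= n" "j <= n" for n j
  using cyclicD(2)[OF Y, of n j] that by simp
 have DY: "degen Y n j : lin K (comp Y n) (comp Y (Suc n))" if "j <= n" for n j
  using cyclicD(3)[OF Y, of n j] that by simp
 note TY = cyclicD(4)[OF Y]
 note RX = cocyclic_relD[OF cyclicD(5)[OF X]] and RY = cyclic_relD[OF cyclicD(5)[OF Y]]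
 note cl = lin_cl[OF FX] lin_cl[OF DX] lin_cl[OF TX] hom_app
 have cl': "face X (n - 1) j x :> comp X n" if "1 <= n" "j <= n" "x :> comp X (n - 1)" for n j x
  using lin_cl[OF FX, of j "n - 1" x] that by simp
 have TPX: "(cyc X n ^^ k) x :> comp X n" if "x :> comp X n" for n k x
  by(induction k) (use that cl in auto)
 have pow: "((%f. \<lambda>x\<in>el X n. cyc Y n (f (cyc X n x))) ^^ k) f x = (cyc Y n ^^ k) (f ((cyc X n ^^ k) x))"
  if "x :> comp X n" for n k f x using that
 proof(induction k arbitrary: x)
  case (Suc k)
  thus ?case by(simp add: cl funpow_swap1)
 qed simp
 have ext: "((%f. \<lambda>x\<in>el X n. cyc Y n (f (cyc X n x))) ^^ Suc k) f : extensional (el X n)" for n k f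
  by simp
 show ?thesis
 proof(rule cyclicI)
  show "module K (comp (diag_hom K X Y) n)" for n unfolding dh_sel by(rule module_hom[OF MX MY])
  show "face (diag_hom K X Y) n j : lin K (comp (diag_hom K X Y) n) (comp (diag_hom K X Y) (face_deg Cyclic n))"
  if "face_ok Cyclic n j" for n j unfolding dh_sel face_deg.simps
  by(rule hom_sandwich[OF MX]) (use that FX[of j "n - 1"] FY in simp_all)
  show "degen (diag_hom K X Y) n j : lin K (comp (diag_hom K X Y) n) (comp (diag_hom K X Y) (degen_deg Cyclic n))"
  if "degen_ok Cyclic n j" for n j unfolding dh_sel degen_deg.simps
  by(rule hom_sandwich[OF MX]) (use that DX DY in simp_all)
  show "cyc (diag_hom K X Y) n : lin K (comp (diag_hom K X Y) n) (comp (diag_hom K X Y) n)" for n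
  unfolding dh_sel by(rule hom_sandwich[OF MX TX TY])
  show "cyclic_relations Cyclic (diag_hom K X Y)"
  proof(rule cyclic_relI; (unfold dh_sel(1))?)
  fix n i j f assume f: "f :> hom_module K (comp X n) (comp Y n)"
  note fa = hom_app[OF f]
  { assume n: "2 <= n" "i < j" "j <= n"
  obtain m where m: "n = Suc (Suc m)" using n(1) by(cases n; cases "n - 1") auto
  show "face ?Z (n - 1) i (face ?Z n j f) = face ?Z (n - 1) (j - 1) (face ?Z n i f)" unfolding dh_sel
  using n RX(1)[of _ m i j] RY(1)[OF fa, of _ i j] m by(auto intro!: restrict_ext simp: cl) }
  { assume n: "i <= j" "j <= n"
  show "degen ?Z (Suc n) i (degen ?Z n j f) = degen ?Z (Suc n) (Suc j) (degen ?Z n i f)" unfolding dh_sel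
  using n RX(2)[of _ "Suc (Suc n)" i j] RY(2)[OF fa, of _ i j] by(auto intro!: restrict_ext simp: cl) }
  { assume n: "j <= n" "i < j"
  obtain m where m: "n = Suc m" using n by(cases n) auto
  show "face ?Z (Suc n) i (degen ?Z n j f) = degen ?Z (n - 1) (j - 1) (face ?Z n i f)" unfolding dh_sel
  using n RX(3)[of _ n j i] RY(3)[OF fa, of _ j i] m by(auto intro!: restrict_ext simp: cl) }
  { assume n: "j <= n" "i = j \<or> i = Suc j"
  have "(\<lambda>x\<in>el X n. face Y (Suc n) i (degen Y n j (f (degen X (Suc n) j (face X n i x))))) = f"
  using n RX(4)[of _ n j i] RY(4)[OF fa, of _ j i] f
  by(auto simp: fun_eq_iff restrict_def hom_carrier extensional_def)
  thus "face ?Z (Suc n) i (degen ?Z n j f) = f" unfolding dh_sel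
  using n by(auto simp: cl cong: restrict_cong) }
  { assume n: "j <= n" "i <= Suc n" "Suc j < i"
  obtain m where m: "n = Suc m" using n by(cases n) auto
  show "face ?Z (Suc n) i (degen ?Z n j f) = degen ?Z (n - 1) j (face ?Z n (i - 1) f)" unfolding dh_sel
  using n RX(5)[of _ n j i] RY(5)[OF fa, of _ j i] m by(auto intro!: restrict_ext simp: cl) }
  { assume n: "1 <= i" "i <= n"
  obtain m where m: "n = Suc m" using n by(cases n) auto
  show "face ?Z n i (cyc ?Z n f) = cyc ?Z (n - 1) (face ?Z n (i - 1) f)" unfolding dh_sel
  using n RX(6)[of _ m i] RY(6)[OF fa, of _ i] m by(auto intro!: restrict_ext simp: cl) }
  { assume n: "1 <= n"
  obtain m where m: "n = Suc m" using n by(cases n) auto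
  show "face ?Z n 0 (cyc ?Z n f) = face ?Z n n f" unfolding dh_sel
  using n RX(7)[of _ m] RY(7)[OF fa] m by(auto intro!: restrict_ext simp: cl) }
  { assume n: "1 <= i" "i <= n"
  show "degen ?Z n i (cyc ?Z n f) = cyc ?Z (Suc n) (degen ?Z n (i - 1) f)" unfolding dh_sel
  using n RX(8)[of _ "Suc n" i] RY(8)[OF fa, of _ i] by(auto intro!: restrict_ext simp: cl) }
  { show "degen ?Z n 0 (cyc ?Z n f) = cyc ?Z (Suc n) (cyc ?Z (Suc n) (degen ?Z n n f))" unfolding dh_sel
  using RX(9)[of _ "Suc n"] RY(9)[OF fa] by(auto intro!: restrict_ext simp: cl) }
  \<comment> \<open>Outside the carrier both sides are undefined: the iterate because it ends in a
    restriction, f because it is extensional.\<close>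
  { have "((%f. \<lambda>x\<in>el X n. cyc Y n (f (cyc X n x))) ^^ Suc n) f x = f x" for x
  proof(cases "x :> comp X n")
  case True
  thus ?thesis using pow[OF True, of "Suc n" f] RX(10)[OF True] RY(10)[OF fa[OF True]] by simp
  next
  case False
  thus ?thesis using f by(simp add: hom_carrier extensional_def)
  qed
  thus "(cyc ?Z n ^^ Suc n) f = f" unfolding dh_sel by blast }
  qed
 qed
qed

lemma cyclic_const: "cring K ==> cyc_mod K v (const_cmod K)"
proof -
 assume K: "cring K"
 have pow: "((%x. x) ^^ m) x = x" for m and x :: 'a by(induction m) auto
 show ?thesis
 proof(rule cyclicI)
  show "cyclic_relations v (const_cmod K)"
  by(cases v) (auto simp: const_cmod_def pow simp del: funpow.simps)
 qed (simp_all add: const_cmod_def module_self[OF K] lin_id)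
qed

lemma dual_sel:
 "comp (dual_cmod K X) n = hom_module K (comp X n) (self_module K)"
 "face (dual_cmod K X) n j = (%f. \<lambda>x\<in>el X (Suc n). f (face X (Suc n) j x))"
 "degen (dual_cmod K X) n j = (%f. \<lambda>x\<in>el X (n - 1). f (degen X (n - 1) j x))"
 "cyc (dual_cmod K X) n = (%f. \<lambda>x\<in>el X n. f (cyc X n x))"
 by(simp_all add: dual_cmod_def)

text \<open>Dualizing reverses composition, so each cocyclic relation is a functional evaluated at
  the two sides of a cyclic relation of X.\<close>

lemma dual_cocyclic:
 assumes X: "cyc_mod K Cyclic X" and K: "cring K"
 shows "cyc_mod K Cocyclic (dual_cmod K X)" (is "cyc_mod K Cocyclic ?Z")
proof -
 note MX = cyclicD(1)[OF X] and MS = module_self[OF K]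
 have FX: "face X (Suc n) j : lin K (comp X (Suc n)) (comp X n)" if "j <= Suc n" for n j
  using cyclicD(2)[OF X, of "Suc n" j] that by simp
 have DX: "degen X n j : lin K (comp X n) (comp X (Suc n))" if "j <= n" for n j
  using cyclicD(3)[OF X, of n j] that by simp
 note TX = cyclicD(4)[OF X]
 note RX = cyclic_relD[OF cyclicD(5)[OF X]]
 note cl = lin_cl[OF FX] lin_cl[OF DX] lin_cl[OF TX] hom_app
 note sand = hom_sandwich[OF MX _ lin_id]
 have pow: "((%f. \<lambda>x\<in>el X n. f (cyc X n x)) ^^ k) f x = f ((cyc X n ^^ k) x)"
  if "x :> comp X n" for n k f x using that
 proof(induction k arbitrary: x)
  case (Suc k)
  thus ?case by(simp add: cl funpow_swap1)
 qed simp
 show ?thesis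
 proof(rule cyclicI)
  show "module K (comp (dual_cmod K X) n)" for n unfolding dual_sel by(rule module_hom[OF MX MS])
  show "face (dual_cmod K X) n j : lin K (comp (dual_cmod K X) n) (comp (dual_cmod K X) (face_deg Cocyclic n))"
  if "face_ok Cocyclic n j" for n j
  unfolding dual_sel face_deg.simps by(rule sand) (use that FX in simp)
  show "degen (dual_cmod K X) n j : lin K (comp (dual_cmod K X) n) (comp (dual_cmod K X) (degen_deg Cocyclic n))"
  if "degen_ok Cocyclic n j" for n j
  unfolding dual_sel degen_deg.simps by(rule sand) (use that DX[of j "n - 1"] in simp)
  show "cyc (dual_cmod K X) n : lin K (comp (dual_cmod K X) n) (comp (dual_cmod K X) n)" for n
  unfolding dual_sel by(rule sand[OF TX])
  show "cyclic_relations Cocyclic (dual_cmod K X)"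
  proof(rule cocyclic_relI; (unfold dual_sel(1))?)
  fix n i j f assume f: "f :> hom_module K (comp X n) (self_module K)"
  { assume n: "i < j" "j <= n + 2"
  show "face ?Z (Suc n) j (face ?Z n i f) = face ?Z (Suc n) i (face ?Z n (j - 1) f)" unfolding dual_sel
  using n RX(1)[of _ "Suc (Suc n)" i j] by(auto intro!: restrict_ext simp: cl) }
  { assume n: "i <= j" "Suc j < n"
  obtain m where m: "n = Suc (Suc m)" using n by(cases n; cases "n - 1") auto
  show "degen ?Z (n - 1) j (degen ?Z n i f) = degen ?Z (n - 1) i (degen ?Z n (Suc j) f)" unfolding dual_sel
  using n RX(2)[of _ m i j] m by(auto intro!: restrict_ext simp: cl) }
  { assume n: "j <= n" "i < j"
  obtain m where m: "n = Suc m" using n by(cases n) auto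
  show "degen ?Z (Suc n) j (face ?Z n i f) = face ?Z (n - 1) i (degen ?Z n (j - 1) f)" unfolding dual_sel
  using n RX(3)[of _ n j i] m by(auto intro!: restrict_ext simp: cl) }
  { assume n: "j <= n" "i = j \<or> i = Suc j"
  have "(\<lambda>x\<in>el X n. f (face X (Suc n) i (degen X n j x))) = f"
  using n RX(4)[of _ n j i] f by(auto simp: fun_eq_iff restrict_def hom_carrier extensional_def)
  thus "degen ?Z (Suc n) j (face ?Z n i f) = f" unfolding dual_sel
  using n by(auto simp: cl cong: restrict_cong) }
  { assume n: "j <= n" "i <= Suc n" "Suc j < i"
  obtain m where m: "n = Suc m" using n by(cases n) auto
  show "degen ?Z (Suc n) j (face ?Z n i f) = face ?Z (n - 1) (i - 1) (degen ?Z n j f)" unfolding dual_sel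
  using n RX(5)[of _ n j i] m by(auto intro!: restrict_ext simp: cl) }
  { assume n: "1 <= i" "i <= Suc n"
  show "cyc ?Z (Suc n) (face ?Z n i f) = face ?Z n (i - 1) (cyc ?Z n f)" unfolding dual_sel
  using n RX(6)[of _ "Suc n" i] by(auto intro!: restrict_ext simp: cl) }
  { show "cyc ?Z (Suc n) (face ?Z n 0 f) = face ?Z n (Suc n) f" unfolding dual_sel
  using RX(7)[of _ "Suc n"] by(auto intro!: restrict_ext simp: cl) }
  { assume n: "1 <= i" "i < n"
  obtain m where m: "n = Suc m" using n by(cases n) auto
  show "cyc ?Z (n - 1) (degen ?Z n i f) = degen ?Z n (i - 1) (cyc ?Z n f)" unfolding dual_sel
  using n RX(8)[of _ m i] m by(auto intro!: restrict_ext simp: cl) }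
  { assume n: "1 <= n"
  obtain m where m: "n = Suc m" using n by(cases n) auto
  show "cyc ?Z (n - 1) (degen ?Z n 0 f) = degen ?Z n (n - 1) (cyc ?Z n (cyc ?Z n f))" unfolding dual_sel
  using n RX(9)[of _ m] m by(auto intro!: restrict_ext simp: cl) }
  { have "((%f. \<lambda>x\<in>el X n. f (cyc X n x)) ^^ Suc n) f x = f x" for x
  proof(cases "x :> comp X n")
  case True
  thus ?thesis using pow[OF True, of "Suc n" f] RX(10)[OF True] by simp
  next
  case False
  thus ?thesis using f by(simp add: hom_carrier extensional_def)
  qed
  thus "(cyc ?Z n ^^ Suc n) f = f" unfolding dual_sel by blast }
  qed
 qed
qed

subsection \<open>Relabellings, push-outs and pull-backs\<close>

lemma relabel_carrier: "el (cmod_relabel io X) n = io ` el X n"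
 and relabel_zero: "0[comp (cmod_relabel io X) n] = io 0[comp X n]"
 by(simp_all add: cmod_relabel_eq cmod_rel_carrier cmod_rel_zero)

lemma relabel:
 assumes "inj io" and X: "cyc_mod K v X"
 shows "(%n. io) : cmod_hom K v X (cmod_relabel io X)" and "cyc_mod K v (cmod_relabel io X)"
 unfolding cmod_relabel_eq using cmod_rel(1,2)[OF X, of "inv_into UNIV io" io] assms(1) by simp_all

lemma hom_from_relabel:
 assumes "inj io" and X: "cyc_mod K v X" and h: "h : cmod_hom K v X Y"
  and eq: "!!n x. x :> comp X n ==> h' n (io x) = h n x"
 shows "h' : cmod_hom K v (cmod_relabel io X) Y"
 by(rule hom_from_epi[OF X relabel(1)[OF assms(1) X] _ h eq]) (simp_all add: relabel_carrier)

lemma inj_labels: "inj InE" "inj InW" "inj InPull" "inj InPush" by(auto intro: injI)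

lemma lin_neg_map:
 assumes "module K W" "f : lin K V W"
 shows "(%x. -[W] f x) : lin K V W"
proof -
 interpret W: module K W by fact
 note cl = lin_cl[OF assms(2)]
 show ?thesis
  by(rule lin_mapsI) (simp_all add: cl lin_add[OF assms(2)] lin_smult[OF assms(2)] W.minus_add W.smult_r_minus)
qed

lemma lin_fst: "(%x. fst x) : lin K (sum_module V W) V"
 and lin_snd: "(%x. snd x) : lin K (sum_module V W) W" by(rule lin_mapsI; auto)+

lemma lin_pair: "f : lin K U V ==> g : lin K U W ==> (%x. (f x, g x)) : lin K U (sum_module V W)"
 by(rule lin_mapsI) (simp_all add: lin_cl[of f K U V] lin_cl[of g K U W] lin_add[of f K U V] lin_add[of g K U W]
  lin_smult[of f K U V] lin_smult[of g K U W])

text \<open>Two representatives differ by an element of N, which H kills. This is what allows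
  functions on a push-out to be computed from an arbitrarily chosen representative.\<close>

lemma coset_some:
 assumes V: "module K V" "submodule N K V" and B: "module K B" and H: "H : lin K V B"
  and kill: "!!x. x : N ==> H x = 0[B]" and x: "x :> V"
 shows "H (SOME s. s : N +>[V] x) = H x"
proof -
 interpret B: module K B by fact
 let ?s = "SOME s. s : N +>[V] x"
 have s: "?s : N +>[V] x" by(rule someI[of "%s. s : N +>[V] x" x]) (rule coset_self[OF V x])
 hence sV: "?s :> V" by(rule coset_subset[OF V x])
 have "H ?s -[B] H x = 0[B]"
  using kill coset_mem_iff[OF V x sV] s by(simp flip: lin_minus[OF V(1) B H sV x])
 thus ?thesis using lin_cl[OF H sV] lin_cl[OF H x] by(simp add: B.diff_eq_iff)
qed

lemma sum_sel:
 "comp (cmod_sum X Y) n = sum_module (comp X n) (comp Y n)"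
 "face (cmod_sum X Y) n j (x, y) = (face X n j x, face Y n j y)"
 "degen (cmod_sum X Y) n j (x, y) = (degen X n j x, degen Y n j y)"
 "cyc (cmod_sum X Y) n (x, y) = (cyc X n x, cyc Y n y)" by(simp_all add: cmod_sum_def)

context
 fixes K :: "'k ring" and v and Y :: "('k, 'y) cmod" and Z :: "('k, 'z) cmod" and E :: "('k, 'e) cmod" and g i
 assumes Y: "cyc_mod K v Y" and Z: "cyc_mod K v Z" and E: "cyc_mod K v E"
  and g: "g : cmod_hom K v Y Z" and i: "i : cmod_hom K v Y E"
begin

abbreviation "po_rel \<equiv> pushout_rel Y E g i"
abbreviation "po_map n x \<equiv> po_rel n +>[sum_module (comp Z n) (comp E n)] x"

lemma po_module: "module K (sum_module (comp Z n) (comp E n))"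
 by(rule module_sum[OF cyclicD(1)[OF Z] cyclicD(1)[OF E]])

lemma po_rel_submodule: "submodule (po_rel n) K (sum_module (comp Z n) (comp E n))"
 unfolding pushout_rel_def by(rule submodule_image[OF cyclicD(1)[OF Y] po_module
  lin_pair[OF cmod_homD(1)[OF g] lin_neg_map[OF cyclicD(1)[OF E] cmod_homD(1)[OF i]]]])

lemma po_relI: "y :> comp Y n ==> (g n y, -[comp E n] i n y) : po_rel n"
 unfolding pushout_rel_def by simp

lemma po_relE:
 assumes "x : po_rel n"
 obtains y where "y :> comp Y n" "x = (g n y, -[comp E n] i n y)"
 using assms unfolding pushout_rel_def by auto

lemma pushout:
 shows "po_map : cmod_hom K v (cmod_sum Z E) (cmod_pushout v Y Z E g i)"
  and "cyc_mod K v (cmod_pushout v Y Z E g i)"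
proof -
 have neg: "f (-[comp E n] i n y) = -[comp E m] f (i n y)"
  if "f : lin K (comp E n) (comp E m)" "y :> comp Y n" for f n m y
  by(rule lin_neg[OF cyclicD(1)[OF E] cyclicD(1)[OF E] that(1)]) (rule cmod_closed[OF i that(2)])
 have sub: "submodule (po_rel n) K (comp (cmod_sum Z E) n)" for n
  unfolding sum_sel by(rule po_rel_submodule)
 have F: "face (cmod_sum Z E) n j ` po_rel n <= po_rel (face_deg v n)" if ok: "face_ok v n j" for n j
 proof(rule image_subsetI)
  fix x assume "x : po_rel n"
  then obtain y where y: "y :> comp Y n" "x = (g n y, -[comp E n] i n y)" by(rule po_relE)
  show "face (cmod_sum Z E) n j x : po_rel (face_deg v n)"
  using po_relI[OF face_closed[OF Y ok y(1)]] neg[OF cyclicD(2)[OF E ok] y(1)] y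
  by(simp add: sum_sel cmod_homD(2)[OF g ok] cmod_homD(2)[OF i ok])
 qed
 have D: "degen (cmod_sum Z E) n j ` po_rel n <= po_rel (degen_deg v n)" if ok: "degen_ok v n j" for n j
 proof(rule image_subsetI)
  fix x assume "x : po_rel n"
  then obtain y where y: "y :> comp Y n" "x = (g n y, -[comp E n] i n y)" by(rule po_relE)
  show "degen (cmod_sum Z E) n j x : po_rel (degen_deg v n)"
  using po_relI[OF degen_closed[OF Y ok y(1)]] neg[OF cyclicD(3)[OF E ok] y(1)] y
  by(simp add: sum_sel cmod_homD(3)[OF g ok] cmod_homD(3)[OF i ok])
 qed
 have T: "cyc (cmod_sum Z E) n ` po_rel n <= po_rel n" for n
 proof(rule image_subsetI)
  fix x assume "x : po_rel n"
  then obtain y where y: "y :> comp Y n" "x = (g n y, -[comp E n] i n y)" by(rule po_relE)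
  show "cyc (cmod_sum Z E) n x : po_rel n"
  using po_relI[OF cyc_closed[OF Y y(1)]] neg[OF cyclicD(4)[OF E] y(1)] y
  by(simp add: sum_sel cmod_homD(4)[OF g] cmod_homD(4)[OF i])
 qed
 note Q = cmod_quot[OF cyclic_sum[OF Z E] sub F D T]
 show "cyc_mod K v (cmod_pushout v Y Z E g i)" unfolding cmod_pushout_def by(rule Q(2))
 show "po_map : cmod_hom K v (cmod_sum Z E) (cmod_pushout v Y Z E g i)"
  using Q(1) unfolding cmod_pushout_def sum_sel .
qed

lemma po_carrier: "el (cmod_pushout v Y Z E g i) n = po_map n ` (el Z n \<times> el E n)"
 by(simp add: cmod_pushout_def cmod_quot_def sum_sel quot_carrier)

lemma po_zero: "0[comp (cmod_pushout v Y Z E g i) n] = po_map n (0[comp Z n], 0[comp E n])"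
 using coset_zero[OF po_module po_rel_submodule, of n] by(simp add: cmod_pushout_def cmod_quot_def sum_sel quot_zero)

text \<open>Relators have the form (g y, - i y), so passing from (z', e') to (z, e) adds g y to the
  first component and removes i y from the second. The second equation is solved for e' so that no
  minus sign remains.\<close>

lemma po_eq_iff:
 assumes "z :> comp Z n" "e :> comp E n" "z' :> comp Z n" "e' :> comp E n"
 shows "po_map n (z, e) = po_map n (z', e') \<longleftrightarrow>
  (\<exists>y\<in>el Y n. z = g n y +[comp Z n] z' & e' = i n y +[comp E n] e)"
proof -
 interpret Zm: module K "comp Z n" by(rule cyclicD(1)[OF Z])
 interpret Em: module K "comp E n" by(rule cyclicD(1)[OF E])
 have gc: "y :> comp Y n ==> g n y :> comp Z n" for y by(rule cmod_closed[OF g])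
 have ic: "y :> comp Y n ==> i n y :> comp E n" for y by(rule cmod_closed[OF i])
 have "po_map n (z, e) = po_map n (z', e') \<longleftrightarrow>
  (z, e) -[sum_module (comp Z n) (comp E n)] (z', e') : po_rel n"
  by(rule coset_eq_iff[OF po_module po_rel_submodule]) (use assms in simp_all)
 also have "(z, e) -[sum_module (comp Z n) (comp E n)] (z', e') = (z -[comp Z n] z', e -[comp E n] e')"
  unfolding a_minus_def using assms by(simp add: sum_neg[OF cyclicD(1)[OF Z] cyclicD(1)[OF E]])
 also have "... : po_rel n \<longleftrightarrow> (\<exists>y\<in>el Y n. z -[comp Z n] z' = g n y & e -[comp E n] e' = -[comp E n] i n y)"
  unfolding pushout_rel_def by auto
 also have "... \<longleftrightarrow> (\<exists>y\<in>el Y n. z = g n y +[comp Z n] z' & e' = i n y +[comp E n] e)"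
 proof(rule bex_cong[OF refl])
  fix y assume y: "y :> comp Y n"
  have "e -[comp E n] e' = -[comp E n] i n y \<longleftrightarrow> e = -[comp E n] i n y +[comp E n] e'"
  using assms ic[OF y] by(simp add: Em.diff_eq_iff)
  also have "... \<longleftrightarrow> e' = i n y +[comp E n] e"
  using assms ic[OF y] by(metis Em.a_inv_closed Em.r_neg1 Em.r_neg2)
  finally show "(z -[comp Z n] z' = g n y & e -[comp E n] e' = -[comp E n] i n y) \<longleftrightarrow>
  (z = g n y +[comp Z n] z' & e' = i n y +[comp E n] e)"
  using assms gc[OF y] by(simp add: Zm.diff_eq_iff)
 qed
 finally show ?thesis .
qed

lemma po_some:
 assumes B: "module K B" and H: "H : lin K (sum_module (comp Z n) (comp E n)) B"
  and kill: "!!y. y :> comp Y n ==> H (g n y, -[comp E n] i n y) = 0[B]"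
  and z: "z :> comp Z n" "e :> comp E n"
 shows "H (SOME s. s : po_map n (z, e)) = H (z, e)"
 by(rule coset_some[OF po_module po_rel_submodule B H]) (use kill z in \<open>auto elim: po_relE\<close>)

text \<open>\<open>e_part\<close> forgets the Z-component of an arbitrary representative.
  Representatives of one class differ in E only by elements of i(Y), so any h that vanishes on i(Y)
  does not notice the choice. The next map of an exact sequence is such an h.\<close>

lemma po_e_part:
 assumes B: "module K B" and h: "h : lin K (comp E n) B"
  and kill: "!!y. y :> comp Y n ==> h (i n y) = 0[B]"
  and z: "z :> comp Z n" "e :> comp E n"
 shows "h (e_part (InPush (po_map n (z, e)))) = h e"
proof -
 interpret B: module K B by fact
 have "-[B] 0[B] = 0[B]" by(rule B.minus_equality) simp_all
 hence "(%x. h (snd x)) (SOME s. s : po_map n (z, e)) = (%x. h (snd x)) (z, e)"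
  by(intro po_some[OF B lin_comp[OF lin_snd h] _ z])
  (simp add: kill lin_neg[OF cyclicD(1)[OF E] B h] cmod_closed[OF i])
 thus ?thesis by simp
qed

end

lemma hom_zero_map:
 assumes A: "cyc_mod K v A" and X: "cyc_mod K v X"
 shows "(%n a. 0[comp X n]) : cmod_hom K v A X"
proof(rule cmod_homI)
 show "(%a. 0[comp X n]) : lin K (comp A n) (comp X n)" for n
  by(rule lin_zero_map[OF cyclicD(1)[OF X]])
qed (simp_all add: lin_zero[OF cyclicD(1)[OF X] cyclicD(1)[OF X] cyclicD(2)[OF X]]
 lin_zero[OF cyclicD(1)[OF X] cyclicD(1)[OF X] cyclicD(3)[OF X]]
 lin_zero[OF cyclicD(1)[OF X] cyclicD(1)[OF X] cyclicD(4)[OF X]])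

lemma hom_add_map:
 assumes X: "cyc_mod K v X" and f: "f : cmod_hom K v A X" and g: "g : cmod_hom K v A X"
 shows "(%n a. f n a +[comp X n] g n a) : cmod_hom K v A X" by(rule cmod_homI)
  (simp_all add: lin_add_map[OF cyclicD(1)[OF X] cmod_homD(1)[OF f] cmod_homD(1)[OF g]]
  cmod_homD(2-4)[OF f] cmod_homD(2-4)[OF g] cmod_closed[OF f] cmod_closed[OF g]
  lin_add[OF cyclicD(2)[OF X]] lin_add[OF cyclicD(3)[OF X]] lin_add[OF cyclicD(4)[OF X]])

lemma hom_fst: "(%n x. fst x) : cmod_hom K v (cmod_sum X Y) X"
 and hom_snd: "(%n x. snd x) : cmod_hom K v (cmod_sum X Y) Y"
 by(rule cmod_homI; simp add: cmod_sum_def lin_fst lin_snd)+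

lemma hom_pair:
 assumes f: "f : cmod_hom K v A X" and g: "g : cmod_hom K v A Y"
 shows "(%n a. (f n a, g n a)) : cmod_hom K v A (cmod_sum X Y)" by(rule cmod_homI)
  (simp_all add: sum_sel lin_pair[OF cmod_homD(1)[OF f] cmod_homD(1)[OF g]] cmod_homD(2-4)[OF f] cmod_homD(2-4)[OF g])

context
 fixes K :: "'k ring" and v and F :: "('k, 'w) cmod" and X :: "('k, 'x) cmod" and B :: "('k, 'y) cmod" and r f
 assumes F: "cyc_mod K v F" and X: "cyc_mod K v X" and B: "cyc_mod K v B"
  and r: "r : cmod_hom K v F B" and f: "f : cmod_hom K v X B"
begin

lemma pb_carrier: "el (cmod_pullback F X r f) n =
  {(w, x). w :> comp F n & x :> comp X n & r n w = f n x}"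
 and pb_zero: "0[comp (cmod_pullback F X r f) n] = (0[comp F n], 0[comp X n])"
 by(simp_all add: cmod_pullback_def sum_sel)

text \<open>In each degree the pull-back is the kernel of the difference of r and f on the direct
  sum, hence a submodule; the operators preserve it because r and f commute with them.\<close>

lemma pullback_cyclic: "cyc_mod K v (cmod_pullback F X r f)" unfolding cmod_pullback_def
proof(rule cyclic_sub[OF cyclic_sum[OF F X]])
 fix n
 interpret B: module K "comp B n" by(rule cyclicD(1)[OF B])
 note MB = cyclicD(1)[OF B]
 note rc = cmod_closed[OF r] and fc = cmod_closed[OF f]
 have "(%p. r n (fst p) +[comp B n] (-[comp B n] f n (snd p))) : lin K (sum_module (comp F n) (comp X n)) (comp B n)"
  by(intro lin_add_map[OF MB] lin_neg_map[OF MB] lin_comp[OF lin_fst cmod_homD(1)[OF r]] lin_comp[OF lin_snd cmod_homD(1)[OF f]])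
 from submodule_vimage[OF module_sum[OF cyclicD(1)[OF F] cyclicD(1)[OF X]] MB this submodule_zero[OF MB]]
 have "submodule {p : carrier (sum_module (comp F n) (comp X n)). r n (fst p) -[comp B n] f n (snd p) : {0[comp B n]}} K
  (sum_module (comp F n) (comp X n))" unfolding a_minus_def .
 also have "{p : carrier (sum_module (comp F n) (comp X n)). r n (fst p) -[comp B n] f n (snd p) : {0[comp B n]}} =
  {(w, x). w :> comp F n & x :> comp X n & r n w = f n x}" using rc fc by(auto simp: B.diff_eq_iff)
 finally show "submodule {(w, x). w :> comp F n & x :> comp X n & r n w = f n x} K (comp (cmod_sum F X) n)"
  unfolding sum_sel .
next
 fix n j assume ok: "face_ok v n j"
 show "face (cmod_sum F X) n j ` {(w, x). w :> comp F n & x :> comp X n & r n w = f n x}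
  <= {(w, x). w :> comp F (face_deg v n) & x :> comp X (face_deg v n) & r (face_deg v n) w = f (face_deg v n) x}"
  by(auto simp: sum_sel face_closed[OF F ok] face_closed[OF X ok] cmod_homD(2)[OF r ok] cmod_homD(2)[OF f ok])
next
 fix n j assume ok: "degen_ok v n j"
 show "degen (cmod_sum F X) n j ` {(w, x). w :> comp F n & x :> comp X n & r n w = f n x}
  <= {(w, x). w :> comp F (degen_deg v n) & x :> comp X (degen_deg v n) & r (degen_deg v n) w = f (degen_deg v n) x}"
  by(auto simp: sum_sel degen_closed[OF F ok] degen_closed[OF X ok] cmod_homD(3)[OF r ok] cmod_homD(3)[OF f ok])
next
 fix n
 show "cyc (cmod_sum F X) n ` {(w, x). w :> comp F n & x :> comp X n & r n w = f n x}
  <= {(w, x). w :> comp F n & x :> comp X n & r n w = f n x}"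
  by(auto simp: sum_sel cyc_closed[OF F] cyc_closed[OF X] cmod_homD(4)[OF r] cmod_homD(4)[OF f])
qed

lemma pullback_pair:
 assumes h: "h : cmod_hom K v A F" and k: "k : cmod_hom K v A X"
  and eq: "!!n a. a :> comp A n ==> r n (h n a) = f n (k n a)"
 shows "(%n a. (h n a, k n a)) : cmod_hom K v A (cmod_pullback F X r f)"
proof -
 note P = cmod_homD[OF hom_pair[OF h k]]
 show ?thesis
 proof(rule cmod_homI)
  show "(%a. (h n a, k n a)) : lin K (comp A n) (comp (cmod_pullback F X r f) n)" for n
  proof(rule lin_mapsI)
  show "(h n a, k n a) :> comp (cmod_pullback F X r f) n" if "a :> comp A n" for a
  using that cmod_closed[OF h] cmod_closed[OF k] eq by(simp add: pb_carrier)
  qed (simp_all add: lin_add[OF P(1)] lin_smult[OF P(1)], simp_all add: cmod_pullback_def)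
 qed (use P(2-4) in \<open>simp_all add: cmod_pullback_def\<close>)
qed

lemma pullback_fst: "(%n x. fst x) : cmod_hom K v (cmod_pullback F X r f) F"
 and pullback_snd: "(%n x. snd x) : cmod_hom K v (cmod_pullback F X r f) X"
 by(rule cmod_homI; (rule lin_mapsI)?; auto simp: pb_carrier; auto simp: cmod_pullback_def cmod_sum_def sum_module_def split_beta)+

end

subsection \<open>The functor of linear maps into a cyclic module\<close>

lemma precomp_hom:
 assumes X: "cyc_mod K Cocyclic X" and W: "cyc_mod K Cocyclic W" and T: "cyc_mod K Cyclic T"
  and f: "f : cmod_hom K Cocyclic X W"
 shows "precomp X f : cmod_hom K Cyclic (diag_hom K W T) (diag_hom K X T)"
proof -
 note fc = cmod_closed[OF f]
 show ?thesis
 proof(rule cmod_homI)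
 show "precomp X f n : lin K (comp (diag_hom K W T) n) (comp (diag_hom K X T) n)" for n
  unfolding dh_sel precomp_def using hom_sandwich[OF cyclicD(1)[OF X] cmod_homD(1)[OF f] lin_id] .
next
 fix n j \<phi> assume ok: "face_ok Cyclic n j" and \<phi>: "\<phi> :> comp (diag_hom K W T) n"
 then obtain m where m: "n = Suc m" by(cases n) auto
 show "precomp X f (face_deg Cyclic n) (face (diag_hom K W T) n j \<phi>) = face (diag_hom K X T) n j (precomp X f n \<phi>)"
  using ok cmod_homD(2)[OF f, of m j] face_closed[OF X, of m j] face_closed[OF W, of m j] fc unfolding dh_sel precomp_def m
  by(auto intro!: restrict_ext)
next
 fix n j \<phi> assume ok: "degen_ok Cyclic n j" and \<phi>: "\<phi> :> comp (diag_hom K W T) n"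
 show "precomp X f (degen_deg Cyclic n) (degen (diag_hom K W T) n j \<phi>) = degen (diag_hom K X T) n j (precomp X f n \<phi>)"
  using ok cmod_homD(3)[OF f, of "Suc n" j] degen_closed[OF X, of "Suc n" j] degen_closed[OF W, of "Suc n" j] fc unfolding dh_sel precomp_def
  by(auto intro!: restrict_ext)
next
 fix n \<phi> assume \<phi>: "\<phi> :> comp (diag_hom K W T) n"
 show "precomp X f n (cyc (diag_hom K W T) n \<phi>) = cyc (diag_hom K X T) n (precomp X f n \<phi>)"
  using cmod_homD(4)[OF f, of _ n] cyc_closed[OF X, of _ n] cyc_closed[OF W, of _ n] fc unfolding dh_sel precomp_def
  by(auto intro!: restrict_ext)
qed
qed

definition postcomp :: "('k, 'x) cmod => (nat => 'y => 'z) => nat => ('x => 'y) => 'x => 'z" where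
 "postcomp X t n g = (\<lambda>x\<in>el X n. t n (g x))"

lemma postcomp_hom:
 assumes X: "cyc_mod K Cocyclic X" and t: "t : cmod_hom K Cyclic T T'"
 shows "postcomp X t : cmod_hom K Cyclic (diag_hom K X T) (diag_hom K X T')"
proof(rule cmod_homI)
 show "postcomp X t n : lin K (comp (diag_hom K X T) n) (comp (diag_hom K X T') n)" for n
  unfolding dh_sel postcomp_def using hom_sandwich[OF cyclicD(1)[OF X] lin_id cmod_homD(1)[OF t]] .
next
 fix n j \<phi> assume ok: "face_ok Cyclic n j" and \<phi>: "\<phi> :> comp (diag_hom K X T) n"
 then obtain m where m: "n = Suc m" by(cases n) auto
 show "postcomp X t (face_deg Cyclic n) (face (diag_hom K X T) n j \<phi>) = face (diag_hom K X T') n j (postcomp X t n \<phi>)"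
  using ok cmod_homD(2)[OF t ok] face_closed[OF X, of m j] hom_app[OF \<phi>[unfolded dh_sel]] unfolding dh_sel postcomp_def m
  by(auto intro!: restrict_ext)
next
 fix n j \<phi> assume ok: "degen_ok Cyclic n j" and \<phi>: "\<phi> :> comp (diag_hom K X T) n"
 show "postcomp X t (degen_deg Cyclic n) (degen (diag_hom K X T) n j \<phi>) = degen (diag_hom K X T') n j (postcomp X t n \<phi>)"
  using ok cmod_homD(3)[OF t ok] degen_closed[OF X, of "Suc n" j] hom_app[OF \<phi>[unfolded dh_sel]] unfolding dh_sel postcomp_def
  by(auto intro!: restrict_ext)
next
 fix n \<phi> assume \<phi>: "\<phi> :> comp (diag_hom K X T) n"
 show "postcomp X t n (cyc (diag_hom K X T) n \<phi>) = cyc (diag_hom K X T') n (postcomp X t n \<phi>)"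
  using cmod_homD(4)[OF t, of _ n] cyc_closed[OF X, of _ n] hom_app[OF \<phi>[unfolded dh_sel]] unfolding dh_sel postcomp_def
  by(auto intro!: restrict_ext)
qed

subsection \<open>Yoneda extensions\<close>

declare e_part.simps(1) [simp del]

text \<open>Exactness at the initial term and at a later term are separated, so that later terms are
  indexed by \<open>Suc j\<close> and no predecessor of j occurs. In both, the outgoing map is q at
  the end of the sequence and d elsewhere.\<close>

lemma yseq_okD:
 assumes ok: "yext_ok K v p X Y (YSeq m E i d q)"
 shows "m = p" "0 < p" "cyc_mod K v X" "cyc_mod K v Y"
  and "j < p ==> cyc_mod K v (E j)" "i : cmod_hom K v Y (E 0)"
  and "Suc j < p ==> d j : cmod_hom K v (E j) (E (Suc j))" "q : cmod_hom K v (E (p - 1)) X"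
  and "inj_on (i n) (el Y n)"
  and "q n ` el (E (p - 1)) n = el X n"
  and "i n ` el Y n = {x \<in> el (E 0) n.
  if Suc 0 = p then q n x = 0[comp X n] else d 0 n x = 0[comp (E (Suc 0)) n]}"
  and "Suc j < p ==> d j n ` el (E j) n = {x \<in> el (E (Suc j)) n.
  if Suc (Suc j) = p then q n x = 0[comp X n] else d (Suc j) n x = 0[comp (E (Suc (Suc j))) n]}"
proof -
 from ok have *: "0 < p" "m = p" "cyc_mod K v X" "cyc_mod K v Y" "ALL j<p. cyc_mod K v (E j)"
  "i : cmod_hom K v Y (E 0)" "ALL j. Suc j < p --> d j : cmod_hom K v (E j) (E (Suc j))"
  "q : cmod_hom K v (E (p - 1)) X" "yext_exact X Y p E i d q" by(simp_all del: yext_exact.simps)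
 thus "m = p" "0 < p" "cyc_mod K v X" "cyc_mod K v Y"
  "j < p ==> cyc_mod K v (E j)" "i : cmod_hom K v Y (E 0)"
  "Suc j < p ==> d j : cmod_hom K v (E j) (E (Suc j))" "q : cmod_hom K v (E (p - 1)) X" by blast+
 note ex = spec[OF *(9)[unfolded yext_exact.simps], of n]
 show "inj_on (i n) (el Y n)" "q n ` el (E (p - 1)) n = el X n" using ex by simp_all
 from ex have k: "(if j = 0 then i n ` el Y n else d (j - 1) n ` el (E (j - 1)) n) =
  {x \<in> el (E j) n. if Suc j = p then q n x = 0[comp X n] else d j n x = 0[comp (E (Suc j)) n]}"
  if "j < p" for j using that by(elim conjE allE[of _ j]) simp
 show "i n ` el Y n = {x \<in> el (E 0) n.
  if Suc 0 = p then q n x = 0[comp X n] else d 0 n x = 0[comp (E (Suc 0)) n]}"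
  using k[OF *(1)] by simp
 show "Suc j < p ==> d j n ` el (E j) n = {x \<in> el (E (Suc j)) n.
  if Suc (Suc j) = p then q n x = 0[comp X n] else d (Suc j) n x = 0[comp (E (Suc (Suc j))) n]}"
  using k[of "Suc j"] by simp
qed

lemma yseq_okI:
 assumes "0 < p" "cyc_mod K v X" "cyc_mod K v Y"
  and "!!j. j < p ==> cyc_mod K v (E j)" "i : cmod_hom K v Y (E 0)"
  and "!!j. Suc j < p ==> d j : cmod_hom K v (E j) (E (Suc j))" "q : cmod_hom K v (E (p - 1)) X"
  and "!!n. inj_on (i n) (el Y n)"
  and "!!n. q n ` el (E (p - 1)) n = el X n"
  and "!!n. i n ` el Y n = {x \<in> el (E 0) n.
  if Suc 0 = p then q n x = 0[comp X n] else d 0 n x = 0[comp (E (Suc 0)) n]}"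
  and k: "!!j n. Suc j < p ==> d j n ` el (E j) n = {x \<in> el (E (Suc j)) n.
  if Suc (Suc j) = p then q n x = 0[comp X n] else d (Suc j) n x = 0[comp (E (Suc (Suc j))) n]}"
 shows "yext_ok K v p X Y (YSeq p E i d q)"
proof -
 have "(if j = 0 then i n ` el Y n else d (j - 1) n ` el (E (j - 1)) n) =
  {x \<in> el (E j) n. if Suc j = p then q n x = 0[comp X n] else d j n x = 0[comp (E (Suc j)) n]}"
  if "j < p" for j n
 proof(cases j)
  case 0
  thus ?thesis using assms(10)[of n] by simp
 next
  case (Suc j')
  thus ?thesis using k[of j' n] that by simp
 qed
 thus ?thesis using assms(1-9) by simp
qed

lemma yseq_zero:
 assumes ok: "yext_ok K v p X Y (YSeq p E i d q)"
 shows "y :> comp Y n ==> Suc 0 = p ==> q n (i n y) = 0[comp X n]"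
  and "y :> comp Y n ==> Suc 0 < p ==> d 0 n (i n y) = 0[comp (E (Suc 0)) n]"
  and "Suc j < p ==> x :> comp (E j) n ==> Suc (Suc j) = p ==> q n (d j n x) = 0[comp X n]"
  and "x :> comp (E j) n ==> Suc (Suc j) < p ==> d (Suc j) n (d j n x) = 0[comp (E (Suc (Suc j))) n]"
proof -
 note k0 = yseq_okD(11)[OF ok, of n] and k = yseq_okD(12)[OF ok, of j n]
 show "q n (i n y) = 0[comp X n]" if "y :> comp Y n" "Suc 0 = p"
  using imageI[OF that(1), of "i n"] that(2) unfolding k0 by simp
 show "d 0 n (i n y) = 0[comp (E (Suc 0)) n]" if "y :> comp Y n" "Suc 0 < p"
  using imageI[OF that(1), of "i n"] that(2) unfolding k0 by simp
 show "q n (d j n x) = 0[comp X n]" if "Suc j < p" "x :> comp (E j) n" "Suc (Suc j) = p"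
  using imageI[OF that(2), of "d j n"] that(3) unfolding k[OF that(1)] by simp
 show "d (Suc j) n (d j n x) = 0[comp (E (Suc (Suc j))) n]" if "x :> comp (E j) n" "Suc (Suc j) < p"
  using imageI[OF that(1), of "d j n"] that(2) k by auto
qed

text \<open>Morphisms of sequences lying over \<open>u : X \<rightarrow> X'\<close> and \<open>w : Y \<rightarrow> Y'\<close>, between possibly different
 universes.\<close>

fun yext_map :: "'k ring => variance => ('k, 'x) cmod => ('k, 'y) cmod => (nat => 'x => 'x1) => (nat => 'y => 'y1) =>
  ('k, 'x, 'y, 'e) yext => ('k, 'x1, 'y1, 'e1) yext => bool" where
 "yext_map K v X Y u w (YHom f) (YHom f') \<longleftrightarrow> (ALL n. ALL x:el X n. w n (f n x) = f' n (u n x))"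
| "yext_map K v X Y u w (YSeq p E i d q) (YSeq p' E' i' d' q') \<longleftrightarrow> p' = p \<and>
  (\<exists>g. (ALL j<p. g j : cmod_hom K v (E j) (E' j)) \<and>
  (ALL n. ALL y:el Y n. g 0 n (i n y) = i' n (w n y)) \<and> (ALL j n. Suc j < p -->
  (ALL x:el (E j) n. g (Suc j) n (d j n x) = d' j n (g j n x))) \<and>
  (ALL n. ALL x:el (E (p - 1)) n. q' n (g (p - 1) n x) = u n (q n x)))"
| "yext_map K v X Y u w _ _ \<longleftrightarrow> False"

lemma yext_map_step: "yext_map K v X Y (%n x. x) (%n y. y) s s' ==> yext_step K v X Y s s'"
 by(cases s; cases s') simp_all

lemma yext_mapE:
 assumes "yext_map K v X Y u w (YSeq p E i d q) s'"
 shows "\<exists>E' i' d' q' g. s' = YSeq p E' i' d' q' & (ALL j<p. g j : cmod_hom K v (E j) (E' j)) \<and>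
  (ALL n. ALL y:el Y n. g 0 n (i n y) = i' n (w n y)) \<and>
  (ALL j n. Suc j < p --> (ALL x:el (E j) n. g (Suc j) n (d j n x) = d' j n (g j n x))) \<and>
  (ALL n. ALL x:el (E (p - 1)) n. q' n (g (p - 1) n x) = u n (q n x))"
proof(cases s')
 case (YHom f)
 thus ?thesis using assms by simp
next
 case (YSeq p' E' i' d' q')
 show ?thesis using assms unfolding YSeq yext_map.simps
  by(intro exI[of _ E'] exI[of _ i'] exI[of _ d'] exI[of _ q']) simp
qed

lemma yext_mapI:
 assumes "!!j. j < p ==> g j : cmod_hom K v (E j) (E' j)"
  "!!n y. y :> comp Y n ==> g 0 n (i n y) = i' n (w n y)"
  "!!j n x. Suc j < p ==> x :> comp (E j) n ==> g (Suc j) n (d j n x) = d' j n (g j n x)"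
  "!!n x. x :> comp (E (p - 1)) n ==> q' n (g (p - 1) n x) = u n (q n x)"
 shows "yext_map K v X Y u w (YSeq p E i d q) (YSeq p E' i' d' q')"
 unfolding yext_map.simps by(intro conjI refl exI[of _ g] allI impI ballI assms)

lemma yext_map_comp:
 assumes m: "yext_map K v X Y u w s s'" and m': "yext_map K v X' Y' u' w' s' s''"
  and ok: "yext_ok K v p X Y s" and u: "u : cmod_hom K v X X'" and w: "w : cmod_hom K v Y Y'"
 shows "yext_map K v X Y (%n x. u' n (u n x)) (%n y. w' n (w n y)) s s''"
proof(cases s)
 case (YHom f)
 then obtain f' where f': "s' = YHom f'" using m by(cases s') auto
 then obtain f'' where "s'' = YHom f''" using m' by(cases s'') auto
 thus ?thesis using m m' f' YHom cmod_closed[OF u] by simp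
next
 case (YSeq p0 E i d q)
 note ok' = ok[unfolded YSeq]
 have p0: "p0 = p" using yseq_okD(1)[OF ok'] .
 from yext_mapE[OF m[unfolded YSeq p0]]
 obtain E' i' d' q' g where M10: "s' = YSeq p E' i' d' q'"
  "ALL j<p. g j : cmod_hom K v (E j) (E' j)"
  "ALL n. ALL y:el Y n. g 0 n (i n y) = i' n (w n y)"
  "ALL j n. Suc j < p --> (ALL x:el (E j) n. g (Suc j) n (d j n x) = d' j n (g j n x))"
  "ALL n. ALL x:el (E (p - 1)) n. q' n (g (p - 1) n x) = u n (q n x)" by(elim exE conjE) (rule that)
 note M1 = M10(1) M10(2)[rule_format] M10(3)[rule_format] M10(4)[rule_format] M10(5)[rule_format]
 from yext_mapE[OF m'[unfolded M1(1)]]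
 obtain E'' i'' d'' q'' g' where M20: "s'' = YSeq p E'' i'' d'' q''"
  "ALL j<p. g' j : cmod_hom K v (E' j) (E'' j)"
  "ALL n. ALL y:el Y' n. g' 0 n (i' n y) = i'' n (w' n y)"
  "ALL j n. Suc j < p --> (ALL x:el (E' j) n. g' (Suc j) n (d' j n x) = d'' j n (g' j n x))"
  "ALL n. ALL x:el (E' (p - 1)) n. q'' n (g' (p - 1) n x) = u' n (q' n x)"
  by(elim exE conjE) (rule that)
 note M2 = M20(1) M20(2)[rule_format] M20(3)[rule_format] M20(4)[rule_format] M20(5)[rule_format]
 show ?thesis unfolding YSeq p0 M2(1)
 proof(rule yext_mapI[where g="%j n x. g' j n (g j n x)"])
  show "(%n x. g' j n (g j n x)) : cmod_hom K v (E j) (E'' j)" if "j < p" for j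
  by(rule cmod_hom_comp[OF M1(2)[OF that] M2(2)[OF that]])
  show "g' 0 n (g 0 n (i n y)) = i'' n (w' n (w n y))" if "y :> comp Y n" for n y
  using that by(simp add: M1(3) M2(3) cmod_closed[OF w])
  show "g' (Suc j) n (g (Suc j) n (d j n x)) = d'' j n (g' j n (g j n x))" if "Suc j < p" "x :> comp (E j) n" for j n x
  using that by(simp add: M1(4) M2(4) cmod_closed[OF M1(2)])
  show "q'' n (g' (p - 1) n (g (p - 1) n x)) = u' n (u n (q n x))" if "x :> comp (E (p - 1)) n" for n x
  using that M1(5) M2(5) cmod_closed[OF M1(2)[of "p - 1"]] yseq_okD(2)[OF ok'] by simp
 qed
qed

text \<open>Only the initial term changes, to the push-out P of Z and \<open>E 0\<close> under Y.
  Maps leaving \<open>E 0\<close> kill i(Y), so they are defined on P through \<open>e_part\<close>.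
  Z embeds in P because i is injective, and a class (z, i y) killed by the next map equals (g y + z,
  0), hence comes from Z.\<close>

lemma push_ok:
 fixes K :: "'k ring" and X :: "('k, 'x) cmod" and Y :: "('k, 'y) cmod" and Z :: "('k, 'z) cmod"
  and s :: "('k, 'x, 'y, 'e) yext"
 assumes ok: "yext_ok K v p X Y s" and Z: "cyc_mod K v Z" and g: "g : cmod_hom K v Y Z"
 shows "yext_ok K v p X Z (yprod v X Y Z s (YHom g :: ('k, 'y, 'z, 'w) yext))"
proof(cases s)
 case (YHom f)
 thus ?thesis using ok Z g cmod_hom_comp[of f K v X Y g Z] by simp
next
 case (YSeq p0 E i d r)
 note ok' = ok[unfolded YSeq]
 have p0: "p0 = p" using yseq_okD(1)[OF ok'] .
 note ok' = ok'[unfolded p0]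
 note D = yseq_okD[OF ok'] and Z0 = yseq_zero[OF ok']
 note p = D(2) and Xc = D(3) and Yc = D(4) and Ec = D(5) and ih = D(6) and dh = D(7) and rh = D(8)
 note E0c = Ec[OF p]
 let ?S = "%n. sum_module (comp Z n) (comp (E 0) n)"
 let ?P = "%n x. pushout_rel Y (E 0) g i n +>[?S n] x"
 let ?EP = "cmod_relabel InPush (cmod_pushout v Y Z (E 0) g i) :: ('k, ('x, 'z, 'e, 'w) yuniv) cmod"
 let ?E = "%j. if j = 0 then ?EP else cmod_relabel InE (E j)"
 note PO = pushout[OF Yc Z E0c g ih] and poc = po_carrier[OF Yc Z E0c g ih] and poz = po_zero[OF Yc Z E0c g ih]
  and poeq = po_eq_iff[OF Yc Z E0c g ih] and poe = po_e_part[OF Yc Z E0c g ih]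
 have Zm: "module K (comp Z n)" and Em: "j < p ==> module K (comp (E j) n)" for n j
  using cyclicD(1)[OF Z] cyclicD(1)[OF Ec] by simp_all
 have zc: "0[comp Z n] :> comp Z n" "0[comp (E 0) n] :> comp (E 0) n" for n
  using Zm[of n] Em[OF p, of n] by(simp_all add: module_def abelian_group_def abelian_monoid.zero_closed)
 have e0: "x +[comp (E 0) n] 0[comp (E 0) n] = x" if "x :> comp (E 0) n" for x n
  using that Em[OF p, of n] by(simp add: module_def abelian_group_def abelian_monoid.r_zero)
 have z0: "x +[comp Z n] 0[comp Z n] = x" "0[comp Z n] +[comp Z n] x = x" if "x :> comp Z n" for x n
  using that Zm[of n] by(simp_all add: module_def abelian_group_def abelian_monoid.r_zero abelian_monoid.l_zero)
 have q: "(%n x. InPush (?P n x)) : cmod_hom K v (cmod_sum Z (E 0)) ?EP"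
  by(rule cmod_hom_comp[OF PO(1) relabel(1)[OF inj_labels(4) PO(2)]])
 have E0car: "el ?EP n = (%x. InPush (?P n x)) ` (el Z n \<times> el (E 0) n)" for n
  by(simp add: relabel_carrier poc image_image)
 \<comment> \<open>A map out of P obtained by forgetting the Z-component; \<open>kill\<close> is
   what makes it well defined and compatible with the operators.\<close>
 have out: "(%n u. h n (e_part u)) : cmod_hom K v ?EP B"
  if B: "cyc_mod K v B" and h: "h : cmod_hom K v (E 0) B"
  and kill: "!!n y. y :> comp Y n ==> h n (i n y) = 0[comp B n]" for B :: "('k, 'f) cmod" and h
 proof(rule hom_from_epi[OF cyclic_sum[OF Z E0c] q])
  show "el ?EP n <= (%x. InPush (?P n x)) ` el (cmod_sum Z (E 0)) n" for n
  by(simp add: E0car sum_sel)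
  show "(%n x. h n (snd x)) : cmod_hom K v (cmod_sum Z (E 0)) B" by(rule cmod_hom_comp[OF hom_snd h])
  show "h n (e_part (InPush (?P n x))) = h n (snd x)" if "x :> comp (cmod_sum Z (E 0)) n" for n x
  using that poe[OF cyclicD(1)[OF B] cmod_homD(1)[OF h] kill] by(auto simp: sum_sel)
 qed
 have out_ev: "h n (e_part (InPush (?P n (z, e)))) = h n e"
  if B: "cyc_mod K v B" and h: "h : cmod_hom K v (E 0) B"
  and kill: "!!n y. y :> comp Y n ==> h n (i n y) = 0[comp B n]"
  and "z :> comp Z n" "e :> comp (E 0) n" for B :: "('k, 'f) cmod" and h n z e
  by(rule poe[OF cyclicD(1)[OF B] cmod_homD(1)[OF h] kill that(4,5)])
 let ?R = "%j. cmod_relabel InE (E j) :: ('k, ('x, 'z, 'e, 'w) yuniv) cmod"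
 have rel: "cyc_mod K v (?R j)" "(%n. InE) : cmod_hom K v (E j) (?R j)" if "j < p" for j
  by(rule relabel[OF inj_labels(1) Ec[OF that]])+
 have EPc: "cyc_mod K v ?EP" by(rule relabel(2)[OF inj_labels(4) PO(2)])
 have from_rel: "h' : cmod_hom K v (?R j) B"
  if j: "j < p" and h: "h : cmod_hom K v (E j) B" and eq: "!!n x. x :> comp (E j) n ==> h' n (InE x) = h n x"
  for j h h' and B :: "('k, 'f) cmod" by(rule hom_from_relabel[OF inj_labels(1) Ec[OF j] h eq])
 have r1: "(%n u. r n (e_part u)) : cmod_hom K v ?EP X" "r n (e_part (InPush (?P n (z, e)))) = r n e"
  if p1: "p = Suc 0" and ze: "z :> comp Z n" "e :> comp (E 0) n" for n z e
 proof -
  have rh': "r : cmod_hom K v (E 0) X" using rh p1 by simp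
  show "(%n u. r n (e_part u)) : cmod_hom K v ?EP X"
  by(rule out[OF Xc rh']) (rule Z0(1)[OF _ p1[symmetric]])
  show "r n (e_part (InPush (?P n (z, e)))) = r n e"
  by(rule out_ev[OF Xc rh' Z0(1)[OF _ p1[symmetric]] ze])
 qed
 have d0: "(%n u. d 0 n (e_part u)) : cmod_hom K v ?EP (E (Suc 0))" "d 0 n (e_part (InPush (?P n (z, e)))) = d 0 n e"
  if p1: "Suc 0 < p" and ze: "z :> comp Z n" "e :> comp (E 0) n" for n z e
 proof -
  show "(%n u. d 0 n (e_part u)) : cmod_hom K v ?EP (E (Suc 0))"
  by(rule out[OF Ec[OF p1] dh[OF p1]]) (rule Z0(2)[OF _ p1])
  show "d 0 n (e_part (InPush (?P n (z, e)))) = d 0 n e"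
  by(rule out_ev[OF Ec[OF p1] dh[OF p1] Z0(2)[OF _ p1] ze])
 qed
 \<comment> \<open>Whichever map follows, q-end or differential, its kernel on P is described by the
   E-component alone, namely by exactness of the old sequence at \<open>E 0\<close>.\<close>
 have kill: "(if Suc 0 = p then r n (e_part (InPush (?P n (z, e)))) = 0[comp X n]
  else d 0 n (e_part (InPush (?P n (z, e)))) = 0[comp (E (Suc 0)) n]) \<longleftrightarrow> e : i n ` el Y n"
  if "z :> comp Z n" "e :> comp (E 0) n" for n z e using that p unfolding D(11) by(auto simp: r1 d0)
 have "yext_ok K v p X Z (YSeq p ?E
  (%n z. InPush (?P n (z, 0[comp (E 0) n]))) (%j n u. InE (d j n (e_part u))) (%n u. r n (e_part u)))"
 proof(rule yseq_okI)
  show "cyc_mod K v (?E j)" if "j < p" for j using rel(1)[OF that] EPc by simp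
  show "(%n z. InPush (?P n (z, 0[comp (E 0) n]))) : cmod_hom K v Z (?E 0)"
  using cmod_hom_comp[OF hom_pair[OF cmod_hom_id hom_zero_map[OF Z E0c]] q] by simp
  show "(%n u. InE (d j n (e_part u))) : cmod_hom K v (?E j) (?E (Suc j))" if "Suc j < p" for j
  proof(cases j)
  case 0
  have j0: "Suc 0 < p" using that 0 by simp
  have "(%n u. InE (d 0 n (e_part u))) : cmod_hom K v ?EP (?R (Suc 0))"
  by(rule cmod_hom_comp[OF d0(1)[OF j0 zc] rel(2)[OF j0]])
  thus ?thesis using 0 by simp
  next
  case (Suc k)
  have "(%n u. InE (d j n (e_part u))) : cmod_hom K v (?R j) (?R (Suc j))"
  by(rule from_rel[OF _ cmod_hom_comp[OF dh[OF that] rel(2)[OF that]]]) (use that in simp_all)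
  thus ?thesis using Suc by simp
  qed
  show "(%n u. r n (e_part u)) : cmod_hom K v (?E (p - 1)) X"
  proof(cases "p = Suc 0")
  case True
  thus ?thesis using r1(1)[OF True zc] by simp
  next
  case False
  have "(%n u. r n (e_part u)) : cmod_hom K v (?R (p - 1)) X"
  by(rule from_rel[OF _ rh]) (use p in simp_all)
  thus ?thesis using p False by simp
  qed
  show "inj_on (%z. InPush (?P n (z, 0[comp (E 0) n]))) (el Z n)" for n
  proof(rule inj_onI)
  fix z z' assume z: "z :> comp Z n" "z' :> comp Z n"
  "InPush (?P n (z, 0[comp (E 0) n])) = InPush (?P n (z', 0[comp (E 0) n]))"
  then obtain y where y: "y :> comp Y n" "z = g n y +[comp Z n] z'" "0[comp (E 0) n] = i n y +[comp (E 0) n] 0[comp (E 0) n]"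
  by(auto simp: poeq zc)
  hence "i n y = i n 0[comp Y n]" using e0[OF cmod_closed[OF ih y(1)]] cmod_hom_zero[OF Yc E0c ih] by simp
  moreover have "0[comp Y n] :> comp Y n" by(rule module_zero_closed[OF cyclicD(1)[OF Yc]])
  ultimately have "y = 0[comp Y n]" using D(9)[of n] y(1) by(auto dest: inj_onD)
  thus "z = z'" using y(2) z z0 cmod_hom_zero[OF Yc Z g] by simp
  qed
  show "(%u. r n (e_part u)) ` el (?E (p - 1)) n = el X n" for n
  proof(cases "p = Suc 0")
  case True
  have "(%u. r n (e_part u)) ` el ?EP n = r n ` el (E 0) n"
  proof
  show "(%u. r n (e_part u)) ` el ?EP n <= r n ` el (E 0) n"
  unfolding E0car by(auto simp: r1[OF True])
  show "r n ` el (E 0) n <= (%u. r n (e_part u)) ` el ?EP n"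
  proof(rule image_subsetI)
  fix e assume e: "e :> comp (E 0) n"
  have "InPush (?P n (0[comp Z n], e)) :> comp ?EP n" unfolding E0car using zc e by blast
  thus "r n e : (%u. r n (e_part u)) ` el ?EP n" by(rule rev_image_eqI) (simp add: r1[OF True zc(1) e])
  qed
  qed
  thus ?thesis using D(10)[of n] True by simp
  next
  case False
  thus ?thesis using p D(10)[of n] by(simp add: relabel_carrier image_image)
  qed
  show "(%z. InPush (?P n (z, 0[comp (E 0) n]))) ` el Z n = {x \<in> el (?E 0) n.
  if Suc 0 = p then r n (e_part x) = 0[comp X n] else InE (d 0 n (e_part x)) = 0[comp (?E (Suc 0)) n]}" (is "?L = ?R") for n
  proof -
  have R: "InPush (?P n (z, e)) : ?R \<longleftrightarrow> e : i n ` el Y n"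
  if "z :> comp Z n" "e :> comp (E 0) n" for z e
  using kill[OF that] that by(auto simp: relabel_zero E0car)
  show ?thesis
  proof
  show "?L <= ?R"
  proof(rule image_subsetI)
  fix z assume z: "z :> comp Z n"
  have "0[comp Y n] :> comp Y n" by(rule module_zero_closed[OF cyclicD(1)[OF Yc]])
  hence "0[comp (E 0) n] : i n ` el Y n"
  using cmod_hom_zero[OF Yc E0c ih, of n] by(intro image_eqI[of _ _ "0[comp Y n]"]) simp_all
  thus "InPush (?P n (z, 0[comp (E 0) n])) : ?R" using R[OF z zc(2)] by simp
  qed
  show "?R <= ?L"
  proof
  fix u assume u: "u : ?R"
  then obtain z e where ze: "z :> comp Z n" "e :> comp (E 0) n" "u = InPush (?P n (z, e))"
  by(auto simp: E0car)
  then obtain y where y: "y :> comp Y n" "e = i n y" using R[OF ze(1,2)] u by auto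
  have gy: "g n y :> comp Z n" by(rule cmod_closed[OF g y(1)])
  interpret Zn: module K "comp Z n" by(rule Zm)
  \<comment> \<open>The relator of y moves i y across the push-out, where it becomes g y in the
    Z-component.\<close>
  have "?P n (g n y +[comp Z n] z, 0[comp (E 0) n]) = ?P n (z, e)"
  using ze y gy zc e0 by(subst poeq) auto
  thus "u : ?L" unfolding ze(3)
  by(intro image_eqI[of _ _ "g n y +[comp Z n] z"]) (use ze gy in simp_all)
  qed
  qed
  qed
  show "(%u. InE (d j n (e_part u))) ` el (?E j) n = {x \<in> el (?E (Suc j)) n.
  if Suc (Suc j) = p then r n (e_part x) = 0[comp X n] else InE (d (Suc j) n (e_part x)) = 0[comp (?E (Suc (Suc j))) n]}"
  if j: "Suc j < p" for j n
  proof -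
  have "(%u. d j n (e_part u)) ` el (?E j) n = d j n ` el (E j) n"
  proof(cases j)
  case 0
  have j0: "Suc 0 < p" using j 0 by simp
  show ?thesis unfolding 0
  proof
  show "(%u. d 0 n (e_part u)) ` el (?E 0) n <= d 0 n ` el (E 0) n"
  by(auto simp: d0[OF j0] E0car)
  show "d 0 n ` el (E 0) n <= (%u. d 0 n (e_part u)) ` el (?E 0) n"
  proof(rule image_subsetI)
  fix e assume e: "e :> comp (E 0) n"
  have "InPush (?P n (0[comp Z n], e)) :> comp (?E 0) n" using zc e by(auto simp: E0car)
  thus "d 0 n e : (%u. d 0 n (e_part u)) ` el (?E 0) n" by(rule rev_image_eqI) (simp add: d0[OF j0 zc(1) e])
  qed
  qed
  next
  case (Suc k)
  thus ?thesis by(simp add: relabel_carrier image_image)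
  qed
  moreover have "(%u. InE (d j n (e_part u))) ` el (?E j) n = InE ` ((%u. d j n (e_part u)) ` el (?E j) n)"
  by(simp only: image_image)
  ultimately have "(%u. InE (d j n (e_part u))) ` el (?E j) n = InE ` (d j n ` el (E j) n)"
  by(simp only:)
  also have "... = {x \<in> el (?E (Suc j)) n.
  if Suc (Suc j) = p then r n (e_part x) = 0[comp X n] else InE (d (Suc j) n (e_part x)) = 0[comp (?E (Suc (Suc j))) n]}"
  unfolding D(12)[OF j] by(auto simp: relabel_carrier relabel_zero split: if_splits)
  finally show ?thesis .
  qed
 qed (use p Xc Z in simp_all)
 thus ?thesis unfolding YSeq p0 yprod.simps .
qed

text \<open>The universal property of the push-out: a map of sequences over w extends over the
  push-out along g once w factors through g. Only the component at the initial term has to be built;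
  the others are those of the given map.\<close>

lemma push_map_out:
 fixes K :: "'k ring" and X :: "('k, 'x) cmod" and Y :: "('k, 'y) cmod" and Z :: "('k, 'z) cmod"
  and s :: "('k, 'x, 'y, 'e) yext" and s' :: "('k, 'x1, 'y1, 'e1) yext"
 assumes ok: "yext_ok K v p X Y s" and ok1: "yext_ok K v p X1 Y1 s'"
  and m: "yext_map K v X Y u w s s'" and Z: "cyc_mod K v Z" and g: "g : cmod_hom K v Y Z"
  and w': "w' : cmod_hom K v Z Y1" and eq: "!!n y. y :> comp Y n ==> w' n (g n y) = w n y"
 shows "yext_map K v X Z u w' (yprod v X Y Z s (YHom g :: ('k, 'y, 'z, 'w) yext)) s'"
proof(cases s)
 case (YHom f)
 then obtain f' where f': "s' = YHom f'" using m by(cases s') auto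
 have f: "f : cmod_hom K v X Y" using ok YHom by simp
 show ?thesis using m YHom f' eq cmod_closed[OF f] by simp
next
 case (YSeq p0 E i d r)
 note ok' = ok[unfolded YSeq]
 have p0: "p0 = p" using yseq_okD(1)[OF ok'] .
 note ok' = ok'[unfolded p0]
 note D = yseq_okD[OF ok'] and Z0 = yseq_zero[OF ok']
 note p = D(2) and Xc = D(3) and Yc = D(4) and Ec = D(5) and ih = D(6) and dh = D(7) and rh = D(8)
 note E0c = Ec[OF p]
 from yext_mapE[OF m[unfolded YSeq p0]]
 obtain E' i' d' q' \<phi> where M0: "s' = YSeq p E' i' d' q'"
  "ALL j<p. \<phi> j : cmod_hom K v (E j) (E' j)"
  "ALL n. ALL y:el Y n. \<phi> 0 n (i n y) = i' n (w n y)"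
  "ALL j n. Suc j < p --> (ALL x:el (E j) n. \<phi> (Suc j) n (d j n x) = d' j n (\<phi> j n x))"
  "ALL n. ALL x:el (E (p - 1)) n. q' n (\<phi> (p - 1) n x) = u n (r n x)"
  by(elim exE conjE) (rule that)
 note M = M0(1) M0(2)[rule_format] M0(3)[rule_format] M0(4)[rule_format] M0(5)[rule_format]
 note ok1' = ok1[unfolded M(1)]
 note D1 = yseq_okD[OF ok1'] and Z1 = yseq_zero[OF ok1']
 note Y1c = D1(4) and E1c = D1(5) and ih1 = D1(6)
 let ?S = "%n. sum_module (comp Z n) (comp (E 0) n)"
 let ?P = "%n x. pushout_rel Y (E 0) g i n +>[?S n] x"
 let ?EP = "cmod_relabel InPush (cmod_pushout v Y Z (E 0) g i) :: ('k, ('x, 'z, 'e, 'w) yuniv) cmod"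
 let ?E = "%j. if j = 0 then ?EP else cmod_relabel InE (E j)"
 note PO = pushout[OF Yc Z E0c g ih] and poc = po_carrier[OF Yc Z E0c g ih] and pos = po_some[OF Yc Z E0c g ih]
  and poe = po_e_part[OF Yc Z E0c g ih]
 note E0m = cyclicD(1)[OF E0c] and E1m = cyclicD(1)[OF E1c[OF p]]
 have zc: "0[comp (E 0) n] :> comp (E 0) n" for n by(rule module_zero_closed[OF E0m])
 have q: "(%n x. InPush (?P n x)) : cmod_hom K v (cmod_sum Z (E 0)) ?EP"
  by(rule cmod_hom_comp[OF PO(1) relabel(1)[OF inj_labels(4) PO(2)]])
 have E0car: "el ?EP n = (%x. InPush (?P n x)) ` (el Z n \<times> el (E 0) n)" for n
  by(simp add: relabel_carrier poc image_image)
 \<comment> \<open>The map on the direct sum that induces the component at the push-out: the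
   target's inclusion after w' on Z, the old component on \<open>E 0\<close>. The two cancel on
   relators because w = w' g.\<close>
 define H where "H = (%n x. i' n (w' n (fst x)) +[comp (E' 0) n] \<phi> 0 n (snd x))"
 have Hh: "H : cmod_hom K v (cmod_sum Z (E 0)) (E' 0)"
  unfolding H_def by(rule hom_add_map[OF E1c[OF p] cmod_hom_comp[OF cmod_hom_comp[OF hom_fst w'] ih1] cmod_hom_comp[OF hom_snd M(2)[OF p]]])
 have Hkill: "H n (g n y, -[comp (E 0) n] i n y) = 0[comp (E' 0) n]" if y: "y :> comp Y n" for n y
 proof -
  interpret B: module K "comp (E' 0) n" by(rule E1m)
  have iy: "i n y :> comp (E 0) n" by(rule cmod_closed[OF ih y])
  have "w n y :> comp Y1 n" using cmod_closed[OF w' cmod_closed[OF g y]] eq[OF y] by simp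
  hence "i' n (w n y) :> comp (E' 0) n" by(rule cmod_closed[OF ih1])
  thus ?thesis
  by(simp add: H_def eq[OF y] lin_neg[OF E0m E1m cmod_homD(1)[OF M(2)[OF p]] iy] M(3)[OF y] B.r_neg)
 qed
 \<comment> \<open>The value on a push-out class is taken at a chosen representative;
   \<open>Hkill\<close> shows that every representative gives the same value.\<close>
 define \<psi> where "\<psi> = (%j n (u :: ('x, 'z, 'e, 'w) yuniv). if j = 0 then H n (SOME s. s : unPush u) else \<phi> j n (unE u))"
 have \<psi>0: "\<psi> 0 n (InPush (?P n (z, e))) = i' n (w' n z) +[comp (E' 0) n] \<phi> 0 n e"
  if "z :> comp Z n" "e :> comp (E 0) n" for n z e
  using pos[OF E1m cmod_homD(1)[OF Hh, unfolded sum_sel] Hkill that] by(simp add: \<psi>_def H_def)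
 have \<psi>j: "\<psi> (Suc j) n (InE x) = \<phi> (Suc j) n x" for j n x by(simp add: \<psi>_def)
 have \<phi>0c: "\<phi> 0 n e :> comp (E' 0) n" if "e :> comp (E 0) n" for n e
  by(rule cmod_closed[OF M(2)[OF p] that])
 have iwc: "i' n (w' n z) :> comp (E' 0) n" if "z :> comp Z n" for n z
  by(rule cmod_closed[OF ih1 cmod_closed[OF w' that]])
 have "yext_map K v X Z u w' (YSeq p ?E
  (%n z. InPush (?P n (z, 0[comp (E 0) n]))) (%j n u. InE (d j n (e_part u))) (%n u. r n (e_part u)))
  (YSeq p E' i' d' q')"
 proof(rule yext_mapI[where g=\<psi>])
  show "\<psi> j : cmod_hom K v (?E j) (E' j)" if "j < p" for j
  proof(cases j)
  case 0
  have "\<psi> 0 : cmod_hom K v ?EP (E' 0)"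
  by(rule hom_from_epi[OF cyclic_sum[OF Z E0c] q _ Hh]) (auto simp: E0car sum_sel \<psi>0, simp add: H_def)
  thus ?thesis using 0 by simp
  next
  case (Suc k)
  have "\<psi> j : cmod_hom K v (cmod_relabel InE (E j)) (E' j)"
  by(rule hom_from_relabel[OF inj_labels(1) Ec[OF that] M(2)[OF that]]) (simp add: Suc \<psi>j)
  thus ?thesis using Suc by simp
  qed
  show "\<psi> 0 n (InPush (?P n (z, 0[comp (E 0) n]))) = i' n (w' n z)" if "z :> comp Z n" for n z
  proof -
  interpret B: module K "comp (E' 0) n" by(rule E1m)
  show ?thesis using that zc iwc cmod_hom_zero[OF E0c E1c[OF p] M(2)[OF p]] by(simp add: \<psi>0)
  qed
  show "\<psi> (Suc j) n (InE (d j n (e_part x))) = d' j n (\<psi> j n x)" if j: "Suc j < p" and x: "x :> comp (?E j) n" for j n x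
  proof(cases j)
  case 0
  then obtain z e where ze: "z :> comp Z n" "e :> comp (E 0) n" "x = InPush (?P n (z, e))"
  using x by(auto simp: E0car)
  have j0: "Suc 0 < p" using j 0 by simp
  interpret B: module K "comp (E' (Suc 0)) n" by(rule cyclicD(1)[OF E1c[OF j0]])
  have "d 0 n (e_part x) = d 0 n e"
  unfolding ze(3) by(rule poe[OF cyclicD(1)[OF Ec[OF j0]] cmod_homD(1)[OF dh[OF j0]] Z0(2)[OF _ j0] ze(1,2)])
  moreover have "d' 0 n (\<psi> 0 n x) = d' 0 n (\<phi> 0 n e)"
  using ze iwc[OF ze(1)] \<phi>0c[OF ze(2)] lin_add[OF cmod_homD(1)[OF D1(7)[OF j0]]] Z1(2)[OF cmod_closed[OF w' ze(1)] j0]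
  cmod_closed[OF D1(7)[OF j0] \<phi>0c[OF ze(2)]] by(simp add: \<psi>0)
  ultimately show ?thesis using M(4)[OF j0 ze(2)] 0 by(simp add: \<psi>j)
  next
  case (Suc k)
  then obtain y where "y :> comp (E j) n" "x = InE y" using x by(auto simp: relabel_carrier)
  thus ?thesis using Suc M(4)[OF j] by(simp add: \<psi>j)
  qed
  show "q' n (\<psi> (p - 1) n x) = u n (r n (e_part x))" if x: "x :> comp (?E (p - 1)) n" for n x
  proof(cases "p = Suc 0")
  case True
  then obtain z e where ze: "z :> comp Z n" "e :> comp (E 0) n" "x = InPush (?P n (z, e))"
  using x by(auto simp: E0car)
  have rh': "r : cmod_hom K v (E 0) X" and qh': "q' : cmod_hom K v (E' 0) X1" using rh D1(8) True by simp_all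
  interpret B: module K "comp X1 n" by(rule cyclicD(1)[OF D1(3)])
  have "r n (e_part x) = r n e"
  unfolding ze(3) by(rule poe[OF cyclicD(1)[OF Xc] cmod_homD(1)[OF rh'] Z0(1)[OF _ True[symmetric]] ze(1,2)])
  moreover have "q' n (\<psi> 0 n x) = q' n (\<phi> 0 n e)"
  using ze iwc[OF ze(1)] \<phi>0c[OF ze(2)] lin_add[OF cmod_homD(1)[OF qh']] Z1(1)[OF cmod_closed[OF w' ze(1)] True[symmetric]]
  cmod_closed[OF qh' \<phi>0c[OF ze(2)]] by(simp add: \<psi>0)
  ultimately show ?thesis using M(5)[of e n] ze(2) True by simp
  next
  case False
  then obtain y where y: "y :> comp (E (p - 1)) n" "x = InE y" using x p by(auto simp: relabel_carrier)
  obtain k where k: "p - 1 = Suc k" using False p by(cases "p - 1") auto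
  show ?thesis using M(5)[OF y(1)] y(2) unfolding k by(simp add: \<psi>j)
  qed
 qed
 thus ?thesis unfolding YSeq p0 M(1) yprod.simps .
qed

text \<open>Only the last term changes, to the pull-back of r and f. An element w arriving there
  from the left is paired with zero, which is legitimate because r kills it by exactness. The
  projection to X1 is onto because r is, and its kernel consists of the pairs (w, 0) with r w = 0.
  For q = 1 the last term is also the initial one, which the case distinction in \<open>?tag\<close>
  covers.\<close>

lemma pull_ok:
 fixes K :: "'k ring" and X :: "('k, 'x) cmod" and X1 :: "('k, 'x1) cmod" and Y :: "('k, 'y) cmod"
  and s :: "('k, 'x, 'y, 'e) yext"
 assumes ok: "yext_ok K v q X Y s" and X1: "cyc_mod K v X1" and f: "f : cmod_hom K v X1 X"
 shows "yext_ok K v q X1 Y (yprod v X1 X Y (YHom f :: ('k, 'x1, 'x, 'w) yext) s)"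
proof(cases s)
 case (YHom g)
 thus ?thesis using ok X1 f cmod_hom_comp[of f K v X1 X g Y] by simp
next
 case (YSeq q0 F i d r)
 note ok' = ok[unfolded YSeq]
 have q0: "q0 = q" using yseq_okD(1)[OF ok'] .
 note ok' = ok'[unfolded q0]
 note D = yseq_okD[OF ok'] and Z0 = yseq_zero[OF ok']
 note q = D(2) and Xc = D(3) and Yc = D(4) and Fc = D(5) and ih = D(6) and dh = D(7) and rh = D(8)
 have q1: "q - 1 < q" "Suc (q - 1) = q" using q by simp_all
 note Fm = Fc[OF q1(1)]
 let ?PB = "cmod_pullback (F (q - 1)) X1 r f"
 note pbc = pullback_cyclic[OF Fm X1 Xc rh f] and pbcar = pb_carrier[OF Fm X1 Xc rh f]
  and pbz = pb_zero[OF Fm X1 Xc rh f]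
 let ?E = "%j. (if Suc j = q then cmod_relabel InPull (cmod_pullback (F j) X1 r f) else cmod_relabel InW (F j))
  :: ('k, ('x1, 'y, 'w, 'e) yuniv) cmod"
 let ?tag = "%j n w. (if Suc j = q then InPull (w, 0[comp X1 n]) else InW w) :: ('x1, 'y, 'w, 'e) yuniv"
 have Elast: "?E (q - 1) = cmod_relabel InPull ?PB" using q1(2) by simp
 have Ej: "?E j = cmod_relabel InW (F j)" if "Suc j < q" for j using that by simp
 have pbh: "(%n. InPull) : cmod_hom K v ?PB (?E (q - 1))" unfolding Elast by(rule relabel(1)[OF inj_labels(3) pbc])
 have Fzc: "0[comp (F j) n] :> comp (F j) n" if "j < q" for j n
  by(rule module_zero_closed[OF cyclicD(1)[OF Fc[OF that]]])
 have X1z: "0[comp X1 n] :> comp X1 n" for n by(rule module_zero_closed[OF cyclicD(1)[OF X1]])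
 have f0: "f n 0[comp X1 n] = 0[comp X n]" for n by(rule cmod_hom_zero[OF X1 Xc f])
 have Ec: "cyc_mod K v (?E j)" if "j < q" for j
 proof(cases "Suc j = q")
  case True
  hence "j = q - 1" by simp
  thus ?thesis using relabel(2)[OF inj_labels(3) pbc] q1 by simp
 next
  case False
  thus ?thesis using relabel(2)[OF inj_labels(2) Fc[OF that]] by simp
 qed
 have tagh: "(%n a. ?tag j n (h n a)) : cmod_hom K v A (?E j)"
  if j: "j < q" and A: "cyc_mod K v A" and h: "h : cmod_hom K v A (F j)"
  and kill: "!!n a. Suc j = q ==> a :> comp A n ==> r n (h n a) = 0[comp X n]" for j h and A :: "('k, 'g) cmod"
 proof(cases "Suc j = q")
  case True
  hence jq: "j = q - 1" by simp
  have h': "h : cmod_hom K v A (F (q - 1))" using h jq by simp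
  have "(%n a. (h n a, 0[comp X1 n])) : cmod_hom K v A ?PB"
  by(rule pullback_pair[OF Fm X1 Xc rh f h' hom_zero_map[OF A X1]]) (simp add: kill[OF True] f0)
  from cmod_hom_comp[OF this pbh] show ?thesis using True jq q1 by simp
 next
  case False
  thus ?thesis using cmod_hom_comp[OF h relabel(1)[OF inj_labels(2) Fc[OF j]]] by simp
 qed
 have tag_inj: "?tag j n w = ?tag j n w' \<longleftrightarrow> w = w'" for j n w w' by simp
 have w_tag: "w_part (?tag j n w) = w" for j n w by simp
 have Ez: "0[comp (?E j) n] = ?tag j n 0[comp (F j) n]" if "j < q" for j n
 proof(cases "Suc j = q")
  case True
  hence "j = q - 1" by simp
  thus ?thesis using True q1 by(simp add: relabel_zero pbz[unfolded One_nat_def])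
 qed (simp add: relabel_zero)
 \<comment> \<open>Tagging identifies the kernels of the new sequence with those of the old one; at
   the last position because f 0 = 0, elsewhere because tags are injective.\<close>
 have ker: "{u : el (?E j) n. if Suc j = q then snd (unPull u) = 0[comp X1 n]
  else ?tag (Suc j) n (d j n (w_part u)) = 0[comp (?E (Suc j)) n]} =
  ?tag j n ` {w : el (F j) n. if Suc j = q then r n w = 0[comp X n] else d j n w = 0[comp (F (Suc j)) n]}"
  if j: "j < q" for j n
 proof(cases "Suc j = q")
  case True
  hence jq: "j = q - 1" by simp
  have car: "el (?E j) n = InPull ` {(w, x). w :> comp (F j) n & x :> comp X1 n & r n w = f n x}"
  using jq q1 by(simp add: relabel_carrier pbcar[unfolded One_nat_def])
  show ?thesis unfolding car using True X1z by(auto simp: f0)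
 next
  case False
  hence j': "Suc j < q" using j by simp
  have car: "el (?E j) n = InW ` el (F j) n" using j' by(simp add: relabel_carrier)
  show ?thesis unfolding car Ez[OF j'] tag_inj using False by auto
 qed
 have "yext_ok K v q X1 Y (YSeq q ?E (%n z. ?tag 0 n (i n z)) (%j n u. ?tag (Suc j) n (d j n (w_part u))) (%n u. snd (unPull u)))"
 proof(rule yseq_okI)
  show "cyc_mod K v (?E j)" if "j < q" for j by(rule Ec[OF that])
  show "(%n z. ?tag 0 n (i n z)) : cmod_hom K v Y (?E 0)"
  by(rule tagh[OF q Yc ih]) (simp add: Z0(1))
  show "(%j n u. ?tag (Suc j) n (d j n (w_part u))) j : cmod_hom K v (?E j) (?E (Suc j))" if j: "Suc j < q" for j
  proof -
  have jq: "j < q" using j by simp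
  have "(%n u. ?tag (Suc j) n (d j n (w_part u))) : cmod_hom K v (cmod_relabel InW (F j)) (?E (Suc j))"
  proof(rule hom_from_relabel[OF inj_labels(2) Fc[OF jq]])
  show "(%n a. ?tag (Suc j) n (d j n a)) : cmod_hom K v (F j) (?E (Suc j))"
  by(rule tagh[OF j Fc[OF jq] dh[OF j]]) (rule Z0(3)[OF j])
  qed simp
  thus ?thesis unfolding Ej[OF j] .
  qed
  show "(%n u. snd (unPull u)) : cmod_hom K v (?E (q - 1)) X1"
  unfolding Elast by(rule hom_from_relabel[OF inj_labels(3) pbc pullback_snd[OF Fm X1 Xc rh f]]) simp
  show "inj_on (%z. ?tag 0 n (i n z)) (el Y n)" for n using D(9)[of n] by(auto simp: inj_on_def)
  show "(%u. snd (unPull u)) ` el (?E (q - 1)) n = el X1 n" for n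
  proof -
  have "\<exists>w. w :> comp (F (q - 1)) n & r n w = f n x" if "x :> comp X1 n" for x
  proof -
  have "f n x : r n ` el (F (q - 1)) n" unfolding D(10) by(rule cmod_closed[OF f that])
  thus ?thesis by auto
  qed
  thus ?thesis unfolding Elast relabel_carrier pbcar by(force simp: image_iff)
  qed
  show "(%z. ?tag 0 n (i n z)) ` el Y n = {x \<in> el (?E 0) n.
  if Suc 0 = q then snd (unPull x) = 0[comp X1 n] else (%j n u. ?tag (Suc j) n (d j n (w_part u))) 0 n x = 0[comp (?E (Suc 0)) n]}" for n
  unfolding ker[OF q] D(11)[symmetric] by(simp only: image_image)
  show "(%j n u. ?tag (Suc j) n (d j n (w_part u))) j n ` el (?E j) n = {x \<in> el (?E (Suc j)) n.
  if Suc (Suc j) = q then snd (unPull x) = 0[comp X1 n]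
  else (%j n u. ?tag (Suc j) n (d j n (w_part u))) (Suc j) n x = 0[comp (?E (Suc (Suc j))) n]}" if j: "Suc j < q" for j n
  unfolding ker[OF j] D(12)[OF j, symmetric] Ej[OF j] relabel_carrier by(simp add: image_image)
 qed (use q Yc X1 in simp_all)
 thus ?thesis unfolding YSeq q0 yprod.simps Let_def .
qed

text \<open>\<open>w_part\<close> is the projection from the pull-back at the last position and
  strips the label elsewhere, so a single formula serves all components.\<close>

lemma pull_map_out:
 fixes K :: "'k ring" and X :: "('k, 'x) cmod" and X1 :: "('k, 'x1) cmod" and Y :: "('k, 'y) cmod"
  and s :: "('k, 'x, 'y, 'e) yext"
 assumes ok: "yext_ok K v q X Y s" and X1: "cyc_mod K v X1" and f: "f : cmod_hom K v X1 X"
 shows "yext_map K v X1 Y f (%n y. y) (yprod v X1 X Y (YHom f :: ('k, 'x1, 'x, 'w) yext) s) s"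
proof(cases s)
 case (YHom g)
 thus ?thesis by simp
next
 case (YSeq q0 F i d r)
 note ok' = ok[unfolded YSeq]
 have q0: "q0 = q" using yseq_okD(1)[OF ok'] .
 note ok' = ok'[unfolded q0]
 note D = yseq_okD[OF ok']
 note q = D(2) and Xc = D(3) and Yc = D(4) and Fc = D(5) and ih = D(6) and dh = D(7) and rh = D(8)
 have q1: "q - 1 < q" "Suc (q - 1) = q" using q by simp_all
 note Fm = Fc[OF q1(1)]
 let ?PB = "cmod_pullback (F (q - 1)) X1 r f"
 note pbc = pullback_cyclic[OF Fm X1 Xc rh f] and pbcar = pb_carrier[OF Fm X1 Xc rh f]
 let ?E = "%j. (if Suc j = q then cmod_relabel InPull (cmod_pullback (F j) X1 r f) else cmod_relabel InW (F j))
  :: ('k, ('x1, 'y, 'w, 'e) yuniv) cmod"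
 let ?tag = "%j n w. (if Suc j = q then InPull (w, 0[comp X1 n]) else InW w) :: ('x1, 'y, 'w, 'e) yuniv"
 have "yext_map K v X1 Y f (%n y. y) (YSeq q ?E (%n z. ?tag 0 n (i n z)) (%j n u. ?tag (Suc j) n (d j n (w_part u))) (%n u. snd (unPull u)))
  (YSeq q F i d r)"
 proof(rule yext_mapI[where g="%j n u. w_part u"])
  show "(%n u. w_part u) : cmod_hom K v (?E j) (F j)" if j: "j < q" for j
  proof(cases "Suc j = q")
  case True
  hence jq: "j = q - 1" by simp
  have "(%n u. w_part u) : cmod_hom K v (cmod_relabel InPull ?PB :: ('k, ('x1, 'y, 'w, 'e) yuniv) cmod) (F (q - 1))"
  by(rule hom_from_relabel[OF inj_labels(3) pbc pullback_fst[OF Fm X1 Xc rh f]]) simp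
  thus ?thesis using jq q1 by simp
  next
  case False
  have "(%n u. w_part u) : cmod_hom K v (cmod_relabel InW (F j) :: ('k, ('x1, 'y, 'w, 'e) yuniv) cmod) (F j)"
  by(rule hom_from_relabel[OF inj_labels(2) Fc[OF j] cmod_hom_id]) simp
  thus ?thesis using False by simp
  qed
  show "r n (w_part x) = f n (snd (unPull x))" if "x :> comp (?E (q - 1)) n" for n x
  using that q1 by(auto simp: relabel_carrier pbcar[unfolded One_nat_def])
 qed simp_all
 thus ?thesis unfolding YSeq q0 yprod.simps Let_def .
qed

text \<open>The universal property of the pull-back: a map of sequences over u lifts once u factors
  through f. The component at the last term pairs the old component with u' after the end map of
  \<open>s0\<close>.\<close>

lemma pull_map_into:
 fixes K :: "'k ring" and X :: "('k, 'x) cmod" and X1 :: "('k, 'x1) cmod" and Y :: "('k, 'y) cmod"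
  and s :: "('k, 'x, 'y, 'e) yext" and s0 :: "('k, 'x0, 'y0, 'e0) yext"
 assumes ok: "yext_ok K v q X Y s" and X1: "cyc_mod K v X1" and f: "f : cmod_hom K v X1 X"
  and ok0: "yext_ok K v q X0 Y0 s0" and m: "yext_map K v X0 Y0 u w s0 s"
  and u': "u' : cmod_hom K v X0 X1" and eq: "!!n x. x :> comp X0 n ==> f n (u' n x) = u n x"
  and w: "w : cmod_hom K v Y0 Y"
 shows "yext_map K v X0 Y0 u' w s0 (yprod v X1 X Y (YHom f :: ('k, 'x1, 'x, 'w) yext) s)"
proof(cases s0)
 case (YHom g)
 then obtain g' where g': "s = YHom g'" using m by(cases s) auto
 thus ?thesis using m YHom eq by simp
next
 case (YSeq p0 E0 i0 d0 q0')
 note ok0' = ok0[unfolded YSeq]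
 have p0: "p0 = q" using yseq_okD(1)[OF ok0'] .
 note ok0' = ok0'[unfolded p0]
 note D0 = yseq_okD[OF ok0'] and Z0 = yseq_zero[OF ok0']
 from yext_mapE[OF m[unfolded YSeq p0]]
 obtain F i d r g where M0: "s = YSeq q F i d r"
  "ALL j<q. g j : cmod_hom K v (E0 j) (F j)"
  "ALL n. ALL y:el Y0 n. g 0 n (i0 n y) = i n (w n y)"
  "ALL j n. Suc j < q --> (ALL x:el (E0 j) n. g (Suc j) n (d0 j n x) = d j n (g j n x))"
  "ALL n. ALL x:el (E0 (q - 1)) n. r n (g (q - 1) n x) = u n (q0' n x)"
  by(elim exE conjE) (rule that)
 note M = M0(1) M0(2)[rule_format] M0(3)[rule_format] M0(4)[rule_format] M0(5)[rule_format]
 note D = yseq_okD[OF ok[unfolded M(1)]]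
 note q = D(2) and Xc = D(3) and Yc = D(4) and Fc = D(5) and ih = D(6) and dh = D(7) and rh = D(8)
 have q1: "q - 1 < q" "Suc (q - 1) = q" using q by simp_all
 note Fm = Fc[OF q1(1)]
 let ?PB = "cmod_pullback (F (q - 1)) X1 r f"
 note pbc = pullback_cyclic[OF Fm X1 Xc rh f]
 let ?E = "%j. (if Suc j = q then cmod_relabel InPull (cmod_pullback (F j) X1 r f) else cmod_relabel InW (F j))
  :: ('k, ('x1, 'y, 'w, 'e) yuniv) cmod"
 let ?tag = "%j n w. (if Suc j = q then InPull (w, 0[comp X1 n]) else InW w) :: ('x1, 'y, 'w, 'e) yuniv"
 let ?g = "%j n x. (if Suc j = q then InPull (g j n x, u' n (q0' n x)) else InW (g j n x)) :: ('x1, 'y, 'w, 'e) yuniv"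
 note u0 = cmod_hom_zero[OF D0(3) X1 u']
 have "yext_map K v X0 Y0 u' w (YSeq q E0 i0 d0 q0')
  (YSeq q ?E (%n z. ?tag 0 n (i n z)) (%j n u. ?tag (Suc j) n (d j n (w_part u))) (%n u. snd (unPull u)))"
 proof(rule yext_mapI[where g="?g"])
  show "?g j : cmod_hom K v (E0 j) (?E j)" if j: "j < q" for j
  proof(cases "Suc j = q")
  case True
  hence jq: "j = q - 1" by simp
  have "(%n x. (g (q - 1) n x, u' n (q0' n x))) : cmod_hom K v (E0 (q - 1)) ?PB"
  by(rule pullback_pair[OF Fm X1 Xc rh f M(2)[OF q1(1)] cmod_hom_comp[OF D0(8) u']])
  (simp add: M(5)[unfolded One_nat_def] eq cmod_closed[OF D0(8)[unfolded One_nat_def]])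
  from cmod_hom_comp[OF this relabel(1)[OF inj_labels(3) pbc]] show ?thesis using jq q1 by simp
  next
  case False
  thus ?thesis using cmod_hom_comp[OF M(2)[OF j] relabel(1)[OF inj_labels(2) Fc[OF j]]] by simp
  qed
  show "?g 0 n (i0 n y) = ?tag 0 n (i n (w n y))" if "y :> comp Y0 n" for n y
  using that M(3) Z0(1) by(simp add: u0)
  show "?g (Suc j) n (d0 j n x) = ?tag (Suc j) n (d j n (w_part (?g j n x)))" if "Suc j < q" "x :> comp (E0 j) n" for j n x
  using that M(4) Z0(3) by(simp add: u0)
  show "snd (unPull (?g (q - 1) n x)) = u' n (q0' n x)" for n x using q1 by simp
 qed
 thus ?thesis unfolding YSeq p0 M(1) yprod.simps Let_def .
qed

subsection \<open>Exactness of the functor of linear maps\<close>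

text \<open>A form vanishing on the kernel of f factors through f by \<open>lin_extend\<close>,
  which is where complements of subspaces enter. Exactness of \<open>diag_hom_ext\<close> at every
  position is a translation of this equality.\<close>

lemma hom_exact:
 assumes K: "field K" and V: "module K V" and B: "module K B" and T: "module K T" and f: "f : lin K V B"
 shows "(%\<psi>. \<lambda>x\<in>carrier V. \<psi> (f x)) ` carrier (hom_module K B T) =
  {\<phi> \<in> carrier (hom_module K V T). ALL x:carrier V. f x = 0[B] --> \<phi> x = 0[T]}" (is "?L = ?R")
proof
 show "?L <= ?R"
 proof(rule image_subsetI)
  fix \<psi> assume \<psi>: "\<psi> :> hom_module K B T"
  hence \<psi>': "\<psi> : lin K B T" by(simp add: hom_carrier)
  have "\<psi> 0[B] = 0[T]" by(rule lin_zero[OF B T \<psi>'])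
  thus "(\<lambda>x\<in>carrier V. \<psi> (f x)) : ?R" using restrict_hom[OF V lin_comp[OF f \<psi>']] by simp
 qed
 show "?R <= ?L"
 proof
  fix \<phi> assume \<phi>: "\<phi> : ?R"
  hence \<phi>': "\<phi> : lin K V T" "\<phi> : extensional (carrier V)" by(simp_all add: hom_carrier)
  obtain \<psi> where \<psi>: "\<psi> : lin K B T" "\<psi> : extensional (carrier B)" "ALL x:carrier V. \<psi> (f x) = \<phi> x"
  using lin_extend[OF K V B T f \<phi>'(1)] \<phi> by auto
  have "\<phi> = (\<lambda>x\<in>carrier V. \<psi> (f x))"
  by(rule extensionalityI[OF \<phi>'(2)]) (use \<psi>(3) in auto)
  moreover have "\<psi> :> hom_module K B T" using \<psi> by(simp add: hom_carrier)
  ultimately show "\<phi> : ?L" by(rule image_eqI)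
 qed
qed

lemma restrict_zero_iff:
 "(\<lambda>x\<in>carrier V. g x) = 0[hom_module K V T] \<longleftrightarrow> (ALL x:carrier V. g x = 0[T])"
 by(auto simp: hom_module_def fun_eq_iff restrict_def)

text \<open>By \<open>hom_exact\<close> the image of precomposition with a map is the set of forms
  vanishing on its kernel. In an exact sequence that kernel is the image of the preceding map, and
  vanishing there means being killed by precomposition with it.\<close>

lemma diag_hom_ext_ok:
 fixes K :: "'k ring" and s :: "('k, 'x, 'w, 'e) yext" and T :: "('k, 't) cmod"
 assumes K: "field K" and ok: "yext_ok K Cocyclic p X W s" and T: "cyc_mod K Cyclic T"
 shows "yext_ok K Cyclic p (diag_hom K W T) (diag_hom K X T) (diag_hom_ext K X W T s)"
proof(cases s)
 case (YHom f)
 thus ?thesis using ok T precomp_hom[of K X W T f] diag_hom_cyclic[of K X T] diag_hom_cyclic[of K W T] by simp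
next
 case (YSeq p0 E i d q)
 note ok' = ok[unfolded YSeq]
 have p0: "p0 = p" using yseq_okD(1)[OF ok'] .
 note ok' = ok'[unfolded p0]
 note D = yseq_okD[OF ok']
 note p = D(2) and Xc = D(3) and Wc = D(4) and Ec = D(5) and ih = D(6) and dh = D(7) and qh = D(8)
 have Em: "j < p ==> module K (comp (E j) n)" for j n by(rule cyclicD(1)[OF Ec])
 note Xm = cyclicD(1)[OF Xc] and Wm = cyclicD(1)[OF Wc] and Tm = cyclicD(1)[OF T]
 \<comment> \<open>The order of the terms is reversed: position j carries
   \<open>E (p - 1 - j)\<close>, and the map leaving it is precomposition with
   \<open>d (p - 2 - j)\<close>. These identities tame the truncated subtraction.\<close>
 have idx: "p - 1 - j = Suc (p - 2 - j)" "p - 1 - Suc j = p - 2 - j" "p - 2 - j < p" "Suc (p - 2 - j) < p" if "Suc j < p" for j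
  using that by auto
 have exq: "precomp (E (p - 1)) q n ` carrier (hom_module K (comp X n) (comp T n)) =
  {\<phi> \<in> carrier (hom_module K (comp (E (p - 1)) n) (comp T n)).
  ALL x:el (E (p - 1)) n. q n x = 0[comp X n] --> \<phi> x = 0[comp T n]}" for n
  unfolding precomp_def by(rule hom_exact[OF K Em Xm Tm cmod_homD(1)[OF qh]]) (use p in simp)
 have exd: "precomp (E k) (d k) n ` carrier (hom_module K (comp (E (Suc k)) n) (comp T n)) =
  {\<phi> \<in> carrier (hom_module K (comp (E k) n) (comp T n)).
  ALL x:el (E k) n. d k n x = 0[comp (E (Suc k)) n] --> \<phi> x = 0[comp T n]}" if "Suc k < p" for k n
  unfolding precomp_def by(rule hom_exact[OF K Em Em Tm cmod_homD(1)[OF dh[OF that]]]) (use that in simp_all)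
 have zi: "precomp W i n \<phi> = 0[hom_module K (comp W n) (comp T n)] \<longleftrightarrow>
  (ALL x:i n ` el W n. \<phi> x = 0[comp T n])" for n \<phi>
  unfolding precomp_def restrict_zero_iff by simp
 have zd: "precomp (E k) (d k) n \<phi> = 0[hom_module K (comp (E k) n) (comp T n)] \<longleftrightarrow>
  (ALL x:d k n ` el (E k) n. \<phi> x = 0[comp T n])" for k n \<phi>
  unfolding precomp_def restrict_zero_iff by simp
 have "yext_ok K Cyclic p (diag_hom K W T) (diag_hom K X T) (YSeq p (%j. diag_hom K (E (p - 1 - j)) T)
  (precomp (E (p - 1)) q) (%j. precomp (E (p - 2 - j)) (d (p - 2 - j))) (precomp W i))"
 proof(rule yseq_okI)
  show "cyc_mod K Cyclic (diag_hom K (E (p - 1 - j)) T)" if "j < p" for j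
  by(rule diag_hom_cyclic[OF Ec T]) (use that in simp)
  show "precomp (E (p - 1)) q : cmod_hom K Cyclic (diag_hom K X T) (diag_hom K (E (p - 1 - 0)) T)"
  using precomp_hom[OF Ec[of "p - 1"] Xc T qh] p by simp
  show "precomp (E (p - 2 - j)) (d (p - 2 - j)) : cmod_hom K Cyclic (diag_hom K (E (p - 1 - j)) T) (diag_hom K (E (p - 1 - Suc j)) T)"
  if "Suc j < p" for j
  unfolding idx(1,2)[OF that] by(rule precomp_hom[OF Ec[OF idx(3)[OF that]] Ec[OF idx(4)[OF that]] T dh[OF idx(4)[OF that]]])
  show "precomp W i : cmod_hom K Cyclic (diag_hom K (E (p - 1 - (p - 1))) T) (diag_hom K W T)"
  using precomp_hom[OF Wc Ec[OF p] T ih] by simp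
  show "inj_on (precomp (E (p - 1)) q n) (el (diag_hom K X T) n)" for n unfolding dh_sel
  proof(rule inj_onI)
  fix \<phi> \<psi> assume *: "\<phi> :> hom_module K (comp X n) (comp T n)" "\<psi> :> hom_module K (comp X n) (comp T n)"
  "precomp (E (p - 1)) q n \<phi> = precomp (E (p - 1)) q n \<psi>"
  show "\<phi> = \<psi>"
  proof(rule hom_eqI[OF *(1,2)])
  fix x assume "x :> comp X n"
  then obtain e where "e :> comp (E (p - 1)) n" "x = q n e" unfolding D(10)[symmetric] by auto
  thus "\<phi> x = \<psi> x" using fun_cong[OF *(3), of e] by(simp add: precomp_def)
  qed
  qed
  show "precomp W i n ` el (diag_hom K (E (p - 1 - (p - 1))) T) n = el (diag_hom K W T) n" for n
  proof -
  \<comment> \<open>Injectivity of i makes the vanishing condition of \<open>hom_exact\<close>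
    vacuous, so every form on W extends to \<open>E 0\<close>.\<close>
  have "\<phi> x = 0[comp T n]" if "x :> comp W n" "i n x = 0[comp (E 0) n]" "\<phi> :> hom_module K (comp W n) (comp T n)" for \<phi> x
  proof -
  have "x = 0[comp W n]"
  using inj_onD[OF D(9), of n x "0[comp W n]"] that cmod_hom_zero[OF Wc Ec[OF p] ih] module_zero_closed[OF Wm, of n] by simp
  thus ?thesis using that(3) lin_zero[OF Wm Tm, of \<phi> n n] by(simp add: hom_carrier)
  qed
  thus ?thesis
  using hom_exact[OF K Wm Em[OF p] Tm cmod_homD(1)[OF ih], of n n] unfolding dh_sel precomp_def by auto
  qed
  show "precomp (E (p - 1)) q n ` el (diag_hom K X T) n = {x \<in> el (diag_hom K (E (p - 1 - 0)) T) n.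
  if Suc 0 = p then precomp W i n x = 0[comp (diag_hom K W T) n]
  else precomp (E (p - 2 - 0)) (d (p - 2 - 0)) n x = 0[comp (diag_hom K (E (p - 1 - Suc 0)) T) n]}" for n
  proof(cases "Suc 0 = p")
  case True
  hence p1: "p - 1 = 0" by simp
  show ?thesis using D(11)[of n] True unfolding dh_sel p1 diff_zero exq[unfolded p1] zi by auto
  next
  case False
  hence p1: "Suc 0 < p" using p by simp
  then obtain m where m: "p = Suc (Suc m)" by(cases p; cases "p - 1") auto
  hence e: "p - Suc 0 = Suc m" "p - 2 = m" "Suc (Suc m) = p" "p - Suc (Suc 0) = m" by simp_all
  have j: "Suc m < p" using m by simp
  show ?thesis using D(12)[OF j, of n] False unfolding dh_sel exq idx(2)[OF p1] zd by(auto simp: e)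
  qed
  show "precomp (E (p - 2 - j)) (d (p - 2 - j)) n ` el (diag_hom K (E (p - 1 - j)) T) n =
  {x \<in> el (diag_hom K (E (p - 1 - Suc j)) T) n.
  if Suc (Suc j) = p then precomp W i n x = 0[comp (diag_hom K W T) n]
  else precomp (E (p - 2 - Suc j)) (d (p - 2 - Suc j)) n x = 0[comp (diag_hom K (E (p - 1 - Suc (Suc j))) T) n]}"
  if j: "Suc j < p" for j n
  proof(cases "Suc (Suc j) = p")
  case True
  hence e: "p - 2 - j = 0" by simp
  show ?thesis using D(11)[of n] True j unfolding dh_sel idx(1,2)[OF j] exd[OF idx(4)[OF j]] zi unfolding e by auto
  next
  case False
  hence j2: "Suc (Suc j) < p" using j by simp
  obtain m where m: "p = Suc (Suc (Suc (j + m)))" using j2 by(metis add_Suc less_iff_Suc_add)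
  have e: "p - 2 - j = Suc m" "p - 2 - Suc j = m" and lt: "Suc m < p" "Suc (Suc m) ~= p" using m by simp_all
  show ?thesis using D(12)[OF lt(1), of n] False lt(2)
  unfolding dh_sel idx(1,2)[OF j] exd[OF idx(4)[OF j]] idx(2)[OF j2] zd unfolding e by auto
  qed
 qed (use p diag_hom_cyclic[OF Xc T] diag_hom_cyclic[OF Wc T] in simp_all)
 thus ?thesis unfolding YSeq p0 diag_hom_ext.simps .
qed

text \<open>Precomposition turns a map from s to s' into one from the sequence of s' to that of s,
  with its two ends exchanged; position j uses the component with index p - 1 - j.\<close>

lemma diag_hom_ext_pre:
 assumes ok: "yext_ok K Cocyclic p X Y s" and ok': "yext_ok K Cocyclic p X' Y' s'"
  and m: "yext_map K Cocyclic X Y u w s s'" and T: "cyc_mod K Cyclic T"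
  and u: "u : cmod_hom K Cocyclic X X'" and w: "w : cmod_hom K Cocyclic Y Y'"
 shows "yext_map K Cyclic (diag_hom K Y' T) (diag_hom K X' T) (precomp Y w) (precomp X u)
  (diag_hom_ext K X' Y' T s') (diag_hom_ext K X Y T s)"
proof(cases s)
 case (YHom f)
 then obtain f' where f': "s' = YHom f'" using m by(cases s') auto
 have fh: "f : cmod_hom K Cocyclic X Y" and fh': "f' : cmod_hom K Cocyclic X' Y'" using ok ok' YHom f' by simp_all
 show ?thesis using m YHom f' cmod_closed[OF fh] cmod_closed[OF u]
  by(auto simp: precomp_def intro!: restrict_ext)
next
 case (YSeq p0 E i d q)
 have p0: "p0 = p" using yseq_okD(1)[OF ok[unfolded YSeq]] .
 note D = yseq_okD[OF ok[unfolded YSeq p0]]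
 from yext_mapE[OF m[unfolded YSeq p0]]
 obtain E' i' d' q' g where M0: "s' = YSeq p E' i' d' q'"
  "ALL j<p. g j : cmod_hom K Cocyclic (E j) (E' j)"
  "ALL n. ALL y:el Y n. g 0 n (i n y) = i' n (w n y)"
  "ALL j n. Suc j < p --> (ALL x:el (E j) n. g (Suc j) n (d j n x) = d' j n (g j n x))"
  "ALL n. ALL x:el (E (p - 1)) n. q' n (g (p - 1) n x) = u n (q n x)" by(elim exE conjE) (rule that)
 note M = M0(1) M0(2)[rule_format] M0(3)[rule_format] M0(4)[rule_format] M0(5)[rule_format]
 note D' = yseq_okD[OF ok'[unfolded M(1)]]
 note p = D(2)
 have p1: "p - 1 < p" using p by simp
 have "yext_map K Cyclic (diag_hom K Y' T) (diag_hom K X' T) (precomp Y w) (precomp X u)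
  (YSeq p (%j. diag_hom K (E' (p - 1 - j)) T) (precomp (E' (p - 1)) q') (%j. precomp (E' (p - 2 - j)) (d' (p - 2 - j))) (precomp Y' i'))
  (YSeq p (%j. diag_hom K (E (p - 1 - j)) T) (precomp (E (p - 1)) q) (%j. precomp (E (p - 2 - j)) (d (p - 2 - j))) (precomp Y i))"
 proof(rule yext_mapI[where g="%j. precomp (E (p - 1 - j)) (g (p - 1 - j))"])
  show "precomp (E (p - 1 - j)) (g (p - 1 - j)) : cmod_hom K Cyclic (diag_hom K (E' (p - 1 - j)) T) (diag_hom K (E (p - 1 - j)) T)"
  if "j < p" for j by(rule precomp_hom[OF D(5) D'(5) T M(2)]) (use that in simp_all)
  show "precomp (E (p - 1 - 0)) (g (p - 1 - 0)) n (precomp (E' (p - 1)) q' n y) = precomp (E (p - 1)) q n (precomp X u n y)" for n y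
  using M(5) cmod_closed[OF M(2)[OF p1]] cmod_closed[OF D(8)] by(auto simp: precomp_def intro!: restrict_ext)
  show "precomp (E (p - 1 - Suc j)) (g (p - 1 - Suc j)) n (precomp (E' (p - 2 - j)) (d' (p - 2 - j)) n x) =
  precomp (E (p - 2 - j)) (d (p - 2 - j)) n (precomp (E (p - 1 - j)) (g (p - 1 - j)) n x)" if j: "Suc j < p" for j n x
  proof -
  have e: "p - 1 - Suc j = p - 2 - j" "p - 1 - j = Suc (p - 2 - j)" and k: "Suc (p - 2 - j) < p" "p - 2 - j < p" using j by simp_all
  show ?thesis unfolding e
  using M(4)[OF k(1)] cmod_closed[OF M(2)[OF k(2)]] cmod_closed[OF D(7)[OF k(1)]] by(auto simp: precomp_def intro!: restrict_ext)
  qed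
  show "precomp Y i n (precomp (E (p - 1 - (p - 1))) (g (p - 1 - (p - 1))) n x) = precomp Y w n (precomp Y' i' n x)" for n x
  using M(3) cmod_closed[OF D(6)] cmod_closed[OF w] by(auto simp: precomp_def intro!: restrict_ext)
 qed
 thus ?thesis unfolding YSeq p0 M(1) diag_hom_ext.simps .
qed

lemma diag_hom_ext_post:
 assumes ok: "yext_ok K Cocyclic p X Y s" and t: "t : cmod_hom K Cyclic T T'"
 shows "yext_map K Cyclic (diag_hom K Y T) (diag_hom K X T) (postcomp Y t) (postcomp X t)
  (diag_hom_ext K X Y T s) (diag_hom_ext K X Y T' s)"
proof(cases s)
 case (YHom f)
 have fh: "f : cmod_hom K Cocyclic X Y" using ok YHom by simp
 show ?thesis using YHom cmod_closed[OF fh]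
  by(auto simp: precomp_def postcomp_def intro!: restrict_ext)
next
 case (YSeq p0 E i d q)
 have p0: "p0 = p" using yseq_okD(1)[OF ok[unfolded YSeq]] .
 note D = yseq_okD[OF ok[unfolded YSeq p0]]
 note p = D(2)
 have "yext_map K Cyclic (diag_hom K Y T) (diag_hom K X T) (postcomp Y t) (postcomp X t)
  (YSeq p (%j. diag_hom K (E (p - 1 - j)) T) (precomp (E (p - 1)) q) (%j. precomp (E (p - 2 - j)) (d (p - 2 - j))) (precomp Y i))
  (YSeq p (%j. diag_hom K (E (p - 1 - j)) T') (precomp (E (p - 1)) q) (%j. precomp (E (p - 2 - j)) (d (p - 2 - j))) (precomp Y i))"
 proof(rule yext_mapI[where g="%j. postcomp (E (p - 1 - j)) t"])
  show "postcomp (E (p - 1 - j)) t : cmod_hom K Cyclic (diag_hom K (E (p - 1 - j)) T) (diag_hom K (E (p - 1 - j)) T')"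
  if "j < p" for j by(rule postcomp_hom[OF D(5) t]) (use that in simp)
  show "postcomp (E (p - 1 - 0)) t n (precomp (E (p - 1)) q n y) = precomp (E (p - 1)) q n (postcomp X t n y)" for n y
  using cmod_closed[OF D(8)] by(auto simp: precomp_def postcomp_def intro!: restrict_ext)
  show "postcomp (E (p - 1 - Suc j)) t n (precomp (E (p - 2 - j)) (d (p - 2 - j)) n x) =
  precomp (E (p - 2 - j)) (d (p - 2 - j)) n (postcomp (E (p - 1 - j)) t n x)" if j: "Suc j < p" for j n x
  proof -
  have e: "p - 1 - Suc j = p - 2 - j" "p - 1 - j = Suc (p - 2 - j)" and k: "Suc (p - 2 - j) < p" "p - 2 - j < p" using j by simp_all
  show ?thesis unfolding e
  using cmod_closed[OF D(7)[OF k(1)]] by(auto simp: precomp_def postcomp_def intro!: restrict_ext)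
  qed
  show "precomp Y i n (postcomp (E (p - 1 - (p - 1))) t n x) = postcomp Y t n (precomp Y i n x)" for n x
  using cmod_closed[OF D(6)] by(auto simp: precomp_def postcomp_def intro!: restrict_ext)
 qed
 thus ?thesis unfolding YSeq p0 diag_hom_ext.simps .
qed

subsection \<open>Change of universe\<close>

text \<open>Unlike \<open>yext_relabel\<close>, the inverse relabelling r is an argument. It then
  suffices that r undoes the labels that actually occur, so a map that is not injective on the whole
  universe may be used.\<close>

fun yext_rel :: "('e => 'u) => ('u => 'e) => ('k, 'x, 'y, 'e) yext => ('k, 'x, 'y, 'u) yext" where
 "yext_rel io r (YHom f) = YHom f"
| "yext_rel io r (YSeq p E i d q) =
  YSeq p (%j. cmod_rel io r (E j)) (%n y. io (i n y)) (%j n u. io (d j n (r u))) (%n u. q n (r u))"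

lemma yext_relabel_eq: "yext_relabel io s = yext_rel io (inv_into UNIV io) s"
 by(cases s) (simp_all add: cmod_relabel_eq)

fun yext_univ :: "('k, 'x, 'y, 'e) yext => 'e set" where
 "yext_univ (YHom f) = {}"
| "yext_univ (YSeq p E i d q) = (\<Union>j\<in>{..<p}. \<Union>n. el (E j) n)"

text \<open>Relabelling and its inverse are both maps of sequences that are the identity at the
  ends, so a sequence and its relabelled copy may replace each other in the middle of a chain of
  maps.\<close>

lemma yext_rel:
 fixes K :: "'k ring" and s :: "('k, 'x, 'y, 'e) yext" and io :: "'e => 'u"
 assumes ok: "yext_ok K v p X Y s" and r: "!!x. x : yext_univ s ==> r (io x) = x"
 shows "yext_ok K v p X Y (yext_rel io r s)"
  and "yext_map K v X Y (%n x. x) (%n y. y) s (yext_rel io r s)"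
  and "yext_map K v X Y (%n x. x) (%n y. y) (yext_rel io r s) s"
proof -
 have "yext_ok K v p X Y (yext_rel io r s) & yext_map K v X Y (%n x. x) (%n y. y) s (yext_rel io r s) \<and>
  yext_map K v X Y (%n x. x) (%n y. y) (yext_rel io r s) s"
 proof(cases s)
  case (YHom f)
  thus ?thesis using ok by simp
 next
  case (YSeq p0 E i d q)
  have p0: "p0 = p" using yseq_okD(1)[OF ok[unfolded YSeq]] .
  note D = yseq_okD[OF ok[unfolded YSeq p0]]
  note p = D(2)
  have p1: "p - 1 < p" using p by simp
  have rj: "r (io x) = x" if "j < p" "x :> comp (E j) n" for j n x
  using r[of x] that by(auto simp: YSeq p0)
  have R: "(%n. io) : cmod_hom K v (E j) (cmod_rel io r (E j))" "cyc_mod K v (cmod_rel io r (E j))"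
  "(%n. r) : cmod_hom K v (cmod_rel io r (E j)) (E j)" if "j < p" for j
  proof -
  show "(%n. io) : cmod_hom K v (E j) (cmod_rel io r (E j))"
  by(rule cmod_rel(1)[OF D(5)[OF that]], erule rj[OF that])
  show "cyc_mod K v (cmod_rel io r (E j))"
  by(rule cmod_rel(2)[OF D(5)[OF that]], erule rj[OF that])
  show "(%n. r) : cmod_hom K v (cmod_rel io r (E j)) (E j)"
  by(rule cmod_rel(3)[OF D(5)[OF that]], erule rj[OF that])
  qed
  have dc: "Suc j < p ==> x :> comp (E j) n ==> d j n x :> comp (E (Suc j)) n" for j n x
  by(rule cmod_closed[OF D(7)])
  have zc: "0[comp (E j) n] :> comp (E j) n" if "j < p" for j n
  by(rule module_zero_closed[OF cyclicD(1)[OF D(5)[OF that]]])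
  have inj: "io x = io y \<longleftrightarrow> x = y" if "j < p" "x :> comp (E j) n" "y :> comp (E j) n" for j n x y
  using rj[OF that(1,2)] rj[OF that(1,3)] by metis
  have ker: "{u : el (cmod_rel io r (E j)) n. if Suc j = p then q n (r u) = 0[comp X n]
  else io (d j n (r u)) = 0[comp (cmod_rel io r (E (Suc j))) n]} =
  io ` {x \<in> el (E j) n. if Suc j = p then q n x = 0[comp X n] else d j n x = 0[comp (E (Suc j)) n]}"
  if j: "j < p" for j n
  proof(cases "Suc j = p")
  case True
  thus ?thesis using rj[OF j] by(auto simp: cmod_rel_carrier)
  next
  case False
  hence j': "Suc j < p" using j by simp
  show ?thesis using False rj[OF j] inj[OF j' dc[OF j'] zc[OF j']] by(auto simp: cmod_rel_carrier cmod_rel_zero)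
  qed
  have "yext_ok K v p X Y (YSeq p (%j. cmod_rel io r (E j)) (%n y. io (i n y)) (%j n u. io (d j n (r u))) (%n u. q n (r u)))"
  proof(rule yseq_okI)
  show "cyc_mod K v (cmod_rel io r (E j))" if "j < p" for j by(rule R(2)[OF that])
  show "(%n y. io (i n y)) : cmod_hom K v Y (cmod_rel io r (E 0))"
  by(rule cmod_hom_comp[OF D(6) R(1)[OF p]])
  show "(%n u. io (d j n (r u))) : cmod_hom K v (cmod_rel io r (E j)) (cmod_rel io r (E (Suc j)))" if j: "Suc j < p" for j
  proof -
  have j': "j < p" using j by simp
  show ?thesis by(rule cmod_hom_comp[OF cmod_hom_comp[OF R(3)[OF j'] D(7)[OF j]] R(1)[OF j]])
  qed
  show "(%n u. q n (r u)) : cmod_hom K v (cmod_rel io r (E (p - 1))) X"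
  by(rule cmod_hom_comp[OF R(3)[OF p1] D(8)])
  show "inj_on (%y. io (i n y)) (el Y n)" for n
  using D(9)[of n] inj[OF p cmod_closed[OF D(6)] cmod_closed[OF D(6)]] unfolding inj_on_def by simp
  show "(%u. q n (r u)) ` el (cmod_rel io r (E (p - 1))) n = el X n" for n
  unfolding cmod_rel_carrier image_image D(10)[symmetric] using rj[OF p1] by simp
  show "(%y. io (i n y)) ` el Y n = {x \<in> el (cmod_rel io r (E 0)) n.
  if Suc 0 = p then q n (r x) = 0[comp X n] else io (d 0 n (r x)) = 0[comp (cmod_rel io r (E (Suc 0))) n]}" for n
  unfolding ker[OF p] D(11)[symmetric] by(simp only: image_image)
  show "(%u. io (d j n (r u))) ` el (cmod_rel io r (E j)) n = {x \<in> el (cmod_rel io r (E (Suc j))) n.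
  if Suc (Suc j) = p then q n (r x) = 0[comp X n] else io (d (Suc j) n (r x)) = 0[comp (cmod_rel io r (E (Suc (Suc j)))) n]}"
  if j: "Suc j < p" for j n
  unfolding ker[OF j] D(12)[OF j, symmetric] unfolding cmod_rel_carrier image_image using rj[of j] j by simp
  qed (use p D(3,4) in simp_all)
  moreover have "yext_map K v X Y (%n x. x) (%n y. y) (YSeq p E i d q)
  (YSeq p (%j. cmod_rel io r (E j)) (%n y. io (i n y)) (%j n u. io (d j n (r u))) (%n u. q n (r u)))"
  proof(rule yext_mapI[where g="%j n. io"])
  show "io (d j n x) = io (d j n (r (io x)))" if "Suc j < p" "x :> comp (E j) n" for j n x
  using rj[OF _ that(2)] that(1) by simp
  show "q n (r (io x)) = q n x" if "x :> comp (E (p - 1)) n" for n x using rj[OF p1 that] by simp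
  qed (use R(1) in simp_all)
  moreover have "yext_map K v X Y (%n x. x) (%n y. y)
  (YSeq p (%j. cmod_rel io r (E j)) (%n y. io (i n y)) (%j n u. io (d j n (r u))) (%n u. q n (r u))) (YSeq p E i d q)"
  proof(rule yext_mapI[where g="%j n. r"])
  show "r (io (d j n (r x))) = d j n (r x)" if "Suc j < p" "x :> comp (cmod_rel io r (E j)) n" for j n x
  using that rj[OF that(1) dc[OF that(1)]] rj[of j] by(auto simp: cmod_rel_carrier)
  qed (use R(3) rj[OF p cmod_closed[OF D(6)]] in simp_all)
  ultimately show ?thesis unfolding YSeq p0 yext_rel.simps by blast
 qed
 thus "yext_ok K v p X Y (yext_rel io r s)" "yext_map K v X Y (%n x. x) (%n y. y) s (yext_rel io r s)"
  "yext_map K v X Y (%n x. x) (%n y. y) (yext_rel io r s) s" by blast+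
qed

text \<open>Two arrows into the same z form a zigzag. All three sequences have to be in one
  universe, which is why the comparison sequence has to be relabelled.\<close>

lemma yext_equiv_common:
 assumes ok: "yext_ok K v p X Y e" "yext_ok K v p X Y e'" "yext_ok K v p X Y z"
  and "yext_step K v X Y e z" "yext_step K v X Y e' z"
 shows "yext_equiv K v p X Y `` {e} = yext_equiv K v p X Y `` {e'}"
proof -
 let ?S = "{e. yext_ok K v p X Y e}"
 let ?R = "{(e, e'). e : ?S & e' : ?S & yext_step K v X Y e e'}"
 let ?Q = "(?R \<union> ?R\<inverse>)\<^sup>*"
 have "(e, z) : ?R \<union> ?R\<inverse>" "(z, e') : ?R \<union> ?R\<inverse>" "(e', z) : ?R \<union> ?R\<inverse>" "(z, e) : ?R \<union> ?R\<inverse>"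
  using assms by auto
 hence "(e, e') : ?Q" "(e', e) : ?Q" by(meson converse_rtrancl_into_rtrancl r_into_rtrancl)+
 hence "(e, x) : ?Q \<longleftrightarrow> (e', x) : ?Q" for x by(meson rtrancl_trans)
 thus ?thesis using ok by(auto simp: yext_equiv_def Let_def)
qed

text \<open>The canonical map to the push-out sends e to the class of (0, e) at the initial term and
  only relabels the other terms.\<close>

lemma push_map_into:
 fixes K :: "'k ring" and X :: "('k, 'x) cmod" and Y :: "('k, 'y) cmod" and Z :: "('k, 'z) cmod"
  and s :: "('k, 'x, 'y, 'e) yext"
 assumes ok: "yext_ok K v p X Y s" and Z: "cyc_mod K v Z" and g: "g : cmod_hom K v Y Z"
 shows "yext_map K v X Y (%n x. x) g s (yprod v X Y Z s (YHom g :: ('k, 'y, 'z, 'w) yext))"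
proof(cases s)
 case (YHom f)
 thus ?thesis by simp
next
 case (YSeq p0 E i d r)
 have p0: "p0 = p" using yseq_okD(1)[OF ok[unfolded YSeq]] .
 note ok' = ok[unfolded YSeq p0]
 note D = yseq_okD[OF ok'] and Z0 = yseq_zero[OF ok']
 note p = D(2) and Xc = D(3) and Yc = D(4) and Ec = D(5) and ih = D(6) and dh = D(7) and rh = D(8)
 note E0c = Ec[OF p]
 let ?S = "%n. sum_module (comp Z n) (comp (E 0) n)"
 let ?P = "%n x. pushout_rel Y (E 0) g i n +>[?S n] x"
 let ?EP = "cmod_relabel InPush (cmod_pushout v Y Z (E 0) g i) :: ('k, ('x, 'z, 'e, 'w) yuniv) cmod"
 let ?E = "%j. if j = 0 then ?EP else cmod_relabel InE (E j)"
 let ?g = "%j n x. (if j = 0 then InPush (?P n (0[comp Z n], x)) else InE x) :: ('x, 'z, 'e, 'w) yuniv"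
 note PO = pushout[OF Yc Z E0c g ih] and poe = po_e_part[OF Yc Z E0c g ih] and poeq = po_eq_iff[OF Yc Z E0c g ih]
 have Zz: "0[comp Z n] :> comp Z n" for n by(rule module_zero_closed[OF cyclicD(1)[OF Z]])
 have Ez: "0[comp (E 0) n] :> comp (E 0) n" for n by(rule module_zero_closed[OF cyclicD(1)[OF E0c]])
 have q: "(%n x. InPush (?P n x)) : cmod_hom K v (cmod_sum Z (E 0)) ?EP"
  by(rule cmod_hom_comp[OF PO(1) relabel(1)[OF inj_labels(4) PO(2)]])
 have "yext_map K v X Y (%n x. x) g (YSeq p E i d r) (YSeq p ?E
  (%n z. InPush (?P n (z, 0[comp (E 0) n]))) (%j n u. InE (d j n (e_part u))) (%n u. r n (e_part u)))"
 proof(rule yext_mapI[where g="?g"])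
  show "?g j : cmod_hom K v (E j) (?E j)" if "j < p" for j
  proof(cases "j = 0")
  case True
  thus ?thesis using cmod_hom_comp[OF hom_pair[OF hom_zero_map[OF E0c Z] cmod_hom_id] q] by simp
  next
  case False
  have "(%n. InE) : cmod_hom K v (E j) (cmod_relabel InE (E j) :: ('k, ('x, 'z, 'e, 'w) yuniv) cmod)"
  by(rule relabel(1)[OF inj_labels(1) Ec[OF that]])
  thus ?thesis using False by simp
  qed
  show "?g 0 n (i n y) = InPush (?P n (g n y, 0[comp (E 0) n]))" if y: "y :> comp Y n" for n y
  proof -
  interpret Zn: module K "comp Z n" by(rule cyclicD(1)[OF Z])
  interpret En: module K "comp (E 0) n" by(rule cyclicD(1)[OF E0c])
  have gy: "g n y :> comp Z n" and iy: "i n y :> comp (E 0) n"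
  by(rule cmod_closed[OF g y], rule cmod_closed[OF ih y])
  \<comment> \<open>The relator of y itself: (0, i y) and (g y, 0) have the same class, which is the
    required compatibility with g.\<close>
  have "?P n (g n y, 0[comp (E 0) n]) = ?P n (0[comp Z n], i n y)"
  using y gy iy by(subst poeq) (auto intro!: bexI[of _ y])
  thus ?thesis by simp
  qed
  show "?g (Suc j) n (d j n x) = InE (d j n (e_part (?g j n x)))" if j: "Suc j < p" and x: "x :> comp (E j) n" for j n x
  proof(cases "j = 0")
  case True
  have "d 0 n (e_part (InPush (?P n (0[comp Z n], x)) :: ('x, 'z, 'e, 'w) yuniv)) = d 0 n x"
  using j x True by(intro poe[OF cyclicD(1)[OF Ec] cmod_homD(1)[OF dh] Z0(2) Zz]) simp_all
  thus ?thesis using True by simp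
  qed simp
  show "r n (e_part (?g (p - 1) n x)) = r n x" if x: "x :> comp (E (p - 1)) n" for n x
  proof(cases "p = Suc 0")
  case True
  have rh': "r : cmod_hom K v (E 0) X" and x': "x :> comp (E 0) n" using rh x True by simp_all
  have "r n (e_part (InPush (?P n (0[comp Z n], x)) :: ('x, 'z, 'e, 'w) yuniv)) = r n x"
  by(rule poe[OF cyclicD(1)[OF Xc] cmod_homD(1)[OF rh'] Z0(1)[OF _ True[symmetric]] Zz x'])
  thus ?thesis using True by simp
  next
  case False
  thus ?thesis using p by simp
  qed
 qed
 thus ?thesis unfolding YSeq p0 yprod.simps .
qed

section \<open>Evaluation at one, the bidual map, and comparison of the two representatives\<close>

lemma const_sel [simp]: "comp (const_cmod K) n = self_module K" "face (const_cmod K) n j x = x"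
 "degen (const_cmod K) n j x = x" "cyc (const_cmod K) n x = x" by(simp_all add: const_cmod_def)

lemma eval_one_hom:
 assumes "cring K"
 shows "eval_one K : cmod_hom K Cyclic (diag_hom K (const_cmod K) Y) Y"
proof -
 interpret cring K by fact
 have one: "1[K] :> self_module K" by simp
 show ?thesis
 proof(rule cmod_homI)
  show "eval_one K n : lin K (comp (diag_hom K (const_cmod K) Y) n) (comp Y n)" for n
  using hom_eval_lin[OF one] unfolding dh_sel const_sel eval_one_def[abs_def] .
 qed (simp_all add: dh_sel eval_one_def)
qed

lemma bidual_map_hom:
 assumes K: "cring K" and X: "cyc_mod K Cyclic X"
 shows "bidual_map K X : cmod_hom K Cyclic X (diag_hom K (dual_cmod K X) (const_cmod K))"
proof -
 note Dc = dual_cocyclic[OF X K]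
 note Dm = cyclicD(1)[OF Dc] and Xm = cyclicD(1)[OF X]
 have ev: "(%f. f x) : lin K (comp (dual_cmod K X) n) (self_module K)" if "x :> comp X n" for n x
  unfolding dual_sel by(rule hom_eval_lin[OF that])
 have ml: "f : lin K (comp X n) (self_module K)" if "f :> comp (dual_cmod K X) n" for f n
  using that by(simp add: dual_sel hom_carrier)
 show ?thesis
 proof(rule cmod_homI)
  show "bidual_map K X n : lin K (comp X n) (comp (diag_hom K (dual_cmod K X) (const_cmod K)) n)" for n
  proof(rule lin_mapsI)
  show "bidual_map K X n x :> comp (diag_hom K (dual_cmod K X) (const_cmod K)) n" if "x :> comp X n" for x
  unfolding dh_sel bidual_map_def const_sel by(rule restrict_hom[OF Dm ev[OF that]])
  show "bidual_map K X n (x +[comp X n] y) =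
  bidual_map K X n x +[comp (diag_hom K (dual_cmod K X) (const_cmod K)) n] bidual_map K X n y"
  if "x :> comp X n" "y :> comp X n" for x y
  unfolding dh_sel bidual_map_def using lin_add[OF ml] that by(auto simp: hom_module_def intro!: restrict_ext)
  show "bidual_map K X n (c *[comp X n] x) =
  c *[comp (diag_hom K (dual_cmod K X) (const_cmod K)) n] bidual_map K X n x"
  if "c :> K" "x :> comp X n" for c x
  unfolding dh_sel bidual_map_def using lin_smult[OF ml] that by(auto simp: hom_module_def intro!: restrict_ext)
  qed
 next
  fix n j x assume ok: "face_ok Cyclic n j" and x: "x :> comp X n"
  then obtain m where m: "n = Suc m" by(cases n) auto
  have "face (dual_cmod K X) m j f :> comp (dual_cmod K X) (Suc m)" if "f :> comp (dual_cmod K X) m" for f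
  using face_closed[OF Dc, of m j f] that ok m by simp
  thus "bidual_map K X (face_deg Cyclic n) (face X n j x) = face (diag_hom K (dual_cmod K X) (const_cmod K)) n j (bidual_map K X n x)"
  using x unfolding dh_sel bidual_map_def m by(auto intro!: restrict_ext) (simp add: dual_sel)
 next
  fix n j x assume ok: "degen_ok Cyclic n j" and x: "x :> comp X n"
  have "degen (dual_cmod K X) (Suc n) j f :> comp (dual_cmod K X) n" if "f :> comp (dual_cmod K X) (Suc n)" for f
  using degen_closed[OF Dc, of "Suc n" j f] that ok by simp
  thus "bidual_map K X (degen_deg Cyclic n) (degen X n j x) = degen (diag_hom K (dual_cmod K X) (const_cmod K)) n j (bidual_map K X n x)"
  using x unfolding dh_sel bidual_map_def by(auto intro!: restrict_ext) (simp add: dual_sel)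
 next
  fix n x assume x: "x :> comp X n"
  show "bidual_map K X n (cyc X n x) = cyc (diag_hom K (dual_cmod K X) (const_cmod K)) n (bidual_map K X n x)"
  using x cyc_closed[OF Dc] unfolding dh_sel bidual_map_def by(auto intro!: restrict_ext) (simp add: dual_sel)
 qed
qed

text \<open>Embeds the universe of a pulled-back, pushed-out sequence built from linear forms on \<open>'e\<close> into the
 universe of the one built from linear forms on the terms of a push-out; only the labels that occur in
 such sequences matter.\<close>

fun embed_push :: "('a, 'z, 'e => 'z, unit) yuniv => ('b, 'z, ('c, 'd, 'e, 'f) yuniv => 'z, unit) yuniv" where
 "embed_push (InPush S) = InPush ((%(z, g). (z, %u. g (unE u))) ` S)"
| "embed_push (InE g) = InE (%u. g (unE u))"
| "embed_push _ = InW ()"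

fun embed_pull :: "('x, 'z, unit, ('a, 'z, 'e => 'z, unit) yuniv) yuniv =>
  ('x, 'z, unit, ('b, 'z, ('c, 'd, 'e, 'f) yuniv => 'z, unit) yuniv) yuniv" where
 "embed_pull (InPull p) = InPull (embed_push (fst p), snd p)"
| "embed_pull (InW w) = InW (embed_push w)"
| "embed_pull _ = InE ()"

lemma inj_embed_push:
 "inj_on (embed_push :: ('a, 'z, 'e => 'z, unit) yuniv => ('b, 'z, ('c, 'd, 'e, 'f) yuniv => 'z, unit) yuniv)
  (range InPush \<union> range InE)"
proof(rule inj_onI)
 \<comment> \<open>Evaluation at \<open>InE x\<close> recovers g x, so pulling linear forms back
   along \<open>unE\<close> loses nothing.\<close>
 have inj1: "(%u :: ('c, 'd, 'e, 'f) yuniv. g (unE u)) = (%u. g' (unE u)) \<longleftrightarrow> g = g'" for g g' :: "'e => 'z"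
 proof
  assume *: "(%u :: ('c, 'd, 'e, 'f) yuniv. g (unE u)) = (%u. g' (unE u))"
  show "g = g'"
  proof
  fix x show "g x = g' x" using fun_cong[OF *, of "InE x"] by simp
  qed
 qed simp
 have "inj (%(z, g). (z, %u :: ('c, 'd, 'e, 'f) yuniv. g (unE u)) :: 'z \<times> (('c, 'd, 'e, 'f) yuniv => 'z))"
  by(rule injI) (auto simp: inj1)
 note inj2 = inj_image_eq_iff[OF this]
 fix u u' :: "('a, 'z, 'e => 'z, unit) yuniv"
 assume "u : range InPush \<union> range InE" "u' : range InPush \<union> range InE"
  "(embed_push u :: ('b, 'z, ('c, 'd, 'e, 'f) yuniv => 'z, unit) yuniv) = embed_push u'"
 thus "u = u'" by(auto simp: inj1 inj2)
qed

text \<open>Bounds the labels that occur in a pushed-out sequence, so that injectivity of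
  \<open>embed_push\<close> is demanded on these alone.\<close>

lemma push_univ:
 "yext_univ (yprod v X Y Z s (YHom g)) <= range InPush \<union> range InE"
 by(cases s) (auto simp: relabel_carrier split: if_splits)

lemma pull_univ:
 "yext_univ (yprod v X Y Z (YHom f) s) <= {InPull (w, x) | w x. w : yext_univ s} \<union> InW ` yext_univ s"
proof(cases s)
 case (YSeq q F i d r)
 show ?thesis
 proof
  fix u assume "u : yext_univ (yprod v X Y Z (YHom f) s)"
  then obtain j n where j: "j < q" and u: "u :> comp
  (if Suc j = q then cmod_relabel InPull (cmod_pullback (F j) X r f) else cmod_relabel InW (F j)) n"
  by(auto simp: YSeq Let_def)
  have F: "w : yext_univ s" if "w :> comp (F j) n" for w using that j by(auto simp: YSeq)
  show "u : {InPull (w, x) | w x. w : yext_univ s} \<union> InW ` yext_univ s"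
  proof(cases "Suc j = q")
  case True
  then obtain p where "u = InPull p" "p :> comp (cmod_pullback (F j) X r f) n"
  using u by(auto simp: relabel_carrier)
  moreover from this have "fst p :> comp (F j) n" by(auto simp: cmod_pullback_def)
  ultimately show ?thesis using F[of "fst p"] by(cases p) simp
  next
  case False
  then obtain w where "u = InW w" "w :> comp (F j) n" using u by(auto simp: relabel_carrier)
  thus ?thesis using F by simp
  qed
 qed
qed simp

text \<open>The labels of the pull-back wrap labels already covered by \<open>embed_push\<close>;
  the extra component of a pair is kept unchanged. The variable \<open>embed\<close> pins down the
  type instance of \<open>embed_pull\<close>.\<close>

lemma inj_embed_pull:
 fixes t :: "('k, 'y, 'z, ('a, 'z, 'e => 'z, unit) yuniv) yext"
  and embed :: "('x, 'z, unit, ('a, 'z, 'e => 'z, unit) yuniv) yuniv =>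
  ('x, 'z, unit, ('b, 'z, ('c, 'd, 'e, 'f) yuniv => 'z, unit) yuniv) yuniv"
 assumes "yext_univ t <= range InPush \<union> range InE" and embed: "embed = embed_pull"
 shows "inj_on embed (yext_univ (yprod v X Y Z (YHom f) t))"
proof(rule inj_onI)
 fix u u' assume *: "u : yext_univ (yprod v X Y Z (YHom f) t)" "u' : yext_univ (yprod v X Y Z (YHom f) t)" "embed u = embed u'"
 have "(\<exists>w x. u = InPull (w, x) & w : range InPush \<union> range InE) \<or> (\<exists>w. u = InW w & w : range InPush \<union> range InE)"
  using subsetD[OF pull_univ *(1)] assms(1) by auto
 moreover have "(\<exists>w x. u' = InPull (w, x) & w : range InPush \<union> range InE) \<or> (\<exists>w. u' = InW w & w : range InPush \<union> range InE)"
  using subsetD[OF pull_univ *(2)] assms(1) by auto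
 ultimately show "u = u'" using *(3) unfolding embed
  by(elim disjE exE conjE) (simp_all add: inj_on_eq_iff[OF inj_embed_push])
qed

text \<open>Both representatives map to the push-out along \<open>eval_one\<close> and pull-back along \<open>c\<close> of
 \<open>diag Hom(e, k)\<close>, where \<open>c\<close> is the common composite of \<open>\<alpha>\<close> with \<open>t\<close> and of the bidual map
 with \<open>\<gamma>\<close>.\<close>

lemma representatives_equivalent:
 fixes K :: "'k ring" and Cy :: "('k, 'c) cmod" and X :: "('k, 'x) cmod" and Y :: "('k, 'y) cmod"
  and e :: "('k, 'k, 'x, 'e) yext"
  and io :: "('c, 'k, unit, (('c => 'k) => 'k, 'k, ('k, 'c => 'k, 'e, unit) yuniv => 'k, unit) yuniv) yuniv => 'u"
  and \<kappa> :: "('c, 'k, unit, ('x => 'y, 'k, ('x => 'y, 'y, 'e => 'y, unit) yuniv, 'w) yuniv) yuniv => 'u"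
 assumes K: "field K" and Cy: "cyc_mod K Cyclic Cy"
  and X: "cyc_mod K Cocyclic X" and Y: "cyc_mod K Cyclic Y"
  and \<alpha>: "\<alpha> : cmod_hom K Cyclic Cy (diag_hom K X Y)" and t: "t : cmod_hom K Cyclic Y (const_cmod K)"
  and \<gamma>: "\<gamma> : cmod_hom K Cocyclic X (dual_cmod K Cy)"
  and eq: "!!n x a. x :> comp X n ==> a :> comp Cy n ==> \<gamma> n x a = t n (\<alpha> n a x)"
  and e: "yext_ok K Cocyclic p (const_cmod K) X e" and io: "inj io" and \<kappa>: "inj \<kappa>"
 shows "yext_equiv K Cyclic p Cy (const_cmod K) `` {yext_relabel io
  (yprod Cyclic Cy (diag_hom K (dual_cmod K Cy) (const_cmod K)) (const_cmod K) (YHom (bidual_map K Cy))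
  (yprod Cyclic (diag_hom K (dual_cmod K Cy) (const_cmod K)) (diag_hom K (const_cmod K) (const_cmod K)) (const_cmod K)
  (diag_hom_ext K (const_cmod K) (dual_cmod K Cy) (const_cmod K)
  (yprod Cocyclic (const_cmod K) X (dual_cmod K Cy) e (YHom \<gamma>))) (YHom (eval_one K))))} =
  yext_equiv K Cyclic p Cy (const_cmod K) `` {yext_relabel \<kappa>
  (yprod Cyclic Cy (diag_hom K X Y) (const_cmod K) (YHom \<alpha>)
  (yprod Cyclic (diag_hom K X Y) Y (const_cmod K)
  (yprod Cyclic (diag_hom K X Y) (diag_hom K (const_cmod K) Y) Y
  (diag_hom_ext K (const_cmod K) X Y e) (YHom (eval_one K)))
  (YHom t)))}" (is "_ `` {yext_relabel io ?R2} = _ `` {yext_relabel \<kappa> ?R1}")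
proof -
 interpret K: field K by fact
 note Kc = K.is_cring
 let ?k = "const_cmod K" and ?D = "dual_cmod K Cy"
 have kc: "cyc_mod K v ?k" for v by(rule cyclic_const[OF Kc])
 note Dc = dual_cocyclic[OF Cy Kc]
 note ev = eval_one_hom[OF Kc]
 note XY = diag_hom_cyclic[OF X Y] and Xk = diag_hom_cyclic[OF X kc] and kY = diag_hom_cyclic[OF kc Y]
  and kk = diag_hom_cyclic[OF kc kc] and Dk = diag_hom_cyclic[OF Dc kc]
 note bid = bidual_map_hom[OF Kc Cy]
 \<comment> \<open>Along c the sequence of forms on e is pulled back; both \<alpha> followed by t
   and the bidual map followed by \<gamma> are this one morphism.\<close>
 define c where "c = (%n a. postcomp X t n (\<alpha> n a))"
 have ch: "c : cmod_hom K Cyclic Cy (diag_hom K X ?k)"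
  unfolding c_def by(rule cmod_hom_comp[OF \<alpha> postcomp_hom[OF X t]])
 note post = postcomp_hom[OF X t] and pre = precomp_hom[OF X Dc kc \<gamma>]
 note Q0 = diag_hom_ext_ok[OF K e kc]
 note T = push_ok[OF Q0 kc ev]
 note mT = push_map_into[OF Q0 kc ev]
 note Z = pull_ok[OF T Cy ch]
 let ?T = "yprod Cyclic (diag_hom K X ?k) (diag_hom K ?k ?k) ?k (diag_hom_ext K ?k X ?k e) (YHom (eval_one K))
  :: ('k, 'x => 'k, 'k, ('x => 'k, 'k, 'e => 'k, unit) yuniv) yext"
 let ?Z = "yprod Cyclic Cy (diag_hom K X ?k) ?k (YHom c) ?T
  :: ('k, 'c, 'k, ('c, 'k, unit, ('x => 'k, 'k, 'e => 'k, unit) yuniv) yuniv) yext"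
 have Tok: "yext_ok K Cyclic p (diag_hom K X ?k) ?k ?T" by(rule T)
 have Zok: "yext_ok K Cyclic p Cy ?k ?Z" by(rule Z)
 \<comment> \<open>Postcomposition with t maps the sequence of Y-valued maps to that of k-valued
   ones. The universal properties of the two push-outs and of the pull-back extend it step by step
   to the whole representative.\<close>
 have R1: "yext_ok K Cyclic p Cy ?k ?R1 & yext_map K Cyclic Cy ?k (%n x. x) (%n x. x) ?R1 ?Z"
 proof -
  note P0 = diag_hom_ext_ok[OF K e Y]
  note P1 = push_ok[OF P0 Y ev]
  note P2 = push_ok[OF P1 kc t]
  have "yext_ok K Cyclic p (diag_hom K X Y) ?k (yprod Cyclic (diag_hom K X Y) Y (const_cmod K)
  (yprod Cyclic (diag_hom K X Y) (diag_hom K (const_cmod K) Y) Y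
  (diag_hom_ext K (const_cmod K) X Y e) (YHom (eval_one K) :: (_, _, _, unit) yext))
  (YHom t :: (_, _, _, 'w) yext))" (is "yext_ok _ _ _ _ _ ?P2") by(rule P2)
  have m: "yext_map K Cyclic (diag_hom K X Y) (diag_hom K ?k Y) (%n x. postcomp X t n x) (%n y. eval_one K n (postcomp ?k t n y))
  (diag_hom_ext K ?k X Y e) ?T"
  by(rule yext_map_comp[OF diag_hom_ext_post[OF e t] mT P0 post postcomp_hom[OF kc t]])
  \<comment> \<open>Evaluating at one commutes with postcomposition by t, which is the factorization
    required by the push-out.\<close>
  have m1: "yext_map K Cyclic (diag_hom K X Y) Y (%n x. postcomp X t n x) t
  (yprod Cyclic (diag_hom K X Y) (diag_hom K ?k Y) Y (diag_hom_ext K ?k X Y e) (YHom (eval_one K) :: (_, _, _, unit) yext)) ?T"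
  by(rule push_map_out[OF P0 Tok m Y ev t]) (simp add: eval_one_def postcomp_def)
  have m2: "yext_map K Cyclic (diag_hom K X Y) ?k (%n x. postcomp X t n x) (%n x. x) ?P2 ?T"
  by(rule push_map_out[OF P1 Tok m1 kc t cmod_hom_id]) simp
  have ok: "yext_ok K Cyclic p Cy ?k ?R1" by(rule pull_ok[OF P2 Cy \<alpha>])
  have "yext_map K Cyclic Cy ?k (%n x. postcomp X t n (\<alpha> n x)) (%n x. x) ?R1 ?T"
  by(rule yext_map_comp[OF pull_map_out[OF P2 Cy \<alpha>] m2 ok \<alpha> cmod_hom_id])
  hence "yext_map K Cyclic Cy ?k (%n x. x) (%n x. x) ?R1 ?Z"
  by(rule pull_map_into[OF Tok Cy ch ok _ cmod_hom_id _ cmod_hom_id]) (simp add: c_def)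
  with ok show ?thesis by blast
 qed
 \<comment> \<open>Here the source is the canonical map from e to its push-out along \<gamma>.
   Taking k-valued forms reverses it, so the representative maps towards forms on e.\<close>
 have R2: "yext_ok K Cyclic p Cy ?k ?R2 & yext_map K Cyclic Cy ?k (%n x. x) (%n x. x) ?R2 ?Z"
 proof -
  note e1 = push_ok[OF e Dc \<gamma>]
  note P0 = diag_hom_ext_ok[OF K e1 kc]
  note P1 = push_ok[OF P0 kc ev]
  let ?P0 = "diag_hom_ext K ?k ?D ?k (yprod Cocyclic ?k X ?D e (YHom \<gamma> :: ('k, 'x, 'c => 'k, unit) yext))"
  let ?P1 = "yprod Cyclic (diag_hom K ?D ?k) (diag_hom K ?k ?k) ?k ?P0 (YHom (eval_one K) :: (_, _, _, unit) yext)"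
  have m: "yext_map K Cyclic (diag_hom K ?D ?k) (diag_hom K ?k ?k) (precomp X \<gamma>) (precomp ?k (%n x. x)) ?P0 (diag_hom_ext K ?k X ?k e)"
  by(rule diag_hom_ext_pre[OF e e1 push_map_into[OF e Dc \<gamma>] kc cmod_hom_id \<gamma>])
  have m': "yext_map K Cyclic (diag_hom K ?D ?k) (diag_hom K ?k ?k) (%n x. precomp X \<gamma> n x)
  (%n y. eval_one K n (precomp ?k (%n x. x) n y)) ?P0 ?T"
  by(rule yext_map_comp[OF m mT P0 pre precomp_hom[OF kc kc kc cmod_hom_id]])
  have m1: "yext_map K Cyclic (diag_hom K ?D ?k) ?k (%n x. precomp X \<gamma> n x) (%n x. x) ?P1 ?T"
  by(rule push_map_out[OF P0 Tok m' kc ev cmod_hom_id]) (simp add: eval_one_def precomp_def)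
  have ok: "yext_ok K Cyclic p Cy ?k ?R2" by(rule pull_ok[OF P1 Cy bid])
  have "yext_map K Cyclic Cy ?k (%n x. precomp X \<gamma> n (bidual_map K Cy n x)) (%n x. x) ?R2 ?T"
  by(rule yext_map_comp[OF pull_map_out[OF P1 Cy bid] m1 ok bid cmod_hom_id])
  hence "yext_map K Cyclic Cy ?k (%n x. x) (%n x. x) ?R2 ?Z"
  proof(rule pull_map_into[OF Tok Cy ch ok _ cmod_hom_id _ cmod_hom_id])
  fix n a assume a: "a :> comp Cy n"
  show "c n a = precomp X \<gamma> n (bidual_map K Cy n a)"
  using a eq cmod_closed[OF \<gamma>] by(auto simp: c_def precomp_def postcomp_def bidual_map_def intro!: restrict_ext)
  qed
  with ok show ?thesis by blast
 qed
 \<comment> \<open>About the type \<open>'u\<close> it is known only that \<open>io\<close> and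
   \<kappa> inject into it. Via \<open>embed_pull\<close> the labels of \<open>?Z\<close> first
   enter the domain of \<open>io\<close>.\<close>
 define J where "J = (%x :: ('c, 'k, unit, ('x => 'k, 'k, 'e => 'k, unit) yuniv) yuniv. io (embed_pull x))"
 have "inj_on J (yext_univ ?Z)"
 proof(rule inj_onI)
  fix x y assume *: "x : yext_univ ?Z" "y : yext_univ ?Z" "J x = J y"
  show "x = y"
  by(rule inj_onD[OF inj_embed_pull[OF push_univ refl] injD[OF io *(3)[unfolded J_def]] *(1,2)])
 qed
 hence r: "inv_into (yext_univ ?Z) J (J x) = x" if "x : yext_univ ?Z" for x using that by simp
 note Zr = yext_rel[where io=J and r="inv_into (yext_univ ?Z) J", OF Zok r]
 have rio: "inv_into UNIV io (io x) = x" and r\<kappa>: "inv_into UNIV \<kappa> (\<kappa> y) = y" for x y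
  using io \<kappa> by simp_all
 have id: "(%n x. x) : cmod_hom K Cyclic U U" for U :: "('k, 'q) cmod" by(rule cmod_hom_id)
 \<comment> \<open>Undo the relabelling by l, go to \<open>?Z\<close>, and relabel by J: a map of
   sequences within the universe \<open>'u\<close>.\<close>
 have step: "yext_ok K Cyclic p Cy ?k (yext_rel l (inv_into UNIV l) s) \<and>
  yext_step K Cyclic Cy ?k (yext_rel l (inv_into UNIV l) s) (yext_rel J (inv_into (yext_univ ?Z) J) ?Z)"
  if l: "inj l" and s: "yext_ok K Cyclic p Cy ?k s & yext_map K Cyclic Cy ?k (%n x. x) (%n x. x) s ?Z"
  for l :: "'f => 'u" and s
 proof -
  have rl: "inv_into UNIV l (l x) = x" for x using l by simp
  note S = yext_rel[where io=l and r="inv_into UNIV l", OF conjunct1[OF s] rl]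
  from yext_map_comp[OF S(3) conjunct2[OF s] S(1) id id]
  have "yext_map K Cyclic Cy ?k (%n x. x) (%n x. x) (yext_rel l (inv_into UNIV l) s) ?Z" .
  from yext_map_comp[OF this Zr(2) S(1) id id]
  have "yext_map K Cyclic Cy ?k (%n x. x) (%n x. x) (yext_rel l (inv_into UNIV l) s) (yext_rel J (inv_into (yext_univ ?Z) J) ?Z)" .
  thus ?thesis using S(1) yext_map_step by blast
 qed
 show ?thesis unfolding yext_relabel_eq
  by(rule yext_equiv_common[OF conjunct1[OF step[OF io R2]] conjunct1[OF step[OF \<kappa> R1]] Zr(1)
  conjunct2[OF step[OF io R2]] conjunct2[OF step[OF \<kappa> R1]]])
qed

subsection \<open>The classical cyclic module\<close>

lemma mlin_insert:
 assumes "j <= m" "mlin K (Suc m) A U T" "c :> A"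
 shows "mlin K m A U (%as. T (take j as @ [c] @ drop j as))" using assms(1,2)
proof(induction j arbitrary: m T)
 case 0
 thus ?case using mlin_tail[OF _ assms(3)] by simp
next
 case (Suc j)
 then obtain m' where m: "m = Suc m'" by(cases m) auto
 show ?case unfolding m
 proof(rule mlin_ConsI)
  show "mlin K m' A U (%vs. T (take (Suc j) (v # vs) @ [c] @ drop (Suc j) (v # vs)))" if "v :> A" for v
  using Suc.IH[of m' "%vs. T (v # vs)"] mlin_tail[OF Suc.prems(2)[unfolded m] that] Suc.prems(1) m by simp
  show "(%v. T (take (Suc j) (v # vs) @ [c] @ drop (Suc j) (v # vs))) : lin K A U"
  if "length vs = m'" "vs :>* A" for vs
  proof -
  have "(take j vs @ [c] @ drop j vs) :>* A"
  using that(2) assms(3) set_take_subset[of j vs] set_drop_subset[of j vs] by auto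
  from mlin_head[OF Suc.prems(2)[unfolded m] _ this] show ?thesis
  using that(1) Suc.prems(1) m by simp
  qed
 qed
qed

locale algebra_over = tensor K A A for K :: "'k ring" and A :: "('k, 'a) module" +
 assumes ring_A: "ring A" and mult_bilin: "monoid.mult A : bilin K A A A"
begin

sublocale A: ring A by(rule ring_A)

lemma mult_lin: "a :> A ==> (%b. a **[A] b) : lin K A A" "b :> A ==> (%a. a **[A] b) : lin K A A"
 using mult_bilin unfolding bilin_maps_def by auto

lemma mlin_mult:
 assumes "j < m" "mlin K m A U T"
 shows "mlin K (Suc m) A U (%as. T (take j as @ [as ! j **[A] as ! Suc j] @ drop (j + 2) as))"
 using assms
proof(induction j arbitrary: m T)
 case 0
 then obtain m' where m: "m = Suc m'" by(cases m) auto
 note T = 0(2)[unfolded m]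
 show ?case unfolding m
 proof(rule mlin_ConsI)
  fix a assume a: "a :> A"
  show "mlin K (Suc m') A U (%vs. T (take 0 (a # vs) @ [(a # vs) ! 0 **[A] (a # vs) ! Suc 0] @ drop (0 + 2) (a # vs)))"
  proof(rule mlin_ConsI)
  show "mlin K m' A U (%vs. T (take 0 (a # v # vs) @ [(a # v # vs) ! 0 **[A] (a # v # vs) ! Suc 0] @ drop (0 + 2) (a # v # vs)))"
  if "v :> A" for v using mlin_tail[OF T, of "a **[A] v"] a that by simp
  show "(%v. T (take 0 (a # v # vs) @ [(a # v # vs) ! 0 **[A] (a # v # vs) ! Suc 0] @ drop (0 + 2) (a # v # vs))) : lin K A U"
  if "length vs = m'" "vs :>* A" for vs
  using lin_comp[OF mult_lin(1)[OF a] mlin_head[OF T that]] by simp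
  qed
 next
  fix vs assume vs: "length vs = Suc m'" "vs :>* A"
  then obtain b r where r: "vs = b # r" "b :> A" "length r = m'" "r :>* A" by(cases vs) auto
  show "(%v. T (take 0 (v # vs) @ [(v # vs) ! 0 **[A] (v # vs) ! Suc 0] @ drop (0 + 2) (v # vs))) : lin K A U"
  using lin_comp[OF mult_lin(2)[OF r(2)] mlin_head[OF T r(3,4)]] r(1) by simp
 qed
next
 case (Suc j)
 then obtain m' where m: "m = Suc m'" by(cases m) auto
 note T = Suc.prems(2)[unfolded m]
 show ?case unfolding m
 proof(rule mlin_ConsI)
  show "mlin K (Suc m') A U (%vs. T (take (Suc j) (v # vs) @ [(v # vs) ! Suc j **[A] (v # vs) ! Suc (Suc j)] @ drop (Suc j + 2) (v # vs)))"
  if "v :> A" for v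
  using Suc.IH[of m' "%vs. T (v # vs)"] mlin_tail[OF T that] Suc.prems(1) m by simp
  show "(%v. T (take (Suc j) (v # vs) @ [(v # vs) ! Suc j **[A] (v # vs) ! Suc (Suc j)] @ drop (Suc j + 2) (v # vs))) : lin K A U"
  if "length vs = Suc m'" "vs :>* A" for vs
  proof -
  have "vs ! j :> A" "vs ! Suc j :> A"
  using that Suc.prems(1) m by(auto intro!: subsetD[OF that(2)])
  hence "(take j vs @ [vs ! j **[A] vs ! Suc j] @ drop (j + 2) vs) :>* A"
  using that(2) set_take_subset[of j vs] set_drop_subset[of "j + 2" vs] by auto
  from mlin_head[OF T _ this] show ?thesis using that(1) Suc.prems(1) m by simp
  qed
 qed
qed

lemma mlin_mult_last:
 assumes "mlin K (Suc m) A U T"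
 shows "mlin K (Suc (Suc m)) A U (%as. T ((last as **[A] hd as) # tl (butlast as)))"
proof(rule mlin_ConsI)
 fix a assume a: "a :> A"
 show "mlin K (Suc m) A U (%vs. T ((last (a # vs) **[A] hd (a # vs)) # tl (butlast (a # vs))))"
 proof(rule mlin_snocI)
  show "mlin K m A U (%vs. T ((last (a # vs @ [v]) **[A] hd (a # vs @ [v])) # tl (butlast (a # vs @ [v]))))"
  if "v :> A" for v using mlin_tail[OF assms, of "v **[A] a"] that a by simp
  show "(%v. T ((last (a # vs @ [v]) **[A] hd (a # vs @ [v])) # tl (butlast (a # vs @ [v])))) : lin K A U"
  if "length vs = m" "vs :>* A" for vs
  using lin_comp[OF mult_lin(2)[OF a] mlin_head[OF assms that]] by simp
 qed
next
 fix vs assume vs: "length vs = Suc m" "vs :>* A"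
 then obtain z r where r: "vs = r @ [z]" "z :> A" "length r = m" "r :>* A" by(cases vs rule: rev_cases) auto
 show "(%v. T ((last (v # vs) **[A] hd (v # vs)) # tl (butlast (v # vs)))) : lin K A U"
  using lin_comp[OF mult_lin(1)[OF r(2)] mlin_head[OF assms r(3,4)]] r(1) by simp
qed

lemma mlin_rot:
 assumes "mlin K (Suc m) A U T"
 shows "mlin K (Suc m) A U (%as. T (last as # butlast as))"
proof(rule mlin_snocI)
 show "mlin K m A U (%vs. T (last (vs @ [v]) # butlast (vs @ [v])))" if "v :> A" for v
  using mlin_tail[OF assms that] by simp
 show "(%v. T (last (vs @ [v]) # butlast (vs @ [v]))) : lin K A U" if "length vs = m" "vs :>* A" for vs
  using mlin_head[OF assms that] by simp
qed

lemma tprod_list_mlin: "mlin K (Suc n) A (tens K n A A) (tprod_list K A)"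
 unfolding mlin2_snoc_iff[symmetric] tprod_list_def butlast_snoc last_snoc by(rule tprod_mlin2)

lemma tlift_list_lin:
 assumes "module K U" "mlin K (Suc n) A U f"
 shows "tlift_list K U f : lin K (tens K n A A) U"
 unfolding tlift_list_def by(rule tlift_lin[OF assms(1)]) (simp add: mlin2_snoc_iff assms(2))

lemma tlift_list_tprod:
 assumes "module K U" "mlin K (Suc n) A U f" "length as = Suc n" "as :>* A"
 shows "tlift_list K U f (tprod_list K A as) = f as"
proof -
 have "as = butlast as @ [last as]" using assms(3) by(cases as rule: rev_cases) auto
 moreover have "(butlast as) :>* A" "last as :> A"
  using assms(3,4) by(auto dest: in_set_butlastD) (metis last_in_set list.size(3) nat.distinct(1) subsetD)
 ultimately show ?thesis unfolding tlift_list_def tprod_list_def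
  using assms by(subst tlift_tprod[OF assms(1)]) (simp_all add: mlin2_snoc_iff)
qed

lemma tens_list_ext:
 assumes U: "module K U" and F: "F : lin K (tens K n A A) U" and G: "G : lin K (tens K n A A) U"
  and eq: "!!as. length as = Suc n ==> as :>* A ==> F (tprod_list K A as) = G (tprod_list K A as)"
  and t: "t :> tens K n A A"
 shows "F t = G t"
proof(rule tens_ext[OF U F G _ t])
 fix vs w assume "length vs = n" "vs :>* A" "w :> A"
 thus "F (tprod K A A vs w) = G (tprod K A A vs w)" using eq[of "vs @ [w]"] by(simp add: tprod_list_def)
qed

lemma tprod_list_closed: "length as = Suc n ==> as :>* A ==> tprod_list K A as :> tens K n A A"
 by(rule mlin_closed[OF tprod_list_mlin])

text \<open>The operators of \<open>Cyc\<close> on pure tensors are operations on lists. The cyclic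
  relations can then be checked entry by entry instead of in a tensor product.\<close>

definition face_list :: "nat => nat => 'a list => 'a list" where
 "face_list n j as = (if j < n then take j as @ [as ! j **[A] as ! Suc j] @ drop (j + 2) as
  else (last as **[A] hd as) # tl (butlast as))"

definition degen_list :: "nat => 'a list => 'a list" where
 "degen_list j as = take (Suc j) as @ [1[A]] @ drop (Suc j) as"

definition rot_list :: "'a list => 'a list" where
 "rot_list as = last as # butlast as"

lemma Cyc_sel:
 "comp (Cyc K A) n = tens K n A A"
 "face (Cyc K A) n j = tlift_list K (tens K (n - 1) A A) (%as. tprod_list K A (face_list n j as))"
 "degen (Cyc K A) n j = tlift_list K (tens K (Suc n) A A) (%as. tprod_list K A (degen_list j as))"
 "cyc (Cyc K A) n = tlift_list K (tens K n A A) (%as. tprod_list K A (rot_list as))"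
 by(simp_all add: Cyc_def face_list_def degen_list_def rot_list_def if_distrib)

lemma face_list_nth:
 assumes "length as = Suc n" "1 <= n" "j <= n"
 shows "length (face_list n j as) = n"
  and "k < n ==> face_list n j as ! k = (if j < n then (if k < j then as ! k else if k = j then as ! j **[A] as ! Suc j else as ! Suc k)
  else (if k = 0 then as ! n **[A] as ! 0 else as ! k))"
proof -
 show "length (face_list n j as) = n" using assms by(auto simp: face_list_def)
 have ne: "as ~= []" using assms by auto
 show "face_list n j as ! k = (if j < n then (if k < j then as ! k else if k = j then as ! j **[A] as ! Suc j else as ! Suc k)
  else (if k = 0 then as ! n **[A] as ! 0 else as ! k))" if "k < n"
 proof(cases "j < n")
  case True
  thus ?thesis using assms that by(auto simp: face_list_def nth_append min_def nth_Cons')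
 next
  case False
  thus ?thesis using assms that ne
  by(cases k) (auto simp: face_list_def last_conv_nth hd_conv_nth nth_tl nth_butlast)
 qed
qed

lemma degen_list_nth:
 assumes "length as = Suc n" "j <= n"
 shows "length (degen_list j as) = Suc (Suc n)"
  and "k < Suc (Suc n) ==> degen_list j as ! k = (if k <= j then as ! k else if k = Suc j then 1[A] else as ! (k - 1))"
proof -
 show "length (degen_list j as) = Suc (Suc n)" using assms by(simp add: degen_list_def)
 show "degen_list j as ! k = (if k <= j then as ! k else if k = Suc j then 1[A] else as ! (k - 1))" if "k < Suc (Suc n)"
 proof(cases "Suc j < k")
  case True
  hence "Suc (j + (k - Suc (Suc j))) = k - 1" by simp
  thus ?thesis using assms that True by(auto simp: degen_list_def nth_append min_def nth_Cons')
 next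
  case False
  thus ?thesis using assms that by(auto simp: degen_list_def nth_append min_def nth_Cons')
 qed
qed

lemma rot_list_nth:
 assumes "length as = Suc n"
 shows "length (rot_list as) = Suc n"
  and "k < Suc n ==> rot_list as ! k = (if k = 0 then as ! n else as ! (k - 1))"
proof -
 have ne: "as ~= []" using assms by auto
 show "length (rot_list as) = Suc n" "k < Suc n ==> rot_list as ! k = (if k = 0 then as ! n else as ! (k - 1))"
  using assms ne by(auto simp: rot_list_def last_conv_nth nth_butlast nth_Cons')
qed

lemma list_set_nth: "length as = m ==> (!!k. k < m ==> as ! k : S) ==> set as <= S"
 by(auto simp: in_set_conv_nth)

lemma face_list_set:
 assumes "length as = Suc n" "1 <= n" "j <= n" "as :>* A"
 shows "(face_list n j as) :>* A"
proof(rule list_set_nth[OF face_list_nth(1)[OF assms(1-3)]])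
 fix k assume "k < n"
 moreover have "as ! i :> A" if "i <= n" for i using assms(1,4) that by(auto intro!: subsetD[OF assms(4)])
 ultimately show "face_list n j as ! k :> A" using assms(2,3) by(simp add: face_list_nth(2)[OF assms(1-3)])
qed

lemma degen_list_set: "as :>* A ==> (degen_list j as) :>* A"
 using set_take_subset[of "Suc j" as] set_drop_subset[of "Suc j" as] by(auto simp: degen_list_def)

lemma rot_list_set: "as :>* A ==> as ~= [] ==> (rot_list as) :>* A"
 by(auto simp: rot_list_def dest: in_set_butlastD)

lemma rot_list_funpow: "length as = Suc n ==> (rot_list ^^ Suc n) as = as"
proof -
 assume l: "length as = Suc n"
 \<comment> \<open>Reversal conjugates this rotation into the library's \<open>rotate1\<close>, for
   which the period is known.\<close>
 have r: "rot_list xs = rev (rotate1 (rev xs))" if "xs ~= []" for xs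
  using that by(cases xs rule: rev_cases) (simp_all add: rot_list_def)
 have pow: "(rot_list ^^ k) as = rev (rotate k (rev as))" for k
 proof(induction k)
  case (Suc k)
  have "rev (rotate k (rev as)) ~= []" using l by auto
  thus ?case using Suc r by simp
 qed simp
 have "rotate (Suc n) (rev as) = rev as" by(rule rotate_id) (simp add: l)
 thus ?thesis using pow[of "Suc n"] by(simp only: rev_rev_ident)
qed

lemma face_mlin: "1 <= n ==> j <= n ==> mlin K (Suc n) A (tens K (n - 1) A A) (%as. tprod_list K A (face_list n j as))"
proof(cases n)
 case (Suc m)
 assume j: "j <= n"
 show ?thesis
 proof(cases "j < n")
  case True
  thus ?thesis using mlin_mult[OF _ tprod_list_mlin[of m], of j] Suc by(simp add: face_list_def)
 next
  case False
  thus ?thesis using mlin_mult_last[OF tprod_list_mlin[of m]] Suc by(simp add: face_list_def)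
 qed
qed simp

lemma degen_mlin: "j <= n ==> mlin K (Suc n) A (tens K (Suc n) A A) (%as. tprod_list K A (degen_list j as))"
 unfolding degen_list_def by(rule mlin_insert[OF _ tprod_list_mlin]) simp_all

lemma rot_mlin: "mlin K (Suc n) A (tens K n A A) (%as. tprod_list K A (rot_list as))"
 unfolding rot_list_def by(rule mlin_rot[OF tprod_list_mlin])

lemma Cyc_face_lin: "1 <= n ==> j <= n ==> face (Cyc K A) n j : lin K (tens K n A A) (tens K (n - 1) A A)"
 unfolding Cyc_sel by(rule tlift_list_lin[OF mtens face_mlin])

lemma Cyc_degen_lin: "j <= n ==> degen (Cyc K A) n j : lin K (tens K n A A) (tens K (Suc n) A A)"
 unfolding Cyc_sel by(rule tlift_list_lin[OF mtens degen_mlin])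

lemma Cyc_cyc_lin: "cyc (Cyc K A) n : lin K (tens K n A A) (tens K n A A)"
 unfolding Cyc_sel by(rule tlift_list_lin[OF mtens rot_mlin])

lemma Cyc_tprod:
 assumes "length as = Suc n" "as :>* A"
 shows "1 <= n ==> j <= n ==> face (Cyc K A) n j (tprod_list K A as) = tprod_list K A (face_list n j as)"
  and "j <= n ==> degen (Cyc K A) n j (tprod_list K A as) = tprod_list K A (degen_list j as)"
  and "cyc (Cyc K A) n (tprod_list K A as) = tprod_list K A (rot_list as)" unfolding Cyc_sel
 by(rule tlift_list_tprod[OF mtens face_mlin assms], assumption+)
  (rule tlift_list_tprod[OF mtens degen_mlin assms], assumption,
  rule tlift_list_tprod[OF mtens rot_mlin assms])

text \<open>Both sides of each relation are linear, so they are compared on pure tensors and there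
  as lists. The ring axioms enter only through entries where multiplications overlap or meet the
  inserted unit.\<close>

lemma Cyc_cyclic: "cyc_mod K Cyclic (Cyc K A)"
proof(rule cyclicI)
 show "module K (comp (Cyc K A) n)" for n unfolding Cyc_sel by(rule mtens)
 show "face (Cyc K A) n j : lin K (comp (Cyc K A) n) (comp (Cyc K A) (face_deg Cyclic n))" if "face_ok Cyclic n j" for n j
  using Cyc_face_lin that by(simp add: Cyc_sel(1))
 show "degen (Cyc K A) n j : lin K (comp (Cyc K A) n) (comp (Cyc K A) (degen_deg Cyclic n))" if "degen_ok Cyclic n j" for n j
  using Cyc_degen_lin that by(simp add: Cyc_sel(1))
 show "cyc (Cyc K A) n : lin K (comp (Cyc K A) n) (comp (Cyc K A) n)" for n
  using Cyc_cyc_lin by(simp add: Cyc_sel(1))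
 have ext: "F t = G t" if "F : lin K (tens K n A A) (tens K m A A)" "G : lin K (tens K n A A) (tens K m A A)"
  "!!as. length as = Suc n ==> as :>* A ==> F (tprod_list K A as) = G (tprod_list K A as)"
  "t :> comp (Cyc K A) n" for F G n m t
  by(rule tens_list_ext[OF mtens that(1-3)]) (use that(4) in \<open>simp_all add: Cyc_sel(1)\<close>)
 note len = face_list_nth(1) degen_list_nth(1) rot_list_nth(1)
 note st = face_list_set degen_list_set rot_list_set
 have ne: "as ~= []" if "length as = Suc n" for as :: "'a list" and n using that by auto
 have nc: "as ! i :> A" if "as :>* A" "i < length as" for as i using that by(auto intro!: subsetD[OF that(1)])
 note F = Cyc_face_lin and D = Cyc_degen_lin and T = Cyc_cyc_lin
 show "cyclic_relations Cyclic (Cyc K A)"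
 proof(rule cyclic_relI)
  fix n i j x assume x: "x :> comp (Cyc K A) n"
  { assume n: "2 <= n" "i < j" "j <= n"
  then obtain m where m: "n = Suc (Suc m)" by(cases n; cases "n - 1") auto
  have l: "face_list (Suc m) i (face_list n j as) = face_list (Suc m) (j - 1) (face_list n i as)"
  if as: "length as = Suc n" "as :>* A" for as
  proof -
  \<comment> \<open>Adjacent faces multiply three consecutive entries; in the second case the last
    face is involved, whose product wraps around the end of the list. Separating these patterns lets
    the index arithmetic simplify.\<close>
  consider "j = Suc i" "i < Suc m" | "j = Suc i" "i = Suc m" | "Suc i < j" using n m by linarith
  thus ?thesis
  proof cases
  case 1 thus ?thesis using n as m by(intro nth_equalityI) (auto simp: face_list_nth nc A.m_assoc)
  next
  case 2 thus ?thesis using n as m by(intro nth_equalityI) (auto simp: face_list_nth nc A.m_assoc)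
  next
  case 3 thus ?thesis using n as m by(intro nth_equalityI) (auto simp: face_list_nth nc A.m_assoc)
  qed
  qed
  have "face (Cyc K A) (Suc m) i (face (Cyc K A) n j x) = face (Cyc K A) (Suc m) (j - 1) (face (Cyc K A) n i x)"
  proof -
  have *: "face (Cyc K A) n j : lin K (tens K n A A) (tens K (Suc m) A A)"
  "face (Cyc K A) (Suc m) i : lin K (tens K (Suc m) A A) (tens K m A A)"
  "face (Cyc K A) n i : lin K (tens K n A A) (tens K (Suc m) A A)"
  "face (Cyc K A) (Suc m) (j - 1) : lin K (tens K (Suc m) A A) (tens K m A A)"
  using n m F[of n j] F[of n i] F[of "Suc m" i] F[of "Suc m" "j - 1"] by simp_all
  show ?thesis by(rule ext[OF lin_comp[OF *(1,2)] lin_comp[OF *(3,4)] _ x])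
  (use n m in \<open>simp add: Cyc_tprod l[unfolded m] l[unfolded m One_nat_def] len st\<close>)
  qed
  thus "face (Cyc K A) (n - 1) i (face (Cyc K A) n j x) = face (Cyc K A) (n - 1) (j - 1) (face (Cyc K A) n i x)"
  using m by simp }
  { assume n: "i <= j" "j <= n"
  have l: "degen_list i (degen_list j as) = degen_list (Suc j) (degen_list i as)" if as: "length as = Suc n" for as
  using n as by(intro nth_equalityI) (auto simp: degen_list_nth)
  show "degen (Cyc K A) (Suc n) i (degen (Cyc K A) n j x) = degen (Cyc K A) (Suc n) (Suc j) (degen (Cyc K A) n i x)"
  using n by(intro ext[OF lin_comp[OF D[of j n] D[of i "Suc n"]] lin_comp[OF D[of i n] D[of "Suc j" "Suc n"]] _ x]) (simp_all add: Cyc_tprod l len st) }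
  { assume n: "j <= n" "i < j"
  then obtain m where m: "n = Suc m" by(cases n) auto
  have l: "face_list (Suc n) i (degen_list j as) = degen_list (j - 1) (face_list n i as)" if as: "length as = Suc n" for as
  using n as m by(intro nth_equalityI) (auto simp: degen_list_nth face_list_nth)
  have "face (Cyc K A) (Suc n) i (degen (Cyc K A) n j x) = degen (Cyc K A) m (j - 1) (face (Cyc K A) n i x)"
  proof -
  have *: "degen (Cyc K A) n j : lin K (tens K n A A) (tens K (Suc n) A A)"
  "face (Cyc K A) (Suc n) i : lin K (tens K (Suc n) A A) (tens K n A A)"
  "face (Cyc K A) n i : lin K (tens K n A A) (tens K m A A)"
  "degen (Cyc K A) m (j - 1) : lin K (tens K m A A) (tens K n A A)"
  using n m F[of "Suc n" i] D[of j n] F[of n i] D[of "j - 1" m] by simp_all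
  show ?thesis by(rule ext[OF lin_comp[OF *(1,2)] lin_comp[OF *(3,4)] _ x])
  (use n m in \<open>simp add: Cyc_tprod l[unfolded m] l[unfolded m One_nat_def] len st\<close>)
  qed
  thus "face (Cyc K A) (Suc n) i (degen (Cyc K A) n j x) = degen (Cyc K A) (n - 1) (j - 1) (face (Cyc K A) n i x)"
  using m by simp }
  { assume n: "j <= n" "i = j \<or> i = Suc j"
  have l: "face_list (Suc n) i (degen_list j as) = as" if as: "length as = Suc n" "as :>* A" for as
  using n as by(intro nth_equalityI) (auto simp: degen_list_nth face_list_nth nc less_Suc_eq_le not_less)
  show "face (Cyc K A) (Suc n) i (degen (Cyc K A) n j x) = x"
  proof -
  have *: "degen (Cyc K A) n j : lin K (tens K n A A) (tens K (Suc n) A A)"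
  "face (Cyc K A) (Suc n) i : lin K (tens K (Suc n) A A) (tens K n A A)"
  using n F[of "Suc n" i] D[of j n] by auto
  have "i <= Suc n" using n by auto
  thus ?thesis
  by(intro ext[OF lin_comp[OF *] lin_id _ x]) (use n in \<open>simp add: Cyc_tprod l len st\<close>)
  qed }
  { assume n: "j <= n" "i <= Suc n" "Suc j < i"
  then obtain m where m: "n = Suc m" by(cases n) auto
  have l: "face_list (Suc n) i (degen_list j as) = degen_list j (face_list n (i - 1) as)" if as: "length as = Suc n" for as
  using n as m by(intro nth_equalityI) (auto simp: degen_list_nth face_list_nth)
  have "face (Cyc K A) (Suc n) i (degen (Cyc K A) n j x) = degen (Cyc K A) m j (face (Cyc K A) n (i - 1) x)"
  proof -
  have *: "degen (Cyc K A) n j : lin K (tens K n A A) (tens K (Suc n) A A)"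
  "face (Cyc K A) (Suc n) i : lin K (tens K (Suc n) A A) (tens K n A A)"
  "face (Cyc K A) n (i - 1) : lin K (tens K n A A) (tens K m A A)"
  "degen (Cyc K A) m j : lin K (tens K m A A) (tens K n A A)"
  using n m F[of "Suc n" i] D[of j n] F[of n "i - 1"] D[of j m] by simp_all
  show ?thesis by(rule ext[OF lin_comp[OF *(1,2)] lin_comp[OF *(3,4)] _ x])
  (use n m in \<open>simp add: Cyc_tprod l[unfolded m] l[unfolded m One_nat_def] len st\<close>)
  qed
  thus "face (Cyc K A) (Suc n) i (degen (Cyc K A) n j x) = degen (Cyc K A) (n - 1) j (face (Cyc K A) n (i - 1) x)"
  using m by simp }
  { assume n: "1 <= i" "i <= n"
  then obtain m where m: "n = Suc m" by(cases n) auto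
  have l: "face_list n i (rot_list as) = rot_list (face_list n (i - 1) as)" if as: "length as = Suc n" for as
  using n as m by(intro nth_equalityI) (auto simp: rot_list_nth face_list_nth)
  have "face (Cyc K A) n i (cyc (Cyc K A) n x) = cyc (Cyc K A) m (face (Cyc K A) n (i - 1) x)"
  proof -
  have *: "face (Cyc K A) n i : lin K (tens K n A A) (tens K m A A)"
  "face (Cyc K A) n (i - 1) : lin K (tens K n A A) (tens K m A A)"
  using n m F[of n i] F[of n "i - 1"] by simp_all
  show ?thesis by(rule ext[OF lin_comp[OF T *(1)] lin_comp[OF *(2) T] _ x])
  (use n m in \<open>simp add: Cyc_tprod l[unfolded m] l[unfolded m One_nat_def] len st ne\<close>)
  qed
  thus "face (Cyc K A) n i (cyc (Cyc K A) n x) = cyc (Cyc K A) (n - 1) (face (Cyc K A) n (i - 1) x)"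
  using m by simp }
  { assume n: "1 <= n"
  have l: "face_list n 0 (rot_list as) = face_list n n as" if as: "length as = Suc n" for as
  using n as by(intro nth_equalityI) (auto simp: rot_list_nth face_list_nth)
  show "face (Cyc K A) n 0 (cyc (Cyc K A) n x) = face (Cyc K A) n n x"
  using n by(intro ext[OF lin_comp[OF T F[of n 0]] F[of n n] _ x]) (simp_all add: Cyc_tprod l len st ne) }
  { assume n: "1 <= i" "i <= n"
  have l: "degen_list i (rot_list as) = rot_list (degen_list (i - 1) as)" if as: "length as = Suc n" for as
  using n as by(intro nth_equalityI) (auto simp: rot_list_nth degen_list_nth)
  show "degen (Cyc K A) n i (cyc (Cyc K A) n x) = cyc (Cyc K A) (Suc n) (degen (Cyc K A) n (i - 1) x)"
  using n by(intro ext[OF lin_comp[OF T D[of i n]] lin_comp[OF D[of "i - 1" n] T] _ x]) (simp_all add: Cyc_tprod l len st ne) }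
  { have l: "degen_list 0 (rot_list as) = rot_list (rot_list (degen_list n as))" if as: "length as = Suc n" for as
  using as by(intro nth_equalityI) (auto simp: rot_list_nth degen_list_nth)
  have ned: "degen_list n as ~= []" "rot_list as ~= []" for as by(simp_all add: degen_list_def rot_list_def)
  show "degen (Cyc K A) n 0 (cyc (Cyc K A) n x) = cyc (Cyc K A) (Suc n) (cyc (Cyc K A) (Suc n) (degen (Cyc K A) n n x))"
  by(intro ext[OF lin_comp[OF T D[of 0 n]] lin_comp[OF lin_comp[OF D[of n n] T] T] _ x]) (simp_all add: Cyc_tprod l len st ne ned) }
  { have p: "(cyc (Cyc K A) n ^^ k) (tprod_list K A as) = tprod_list K A ((rot_list ^^ k) as) \<and>
  length ((rot_list ^^ k) as) = Suc n & ((rot_list ^^ k) as) :>* A"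
  if as: "length as = Suc n" "as :>* A" for as k
  proof(induction k)
  case (Suc k)
  thus ?case using rot_list_set[OF _ ne, of "(rot_list ^^ k) as" n] by(simp add: Cyc_tprod(3) rot_list_nth(1))
  qed (simp add: as)
  have lin: "(cyc (Cyc K A) n ^^ k) : lin K (tens K n A A) (tens K n A A)" for k
  proof(induction k)
  case 0
  thus ?case using lin_id by(simp add: id_def)
  next
  case (Suc k)
  thus ?case using lin_comp[OF Suc T] by(simp add: comp_def)
  qed
  show "(cyc (Cyc K A) n ^^ Suc n) x = x"
  proof(rule ext[OF lin lin_id _ x])
  fix as :: "'a list" assume as: "length as = Suc n" "as :>* A"
  show "(cyc (Cyc K A) n ^^ Suc n) (tprod_list K A as) = tprod_list K A as"
  using p[OF as, of "Suc n"] unfolding rot_list_funpow[OF as(1)] by(rule conjunct1)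
  qed }
 qed
qed

end

subsection \<open>Sweedler calculus\<close>

lemma bilinI:
 assumes "!!u. u :> U ==> b u : lin K V W" "!!v. v :> V ==> (%u. b u v) : lin K U W"
 shows "b : bilin K U V W" using assms unfolding bilin_maps_def by simp

lemma bilin_right: "b : bilin K U V W ==> u :> U ==> b u : lin K V W"
 and bilin_left: "b : bilin K U V W ==> v :> V ==> (%u. b u v) : lin K U W"
 unfolding bilin_maps_def by simp_all

lemma bilin_closed: "b : bilin K U V W ==> u :> U ==> v :> V ==> b u v :> W"
 by(rule lin_cl[OF bilin_right])

lemma bilin_comp: "b : bilin K U V W ==> F : lin K W W' ==> (%u v. F (b u v)) : bilin K U V W'"
 by(rule bilinI) (rule lin_comp[OF bilin_right] lin_comp[OF bilin_left]; assumption)+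

lemma bilin_lin1:
 assumes "b : bilin K U V W" "f : lin K U' U"
 shows "(%u v. b (f u) v) : bilin K U' V W"
 by(rule bilinI) (rule bilin_right[OF assms(1) lin_cl[OF assms(2)]] lin_comp[OF assms(2) bilin_left[OF assms(1)]]; assumption)+

lemma bilin_lin2:
 assumes "b : bilin K U V W" "f : lin K V' V"
 shows "(%u v. b u (f v)) : bilin K U V' W"
 by(rule bilinI) (rule lin_comp[OF assms(2) bilin_right[OF assms(1)]] bilin_left[OF assms(1) lin_cl[OF assms(2)]]; assumption)+

lemma map2_flip: "map2 f xs ys = map2 (%y x. f x y) ys xs"
 by(induction xs ys rule: list_induct2') simp_all

lemma (in tensor) sweedler_lin:
 assumes "module K U" "f : bilin K V W U"
 shows "sweedler K U f : lin K (tens K 1 V W) U" unfolding sweedler_def[abs_def]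
 by(rule tlift_lin[OF assms(1) mlin2_bilin]) (rule bilin_right[OF assms(2)] bilin_left[OF assms(2)]; assumption)+

lemma (in tensor) sweedler_tprod:
 assumes "module K U" "f : bilin K V W U" "v :> V" "w :> W"
 shows "sweedler K U f (tprod K V W [v] w) = f v w"
proof -
 have "mlin2 K 1 V W U (%vs w. f (hd vs) w)"
  by(rule mlin2_bilin) (rule bilin_right[OF assms(2)] bilin_left[OF assms(2)]; assumption)+
 from tlift_tprod[OF assms(1) this, of "[v]" w] show ?thesis unfolding sweedler_def using assms(3,4) by simp
qed

text \<open>Prepending a factor to an arbitrary, not necessarily pure, tensor. Together with
  \<open>tens_cons_ext\<close> it permits induction on the number of factors without unfolding the
  tail.\<close>

definition tcons where
 "tcons K V W n v = tlift K (tens K (Suc n) V W) (%vs w. tprod K V W (v # vs) w)"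

context tensor begin

lemma tcons_mlin2: "v :> V ==> mlin2 K n V W (tens K (Suc n) V W) (%vs w. tprod K V W (v # vs) w)"
 by(rule mlin2_tail[OF tprod_mlin2])

lemma tcons_lin: "v :> V ==> tcons K V W n v : lin K (tens K n V W) (tens K (Suc n) V W)"
 unfolding tcons_def by(rule tlift_lin[OF mtens tcons_mlin2])

lemma tcons_tprod: "v :> V ==> length vs = n ==> vs :>* V ==> w :> W ==>
  tcons K V W n v (tprod K V W vs w) = tprod K V W (v # vs) w"
 unfolding tcons_def by(rule tlift_tprod[OF mtens tcons_mlin2])

lemma tcons_bilin: "tcons K V W n : bilin K V (tens K n V W) (tens K (Suc n) V W)"
proof(rule bilinI[OF tcons_lin])
 fix y assume y: "y :> tens K n V W"
 show "(%v. tcons K V W n v y) : lin K V (tens K (Suc n) V W)" unfolding tcons_def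
  by(rule tlift_param_lin[OF mtens tcons_mlin2 _ module_V y]) (simp_all add: mlin_head[OF mlin2_1[OF tprod_mlin2]])
qed

lemma tens_cons_ext:
 assumes U: "module K U" and F: "F : lin K (tens K (Suc n) V W) U" and G: "G : lin K (tens K (Suc n) V W) U"
  and eq: "!!v y. v :> V ==> y :> tens K n V W ==> F (tcons K V W n v y) = G (tcons K V W n v y)"
  and t: "t :> tens K (Suc n) V W"
 shows "F t = G t"
proof(rule tens_ext[OF U F G _ t])
 fix vs w assume *: "length vs = Suc n" "vs :>* V" "w :> W"
 then obtain v vs' where vs: "vs = v # vs'" by(cases vs) auto
 show "F (tprod K V W vs w) = G (tprod K V W vs w)"
  using eq[of v "tprod K V W vs' w"] * by(simp add: vs tcons_tprod tprod_closed)
qed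

lemma tens_0_ext:
 assumes U: "module K U" and F: "F : lin K (tens K 0 V W) U" and G: "G : lin K (tens K 0 V W) U"
  and eq: "!!w. w :> W ==> F (tprod K V W [] w) = G (tprod K V W [] w)"
  and t: "t :> tens K 0 V W"
 shows "F t = G t" by(rule tens_ext[OF U F G _ t]) (simp add: eq)

end

locale hopf_alg =
 fixes K :: "'k ring" and H :: "('k, 'h) hopf"
 assumes hopf: "hopf_algebra K H"
begin

lemma hopf_facts:
 "field K" "ring H" "module K H" "monoid.mult H : bilin K H H H"
 "comult H : lin K H (tens K 1 H H)" "counit H : lin K H (self_module K)"
 "antipode H : lin K H H"
 "comult H 1[H] = tprod K H H [1[H]] 1[H]" "counit H 1[H] = 1[K]"
 using hopf unfolding hopf_algebra_def k_algebra_def coalgebra_def character_def by simp_all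

sublocale tensor K H H by(rule tensor.intro) (rule hopf_facts)+

sublocale H: ring H by(rule hopf_facts)
sublocale HM: module K H by(rule hopf_facts)

abbreviation sw where "sw U f h \<equiv> sweedler K U f (comult H h)"

lemma comult_closed: "h :> H ==> comult H h :> tens K 1 H H" by(rule lin_cl[OF hopf_facts(5)])

lemma counit_closed: "h :> H ==> counit H h :> K" using lin_cl[OF hopf_facts(6)] by simp

lemma sw_lin: "module K U ==> f : bilin K H H U ==> (%h. sw U f h) : lin K H U"
 by(rule lin_comp[OF hopf_facts(5) sweedler_lin])

lemma bilin_mlin2: "f : bilin K H H U ==> mlin2 K 1 H H U (%vs w. f (hd vs) w)"
 by(rule mlin2_bilin) (rule bilin_right bilin_left; assumption)+

text \<open>The rule by which linear maps are moved under a Sweedler sum; each use needs the summand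
  to be bilinear, which explains the accompanying \<open>bilin\<close> facts throughout.\<close>

lemma lin_sw:
 assumes "module K U" "module K U'" "F : lin K U U'" "f : bilin K H H U" "h :> H"
 shows "F (sw U f h) = sw U' (%x y. F (f x y)) h"
 unfolding sweedler_def by(rule lin_tlift[OF assms(1-3) bilin_mlin2[OF assms(4)] comult_closed[OF assms(5)]])

lemma sw_cong:
 assumes "module K U" "f : bilin K H H U" "g : bilin K H H U" "h :> H"
  and "!!x y. x :> H ==> y :> H ==> f x y = g x y"
 shows "sw U f h = sw U g h"
proof -
 have "hd vs :> H" if "length vs = 1" "vs :>* H" for vs using that by(cases vs) auto
 thus ?thesis unfolding sweedler_def
  by(intro tlift_cong[OF assms(1) bilin_mlin2[OF assms(2)] bilin_mlin2[OF assms(3)] _ comult_closed[OF assms(4)]])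
  (simp add: assms(5))
qed

lemma sw_param:
 assumes "module K U" "module K P" "!!p. p :> P ==> f p : bilin K H H U"
  and "!!x y. x :> H ==> y :> H ==> (%p. f p x y) : lin K P U" and h: "h :> H"
 shows "(%p. sw U (f p) h) : lin K P U"
proof -
 have "hd vs :> H" if "length vs = 1" "vs :>* H" for vs using that by(cases vs) auto
 thus ?thesis unfolding sweedler_def
  by(intro tlift_param_lin[OF assms(1) bilin_mlin2[OF assms(3)] _ assms(2) comult_closed[OF h]]) (simp_all add: assms(4))
qed

lemma sw_group_like:
 assumes "module K U" "f : bilin K H H U" "g :> H" "comult H g = tprod K H H [g] g"
 shows "sw U f g = f g g" using sweedler_tprod[OF assms(1,2,3,3)] by(simp add: assms(4))

lemma sw_counit:
 assumes U: "module K U" and F: "F : lin K H U" and h: "h :> H"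
 shows "sw U (%x y. counit H x *[U] F y) h = F h" and "sw U (%x y. counit H y *[U] F x) h = F h"
proof -
 have b: "(%x y. counit H x *[H] y) : bilin K H H H"
  by(rule bilinI) (rule lin_smult_map[OF hopf_facts(3) counit_closed lin_id] lin_smult_left[OF hopf_facts(3) hopf_facts(6)]; assumption)+
 have b': "(%x y. counit H y *[H] x) : bilin K H H H"
  by(rule bilinI) (rule lin_smult_map[OF hopf_facts(3) counit_closed lin_id] lin_smult_left[OF hopf_facts(3) hopf_facts(6)]; assumption)+
 have c: "(%x y. counit H x *[U] F y) : bilin K H H U"
  by(rule bilinI) (rule lin_smult_map[OF U counit_closed F] lin_smult_left[OF U hopf_facts(6) lin_cl[OF F]]; assumption)+
 have c': "(%x y. counit H y *[U] F x) : bilin K H H U"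
  by(rule bilinI) (rule lin_smult_map[OF U counit_closed F] lin_smult_left[OF U hopf_facts(6) lin_cl[OF F]]; assumption)+
 have "sw H (%x y. counit H x *[H] y) h = h" "sw H (%x y. counit H y *[H] x) h = h"
  using hopf h unfolding hopf_algebra_def coalgebra_def by simp_all
 hence e: "F h = sw U (%x y. F (counit H x *[H] y)) h" "F h = sw U (%x y. F (counit H y *[H] x)) h"
  using lin_sw[OF hopf_facts(3) U F b h] lin_sw[OF hopf_facts(3) U F b' h] by simp_all
 show "sw U (%x y. counit H x *[U] F y) h = F h" unfolding e(1)
  by(rule sw_cong[OF U c bilin_comp[OF b F] h]) (simp add: lin_smult[OF F] counit_closed)
 show "sw U (%x y. counit H y *[U] F x) h = F h" unfolding e(2)
  by(rule sw_cong[OF U c' bilin_comp[OF b' F] h]) (simp add: lin_smult[OF F] counit_closed)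
qed

lemma sw_antipode:
 assumes U: "module K U" and F: "F : lin K H U" and h: "h :> H"
 shows "sw U (%x y. F (x **[H] antipode H y)) h = counit H h *[U] F 1[H]"
proof -
 have "sw H (%x y. x **[H] antipode H y) h = counit H h *[H] 1[H]"
  using hopf h unfolding hopf_algebra_def by simp
 thus ?thesis using lin_sw[OF hopf_facts(3) U F bilin_lin2[OF hopf_facts(4,7)] h]
  by(simp add: lin_smult[OF F] counit_closed[OF h])
qed

lemma sw_swap:
 assumes U: "module K U"
  and f1: "!!x y. x :> H ==> y :> H ==> f x y : bilin K H H U"
  and f2: "!!x y. x :> H ==> y :> H ==> (%a b. f a b x y) : bilin K H H U"
  and g: "g :> H" and h: "h :> H"
 shows "sw U (%x y. sw U (f x y) h) g = sw U (%x y. sw U (%a b. f a b x y) g) h"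
proof -
 have 1: "hd vs :> H" if "length vs = 1" "vs :>* H" for vs using that by(cases vs) auto
 show ?thesis unfolding sweedler_def
  by(rule tlift_commute(1)[where n=1 and m=1, OF tensor_axioms tensor_axioms U _ _ comult_closed[OF g] comult_closed[OF h],
  where f="%vs w vs' w'. f (hd vs) w (hd vs') w'"])
  (simp_all only: bilin_mlin2[OF f1] bilin_mlin2[OF f2] 1)
qed

lemma sw_outer:
 assumes U: "module K U"
  and f1: "!!x y. x :> H ==> y :> H ==> f x y : bilin K H H U"
  and f2: "!!a b. a :> H ==> b :> H ==> (%x y. f x y a b) : bilin K H H U"
  and h: "h :> H"
 shows "(%x y. sw U (f x y) h) : bilin K H H U" by(rule bilinI)
  (rule sw_param[OF U hopf_facts(3) f1 _ h], assumption, assumption, rule bilin_right[OF f2] bilin_left[OF f2]; assumption)+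

text \<open>The axiom for the comultiplication of a product is an identity in H \<otimes> H;
  applying the linear map attached to f and moving it under both sums gives this form.\<close>

lemma sw_mult:
 assumes U: "module K U" and f: "f : bilin K H H U" and g: "g :> H" and h: "h :> H"
 shows "sw U f (g **[H] h) = sw U (%x y. sw U (%a b. f (x **[H] a) (y **[H] b)) h) g"
proof -
 have tp: "(%a b. tprod K H H [a] b) : bilin K H H (tens K 1 H H)"
 proof(rule bilinI)
  show "tprod K H H [a] : lin K H (tens K 1 H H)" if "a :> H" for a
  using mlin2_2[OF tprod_mlin2[of 1], of "[a]"] that by simp
  show "(%a. tprod K H H [a] b) : lin K H (tens K 1 H H)" if "b :> H" for b
  using mlin_head[OF mlin2_1[OF tprod_mlin2[of 1] that, unfolded One_nat_def], of "[]"] by simp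
 qed
 have in1: "(%a b. tprod K H H [x **[H] a] (y **[H] b)) : bilin K H H (tens K 1 H H)"
  if "x :> H" "y :> H" for x y
  by(rule bilin_lin1[OF bilin_lin2[OF tp]]) (rule bilin_right[OF hopf_facts(4)], rule that)+
 have in2: "(%x y. tprod K H H [x **[H] a] (y **[H] b)) : bilin K H H (tens K 1 H H)"
  if "a :> H" "b :> H" for a b
  by(rule bilin_lin1[OF bilin_lin2[OF tp]]) (rule bilin_left[OF hopf_facts(4)], rule that)+
 have fin1: "(%a b. f (x **[H] a) (y **[H] b)) : bilin K H H U"
  if "x :> H" "y :> H" for x y
  by(rule bilin_lin1[OF bilin_lin2[OF f]]) (rule bilin_right[OF hopf_facts(4)], rule that)+
 have fin2: "(%x y. f (x **[H] a) (y **[H] b)) : bilin K H H U"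
  if "a :> H" "b :> H" for a b
  by(rule bilin_lin1[OF bilin_lin2[OF f]]) (rule bilin_left[OF hopf_facts(4)], rule that)+
 let ?F = "sweedler K U f"
 have F: "?F : lin K (tens K 1 H H) U" by(rule sweedler_lin[OF U f])
 have "comult H (g **[H] h) = sw (tens K 1 H H) (%x y. sw (tens K 1 H H) (%a b. tprod K H H [x **[H] a] (y **[H] b)) h) g"
  using hopf g h unfolding hopf_algebra_def by simp
 hence "sw U f (g **[H] h) = ?F (sw (tens K 1 H H) (%x y. sw (tens K 1 H H) (%a b. tprod K H H [x **[H] a] (y **[H] b)) h) g)"
  by simp
 also have "... = sw U (%x y. ?F (sw (tens K 1 H H) (%a b. tprod K H H [x **[H] a] (y **[H] b)) h)) g"
  by(rule lin_sw[OF mtens U F sw_outer[OF mtens in1 in2 h] g])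
 also have "... = sw U (%x y. sw U (%a b. f (x **[H] a) (y **[H] b)) h) g"
 proof(rule sw_cong[OF U bilin_comp[OF sw_outer[OF mtens in1 in2 h] F] sw_outer[OF U fin1 fin2 h] g])
  fix x y assume xy: "x :> H" "y :> H"
  have "?F (sw (tens K 1 H H) (%a b. tprod K H H [x **[H] a] (y **[H] b)) h) = sw U (%a b. ?F (tprod K H H [x **[H] a] (y **[H] b))) h"
  by(rule lin_sw[OF mtens U F in1[OF xy] h])
  also have "... = sw U (%a b. f (x **[H] a) (y **[H] b)) h"
  by(rule sw_cong[OF U bilin_comp[OF in1[OF xy] F] fin1[OF xy] h]) (simp add: sweedler_tprod[OF U f] xy)
  finally show "?F (sw (tens K 1 H H) (%a b. tprod K H H [x **[H] a] (y **[H] b)) h) = ..." .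
 qed
 finally show ?thesis .
qed

lemma sw_coassoc_bilin:
 assumes U: "module K U" and f: "!!x. x :> H ==> f x : bilin K H H U"
  and f': "!!y z. y :> H ==> z :> H ==> (%x. f x y z) : lin K H U"
 shows "(%x y. sw U (f x) y) : bilin K H H U" "(%x y. sw U (%a b. f a b y) x) : bilin K H H U"
proof -
 have g: "(%a b. f a b y) : bilin K H H U" if "y :> H" for y
  by(rule bilinI) (use that in \<open>auto intro: bilin_left[OF f] f'\<close>)
 show "(%x y. sw U (f x) y) : bilin K H H U"
  by(rule bilinI) (rule sw_lin[OF U f] sw_param[OF U hopf_facts(3) f f']; assumption)+
 show "(%x y. sw U (%a b. f a b y) x) : bilin K H H U"
 proof(rule bilinI)
  show "(%y. sw U (%a b. f a b y) x) : lin K H U" if "x :> H" for x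
  by(rule sw_param[OF U hopf_facts(3) g _ that]) (auto intro: bilin_right[OF f])
  show "(%x. sw U (%a b. f a b y) x) : lin K H U" if "y :> H" for y by(rule sw_lin[OF U g[OF that]])
 qed
qed

text \<open>The axiom is an equation in a threefold tensor product. A trilinear f induces a linear
  map F out of that product, and applying F to the axiom yields the equation for f.\<close>

lemma sw_coassoc:
 assumes U: "module K U" and f: "!!x. x :> H ==> f x : bilin K H H U"
  and f': "!!y z. y :> H ==> z :> H ==> (%x. f x y z) : lin K H U"
  and h: "h :> H"
 shows "sw U (%x y. sw U (f x) y) h = sw U (%x y. sw U (%a b. f a b y) x) h"
proof -
 let ?T = "tens K 2 H H"
 define F where "F = tlift K U (%vs z. f (hd vs) (hd (tl vs)) z)"
 have g: "(%a b. f a b y) : bilin K H H U" if "y :> H" for y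
  by(rule bilinI) (use that in \<open>auto intro: bilin_left[OF f] f'\<close>)
 have m: "mlin2 K (Suc (Suc 0)) H H U (%vs z. f (hd vs) (hd (tl vs)) z)"
 proof(rule mlin2I)
  show "mlin K (Suc (Suc 0)) H U (%vs. f (hd vs) (hd (tl vs)) w)" if w: "w :> H" for w
  proof(rule mlin_ConsI)
  show "mlin K (Suc 0) H U (%vs. f (hd (v # vs)) (hd (tl (v # vs))) w)" if v: "v :> H" for v
  using mlin2_1[OF bilin_mlin2[OF f[OF v]] w] by simp
  show "(%v. f (hd (v # vs)) (hd (tl (v # vs))) w) : lin K H U" if "length vs = Suc 0" "vs :>* H" for vs
  using that w by(cases vs) (auto intro: f')
  qed
  show "f (hd vs) (hd (tl vs)) : lin K H U" if v: "length vs = Suc (Suc 0)" "vs :>* H" for vs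
  proof -
  obtain a b where "vs = [a, b]" "a :> H" "b :> H" using v by(auto simp: length_Suc_conv)
  thus ?thesis using bilin_right[OF f, of a b] by simp
  qed
 qed
 have F: "F : lin K ?T U" unfolding F_def numeral_2_eq_2 by(rule tlift_lin[OF U m])
 have Ft: "F (tprod K H H [x, y] z) = f x y z" if "x :> H" "y :> H" "z :> H" for x y z
  unfolding F_def using tlift_tprod[OF U m, of "[x, y]" z] that by simp
 have t1: "(%y z. tprod K H H [x, y] z) : bilin K H H ?T" if x: "x :> H" for x
 proof(rule bilinI)
  show "tprod K H H [x, y] : lin K H ?T" if "y :> H" for y
  using mlin2_2[OF tprod_mlin2[of 2], of "[x, y]"] that x by simp
  show "(%y. tprod K H H [x, y] z) : lin K H ?T" if "z :> H" for z
  using mlin_head[OF mlin_tail[OF mlin2_1[OF tprod_mlin2[of 2] that, unfolded numeral_2_eq_2] x], of "[]"]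
  by(simp add: numeral_2_eq_2)
 qed
 have t2: "(%x. tprod K H H [x, y] z) : lin K H ?T" if "y :> H" "z :> H" for y z
  using mlin_head[OF mlin2_1[OF tprod_mlin2[of 2] that(2), unfolded numeral_2_eq_2], of "[y]"] that(1)
  by(simp add: numeral_2_eq_2)
 have t3: "(%x y. tprod K H H [x, y] z) : bilin K H H ?T" if "z :> H" for z
  by(rule bilinI) (use that in \<open>auto intro: bilin_left[OF t1] t2\<close>)
 have ax: "sw ?T (%x y. sw ?T (%y1 y2. tprod K H H [x, y1] y2) y) h = sw ?T (%x y. sw ?T (%x1 x2. tprod K H H [x1, x2] y) x) h"
  using hopf h unfolding hopf_algebra_def coalgebra_def by simp
 have tb: "(%x y. sw ?T (%y1 y2. tprod K H H [x, y1] y2) y) : bilin K H H ?T"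
  "(%x y. sw ?T (%x1 x2. tprod K H H [x1, x2] y) x) : bilin K H H ?T"
  by(rule sw_coassoc_bilin[OF mtens t1 t2]; assumption)+
 have fb: "(%x y. sw U (f x) y) : bilin K H H U" "(%x y. sw U (%a b. f a b y) x) : bilin K H H U"
  by(rule sw_coassoc_bilin[OF U f f']; assumption)+
 have "F (sw ?T (%x y. sw ?T (%y1 y2. tprod K H H [x, y1] y2) y) h) = sw U (%x y. sw U (f x) y) h"
 proof(rule trans[OF lin_sw[OF mtens U F tb(1) h]], rule sw_cong[OF U bilin_comp[OF tb(1) F] fb(1) h])
  fix x y assume xy: "x :> H" "y :> H"
  show "F (sw ?T (%y1 y2. tprod K H H [x, y1] y2) y) = sw U (f x) y"
  by(rule trans[OF lin_sw[OF mtens U F t1[OF xy(1)] xy(2)]], rule sw_cong[OF U bilin_comp[OF t1[OF xy(1)] F] f[OF xy(1)] xy(2)]) (simp add: Ft xy)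
 qed
 moreover have "F (sw ?T (%x y. sw ?T (%x1 x2. tprod K H H [x1, x2] y) x) h) = sw U (%x y. sw U (%a b. f a b y) x) h"
 proof(rule trans[OF lin_sw[OF mtens U F tb(2) h]], rule sw_cong[OF U bilin_comp[OF tb(2) F] fb(2) h])
  fix x y assume xy: "x :> H" "y :> H"
  show "F (sw ?T (%x1 x2. tprod K H H [x1, x2] y) x) = sw U (%a b. f a b y) x"
  by(rule trans[OF lin_sw[OF mtens U F t3[OF xy(2)] xy(1)]], rule sw_cong[OF U bilin_comp[OF t3[OF xy(2)] F] g[OF xy(2)] xy(1)]) (simp add: Ft xy)
 qed
 ultimately show ?thesis using ax by simp
qed

lemma iter_comult_Suc: "iter_comult K H (Suc n) h = sw (tens K (Suc n) H H) (%x y. tcons K H H n x (iter_comult K H n y)) h"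
 by(simp add: tcons_def)

lemma iter_lin: "iter_comult K H n : lin K H (tens K n H H)"
proof(induction n)
 case 0
 thus ?case using mlin2_2[OF tprod_mlin2[of 0], of "[]"] by(simp add: lin_cong[OF hopf_facts(3)])
next
 case (Suc n)
 show ?case unfolding iter_comult_Suc[abs_def]
  by(rule sw_lin[OF mtens bilin_lin2[OF tcons_bilin Suc]])
qed

end

subsection \<open>The diagonal action\<close>

lemma map2_closed:
 assumes "set xs <= X" "set ys <= Y" "!!x y. x : X ==> y : Y ==> f x y : Z"
 shows "set (map2 f xs ys) <= Z"
 using assms(1,2) by(induction xs ys rule: list_induct2') (simp_all add: assms(3))

lemma mlin2_cong:
 assumes "module K V" "module K W" "mlin2 K n V W U f"
  and "!!vs w. length vs = n ==> vs :>* V ==> w :> W ==> f vs w = g vs w"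
 shows "mlin2 K n V W U g"
proof(rule mlin2I)
 show "mlin K n V U (%vs. g vs w)" if "w :> W" for w
  by(rule mlin_cong[OF assms(1) mlin2_1[OF assms(3) that]]) (simp add: assms(4) that)
 show "g vs : lin K W U" if "length vs = n" "vs :>* V" for vs
  by(rule lin_cong[OF assms(2) mlin2_2[OF assms(3) that]]) (simp add: assms(4) that)
qed

text \<open>Most operators here are defined on pure tensors but only touch the front. Describing
  them by a bilinear b in the first factor and the whole tail gives linearity and a formula valid
  for arbitrary tails at once.\<close>

lemma (in tensor) split_first:
 assumes U: "module K U" and b: "b : bilin K V (tens K n V W) U"
  and eq: "!!v vs w. v :> V ==> length vs = n ==> vs :>* V ==> w :> W ==>
  f (v # vs) w = b v (tprod K V W vs w)"
 shows "mlin2 K (Suc n) V W U f" and "tlift K U f : lin K (tens K (Suc n) V W) U"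
  and "v :> V ==> y :> tens K n V W ==> tlift K U f (tcons K V W n v y) = b v y"
proof -
 have m: "mlin2 K (Suc n) V W U (%cs w. b (hd cs) (tprod K V W (tl cs) w))"
 proof(rule mlin2I)
  show "mlin K (Suc n) V U (%cs. b (hd cs) (tprod K V W (tl cs) w))" if w: "w :> W" for w
  proof(rule mlin_ConsI)
  show "mlin K n V U (%vs. b (hd (v # vs)) (tprod K V W (tl (v # vs)) w))" if "v :> V" for v
  using mlin_comp[OF mlin2_1[OF tprod_mlin2 w] bilin_right[OF b that]] by simp
  show "(%v. b (hd (v # vs)) (tprod K V W (tl (v # vs)) w)) : lin K V U" if "length vs = n" "vs :>* V" for vs
  using bilin_left[OF b tprod_closed[OF that w]] by simp
  qed
  show "(%w. b (hd cs) (tprod K V W (tl cs) w)) : lin K W U" if "length cs = Suc n" "cs :>* V" for cs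
  using that lin_comp[OF mlin2_2[OF tprod_mlin2[of n], of "tl cs"] bilin_right[OF b, of "hd cs"]] by(cases cs) auto
 qed
 show m': "mlin2 K (Suc n) V W U f"
 proof(rule mlin2_cong[OF module_V module_W m])
  fix vs w assume *: "length vs = Suc n" "vs :>* V" "w :> W"
  then obtain v vs' where "vs = v # vs'" by(cases vs) auto
  thus "b (hd vs) (tprod K V W (tl vs) w) = f vs w" using eq[of v vs' w] * by simp
 qed
 show l: "tlift K U f : lin K (tens K (Suc n) V W) U" by(rule tlift_lin[OF U m'])
 show "tlift K U f (tcons K V W n v y) = b v y" if v: "v :> V" and y: "y :> tens K n V W"
  by(rule tens_ext[OF U lin_comp[OF tcons_lin[OF v] l] bilin_right[OF b v] _ y])
  (simp add: tcons_tprod v tlift_tprod[OF U m'] eq)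
qed

locale hopf_act = hopf_alg K H for K :: "'k ring" and H :: "('k, 'h) hopf" +
 fixes M :: "('k, 'h, 'm) hmodcomod" and V :: "('k, 'v, 'x) module_scheme" and act :: "'h => 'v => 'v"
 assumes M_act: "left_module K H M (hact M)" and V_act: "left_module K H V act"
begin

sublocale T: tensor K V M using M_act V_act hopf_facts(1) by(simp add: tensor_def left_module_def)

abbreviation "Tn n \<equiv> tens K n V M"
abbreviation "tp \<equiv> tprod K V M"
abbreviation "cons n \<equiv> tcons K V M n"

lemma act_facts:
 "act : bilin K H V V" "hact M : bilin K H M M"
 "x :> V ==> act 1[H] x = x" "m :> M ==> hact M 1[H] m = m"
 "g :> H ==> h :> H ==> x :> V ==> act (g **[H] h) x = act g (act h x)"
 "g :> H ==> h :> H ==> m :> M ==> hact M (g **[H] h) m = hact M g (hact M h m)"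
 using M_act V_act by(simp_all add: left_module_def)

lemma act_closed: "h :> H ==> x :> V ==> act h x :> V" by(rule bilin_closed[OF act_facts(1)])

lemma hact_closed: "h :> H ==> m :> M ==> hact M h m :> M" by(rule bilin_closed[OF act_facts(2)])

text \<open>The diagonal action indexed by the number of factors of V rather than by degree, so that
  induction can start at zero factors.\<close>

definition diag :: "nat => 'h => ('k, 'v, 'm) tensor => ('k, 'v, 'm) tensor" where
 "diag n h = tlift K (Tn n) (%vs m. tlift K (Tn n) (%hs h'. tp (map2 act hs vs) (hact M h' m)) (iter_comult K H n h))"

lemma diag_act_eq: "diag_act K H V act M n = diag (Suc n)"
 by(rule HOL.ext) (simp add: diag_act_def diag_def)

lemma act2_mlin2:
 assumes "length vs = n" "vs :>* V" "m :> M"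
 shows "mlin2 K n H H (Tn n) (%hs h'. tp (map2 act hs vs) (hact M h' m))"
proof(rule mlin2I)
 show "mlin K n H (Tn n) (%hs. tp (map2 act hs vs) (hact M h m))" if "h :> H" for h
  by(rule mlin_map2[OF mlin2_1[OF T.tprod_mlin2 hact_closed[OF that assms(3)]] assms(1)])
  (rule bilin_left[OF act_facts(1)], use assms(2) in auto)
 show "(%h. tp (map2 act hs vs) (hact M h m)) : lin K H (Tn n)" if "length hs = n" "hs :>* H" for hs
  by(rule lin_comp[OF bilin_left[OF act_facts(2) assms(3)] mlin2_2[OF T.tprod_mlin2]])
  (simp add: that assms(1), rule map2_closed[OF that(2) assms(2) act_closed])
qed

lemma act2_mlin2':
 assumes "length hs = n" "hs :>* H" "h :> H"
 shows "mlin2 K n V M (Tn n) (%vs m. tp (map2 act hs vs) (hact M h m))"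
proof(rule mlin2I)
 show "mlin K n V (Tn n) (%vs. tp (map2 act hs vs) (hact M h m))" if "m :> M" for m
  unfolding map2_flip[of act hs]
  by(rule mlin_map2[OF mlin2_1[OF T.tprod_mlin2 hact_closed[OF assms(3) that]] assms(1)])
  (rule bilin_right[OF act_facts(1)], use assms(2) in auto)
 show "(%m. tp (map2 act hs vs) (hact M h m)) : lin K M (Tn n)" if "length vs = n" "vs :>* V" for vs
  by(rule lin_comp[OF bilin_right[OF act_facts(2) assms(3)] mlin2_2[OF T.tprod_mlin2]])
  (simp add: that assms(1), rule map2_closed[OF assms(2) that(2) act_closed])
qed

lemma diag_mlin2:
 assumes "s :> tens K n H H"
 shows "mlin2 K n V M (Tn n) (%vs m. tlift K (Tn n) (%hs h'. tp (map2 act hs vs) (hact M h' m)) s)"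
 by(rule tlift_commute(2)[OF T.tensor_axioms tensor_axioms T.mtens act2_mlin2 act2_mlin2' module_zero_closed[OF T.mtens] assms])

lemma iter_closed: "h :> H ==> iter_comult K H n h :> tens K n H H" by(rule lin_cl[OF iter_lin])

lemma diag_lin: "h :> H ==> diag n h : lin K (Tn n) (Tn n)"
 unfolding diag_def by(rule T.tlift_lin[OF T.mtens diag_mlin2[OF iter_closed]])

lemma diag_tprod:
 assumes "h :> H" "length vs = n" "vs :>* V" "m :> M"
 shows "diag n h (tp vs m) = tlift K (Tn n) (%hs h'. tp (map2 act hs vs) (hact M h' m)) (iter_comult K H n h)"
 unfolding diag_def by(rule T.tlift_tprod[OF T.mtens diag_mlin2[OF iter_closed] assms(2-4)]) (rule assms(1))

lemma diag_bilin: "diag n : bilin K H (Tn n) (Tn n)"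
proof(rule bilinI[OF diag_lin])
 fix y assume y: "y :> Tn n"
 show "(%h. diag n h y) : lin K H (Tn n)" unfolding diag_def
  by(rule T.tlift_param_lin[OF T.mtens diag_mlin2[OF iter_closed] _ hopf_facts(3) y])
  (assumption, rule lin_comp[OF iter_lin tlift_lin[OF T.mtens act2_mlin2]])
qed

lemma diag_closed: "h :> H ==> y :> Tn n ==> diag n h y :> Tn n"
 by(rule bilin_closed[OF diag_bilin])

lemma diag_0: "h :> H ==> m :> M ==> diag 0 h (tp [] m) = tp [] (hact M h m)"
 using diag_tprod[of h "[]" 0 m] tlift_tprod[OF T.mtens act2_mlin2[of "[]" 0 m], of "[]" h] by simp

lemma cons_diag_bilin:
 assumes "v :> V" "y :> Tn n"
 shows "(%x z. cons n (act x v) (diag n z y)) : bilin K H H (Tn (Suc n))"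
 by(rule bilin_lin1[OF bilin_lin2[OF T.tcons_bilin bilin_left[OF diag_bilin assms(2)]] bilin_left[OF act_facts(1) assms(1)]])

text \<open>The recursion h (v \<otimes> y) = \<open>h\<^sub>(\<^sub>1\<^sub>)\<close> v \<otimes>
  \<open>h\<^sub>(\<^sub>2\<^sub>)\<close> y, inherited from that of \<open>iter_comult\<close>. It
  replaces iterated comultiplications by single ones in everything that follows.\<close>

lemma diag_Suc:
 assumes h: "h :> H" and v: "v :> V" and y: "y :> Tn n"
 shows "diag (Suc n) h (cons n v y) = sw (Tn (Suc n)) (%x z. cons n (act x v) (diag n z y)) h"
proof(rule T.tens_ext[OF T.mtens lin_comp[OF T.tcons_lin[OF v] diag_lin[OF h]] _ _ y])
 note lc = lin_comp[OF diag_lin T.tcons_lin[OF act_closed[OF _ v]]]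
 show "(%y. sw (Tn (Suc n)) (%x z. cons n (act x v) (diag n z y)) h) : lin K (Tn n) (Tn (Suc n))"
  by(rule sw_param[OF T.mtens T.mtens cons_diag_bilin[OF v] _ h]) (assumption, rule lc)
 fix vs m assume vs: "length vs = n" "vs :>* V" "m :> M"
 let ?F = "tlift K (Tn (Suc n)) (%hs h'. tp (map2 act hs (v # vs)) (hact M h' m))"
 let ?G = "tlift K (Tn n) (%hs h'. tp (map2 act hs vs) (hact M h' m))"
 have mF: "mlin2 K (Suc n) H H (Tn (Suc n)) (%hs h'. tp (map2 act hs (v # vs)) (hact M h' m))"
  by(rule act2_mlin2) (use vs v in auto)
 note F = tlift_lin[OF T.mtens mF] and G = tlift_lin[OF T.mtens act2_mlin2[OF vs]]
 \<comment> \<open>On a tuple of acting elements the first acts on v and the remaining ones on the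
   tail; by linearity this persists for an arbitrary s.\<close>
 have FG: "?F (tcons K H H n x s) = cons n (act x v) (?G s)" if x: "x :> H" and s: "s :> tens K n H H" for x s
 proof(rule tens_ext[OF T.mtens lin_comp[OF tcons_lin[OF x] F] lin_comp[OF G T.tcons_lin[OF act_closed[OF x v]]] _ s])
  fix hs h' assume hs: "length hs = n" "hs :>* H" "h' :> H"
  show "?F (tcons K H H n x (tprod K H H hs h')) = cons n (act x v) (?G (tprod K H H hs h'))"
  using tlift_tprod[OF T.mtens mF, of "x # hs" h'] tlift_tprod[OF T.mtens act2_mlin2[OF vs] hs] hs x v vs
  map2_closed[OF hs(2) vs(2) act_closed]
  by(simp add: tcons_tprod T.tcons_tprod act_closed hact_closed del: set_map)
 qed
 have bi: "(%x y. tcons K H H n x (iter_comult K H n y)) : bilin K H H (tens K (Suc n) H H)"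
  by(rule bilin_lin2[OF tcons_bilin iter_lin])
 have "diag (Suc n) h (cons n v (tp vs m)) = ?F (iter_comult K H (Suc n) h)"
  using diag_tprod[OF h, of "v # vs" "Suc n" m] v vs by(simp add: T.tcons_tprod del: iter_comult.simps)
 also have "... = sw (Tn (Suc n)) (%x y. ?F (tcons K H H n x (iter_comult K H n y))) h"
  unfolding iter_comult_Suc by(rule lin_sw[OF mtens T.mtens F bi h])
 also have "... = sw (Tn (Suc n)) (%x z. cons n (act x v) (diag n z (tp vs m))) h"
  by(rule sw_cong[OF T.mtens bilin_comp[OF bi F] cons_diag_bilin[OF v T.tprod_closed[OF vs]] h])
  (simp add: FG iter_closed diag_tprod vs)
 finally show "diag (Suc n) h (cons n v (tp vs m)) = sw (Tn (Suc n)) (%x z. cons n (act x v) (diag n z (tp vs m))) h" .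
qed

text \<open>Induction on the number of factors: multiplicativity of the comultiplication splits the
  action of gh, and interchanging the two Sweedler sums regroups it as the action of g after that of
  h.\<close>

lemma diag_mult:
 assumes g: "g :> H" and h: "h :> H" and y: "y :> Tn n"
 shows "diag n (g **[H] h) y = diag n g (diag n h y)" using g h y
proof(induction n arbitrary: g h y)
 case 0
 show ?case by(rule T.tens_0_ext[OF T.mtens diag_lin lin_comp[OF diag_lin diag_lin] _ 0(3)])
  (use 0 in \<open>simp_all add: diag_0 act_facts hact_closed\<close>)
next
 case (Suc n)
 note g = Suc.prems(1) and h = Suc.prems(2)
 have gh: "g **[H] h :> H" using g h by simp
 show ?case
 proof(rule T.tens_cons_ext[OF T.mtens diag_lin[OF gh] lin_comp[OF diag_lin[OF h] diag_lin[OF g]] _ Suc.prems(3)])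
  fix v y assume v: "v :> V" and y: "y :> Tn n"
  let ?T = "Tn (Suc n)"
  let ?k = "%x x' a b. cons n (act (x **[H] a) v) (diag n (x' **[H] b) y)"
  have k1: "?k x x' : bilin K H H ?T" if "x :> H" "x' :> H" for x x'
  by(rule bilin_lin1[OF bilin_lin2[OF cons_diag_bilin[OF v y]]]) (rule bilin_right[OF hopf_facts(4)], rule that)+
  have k2: "(%x x'. ?k x x' a b) : bilin K H H ?T" if "a :> H" "b :> H" for a b
  by(rule bilin_lin1[OF bilin_lin2[OF cons_diag_bilin[OF v y]]]) (rule bilin_left[OF hopf_facts(4)], rule that)+
  have "diag (Suc n) (g **[H] h) (cons n v y) = sw ?T (%x x'. sw ?T (?k x x') h) g"
  unfolding diag_Suc[OF gh v y] by(rule sw_mult[OF T.mtens cons_diag_bilin[OF v y] g h])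
  also have "... = sw ?T (%a b. sw ?T (%x x'. ?k x x' a b) g) h"
  by(rule sw_swap[OF T.mtens k1 k2 g h])
  also have "... = sw ?T (%a b. diag (Suc n) g (cons n (act a v) (diag n b y))) h"
  proof(rule sw_cong[OF T.mtens sw_outer[OF T.mtens k2 k1 g] bilin_comp[OF cons_diag_bilin[OF v y] diag_lin[OF g]] h])
  fix a b assume ab: "a :> H" "b :> H"
  show "sw ?T (%x x'. ?k x x' a b) g = diag (Suc n) g (cons n (act a v) (diag n b y))"
  unfolding diag_Suc[OF g act_closed[OF ab(1) v] diag_closed[OF ab(2) y]]
  by(rule sw_cong[OF T.mtens k2[OF ab] cons_diag_bilin[OF act_closed[OF ab(1) v] diag_closed[OF ab(2) y]] g])
  (simp add: ab act_facts(5) v Suc.IH y)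
  qed
  also have "... = diag (Suc n) g (diag (Suc n) h (cons n v y))"
  unfolding diag_Suc[OF h v y] by(rule lin_sw[OF T.mtens T.mtens diag_lin[OF g] cons_diag_bilin[OF v y] h, symmetric])
  finally show "diag (Suc n) (g **[H] h) (cons n v y) = diag (Suc n) g (diag (Suc n) h (cons n v y))" .
 qed
qed

lemma diag_one: "y :> Tn n ==> diag n 1[H] y = y"
proof(induction n arbitrary: y)
 case 0
 show ?case by(rule T.tens_0_ext[OF T.mtens diag_lin lin_id _ 0]) (simp_all add: diag_0 act_facts)
next
 case (Suc n)
 show ?case by(rule T.tens_cons_ext[OF T.mtens diag_lin lin_id _ Suc.prems])
  (simp_all add: diag_Suc sw_group_like[OF T.mtens cons_diag_bilin H.one_closed hopf_facts(8)] act_facts Suc.IH)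
qed

text \<open>\<open>at_tail\<close> lets an operator act on all but the first tensor factor; iterating it moves the operator to any slot.\<close>

definition at_tail :: "nat => (('k, 'v, 'm) tensor => ('k, 'v, 'm) tensor) => ('k, 'v, 'm) tensor => ('k, 'v, 'm) tensor" where
 "at_tail n' R = tlift K (Tn (Suc n')) (%cs m. cons n' (hd cs) (R (tp (tl cs) m)))"

definition equivariant :: "nat => nat => (('k, 'v, 'm) tensor => ('k, 'v, 'm) tensor) => bool" where
 "equivariant n n' R \<longleftrightarrow> R : lin K (Tn n) (Tn n') \<and>
  (ALL h:carrier H. ALL y:carrier (Tn n). R (diag n h y) = diag n' h (R y))"

lemma at_tail:
 assumes "R : lin K (Tn n) (Tn n')"
 shows "at_tail n' R : lin K (Tn (Suc n)) (Tn (Suc n'))"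
  and "v :> V ==> y :> Tn n ==> at_tail n' R (cons n v y) = cons n' v (R y)" unfolding at_tail_def
 by(rule T.split_first[OF T.mtens bilin_lin2[OF T.tcons_bilin assms]]; simp)+

text \<open>By \<open>diag_Suc\<close> the first Sweedler leg meets only the untouched factor, while
  the second acts on the tail, where it commutes with R.\<close>

lemma equivariant_at_tail:
 assumes R: "equivariant n n' R"
 shows "equivariant (Suc n) (Suc n') (at_tail n' R)"
proof -
 have Rl: "R : lin K (Tn n) (Tn n')" and Rc: "!!h y. h :> H ==> y :> Tn n ==> R (diag n h y) = diag n' h (R y)"
  using R by(auto simp: equivariant_def)
 note l = at_tail(1)[OF Rl] and c = at_tail(2)[OF Rl]
 have "at_tail n' R (diag (Suc n) h t) = diag (Suc n') h (at_tail n' R t)" if h: "h :> H" and t: "t :> Tn (Suc n)" for h t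
 proof(rule T.tens_cons_ext[OF T.mtens lin_comp[OF diag_lin[OF h] l] lin_comp[OF l diag_lin[OF h]] _ t])
  fix v y assume v: "v :> V" and y: "y :> Tn n"
  have Ry: "R y :> Tn n'" by(rule lin_cl[OF Rl y])
  show "at_tail n' R (diag (Suc n) h (cons n v y)) = diag (Suc n') h (at_tail n' R (cons n v y))"
  unfolding c[OF v y] diag_Suc[OF h v y] diag_Suc[OF h v Ry]
  lin_sw[OF T.mtens T.mtens l cons_diag_bilin[OF v y] h]
  by(rule sw_cong[OF T.mtens bilin_comp[OF cons_diag_bilin[OF v y] l] cons_diag_bilin[OF v Ry] h])
  (simp add: c act_closed v diag_closed y Rc)
 qed
 thus ?thesis using l by(simp add: equivariant_def)
qed

end

subsection \<open>Integer powers and rotations\<close>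

text \<open>Integer powers with an explicit inverse g. \<open>int_pow_map\<close> uses
  \<open>inv_into\<close> instead; the two agree on the carrier, and with g in hand the laws of
  exponents and concrete formulas are available.\<close>

definition ipow :: "('a => 'a) => ('a => 'a) => int => 'a => 'a" where
 "ipow f g i = (if 0 <= i then f ^^ nat i else g ^^ nat (- i))"

locale bij_pair =
 fixes S :: "'a set" and f g :: "'a => 'a"
 assumes f_closed: "x : S ==> f x : S" and g_closed: "x : S ==> g x : S"
  and gf: "x : S ==> g (f x) = x" and fg: "x : S ==> f (g x) = x"
begin

lemma f_pow_closed: "x : S ==> (f ^^ k) x : S" by(induction k) (simp_all add: f_closed)

lemma g_pow_closed: "x : S ==> (g ^^ k) x : S" by(induction k) (simp_all add: g_closed)

lemma ipow_closed: "x : S ==> ipow f g i x : S" by(simp add: ipow_def f_pow_closed g_pow_closed)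

lemma ipow_step:
 assumes "x : S"
 shows "ipow f g (i + 1) x = f (ipow f g i x)" "ipow f g (i - 1) x = g (ipow f g i x)"
proof -
 show "ipow f g (i + 1) x = f (ipow f g i x)"
 proof(cases "0 <= i")
  case True
  hence "nat (i + 1) = Suc (nat i)" by simp
  thus ?thesis using True by(simp add: ipow_def)
 next
  case False
  then obtain k where k: "nat (- i) = Suc k" "nat (- (i + 1)) = k" by(metis Suc_nat_eq_nat_zadd1 add.commute diff_0 le_minus_iff minus_add_cancel minus_diff_eq neg_0_le_iff_le not_le uminus_add_conv_diff zless_imp_add1_zle)
  thus ?thesis using False assms by(cases "i + 1 = 0") (auto simp: ipow_def fg g_pow_closed)
 qed
 show "ipow f g (i - 1) x = g (ipow f g i x)"
 proof(cases "1 <= i")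
  case True
  hence "nat i = Suc (nat (i - 1))" by simp
  thus ?thesis using True assms by(simp add: ipow_def gf f_pow_closed)
 next
  case False
  hence "nat (- (i - 1)) = Suc (nat (- i))" by simp
  thus ?thesis using False by(cases "i = 0") (auto simp: ipow_def)
 qed
qed

lemma ipow_add: "x : S ==> ipow f g (i + j) x = ipow f g i (ipow f g j x)"
proof(induction i rule: int_induct[where k=0])
 case base
 thus ?case by(simp add: ipow_def[of _ _ 0])
next
 case (step1 i)
 thus ?case using ipow_step(1)[of x "i + j"] ipow_step(1)[of "ipow f g j x" i] by(simp add: ipow_closed algebra_simps)
next
 case (step2 i)
 thus ?case using ipow_step(2)[of x "i + j"] ipow_step(2)[of "ipow f g j x" i] by(simp add: ipow_closed algebra_simps)
qed

lemma ipow_cancel: "x : S ==> ipow f g (- i) (ipow f g i x) = x" "x : S ==> ipow f g i (ipow f g (- i) x) = x"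
 using ipow_add[of x "- i" i] ipow_add[of x i "- i"] by(simp_all add: ipow_def[of _ _ 0])

lemma inv_into_eq: "x : S ==> inv_into S f x = g x"
 by(rule inv_into_f_eq) (auto intro: inj_on_inverseI[of _ g] simp: gf fg g_closed)

lemma int_pow_map_eq:
 assumes "carrier V = S" "x : S"
 shows "int_pow_map V f i x = ipow f g i x"
proof -
 have "(inv_into S f ^^ k) x = (g ^^ k) x" for k
  by(induction k) (simp_all add: inv_into_eq g_pow_closed assms(2))
 thus ?thesis by(simp add: int_pow_map_def ipow_def assms(1))
qed

lemma ipow_swap: "x : S ==> ipow g f i x = ipow f g (- i) x" by(cases "i = 0") (auto simp: ipow_def)

lemma swap: "bij_pair S g f" by unfold_locales (simp_all add: f_closed g_closed gf fg)

end

text \<open>For a coaction of the form m \<mapsto> \<sigma> \<otimes> m the cyclic operator on the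
  coalgebra side is \<open>rot\<close>. On the algebra side it is \<open>unrot\<close>, once u is
  known to be \<open>S\<^sup>-\<^sup>1(\<sigma>)\<close>. The locale is therefore used twice, with V
  the Hopf algebra and with V the module algebra.\<close>

locale hopf_rot = hopf_act K H M V act
 for K :: "'k ring" and H :: "('k, 'h) hopf" and M :: "('k, 'h, 'm) hmodcomod"
  and V :: "('k, 'v, 'x) module_scheme" and act +
 fixes \<sigma> u :: 'h
 assumes \<sigma>_closed: "\<sigma> :> H" and u_closed: "u :> H"
  and \<sigma>u: "\<sigma> **[H] u = 1[H]" and u\<sigma>: "u **[H] \<sigma> = 1[H]"
begin

definition rot :: "nat => ('k, 'v, 'm) tensor => ('k, 'v, 'm) tensor" where
 "rot n = tlift K (Tn (Suc n)) (%cs m. tp (tl cs @ [act \<sigma> (hd cs)]) m)"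

definition unrot :: "nat => ('k, 'v, 'm) tensor => ('k, 'v, 'm) tensor" where
 "unrot n = tlift K (Tn (Suc n)) (%cs m. tp (act u (last cs) # butlast cs) m)"

lemma rot_mlin2: "mlin2 K (Suc n) V M (Tn (Suc n)) (%cs m. tp (tl cs @ [act \<sigma> (hd cs)]) m)"
proof(rule mlin2I)
 show "mlin K (Suc n) V (Tn (Suc n)) (%cs. tp (tl cs @ [act \<sigma> (hd cs)]) m)" if m: "m :> M" for m
 proof(rule mlin_ConsI)
  show "mlin K n V (Tn (Suc n)) (%vs. tp (tl (v # vs) @ [act \<sigma> (hd (v # vs))]) m)" if "v :> V" for v
  using mlin_init[OF mlin2_1[OF T.tprod_mlin2 m] act_closed[OF \<sigma>_closed that]] by simp
  show "(%v. tp (tl (v # vs) @ [act \<sigma> (hd (v # vs))]) m) : lin K V (Tn (Suc n))"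
  if "length vs = n" "vs :>* V" for vs
  using lin_comp[OF bilin_right[OF act_facts(1) \<sigma>_closed] mlin_last[OF mlin2_1[OF T.tprod_mlin2 m] that]] by simp
 qed
 show "tp (tl cs @ [act \<sigma> (hd cs)]) : lin K M (Tn (Suc n))" if "length cs = Suc n" "cs :>* V" for cs
  by(rule mlin2_2[OF T.tprod_mlin2]) (use that \<sigma>_closed in \<open>cases cs; auto intro: act_closed\<close>)+
qed

lemma unrot_mlin2: "mlin2 K (Suc n) V M (Tn (Suc n)) (%cs m. tp (act u (last cs) # butlast cs) m)"
proof(rule mlin2I)
 show "mlin K (Suc n) V (Tn (Suc n)) (%cs. tp (act u (last cs) # butlast cs) m)" if m: "m :> M" for m
 proof(rule mlin_snocI)
  show "mlin K n V (Tn (Suc n)) (%vs. tp (act u (last (vs @ [v])) # butlast (vs @ [v])) m)" if "v :> V" for v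
  using mlin_tail[OF mlin2_1[OF T.tprod_mlin2 m] act_closed[OF u_closed that]] by simp
  show "(%v. tp (act u (last (vs @ [v])) # butlast (vs @ [v])) m) : lin K V (Tn (Suc n))"
  if "length vs = n" "vs :>* V" for vs
  using lin_comp[OF bilin_right[OF act_facts(1) u_closed] mlin_head[OF mlin2_1[OF T.tprod_mlin2 m] that]] by simp
 qed
 show "tp (act u (last cs) # butlast cs) : lin K M (Tn (Suc n))" if "length cs = Suc n" "cs :>* V" for cs
  by(rule mlin2_2[OF T.tprod_mlin2]) (use that u_closed in \<open>cases cs rule: rev_cases; auto intro: act_closed\<close>)+
qed

lemma rot_lin: "rot n : lin K (Tn (Suc n)) (Tn (Suc n))"
 unfolding rot_def by(rule T.tlift_lin[OF T.mtens rot_mlin2])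

lemma unrot_lin: "unrot n : lin K (Tn (Suc n)) (Tn (Suc n))"
 unfolding unrot_def by(rule T.tlift_lin[OF T.mtens unrot_mlin2])

lemma rot_tprod:
 "length cs = n ==> c :> V ==> cs :>* V ==> m :> M ==> rot n (tp (c # cs) m) = tp (cs @ [act \<sigma> c]) m"
 using T.tlift_tprod[OF T.mtens rot_mlin2, of "c # cs" n m] by(simp add: rot_def)

lemma unrot_tprod:
 "length cs = n ==> c :> V ==> cs :>* V ==> m :> M ==> unrot n (tp (cs @ [c]) m) = tp (act u c # cs) m"
 using T.tlift_tprod[OF T.mtens unrot_mlin2, of "cs @ [c]" n m] by(simp add: unrot_def)

lemma rot_pair: "bij_pair (carrier (Tn (Suc n))) (rot n) (unrot n)"
proof
 fix x assume x: "x :> Tn (Suc n)"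
 show "rot n x :> Tn (Suc n)" "unrot n x :> Tn (Suc n)"
  using lin_cl[OF rot_lin x] lin_cl[OF unrot_lin x] .
 have c: "act u (act \<sigma> v) = v" "act \<sigma> (act u v) = v" if "v :> V" for v
  using act_facts(5)[OF u_closed \<sigma>_closed that] act_facts(5)[OF \<sigma>_closed u_closed that] act_facts(3)[OF that]
  by(simp_all add: \<sigma>u u\<sigma>)
 show "unrot n (rot n x) = x"
 proof(rule T.tens_ext[OF T.mtens lin_comp[OF rot_lin unrot_lin] lin_id _ x])
  fix vs m assume *: "length vs = Suc n" "vs :>* V" "m :> M"
  then obtain v vs' where "vs = v # vs'" by(cases vs) auto
  thus "unrot n (rot n (tp vs m)) = tp vs m" using * by(simp add: rot_tprod unrot_tprod act_closed \<sigma>_closed c)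
 qed
 show "rot n (unrot n x) = x"
 proof(rule T.tens_ext[OF T.mtens lin_comp[OF unrot_lin rot_lin] lin_id _ x])
  fix vs m assume *: "length vs = Suc n" "vs :>* V" "m :> M"
  then obtain v vs' where "vs = vs' @ [v]" by(cases vs rule: rev_cases) auto
  thus "rot n (unrot n (tp vs m)) = tp vs m" using * by(simp add: rot_tprod unrot_tprod act_closed u_closed c)
 qed
qed

abbreviation "rp n \<equiv> ipow (rot n) (unrot n)"

lemma rp_lin: "rp n i : lin K (Tn (Suc n)) (Tn (Suc n))"
proof -
 have p: "(f ^^ k) : lin K W W" if "f : lin K W W" for f :: "('k, 'v, 'm) tensor => ('k, 'v, 'm) tensor" and k and W :: "('k, ('k, 'v, 'm) tensor) module"
  by(induction k) (use that lin_id in \<open>auto simp: id_def comp_def intro: lin_comp\<close>)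
 show ?thesis unfolding ipow_def using p[OF rot_lin] p[OF unrot_lin] by simp
qed

text \<open>Up to one full turn every factor is multiplied by \<sigma> at most once, which keeps the
  formula in terms of \<open>take\<close> and \<open>drop\<close> valid.\<close>

lemma rot_pow_tprod:
 assumes "length cs = Suc n" "cs :>* V" "m :> M"
 shows "r <= Suc n ==> (rot n ^^ r) (tp cs m) = tp (drop r cs @ map (act \<sigma>) (take r cs)) m"
proof(induction r)
 case (Suc r)
 hence r: "r < length cs" using assms(1) by simp
 have "(drop (Suc r) cs @ map (act \<sigma>) (take r cs)) :>* V"
  using assms(2) set_drop_subset[of "Suc r" cs] set_take_subset[of r cs] by(auto intro!: act_closed \<sigma>_closed)
 moreover have "cs ! r :> V" using assms(2) r by(auto intro!: subsetD[OF assms(2)])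
 ultimately show ?case
  using Suc r assms by(simp add: Cons_nth_drop_Suc[OF r, symmetric] rot_tprod take_Suc_conv_app_nth)
qed simp

end

subsection \<open>The quotients of a para-(co)cyclic module\<close>

lemma minus_mem:
 assumes "module K V" "submodule N K V" "x : N" "y : N"
 shows "x -[V] y : N"
 unfolding a_minus_def by(rule submodule_mem(4)[OF assms(1,2) assms(3) submodule_mem(3)[OF assms(1,2,4)]])

lemma lin_pow: "f : lin K V V ==> (f ^^ k) : lin K V V"
proof(induction k)
 case 0
 thus ?case using lin_id by(simp add: id_def)
next
 case (Suc k)
 thus ?case using lin_comp[OF Suc.IH[OF Suc.prems] Suc.prems] by(simp add: comp_def)
qed

text \<open>Collects what forming J and the coinvariants takes: linear operators and a carrier
  stable under the inverse of \<open>cyc\<close>. The (co)cyclic identities of the resulting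
  quotient enter later as the hypothesis \<open>cyc_mod K v HQ\<close>, supplied by membership in
  Ext.\<close>

locale para_quot =
 fixes K :: "'k ring" and v :: variance and H :: "('k, 'h) hopf" and T :: "('k, 't) cmod" and L :: "nat => 'h => 't => 't"
 assumes T_mod: "module K (comp T n)"
  and T_face: "face_ok v n j ==> face T n j : lin K (comp T n) (comp T (face_deg v n))"
  and T_degen: "degen_ok v n j ==> degen T n j : lin K (comp T n) (comp T (degen_deg v n))"
  and T_cyc: "cyc T n : lin K (comp T n) (comp T n)"
  and T_inv: "x :> comp T n ==> inv_into (el T n) (cyc T n) x :> comp T n"
  and T_act: "h :> H ==> L n h : lin K (comp T n) (comp T n)"
  and counit: "h :> H ==> counit H h :> K"
begin

abbreviation "J \<equiv> J_sub K v H T L"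
abbreviation "Q n \<equiv> quot_module (comp T n) (J n)"
abbreviation "Z \<equiv> coinv_ker K v H T L"
abbreviation "HQ \<equiv> hopf_quot K v H T L"
abbreviation "cls \<equiv> hopf_class K v H T L"

lemma int_pow_closed: "x :> comp T n ==> int_pow_map (comp T n) (cyc T n) i x :> comp T n"
proof -
 assume x: "x :> comp T n"
 have "(inv_into (el T n) (cyc T n) ^^ k) x :> comp T n" for k
  by(induction k) (simp_all add: x T_inv)
 thus ?thesis using lin_cl[OF lin_pow[OF T_cyc] x] by(simp add: int_pow_map_def)
qed

lemma gens_closed: "J_gens H T L n <= el T n"
proof -
 interpret V: module K "comp T n" by(rule T_mod)
 show ?thesis unfolding J_gens_def by(auto simp del: funpow.simps
  intro!: V.a_closed V.minus_closed lin_cl[OF T_act] int_pow_closed lin_cl[OF lin_pow[OF T_cyc]])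
qed

lemma whole_para: "para_submodule K v H T L (%n. el T n)" unfolding para_submodule_def
 by(auto simp: module.carrier_is_submodule[OF T_mod] T_inv
  intro: lin_cl[OF T_face] lin_cl[OF T_degen] lin_cl[OF T_cyc] lin_cl[OF T_act])

lemma J_mem: "x : J n \<longleftrightarrow> (ALL N. para_submodule K v H T L N & (ALL k. J_gens H T L k <= N k) --> x : N n)"
 unfolding J_sub_def by auto

lemma J_gens_mem: "J_gens H T L n <= J n" using J_mem by blast

lemma J_least: "para_submodule K v H T L N ==> (!!k. J_gens H T L k <= N k) ==> J n <= N n"
 using J_mem by blast

lemma J_submodule: "submodule (J n) K (comp T n)" unfolding J_sub_def
proof(rule submodule_Inter[OF T_mod])
 show "{N n |N. para_submodule K v H T L N & (ALL k. J_gens H T L k <= N k)} ~= {}"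
  using whole_para gens_closed by blast
qed (auto simp: para_submodule_def)

lemma J_closed: "(!!N. para_submodule K v H T L N ==> f ` N n <= N m) ==> f ` J n <= J m"
 unfolding image_subset_iff by(simp add: J_mem)

lemma J_face: "face_ok v n j ==> face T n j ` J n <= J (face_deg v n)"
 and J_degen: "degen_ok v n j ==> degen T n j ` J n <= J (degen_deg v n)"
 and J_cyc: "cyc T n ` J n <= J n"
 and J_inv: "inv_into (el T n) (cyc T n) ` J n <= J n"
 and J_act: "h :> H ==> L n h ` J n <= J n" by(rule J_closed, simp add: para_submodule_def)+

lemma J_commutator:
 assumes "h :> H" "x :> comp T n"
 shows "L n h (int_pow_map (comp T n) (cyc T n) i x) -[comp T n] int_pow_map (comp T n) (cyc T n) i (L n h x) : J n"
proof -
 interpret V: module K "comp T n" by(rule T_mod)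
 have c: "L n h (int_pow_map (comp T n) (cyc T n) i x) :> comp T n" "int_pow_map (comp T n) (cyc T n) i (L n h x) :> comp T n"
  by(rule lin_cl[OF T_act[OF assms(1)] int_pow_closed[OF assms(2)]] int_pow_closed[OF lin_cl[OF T_act[OF assms(1)] assms(2)]])+
 \<comment> \<open>The generators of J are sums of two kinds of terms; taking \<Phi> = 0 isolates
   the commutator.\<close>
 have "(cyc T n ^^ Suc n) 0[comp T n] -[comp T n] 0[comp T n] = 0[comp T n]"
  using lin_zero[OF T_mod T_mod lin_pow[OF T_cyc[of n], of "Suc n"]] by(simp add: a_minus_def del: funpow.simps)
 hence "(L n h (int_pow_map (comp T n) (cyc T n) i x) -[comp T n] int_pow_map (comp T n) (cyc T n) i (L n h x))
  +[comp T n] ((cyc T n ^^ Suc n) 0[comp T n] -[comp T n] 0[comp T n]) =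
  L n h (int_pow_map (comp T n) (cyc T n) i x) -[comp T n] int_pow_map (comp T n) (cyc T n) i (L n h x)"
  using V.minus_closed[OF c] by simp
 hence "L n h (int_pow_map (comp T n) (cyc T n) i x) -[comp T n] int_pow_map (comp T n) (cyc T n) i (L n h x) : J_gens H T L n"
  unfolding J_gens_def mem_Collect_eq by(intro exI conjI) (rule sym, assumption, (use assms in simp_all))
 thus ?thesis using J_gens_mem by blast
qed

lemma J_power:
 assumes "1[H] :> H" "x :> comp T n"
 shows "(cyc T n ^^ Suc n) x -[comp T n] x : J n"
proof -
 interpret V: module K "comp T n" by(rule T_mod)
 let ?z = "0[comp T n]" and ?h = "1[H]"
 have i0: "int_pow_map (comp T n) (cyc T n) 0 y = y" for y by(simp add: int_pow_map_def)
 have c: "(cyc T n ^^ Suc n) x -[comp T n] x :> comp T n"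
  by(rule V.minus_closed[OF lin_cl[OF lin_pow[OF T_cyc] assms(2)] assms(2)])
 \<comment> \<open>With \<Psi> = 0, h = 1 and i = 0 the commutator vanishes and the term with \<Phi>
   remains.\<close>
 have "(L n ?h (int_pow_map (comp T n) (cyc T n) 0 ?z) -[comp T n] int_pow_map (comp T n) (cyc T n) 0 (L n ?h ?z))
  +[comp T n] ((cyc T n ^^ Suc n) x -[comp T n] x) = (cyc T n ^^ Suc n) x -[comp T n] x"
  unfolding i0 lin_zero[OF T_mod T_mod T_act[OF assms(1)]] using c by(simp add: a_minus_def del: funpow.simps)
 hence "(cyc T n ^^ Suc n) x -[comp T n] x : J_gens H T L n"
  unfolding J_gens_def mem_Collect_eq by(intro exI conjI) (rule sym, assumption, (use assms in simp_all))
 thus ?thesis using J_gens_mem by blast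
qed

lemma module_Q: "module K (Q n)" by(rule module_quot[OF T_mod J_submodule])

lemma comp_Q: "comp (Q_quot K v H T L) n = Q n" by(simp add: cmod_quot_def)

lemma Z_gens_closed: "{induced (comp T n) (J n) (L n h) S -[Q n] (counit H h *[Q n] S) | h S. h :> H & S :> Q n} <= carrier (Q n)"
proof -
 interpret Q: module K "Q n" by(rule module_Q)
 show ?thesis
  by(auto intro!: Q.minus_closed Q.smult_closed counit lin_cl[OF induced_lin[OF T_mod J_submodule T_mod J_submodule T_act J_act]])
qed

lemma Z_submodule: "submodule (Z n) K (Q n)"
 unfolding coinv_ker_def Let_def comp_Q by(rule gen_submodule[OF module_Q Z_gens_closed])

lemma comp_HQ: "comp HQ n = quot_module (Q n) (Z n)" by(simp add: hopf_quot_def cmod_quot_def)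

lemma cls_lin: "cls n : lin K (comp T n) (comp HQ n)"
 unfolding hopf_class_def[abs_def] comp_Q comp_HQ
 by(rule lin_comp[OF coset_lin[OF T_mod J_submodule] coset_lin[OF module_Q Z_submodule]])

lemma carrier_HQ: "el HQ n = cls n ` el T n"
 unfolding comp_HQ hopf_class_def[abs_def] comp_Q by(auto simp: quot_carrier)

lemma module_HQ: "module K (comp HQ n)"
 unfolding comp_HQ by(rule module_quot[OF module_Q Z_submodule])

lemma coset_J_closed: "x :> comp T n ==> J n +>[comp T n] x :> Q n" by(simp add: quot_carrier)

lemma cls_act:
 assumes h: "h :> H" and x: "x :> comp T n"
 shows "cls n (L n h x) = counit H h *[comp HQ n] cls n x"
proof -
 interpret Q: module K "Q n" by(rule module_Q)
 let ?S = "J n +>[comp T n] x"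
 have S: "?S :> Q n" by(rule coset_J_closed[OF x])
 have i: "induced (comp T n) (J n) (L n h) ?S = J n +>[comp T n] L n h x"
  by(rule induced_coset[OF T_mod J_submodule T_mod J_submodule T_act[OF h] J_act[OF h] x])
 have "induced (comp T n) (J n) (L n h) ?S -[Q n] (counit H h *[Q n] ?S) : Z n"
  unfolding coinv_ker_def Let_def comp_Q by(rule subsetD[OF gen_submodule_incl]) (use h S in blast)
 thus ?thesis
  unfolding i hopf_class_def comp_Q comp_HQ quot_smult[OF module_Q Z_submodule counit[OF h] S]
  using coset_eq_iff[OF module_Q Z_submodule coset_J_closed[OF lin_cl[OF T_act[OF h] x]] Q.smult_closed[OF counit[OF h] S]] by simp
qed

lemma HQ_ops:
 "face HQ n j = induced (Q (face_deg v n)) (Z (face_deg v n)) (induced (comp T (face_deg v n)) (J (face_deg v n)) (face T n j))"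
 "degen HQ n j = induced (Q (degen_deg v n)) (Z (degen_deg v n)) (induced (comp T (degen_deg v n)) (J (degen_deg v n)) (degen T n j))"
 "cyc HQ n = induced (Q n) (Z n) (induced (comp T n) (J n) (cyc T n))"
 by(simp_all add: hopf_quot_def cmod_quot_def)

text \<open>The inner \<open>induced\<close> is well defined because f preserves J. For the outer
  one the value is assumed to be a coset, which follows when \<open>HQ\<close> is a (co)cyclic
  module; the union defining it contains the coset of the image of x, so it is that coset.\<close>

lemma cls_op:
 assumes f: "f : lin K (comp T n) (comp T m)" "f ` J n <= J m" and x: "x :> comp T n"
  and c: "induced (Q m) (Z m) (induced (comp T m) (J m) f) (cls n x) :> comp HQ m"
 shows "induced (Q m) (Z m) (induced (comp T m) (J m) f) (cls n x) = cls m (f x)"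
proof -
 have i: "induced (comp T m) (J m) f (J n +>[comp T n] x) = J m +>[comp T m] f x"
  by(rule induced_coset[OF T_mod J_submodule T_mod J_submodule f x])
 from induced_eq_if_coset[OF module_Q Z_submodule module_Q Z_submodule c[unfolded comp_HQ hopf_class_def comp_Q] coset_J_closed[OF x]]
 show ?thesis unfolding i hopf_class_def comp_Q using coset_J_closed[OF lin_cl[OF f(1) x]] by simp
qed

lemma
 assumes C: "cyc_mod K v HQ" and x: "x :> comp T n"
 shows cls_face: "face_ok v n j ==> face HQ n j (cls n x) = cls (face_deg v n) (face T n j x)"
  and cls_degen: "degen_ok v n j ==> degen HQ n j (cls n x) = cls (degen_deg v n) (degen T n j x)"
  and cls_cyc: "cyc HQ n (cls n x) = cls n (cyc T n x)" unfolding HQ_ops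
 by(rule cls_op[OF T_face J_face x], assumption, assumption,
  rule lin_cl[OF cyclicD(2)[OF C, unfolded HQ_ops] lin_cl[OF cls_lin x]], assumption)
  (rule cls_op[OF T_degen J_degen x], assumption, assumption,
  rule lin_cl[OF cyclicD(3)[OF C, unfolded HQ_ops] lin_cl[OF cls_lin x]], assumption,
  rule cls_op[OF T_cyc J_cyc x lin_cl[OF cyclicD(4)[OF C, unfolded HQ_ops] lin_cl[OF cls_lin x]]])

end

text \<open>Commuting with the two actions sends every generator h q - \<epsilon>(h) q of the
  coinvariant relations to one of the same kind, so f descends through both quotients. This is how
  \<alpha> will be evaluated on classes.\<close>

lemma induced_cls:
 assumes "para_quot K v H T L" "para_quot K v' H T' L'"
  and f: "f : lin K (comp T n) (comp T' m)" and fJ: "f ` J_sub K v H T L n <= J_sub K v' H T' L' m"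
  and fL: "!!h x. h :> H ==> x :> comp T n ==> f (L n h x) = L' m h (f x)"
  and x: "x :> comp T n"
 shows "induced (comp (Q_quot K v' H T' L') m) (coinv_ker K v' H T' L' m)
  (induced (comp T' m) (J_sub K v' H T' L' m) f) (hopf_class K v H T L n x) = hopf_class K v' H T' L' m (f x)"
proof -
 interpret A: para_quot K v H T L by fact
 interpret B: para_quot K v' H T' L' by fact
 let ?g = "induced (comp T' m) (B.J m) f"
 note gl = induced_lin[OF A.T_mod A.J_submodule B.T_mod B.J_submodule f fJ]
 note gc = induced_coset[OF A.T_mod A.J_submodule B.T_mod B.J_submodule f fJ]
 interpret QA: module K "A.Q n" by(rule A.module_Q)
 interpret QB: module K "B.Q m" by(rule B.module_Q)
 have "?g ` A.Z n <= B.Z m" unfolding coinv_ker_def[of K v] Let_def A.comp_Q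
 proof(rule gen_submodule_image[OF A.module_Q B.module_Q gl B.Z_submodule A.Z_gens_closed], rule image_subsetI, elim CollectE exE conjE)
  fix S h S' assume S: "S = induced (comp T n) (A.J n) (L n h) S' -[A.Q n] (counit H h *[A.Q n] S')" and h: "h :> H" and S': "S' :> A.Q n"
  obtain y where y: "y :> comp T n" "S' = A.J n +>[comp T n] y" using S' by(rule quot_carrierE)
  have Lc: "induced (comp T n) (A.J n) (L n h) S' :> A.Q n" "counit H h *[A.Q n] S' :> A.Q n"
  using lin_cl[OF induced_lin[OF A.T_mod A.J_submodule A.T_mod A.J_submodule A.T_act[OF h] A.J_act[OF h]] S']
  QA.smult_closed[OF A.counit[OF h] S'] .
  have "?g S = ?g (induced (comp T n) (A.J n) (L n h) S') -[B.Q m] (counit H h *[B.Q m] ?g S')"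
  unfolding S lin_minus[OF A.module_Q B.module_Q gl Lc] lin_smult[OF gl A.counit[OF h] S'] ..
  also have "?g (induced (comp T n) (A.J n) (L n h) S') = induced (comp T' m) (B.J m) (L' m h) (?g S')"
  unfolding y(2) gc[OF y(1)] induced_coset[OF A.T_mod A.J_submodule A.T_mod A.J_submodule A.T_act[OF h] A.J_act[OF h] y(1)]
  gc[OF lin_cl[OF A.T_act[OF h] y(1)]] fL[OF h y(1)]
  induced_coset[OF B.T_mod B.J_submodule B.T_mod B.J_submodule B.T_act[OF h] B.J_act[OF h] lin_cl[OF f y(1)]] ..
  finally show "?g S : B.Z m" unfolding coinv_ker_def Let_def B.comp_Q
  by(simp only:) (rule subsetD[OF gen_submodule_incl], use h lin_cl[OF gl S'] in blast)
 qed
 from induced_coset[OF A.module_Q A.Z_submodule B.module_Q B.Z_submodule gl this A.coset_J_closed[OF x]]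
 show ?thesis unfolding hopf_class_def A.comp_Q B.comp_Q gc[OF x] .
qed

lemma (in abelian_group) minus_split:
 assumes "a :> G" "b :> G" "c :> G"
 shows "a \<ominus> b = (a \<ominus> c) \<oplus> (c \<ominus> b)" "a \<ominus> b = (a \<ominus> c) \<ominus> (b \<ominus> c)" "a \<ominus> b = (c \<ominus> b) \<ominus> (c \<ominus> a)"
proof -
 have *: "\<ominus> c \<oplus> (c \<oplus> d) = d" if "d :> G" for d using assms that by(simp add: r_neg1)
 show 1: "a \<ominus> b = (a \<ominus> c) \<oplus> (c \<ominus> b)"
  using assms by(simp add: a_minus_def a_assoc *)
 show "a \<ominus> b = (a \<ominus> c) \<ominus> (b \<ominus> c)" "a \<ominus> b = (c \<ominus> b) \<ominus> (c \<ominus> a)"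
  unfolding 1 using assms by(simp_all add: a_minus_def minus_add a_comm)
qed

section \<open>The span of the relations defining J\<close>

context hopf_rot begin

text \<open>Powers of \<^const>\<open>rot\<close> up to an equivariant operator: this makes \<open>\<Phi>\<close> preserve the span of the defining relations of \<open>J\<close>.\<close>

definition rot_compatible :: "nat => nat => (('k, 'v, 'm) tensor => ('k, 'v, 'm) tensor) => bool" where
 "rot_compatible n n' \<Phi> \<longleftrightarrow> equivariant (Suc n) (Suc n') \<Phi> \<and>
  (ALL x:carrier (Tn (Suc n)). \<Phi> (rp n (int (Suc n)) x) = rp n' (int (Suc n')) (\<Phi> x)) \<and>
  (ALL i. \<exists>j R. equivariant (Suc n) (Suc n') R & (ALL x:carrier (Tn (Suc n)). \<Phi> (rp n i x) = rp n' j (R x)))"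

lemma rp_closed: "x :> Tn (Suc n) ==> rp n i x :> Tn (Suc n)"
 by(rule bij_pair.ipow_closed[OF rot_pair])

lemma rp_add: "x :> Tn (Suc n) ==> rp n (i + j) x = rp n i (rp n j x)"
 by(rule bij_pair.ipow_add[OF rot_pair])

lemma rp_nat: "rp n (int k) = rot n ^^ k" by(simp add: ipow_def)

lemma rp_0 [simp]: "rp n 0 x = x" by(simp add: ipow_def)

text \<open>An exponent is written as a multiple of the full turn n + 1 plus a remainder r \<le> n.
  Full turns pass through \<Phi> and become full turns of the target, so only the finitely many
  remainders need an operator R.\<close>

lemma rot_compatibleI:
 assumes eq: "equivariant (Suc n) (Suc n') \<Phi>"
  and w: "!!x. x :> Tn (Suc n) ==> \<Phi> ((rot n ^^ Suc n) x) = (rot n' ^^ Suc n') (\<Phi> x)"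
  and base: "!!r. r <= n ==> \<exists>j R. equivariant (Suc n) (Suc n') R & (ALL x:carrier (Tn (Suc n)). \<Phi> ((rot n ^^ r) x) = (rot n' ^^ j) (R x))"
 shows "rot_compatible n n' \<Phi>"
proof -
 let ?N = "int (Suc n)" and ?N' = "int (Suc n')"
 have \<Phi>: "\<Phi> : lin K (Tn (Suc n)) (Tn (Suc n'))" using eq by(simp add: equivariant_def)
 note \<Phi>c = lin_cl[OF \<Phi>]
 have w': "\<Phi> (rp n ?N x) = rp n' ?N' (\<Phi> x)" if "x :> Tn (Suc n)" for x
  using w[OF that] unfolding rp_nat .
 have q: "\<Phi> (rp n (q * ?N) x) = rp n' (q * ?N') (\<Phi> x)" if x: "x :> Tn (Suc n)" for q x
 proof(induction q rule: int_induct[where k=0])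
  case (step1 q)
  have "\<Phi> (rp n ((q + 1) * ?N) x) = \<Phi> (rp n ?N (rp n (q * ?N) x))"
  using rp_add[OF x, of ?N "q * ?N"] by(simp add: algebra_simps)
  also have "... = rp n' ((q + 1) * ?N') (\<Phi> x)"
  using w'[OF rp_closed[OF x]] step1 rp_add[OF \<Phi>c[OF x], of ?N' "q * ?N'"] by(simp add: algebra_simps)
  finally show ?case .
 next
  \<comment> \<open>For negative exponents one full turn is added, moved through \<Phi>, and
    cancelled in the target, where the rotation is invertible.\<close>
  case (step2 q)
  let ?y = "rp n ((q - 1) * ?N) x"
  note y = rp_closed[OF x, of "(q - 1) * ?N"]
  have "rp n' ?N' (\<Phi> ?y) = \<Phi> (rp n ?N ?y)" using w'[OF y] by simp
  also have "rp n ?N ?y = rp n (q * ?N) x"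
  using rp_add[OF x, of ?N "(q - 1) * ?N"] by(simp add: algebra_simps)
  also have "\<Phi> (rp n (q * ?N) x) = rp n' (q * ?N') (\<Phi> x)" by(rule step2)
  finally have "rp n' (- ?N') (rp n' ?N' (\<Phi> ?y)) = rp n' (- ?N') (rp n' (q * ?N') (\<Phi> x))" by simp
  thus ?case
  using rp_add[OF \<Phi>c[OF y], of "- ?N'" ?N'] rp_add[OF \<Phi>c[OF x], of "- ?N'" "q * ?N'"] by(simp add: algebra_simps)
 qed simp
 have "\<exists>j R. equivariant (Suc n) (Suc n') R & (ALL x:carrier (Tn (Suc n)). \<Phi> (rp n i x) = rp n' j (R x))" for i
 proof -
  define r where "r = nat (i mod ?N)"
  have r: "int r = i mod ?N" "r <= n"
  proof -
  have "0 < ?N" by simp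
  from pos_mod_bound[OF this, of i] pos_mod_sign[OF this, of i]
  show "int r = i mod ?N" "r <= n" unfolding r_def by linarith+
  qed
  obtain j R where R: "equivariant (Suc n) (Suc n') R" "!!x. x :> Tn (Suc n) ==> \<Phi> ((rot n ^^ r) x) = (rot n' ^^ j) (R x)"
  using base[OF r(2)] by blast
  have Rc: "R x :> Tn (Suc n')" if "x :> Tn (Suc n)" for x
  using R(1) lin_cl[OF _ that] by(auto simp: equivariant_def)
  have "\<Phi> (rp n i x) = rp n' (i div ?N * ?N' + int j) (R x)" if x: "x :> Tn (Suc n)" for x
  proof -
  have "i = i div ?N * ?N + int r" using r(1) by(simp only: div_mult_mod_eq)
  hence "\<Phi> (rp n i x) = \<Phi> (rp n (i div ?N * ?N) (rp n (int r) x))" using rp_add[OF x] by metis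
  also have "... = rp n' (i div ?N * ?N') (rp n' (int j) (R x))"
  unfolding q[OF rp_closed[OF x]] using R(2)[OF x] by(simp add: rp_nat)
  finally show ?thesis using rp_add[OF Rc[OF x]] by simp
  qed
  thus ?thesis using R(1) by blast
 qed
 thus ?thesis using eq w' by(simp add: rot_compatible_def)
qed

definition comm :: "nat => 'h => int => ('k, 'v, 'm) tensor => ('k, 'v, 'm) tensor" where
 "comm n h i x = diag (Suc n) h (rp n i x) -[Tn (Suc n)] rp n i (diag (Suc n) h x)"

definition twist :: "nat => ('k, 'v, 'm) tensor => ('k, 'v, 'm) tensor" where
 "twist n x = rp n (int (Suc n)) x -[Tn (Suc n)] x"

definition gens :: "nat => ('k, 'v, 'm) tensor set" where
 "gens n = {comm n h i x +[Tn (Suc n)] twist n y | h i x y.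
  h :> H & x :> Tn (Suc n) & y :> Tn (Suc n)}"

text \<open>The bare K-span of the relations of J, without closing it under the operators. The
  following lemmas show that it is closed already.\<close>

definition span :: "nat => ('k, 'v, 'm) tensor set" where
 "span n = gen_submodule K (Tn (Suc n)) (gens n)"

lemma comm_closed: "h :> H ==> x :> Tn (Suc n) ==> comm n h i x :> Tn (Suc n)"
proof -
 interpret U: module K "Tn (Suc n)" by(rule T.mtens)
 show "h :> H ==> x :> Tn (Suc n) ==> comm n h i x :> Tn (Suc n)"
  unfolding comm_def by(intro U.minus_closed diag_closed rp_closed)
qed

lemma twist_closed: "x :> Tn (Suc n) ==> twist n x :> Tn (Suc n)"
proof -
 interpret U: module K "Tn (Suc n)" by(rule T.mtens)
 show "x :> Tn (Suc n) ==> twist n x :> Tn (Suc n)"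
  unfolding twist_def by(intro U.minus_closed rp_closed)
qed

lemma gens_closed: "gens n <= carrier (Tn (Suc n))"
proof -
 interpret U: module K "Tn (Suc n)" by(rule T.mtens)
 show ?thesis unfolding gens_def by(auto intro!: U.a_closed comm_closed twist_closed)
qed

lemma span_submodule: "submodule (span n) K (Tn (Suc n))"
 unfolding span_def by(rule gen_submodule[OF T.mtens gens_closed])

lemma gens_span: "gens n <= span n" unfolding span_def by(rule gen_submodule_incl)

lemma comm_mem:
 assumes "h :> H" "x :> Tn (Suc n)"
 shows "comm n h i x : span n"
proof -
 interpret U: module K "Tn (Suc n)" by(rule T.mtens)
 have "twist n 0[Tn (Suc n)] = 0[Tn (Suc n)]"
  unfolding twist_def lin_zero[OF T.mtens T.mtens rp_lin] by(simp add: a_minus_def)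
 hence "comm n h i x = comm n h i x +[Tn (Suc n)] twist n 0[Tn (Suc n)]" using comm_closed[OF assms] by simp
 hence "comm n h i x : gens n" unfolding gens_def using assms U.zero_closed by blast
 thus ?thesis using gens_span by blast
qed

lemma twist_mem:
 assumes "x :> Tn (Suc n)"
 shows "twist n x : span n"
proof -
 interpret U: module K "Tn (Suc n)" by(rule T.mtens)
 have "comm n 1[H] 0 0[Tn (Suc n)] = 0[Tn (Suc n)]" by(simp add: comm_def diag_one a_minus_def)
 hence "twist n x = comm n 1[H] 0 0[Tn (Suc n)] +[Tn (Suc n)] twist n x" using twist_closed[OF assms] by simp
 hence "twist n x : gens n" unfolding gens_def using assms U.zero_closed H.one_closed by blast
 thus ?thesis using gens_span by blast
qed

lemma span_image:
 assumes F: "F : lin K (Tn (Suc n)) W" and W: "module K W" and N: "submodule N K W"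
  and "!!h i x. h :> H ==> x :> Tn (Suc n) ==> F (comm n h i x) : N"
  and "!!x. x :> Tn (Suc n) ==> F (twist n x) : N"
 shows "F ` span n <= N" unfolding span_def
proof(rule gen_submodule_image[OF T.mtens W F N gens_closed], rule image_subsetI)
 fix z assume "z : gens n"
 then obtain h i x y where *: "z = comm n h i x +[Tn (Suc n)] twist n y" "h :> H" "x :> Tn (Suc n)" "y :> Tn (Suc n)"
  unfolding gens_def by blast
 show "F z : N" unfolding *(1) lin_add[OF F comm_closed[OF *(2,3)] twist_closed[OF *(4)]]
  by(rule submodule_mem(4)[OF W N assms(4)[OF *(2,3)] assms(5)[OF *(4)]])
qed

lemma rp_commute: "x :> Tn (Suc n) ==> rp n i (rp n j x) = rp n j (rp n i x)"
 using rp_add[of x n i j] rp_add[of x n j i] by(simp add: add.commute)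

text \<open>With \<rho> the rotation, \<open>\<rho>\<^sup>k [L, \<rho>\<^sup>i]\<close> =
  \<open>[L, \<rho>\<^sup>k\<^sup>+\<^sup>i]\<close> -
  \<open>[L, \<rho>\<^sup>k] \<rho>\<^sup>i\<close>, a difference of two commutators; the terms of
  type \<open>twist\<close> commute with powers of \<rho>.\<close>

lemma span_rp: "rp n k ` span n <= span n"
proof(rule span_image[OF rp_lin T.mtens span_submodule])
 interpret U: module K "Tn (Suc n)" by(rule T.mtens)
 fix h i x assume h: "h :> H" and x: "x :> Tn (Suc n)"
 note c = rp_closed diag_closed[OF h]
 have "rp n k (comm n h i x) = rp n k (diag (Suc n) h (rp n i x)) -[Tn (Suc n)] rp n (k + i) (diag (Suc n) h x)"
  unfolding comm_def by(subst lin_minus[OF T.mtens T.mtens rp_lin]) (simp_all add: c x rp_add)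
 also have "... = comm n h (k + i) x -[Tn (Suc n)] comm n h k (rp n i x)"
  unfolding comm_def rp_add[OF x, of k i] by(rule U.minus_split(3)) (intro c x h)+
 finally show "rp n k (comm n h i x) : span n"
  using minus_mem[OF T.mtens span_submodule comm_mem comm_mem] h x c by simp
next
 fix x assume x: "x :> Tn (Suc n)"
 have "rp n k (twist n x) = twist n (rp n k x)"
  unfolding twist_def lin_minus[OF T.mtens T.mtens rp_lin rp_closed[OF x] x] rp_commute[OF x, of k] ..
 thus "rp n k (twist n x) : span n" using twist_mem[OF rp_closed[OF x]] by simp
qed

text \<open>Two identities: \<open>L\<^sub>g [L\<^sub>h, \<rho>\<^sup>i]\<close> =
  \<open>[L\<^sub>g\<^sub>h, \<rho>\<^sup>i]\<close> -
  \<open>[L\<^sub>g, \<rho>\<^sup>i] L\<^sub>h\<close>, and applying \<open>L\<^sub>g\<close> to a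
  \<open>twist\<close> gives a commutator with the full turn plus the \<open>twist\<close> of
  \<open>L\<^sub>g\<close> x.\<close>

lemma span_diag:
 assumes g: "g :> H"
 shows "diag (Suc n) g ` span n <= span n"
proof(rule span_image[OF diag_lin[OF g] T.mtens span_submodule])
 interpret U: module K "Tn (Suc n)" by(rule T.mtens)
 fix x assume x: "x :> Tn (Suc n)"
 note c = rp_closed diag_closed
 { fix h i assume h: "h :> H"
  have "diag (Suc n) g (comm n h i x) = comm n (g **[H] h) i x -[Tn (Suc n)] comm n g i (diag (Suc n) h x)"
  unfolding comm_def lin_minus[OF T.mtens T.mtens diag_lin[OF g] diag_closed[OF h rp_closed[OF x]] rp_closed[OF diag_closed[OF h x]]]
  diag_mult[OF g h x] diag_mult[OF g h rp_closed[OF x]] by(rule U.minus_split(2)) (intro c g h x)+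
  thus "diag (Suc n) g (comm n h i x) : span n"
  using minus_mem[OF T.mtens span_submodule comm_mem comm_mem] g h x c by simp }
 have "diag (Suc n) g (twist n x) = comm n g (int (Suc n)) x +[Tn (Suc n)] twist n (diag (Suc n) g x)"
  unfolding comm_def twist_def lin_minus[OF T.mtens T.mtens diag_lin[OF g] rp_closed[OF x] x]
  by(rule U.minus_split(1)) (intro c g x)+
 thus "diag (Suc n) g (twist n x) : span n"
  using submodule_mem(4)[OF T.mtens span_submodule comm_mem twist_mem] g x c by simp
qed

text \<open>Both terms of a commutator are moved through \<Phi> with the same exponent j and the
  same equivariant R, so the result is the commutator of h with the j-th power, evaluated at R
  x.\<close>

lemma span_compatible:
 assumes "rot_compatible n n' \<Phi>"
 shows "\<Phi> ` span n <= span n'"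
proof -
 have \<Phi>: "\<Phi> : lin K (Tn (Suc n)) (Tn (Suc n'))"
  and \<Phi>h: "!!h x. h :> H ==> x :> Tn (Suc n) ==> \<Phi> (diag (Suc n) h x) = diag (Suc n') h (\<Phi> x)"
  and w: "!!x. x :> Tn (Suc n) ==> \<Phi> (rp n (int (Suc n)) x) = rp n' (int (Suc n')) (\<Phi> x)"
  and ex: "!!i. \<exists>j R. equivariant (Suc n) (Suc n') R & (ALL x:carrier (Tn (Suc n)). \<Phi> (rp n i x) = rp n' j (R x))"
  using assms by(simp_all only: rot_compatible_def equivariant_def)
 show ?thesis
 proof(rule span_image[OF \<Phi> T.mtens span_submodule])
  fix h i x assume h: "h :> H" and x: "x :> Tn (Suc n)"
  obtain j R where R: "equivariant (Suc n) (Suc n') R" "!!x. x :> Tn (Suc n) ==> \<Phi> (rp n i x) = rp n' j (R x)"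
  using ex[of i] by blast
  have Rc: "R x :> Tn (Suc n')" and Rh: "R (diag (Suc n) h x) = diag (Suc n') h (R x)"
  using R(1) lin_cl[OF _ x] h x by(auto simp: equivariant_def)
  have "\<Phi> (comm n h i x) = comm n' h j (R x)"
  unfolding comm_def lin_minus[OF T.mtens T.mtens \<Phi> diag_closed[OF h rp_closed[OF x]] rp_closed[OF diag_closed[OF h x]]]
  \<Phi>h[OF h rp_closed[OF x]] R(2)[OF x] R(2)[OF diag_closed[OF h x]] Rh ..
  thus "\<Phi> (comm n h i x) : span n'" using comm_mem[OF h Rc] by simp
 next
  fix x assume x: "x :> Tn (Suc n)"
  have "\<Phi> (twist n x) = twist n' (\<Phi> x)"
  unfolding twist_def lin_minus[OF T.mtens T.mtens \<Phi> rp_closed[OF x] x] w[OF x] ..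
  thus "\<Phi> (twist n x) : span n'" using twist_mem[OF lin_cl[OF \<Phi> x]] by simp
 qed
qed

end

subsection \<open>The para-cocyclic module of the Hopf algebra\<close>

lemma (in tensor) tprod1_bilin: "(%v w. tprod K V W [v] w) : bilin K V W (tens K 1 V W)"
proof(rule bilinI)
 show "tprod K V W [v] : lin K W (tens K 1 V W)" if "v :> V" for v
  using mlin2_2[OF tprod_mlin2[of 1], of "[v]"] that by simp
 show "(%v. tprod K V W [v] w) : lin K V (tens K 1 V W)" if "w :> W" for w
  using mlin_head[OF mlin2_1[OF tprod_mlin2[of 1] that, unfolded One_nat_def], of "[]"] by simp
qed

lemma inv_into_lin:
 assumes V: "module K V" and f: "f : lin K V V" and b: "bij_betw f (carrier V) (carrier V)"
 shows "inv_into (carrier V) f : lin K V V"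
proof -
 interpret V: module K V by fact
 have img: "f ` carrier V = carrier V" and inj: "inj_on f (carrier V)" using b by(auto simp: bij_betw_def)
 have c: "inv_into (carrier V) f x :> V" "f (inv_into (carrier V) f x) = x" if "x :> V" for x
  using that img inv_into_into[of x f "carrier V"] f_inv_into_f[of x f "carrier V"] by auto
 have e: "inv_into (carrier V) f y = z" if "z :> V" "f z = y" for y z
  using inv_into_f_f[OF inj that(1)] that(2) by simp
 show ?thesis by(rule lin_mapsI) (auto intro!: e c simp: lin_add[OF f] lin_smult[OF f] c)
qed

lemma k_sigma_delta_sel [simp]:
 "carrier (k_sigma_delta K H \<sigma> \<delta>) = carrier K"
 "a +[k_sigma_delta K H \<sigma> \<delta>] b = a +[K] b"
 "a *[k_sigma_delta K H \<sigma> \<delta>] b = a **[K] b"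
 "hact (k_sigma_delta K H \<sigma> \<delta>) = (%h m. \<delta> h **[K] m)"
 by(simp_all add: k_sigma_delta_def module.defs self_module_def)

text \<open>The coaction in \<open>k_sigma_delta\<close> is written with
  \<open>self_module K\<close>, while all tensor products below use the extended record. A tensor
  product depends on carrier, addition and scalar multiplication only, and these coincide.\<close>

lemma tens_k_sigma_delta:
 "tens K n V (self_module K) = tens K n V (k_sigma_delta K H \<sigma> \<delta>)"
 "tprod K V (self_module K) = tprod K V (k_sigma_delta K H \<sigma> \<delta>)"
proof -
 have i: "tens_index n V (self_module K) = tens_index n V (k_sigma_delta K H \<sigma> \<delta>)" for n
  by(simp add: tens_index_def)
 have r: "tens_rels K n V (self_module K) = tens_rels K n V (k_sigma_delta K H \<sigma> \<delta>)" for n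
  by(simp add: tens_rels_def i)
 show "tens K n V (self_module K) = tens K n V (k_sigma_delta K H \<sigma> \<delta>)"
  "tprod K V (self_module K) = tprod K V (k_sigma_delta K H \<sigma> \<delta>)"
  by(simp_all add: tens_def tens_ker_def tprod_def[abs_def] i r)
qed

lemma coact_k_sigma_delta: "coact (k_sigma_delta K H \<sigma> \<delta>) m = tprod K H (k_sigma_delta K H \<sigma> \<delta>) [\<sigma>] m"
 unfolding tens_k_sigma_delta(2)[symmetric] by(simp add: k_sigma_delta_def module.defs)

locale hopf_pair = hopf_alg K H for K :: "'k ring" and H :: "('k, 'h) hopf" +
 fixes \<sigma> :: 'h and \<delta> :: "'h => 'k"
 assumes antipode_bij: "bij_betw (antipode H) (carrier H) (carrier H)"
  and mpi: "modular_pair_in_involution K H \<sigma> \<delta>"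
begin

abbreviation "M \<equiv> k_sigma_delta K H \<sigma> \<delta>"
abbreviation "u \<equiv> antipode_inv H \<sigma>"

lemma pair_facts:
 "\<sigma> :> H" "comult H \<sigma> = tprod K H H [\<sigma>] \<sigma>" "counit H \<sigma> = 1[K]"
 "character K H \<delta>" "SAYD K H M" "left_module K H M (hact M)"
 using mpi unfolding modular_pair_in_involution_def group_like_def SAYD_def by simp_all

sublocale C: hopf_act K H M H "monoid.mult H"
proof
 show "left_module K H M (hact M)" by(rule pair_facts)
 show "left_module K H H (monoid.mult H)"
  unfolding left_module_def using hopf_facts(3,4) by(simp add: H.m_assoc)
qed

lemma antipode_inv_lin: "antipode_inv H : lin K H H"
 unfolding antipode_inv_def by(rule inv_into_lin[OF hopf_facts(3,7) antipode_bij])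

lemma u_closed: "u :> H" by(rule lin_cl[OF antipode_inv_lin pair_facts(1)])

lemma delta_lin: "\<delta> : lin K H M"
proof -
 have "\<delta> : lin K H (self_module K)" using pair_facts(4) by(simp add: character_def)
 thus ?thesis by(simp add: lin_maps_def)
qed

text \<open>Stability evaluated at 1: the coaction gives \<sigma> \<otimes> 1, and \<sigma> acts on
  1 by \<delta>(\<sigma>).\<close>

lemma delta_sigma: "\<delta> \<sigma> = 1[K]"
proof -
 have "ALL m:carrier M. sweedler K M (%x m0. hact M x m0) (coact M m) = m"
  using pair_facts(5) unfolding SAYD_def by blast
 hence "sweedler K M (%x m0. hact M x m0) (coact M 1[K]) = 1[K]" by simp
 moreover have "sweedler K M (%x m0. hact M x m0) (coact M 1[K]) = hact M \<sigma> 1[K]"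
  unfolding coact_k_sigma_delta
  by(rule C.T.sweedler_tprod[OF C.T.module_W C.act_facts(2) pair_facts(1)]) simp
 ultimately show ?thesis using lin_cl[OF delta_lin pair_facts(1)] by simp
qed

lemma iter_sigma: "iter_comult K H 2 \<sigma> = tprod K H H [\<sigma>, \<sigma>] \<sigma>"
proof -
 have s: "iter_comult K H (Suc n) \<sigma> = tcons K H H n \<sigma> (iter_comult K H n \<sigma>)" for n
  unfolding iter_comult_Suc
  by(rule sw_group_like[OF mtens bilin_lin2[OF tcons_bilin iter_lin] pair_facts(1,2)])
 show ?thesis unfolding numeral_2_eq_2 s using pair_facts(1) by(simp add: tcons_tprod)
qed

text \<open>The anti-Yetter-Drinfeld condition at h = \<sigma> and m = 1 reads \<sigma> \<otimes> 1
  = \<sigma> \<sigma> u \<otimes> 1. The antipode axiom gives S(\<sigma>) \<sigma> = 1; cancelling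
  with it yields \<sigma> u = 1, and then S(\<sigma>) = S(\<sigma>) \<sigma> u = u, so u is also a
  left inverse.\<close>

lemma sigma_inverse: "u **[H] \<sigma> = 1[H]" "\<sigma> **[H] u = 1[H]"
proof -
 let ?T = "tens K 1 H M" and ?tp = "tprod K H M"
 note \<sigma> = pair_facts(1)
 let ?g = "%hs h3. ?tp [hs ! 0 **[H] \<sigma> **[H] antipode_inv H h3] (hact M (hs ! 1) 1[K])"
 let ?f = "%hs h3. sweedler K ?T (%x m0. ?tp [hs ! 0 **[H] x **[H] antipode_inv H h3] (hact M (hs ! 1) m0)) (coact M 1[K])"
 have oneM: "1[K] :> M" by simp
 have Sc: "antipode_inv H z :> H" if "z :> H" for z by(rule lin_cl[OF antipode_inv_lin that])
 note mr = bilin_right[OF hopf_facts(4)] and ml = bilin_left[OF hopf_facts(4)]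
 have hs2: "\<exists>x y. hs = [x, y] & x :> H & y :> H" if "length hs = Suc (Suc 0)" "hs :>* H" for hs
  using that by(auto simp: length_Suc_conv)
 have g: "mlin2 K (Suc (Suc 0)) H H ?T ?g"
 proof(rule mlin2I)
  show "mlin K (Suc (Suc 0)) H ?T (%hs. ?g hs w)" if w: "w :> H" for w
  proof(rule mlin_ConsI)
  fix v assume v: "v :> H"
  show "mlin K (Suc 0) H ?T (%vs. ?g (v # vs) w)"
  proof(rule mlin_ConsI)
  show "mlin K 0 H ?T (%vs. ?g (v # a # vs) w)" if "a :> H" for a
  using that v w \<sigma> bilin_closed[OF C.T.tprod1_bilin] C.hact_closed[OF _ oneM]
  by(intro mlin_0) (simp add: Sc)
  show "(%a. ?g (v # a # vs) w) : lin K H ?T" for vs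
  using lin_comp[OF bilin_left[OF C.act_facts(2) oneM] bilin_right[OF C.T.tprod1_bilin]] v w \<sigma> Sc by simp
  qed
  next
  fix vs assume vs: "length vs = Suc 0" "vs :>* H"
  then obtain y where y: "vs = [y]" "y :> H" by(auto simp: length_Suc_conv)
  show "(%v. ?g (v # vs) w) : lin K H ?T"
  using lin_comp[OF lin_comp[OF ml[OF \<sigma>] ml[OF Sc[OF w]]] bilin_left[OF C.T.tprod1_bilin C.hact_closed[OF y(2) oneM]]] y(1) by simp
  qed
  show "?g hs : lin K H ?T" if hs: "length hs = Suc (Suc 0)" "hs :>* H" for hs
  proof -
  obtain x y where xy: "hs = [x, y]" "x :> H" "y :> H" using hs2[OF hs] by blast
  show ?thesis
  using lin_comp[OF lin_comp[OF antipode_inv_lin mr] bilin_left[OF C.T.tprod1_bilin C.hact_closed[OF xy(3) oneM]], of "x **[H] \<sigma>"] xy \<sigma>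
  by simp
  qed
 qed
 have fg: "?g hs h3 = ?f hs h3" if hs: "length hs = Suc (Suc 0)" "hs :>* H" "h3 :> H" for hs h3
 proof -
  obtain x y where xy: "hs = [x, y]" "x :> H" "y :> H" using hs2[OF hs(1,2)] by blast
  have b: "(%z m. ?tp [x **[H] z **[H] antipode_inv H h3] (hact M y m)) : bilin K H M ?T"
  by(rule bilin_lin1[OF bilin_lin2[OF C.T.tprod1_bilin bilin_right[OF C.act_facts(2) xy(3)]] lin_comp[OF mr[OF xy(2)] ml[OF Sc[OF hs(3)]]]])
  show ?thesis using C.T.sweedler_tprod[OF C.T.mtens b \<sigma> oneM] xy by(simp add: coact_k_sigma_delta)
 qed
 have f: "mlin2 K (Suc (Suc 0)) H H ?T ?f" by(rule mlin2_cong[OF hopf_facts(3,3) g fg])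
 have ax: "ALL h:carrier H. ALL m:carrier M. coact M (hact M h m) = tlift K ?T
  (%hs h3. sweedler K ?T (%x m0. ?tp [hs ! 0 **[H] x **[H] antipode_inv H h3] (hact M (hs ! 1) m0)) (coact M m))
  (iter_comult K H 2 h)" using pair_facts(5) unfolding SAYD_def by blast
 have "coact M (hact M \<sigma> 1[K]) = tlift K ?T ?f (tprod K H H [\<sigma>, \<sigma>] \<sigma>)"
  using bspec[OF bspec[OF ax \<sigma>] oneM] unfolding iter_sigma .
 also have "... = ?f [\<sigma>, \<sigma>] \<sigma>" by(rule tlift_tprod[OF C.T.mtens f]) (use \<sigma> in simp_all)
 also have "... = ?g [\<sigma>, \<sigma>] \<sigma>" by(rule fg[symmetric]) (use \<sigma> in simp_all)
 finally have e: "?tp [\<sigma>] 1[K] = ?tp [\<sigma> **[H] \<sigma> **[H] u] 1[K]"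
  by(simp add: delta_sigma coact_k_sigma_delta)
 \<comment> \<open>Contracting H \<otimes> M to H by scalar multiplication turns the equation of
   pure tensors into an equation in H.\<close>
 have b: "(%h m. m *[H] h) : bilin K H M H"
 proof(rule bilinI)
  have "(%m. m *[H] h) : lin K (self_module K) H" if "h :> H" for h
  by(rule lin_smult_left[OF hopf_facts(3) lin_id that])
  thus "(%m. m *[H] h) : lin K M H" if "h :> H" for h using that by(simp add: lin_maps_def)
  show "(%h. m *[H] h) : lin K H H" if "m :> M" for m
  by(rule lin_smult_map[OF hopf_facts(3) _ lin_id]) (use that in simp)
 qed
 have su: "\<sigma> **[H] \<sigma> **[H] u :> H" using \<sigma> u_closed by simp
 have e': "\<sigma> = \<sigma> **[H] \<sigma> **[H] u"
  using arg_cong[OF e, of "sweedler K H (%h m. m *[H] h)"] \<sigma> su oneM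
  unfolding C.T.sweedler_tprod[OF hopf_facts(3) b \<sigma> oneM] C.T.sweedler_tprod[OF hopf_facts(3) b su oneM] by simp
 let ?s = "antipode H \<sigma>"
 have s: "?s :> H" by(rule lin_cl[OF hopf_facts(7) \<sigma>])
 have "sw H (%x y. antipode H x **[H] y) \<sigma> = 1[H]"
  using hopf \<sigma> pair_facts(3) unfolding hopf_algebra_def by simp
 hence s\<sigma>: "?s **[H] \<sigma> = 1[H]"
  using sw_group_like[OF hopf_facts(3) bilin_lin1[OF hopf_facts(4,7)] pair_facts(1,2)] by simp
 have "?s **[H] \<sigma> = ?s **[H] (\<sigma> **[H] \<sigma> **[H] u)" by(rule arg_cong[OF e'])
 also have "... = (?s **[H] \<sigma>) **[H] (\<sigma> **[H] u)" using s \<sigma> u_closed by(simp add: H.m_assoc)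
 finally show su1: "\<sigma> **[H] u = 1[H]" unfolding s\<sigma> using \<sigma> u_closed by simp
 have "?s = (?s **[H] \<sigma>) **[H] u" using s \<sigma> u_closed by(simp add: H.m_assoc su1)
 hence "?s = u" unfolding s\<sigma> using u_closed by simp
 thus "u **[H] \<sigma> = 1[H]" using s\<sigma> by simp
qed

end

lemma bilin_cong:
 assumes "module K U" "module K V" "b : bilin K U V W"
  and "!!u v. u :> U ==> v :> V ==> b u v = b' u v"
 shows "b' : bilin K U V W" by(rule bilinI)
  (rule lin_cong[OF assms(2) bilin_right[OF assms(3)] assms(4)] lin_cong[OF assms(1) bilin_left[OF assms(3)] assms(4)]; assumption)+

lemma (in tensor) tlift_eq:
 assumes U: "module K U" and f: "mlin2 K n V W U f"
  and eq: "!!vs w. length vs = n ==> vs :>* V ==> w :> W ==> f vs w = g vs w"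
 shows "tlift K U g : lin K (tens K n V W) U" and "t :> tens K n V W ==> tlift K U g t = tlift K U f t"
proof -
 have g: "mlin2 K n V W U g" by(rule mlin2_cong[OF module_V module_W f eq])
 show "tlift K U g : lin K (tens K n V W) U" by(rule tlift_lin[OF U g])
 show "tlift K U g t = tlift K U f t" if "t :> tens K n V W"
  by(rule tlift_cong[OF U g f _ that]) (simp add: eq)
qed

lemma (in hopf_alg) sw_eq:
 assumes "module K U" "f : bilin K H H U" "h :> H"
  and "!!x y. x :> H ==> y :> H ==> f x y = g x y"
 shows "sw U g h = sw U f h"
 by(rule sw_cong[OF assms(1) bilin_cong[OF hopf_facts(3,3) assms(2,4)] assms(2,3)]) (simp_all add: assms(4))

lemma bij_pair_cong:
 assumes "bij_pair S f g" "!!x. x : S ==> f' x = f x"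
 shows "bij_pair S f' g" and "x : S ==> ipow f' g i x = ipow f g i x" and "x : S ==> (f' ^^ k) x = (f ^^ k) x"
proof -
 interpret bij_pair S f g by fact
 show "bij_pair S f' g" by unfold_locales (simp_all add: assms(2) f_closed g_closed gf fg)
 have p: "(f' ^^ k) x = (f ^^ k) x" if "x : S" for k x
  by(induction k) (simp_all add: assms(2) f_pow_closed that)
 thus "x : S ==> (f' ^^ k) x = (f ^^ k) x" .
 show "x : S ==> ipow f' g i x = ipow f g i x" by(simp add: ipow_def p)
qed

section \<open>Comultiplication and counit on a single tensor factor\<close>

context hopf_pair begin

sublocale C: hopf_rot K H M H "monoid.mult H" \<sigma> u
 by unfold_locales (rule pair_facts(1) u_closed sigma_inverse)+

lemma coact_sweedler:
 assumes "module K U" "b : bilin K H M U" "m :> M"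
 shows "sweedler K U b (coact M m) = b \<sigma> m"
 unfolding coact_k_sigma_delta by(rule C.T.sweedler_tprod[OF assms(1,2) pair_facts(1) assms(3)])

definition P :: "nat => ('k, 'h, 'k) tensor => ('k, 'h, 'k) tensor" where
 "P n = T_coalg_face0 K H M n"

lemma cons_cons_bilin:
 "y :> C.Tn n ==> (%a b. C.cons (Suc n) a (C.cons n b y)) : bilin K H H (C.Tn (Suc (Suc n)))"
 by(rule bilin_lin2[OF C.T.tcons_bilin bilin_left[OF C.T.tcons_bilin]])

lemma comult_cons_bilin:
 "(%v y. sw (C.Tn (Suc (Suc n))) (%a b. C.cons (Suc n) a (C.cons n b y)) v) : bilin K H (C.Tn n) (C.Tn (Suc (Suc n)))"
proof(rule bilinI)
 show "(%y. sw (C.Tn (Suc (Suc n))) (%a b. C.cons (Suc n) a (C.cons n b y)) v) : lin K (C.Tn n) (C.Tn (Suc (Suc n)))"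
  if v: "v :> H" for v
  by(rule sw_param[OF C.T.mtens C.T.mtens cons_cons_bilin lin_comp[OF C.T.tcons_lin C.T.tcons_lin] v])
 show "(%v. sw (C.Tn (Suc (Suc n))) (%a b. C.cons (Suc n) a (C.cons n b y)) v) : lin K H (C.Tn (Suc (Suc n)))"
  if "y :> C.Tn n" for y by(rule sw_lin[OF C.T.mtens cons_cons_bilin[OF that]])
qed

lemma P_facts:
 "P n : lin K (C.Tn (Suc n)) (C.Tn (Suc (Suc n)))"
 "v :> H ==> y :> C.Tn n ==>
  P n (C.cons n v y) = sw (C.Tn (Suc (Suc n))) (%a b. C.cons (Suc n) a (C.cons n b y)) v"
proof -
 have eq: "sw (C.Tn (Suc (Suc n))) (%x y. C.tp (x # y # vs) m) v =
  sw (C.Tn (Suc (Suc n))) (%a b. C.cons (Suc n) a (C.cons n b (C.tp vs m))) v"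
  if "v :> H" "length vs = n" "vs :>* H" "m :> M" for v vs m
  by(rule sw_eq[OF C.T.mtens cons_cons_bilin[OF C.T.tprod_closed[OF that(2-4)]] that(1)])
  (use that in \<open>simp add: C.T.tcons_tprod\<close>)
 note S = C.T.split_first[OF C.T.mtens comult_cons_bilin[of n],
  where f="%cs m. sweedler K (C.Tn (Suc (Suc n))) (%x y. C.tp (x # y # tl cs) m) (comult H (hd cs))"]
 show "P n : lin K (C.Tn (Suc n)) (C.Tn (Suc (Suc n)))"
  unfolding P_def T_coalg_face0_def add_2_eq_Suc' by(rule S(2)) (simp add: eq)
 show "P n (C.cons n v y) = sw (C.Tn (Suc (Suc n))) (%a b. C.cons (Suc n) a (C.cons n b y)) v"
  if "v :> H" "y :> C.Tn n"
  unfolding P_def T_coalg_face0_def add_2_eq_Suc' by(rule S(3)) (simp_all add: eq that)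
qed

lemma P_tprod:
 assumes "v :> H" "length vs = n" "vs :>* H" "m :> M"
 shows "P n (C.tp (v # vs) m) = sw (C.Tn (Suc (Suc n))) (%a b. C.tp (a # b # vs) m) v"
  and "(%a b. C.tp (a # b # vs) m) : bilin K H H (C.Tn (Suc (Suc n)))"
proof -
 have e: "C.cons (Suc n) a (C.cons n b (C.tp vs m)) = C.tp (a # b # vs) m" if "a :> H" "b :> H" for a b
  using that assms by(simp add: C.T.tcons_tprod)
 note b = cons_cons_bilin[OF C.T.tprod_closed[OF assms(2-4)]]
 show "(%a b. C.tp (a # b # vs) m) : bilin K H H (C.Tn (Suc (Suc n)))"
  by(rule bilin_cong[OF hopf_facts(3,3) b e])
 show "P n (C.tp (v # vs) m) = sw (C.Tn (Suc (Suc n))) (%a b. C.tp (a # b # vs) m) v"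
  using P_facts(2)[OF assms(1) C.T.tprod_closed[OF assms(2-4)]] sw_eq[OF C.T.mtens b assms(1) e] assms
  by(simp add: C.T.tcons_tprod)
qed

text \<open>Both sides equal \<open>h\<^sub>(\<^sub>1\<^sub>)\<close>
  \<open>v\<^sub>(\<^sub>1\<^sub>)\<close> \<otimes> \<open>h\<^sub>(\<^sub>2\<^sub>)\<close>
  \<open>v\<^sub>(\<^sub>2\<^sub>)\<close> \<otimes> \<open>h\<^sub>(\<^sub>3\<^sub>)\<close> y: one
  by multiplicativity of the comultiplication on hv, the other by acting on the three parts;
  coassociativity identifies the two ways of splitting h.\<close>

lemma P_equivariant: "C.equivariant (Suc n) (Suc (Suc n)) (P n)"
proof -
 note T = C.T.mtens
 let ?T = "C.Tn (Suc (Suc n))"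
 have "P n (C.diag (Suc n) h t) = C.diag (Suc (Suc n)) h (P n t)" if h: "h :> H" and t: "t :> C.Tn (Suc n)" for h t
 proof(rule C.T.tens_cons_ext[OF T lin_comp[OF C.diag_lin[OF h] P_facts(1)] lin_comp[OF P_facts(1) C.diag_lin[OF h]] _ t])
  fix v y assume v: "v :> H" and y: "y :> C.Tn n"
  \<comment> \<open>The common summand, with v1, v2 the legs of v and x1, x2, z those of h. Its
    bilinearity in each relevant pair licenses the interchanges of sums below.\<close>
  let ?G = "%v1 v2 x1 x2 z. C.cons (Suc n) (x1 **[H] v1) (C.cons n (x2 **[H] v2) (C.diag n z y))"
  note dy = C.diag_closed[OF _ y]
  have Gx: "(%x1 x2. ?G v1 v2 x1 x2 z) : bilin K H H ?T" if "v1 :> H" "v2 :> H" "z :> H" for v1 v2 z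
  by(rule bilin_lin1[OF bilin_lin2[OF cons_cons_bilin[OF dy[OF that(3)]]]]) (rule bilin_left[OF hopf_facts(4)], rule that)+
  have Gv: "(%v1 v2. ?G v1 v2 x1 x2 z) : bilin K H H ?T" if "x1 :> H" "x2 :> H" "z :> H" for x1 x2 z
  by(rule bilin_lin1[OF bilin_lin2[OF cons_cons_bilin[OF dy[OF that(3)]]]]) (rule bilin_right[OF hopf_facts(4)], rule that)+
  have Gz: "(%x2 z. ?G v1 v2 x1 x2 z) : bilin K H H ?T" if "v1 :> H" "v2 :> H" "x1 :> H" for v1 v2 x1
  using bilin_comp[OF C.cons_diag_bilin[OF that(2) y] C.T.tcons_lin, of "x1 **[H] v1"] that by simp
  have Gl: "(%x1. ?G v1 v2 x1 x2 z) : lin K H ?T" if "v1 :> H" "v2 :> H" "x2 :> H" "z :> H" for v1 v2 x2 z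
  by(rule bilin_left[OF Gx[OF that(1,2,4)] that(3)])
  have coB: "(%x z. sw ?T (%x1 x2. ?G v1 v2 x1 x2 z) x) : bilin K H H ?T" if "v1 :> H" "v2 :> H" for v1 v2
  by(rule sw_coassoc_bilin(2)[OF T Gz[OF that] Gl[OF that]])
  have vB: "(%v1 v2. sw ?T (%x1 x2. ?G v1 v2 x1 x2 z) x) : bilin K H H ?T" if "x :> H" "z :> H" for x z
  by(rule sw_outer[OF T Gx Gv that(1)]) (use that in auto)
  have "P n (C.diag (Suc n) h (C.cons n v y)) = sw ?T (%x z. P n (C.cons n (x **[H] v) (C.diag n z y))) h"
  unfolding C.diag_Suc[OF h v y] by(rule lin_sw[OF T T P_facts(1) C.cons_diag_bilin[OF v y] h])
  also have "... = sw ?T (%x z. sw ?T (%v1 v2. sw ?T (%x1 x2. ?G v1 v2 x1 x2 z) x) v) h"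
  proof(rule sw_eq[OF T bilin_comp[OF C.cons_diag_bilin[OF v y] P_facts(1)] h, symmetric])
  fix x z assume xz: "x :> H" "z :> H"
  have "P n (C.cons n (x **[H] v) (C.diag n z y)) = sw ?T (%x1 x2. sw ?T (%v1 v2. ?G v1 v2 x1 x2 z) v) x"
  using P_facts(2)[of "x **[H] v", OF _ dy[OF xz(2)]] sw_mult[OF T cons_cons_bilin[OF dy[OF xz(2)]] xz(1) v] xz v by simp
  also have "... = sw ?T (%v1 v2. sw ?T (%x1 x2. ?G v1 v2 x1 x2 z) x) v"
  by(rule sw_swap[OF T Gv Gx xz(1) v]) (use xz in auto)
  finally show "P n (C.cons n (x **[H] v) (C.diag n z y)) = ..." .
  qed
  also have "... = sw ?T (%v1 v2. sw ?T (%x z. sw ?T (%x1 x2. ?G v1 v2 x1 x2 z) x) h) v"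
  by(rule sw_swap[OF T vB coB h v])
  also have "... = sw ?T (%v1 v2. C.diag (Suc (Suc n)) h (C.cons (Suc n) v1 (C.cons n v2 y))) v"
  proof(rule sw_eq[OF T bilin_comp[OF cons_cons_bilin[OF y] C.diag_lin[OF h]] v])
  fix v1 v2 assume vv: "v1 :> H" "v2 :> H"
  note cy = lin_cl[OF C.T.tcons_lin[OF vv(2)] y]
  have "C.diag (Suc (Suc n)) h (C.cons (Suc n) v1 (C.cons n v2 y)) =
  sw ?T (%x z. C.cons (Suc n) (x **[H] v1) (C.diag (Suc n) z (C.cons n v2 y))) h"
  by(rule C.diag_Suc[OF h vv(1) cy])
  also have "... = sw ?T (%x z. sw ?T (%x2 z'. ?G v1 v2 x x2 z') z) h"
  proof(rule sw_eq[OF T C.cons_diag_bilin[OF vv(1) cy] h, symmetric])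
  fix x z assume xz: "x :> H" "z :> H"
  show "C.cons (Suc n) (x **[H] v1) (C.diag (Suc n) z (C.cons n v2 y)) = sw ?T (%x2 z'. ?G v1 v2 x x2 z') z"
  unfolding C.diag_Suc[OF xz(2) vv(2) y]
  by(rule lin_sw[OF T T C.T.tcons_lin C.cons_diag_bilin[OF vv(2) y] xz(2)]) (use xz vv in simp)
  qed
  also have "... = sw ?T (%x z. sw ?T (%x1 x2. ?G v1 v2 x1 x2 z) x) h"
  by(rule sw_coassoc[OF T Gz[OF vv] Gl[OF vv] h])
  finally show "C.diag (Suc (Suc n)) h (C.cons (Suc n) v1 (C.cons n v2 y)) = ..." .
  qed
  also have "... = C.diag (Suc (Suc n)) h (P n (C.cons n v y))"
  unfolding P_facts(2)[OF v y] by(rule lin_sw[OF T T C.diag_lin[OF h] cons_cons_bilin[OF y] v, symmetric])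
  finally show "P n (C.diag (Suc n) h (C.cons n v y)) = C.diag (Suc (Suc n)) h (P n (C.cons n v y))" .
 qed
 thus ?thesis using P_facts(1) by(simp add: C.equivariant_def)
qed

text \<open>The counit on the first factor. The degeneracy acts on the second factor instead and is
  obtained from this operator by \<open>at_tail\<close>.\<close>

definition E0 :: "nat => ('k, 'h, 'k) tensor => ('k, 'h, 'k) tensor" where
 "E0 n = tlift K (C.Tn n) (%cs m. counit H (hd cs) *[C.Tn n] C.tp (tl cs) m)"

lemma E0_facts:
 "E0 n : lin K (C.Tn (Suc n)) (C.Tn n)"
 "v :> H ==> y :> C.Tn n ==> E0 n (C.cons n v y) = counit H v *[C.Tn n] y"
proof -
 have b: "(%v y. counit H v *[C.Tn n] y) : bilin K H (C.Tn n) (C.Tn n)"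
  by(rule bilinI) (rule lin_smult_map[OF C.T.mtens counit_closed lin_id] lin_smult_left[OF C.T.mtens hopf_facts(6)]; assumption)+
 show "E0 n : lin K (C.Tn (Suc n)) (C.Tn n)"
  unfolding E0_def by(rule C.T.split_first(2)[OF C.T.mtens b]) simp
 show "E0 n (C.cons n v y) = counit H v *[C.Tn n] y" if "v :> H" "y :> C.Tn n"
  unfolding E0_def by(rule C.T.split_first(3)[OF C.T.mtens b]) (simp_all add: that)
qed

lemma counit_mult: "g :> H ==> h :> H ==> counit H (g **[H] h) = counit H g **[K] counit H h"
 using hopf unfolding hopf_algebra_def character_def by simp

text \<open>The counit is multiplicative, so the first leg of h contributes a scalar that the counit
  axiom absorbs into the second leg.\<close>

lemma E0_equivariant: "C.equivariant (Suc n) n (E0 n)"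
proof -
 note T = C.T.mtens
 interpret U: module K "C.Tn n" by(rule T)
 have "E0 n (C.diag (Suc n) h t) = C.diag n h (E0 n t)" if h: "h :> H" and t: "t :> C.Tn (Suc n)" for h t
 proof(rule C.T.tens_cons_ext[OF T lin_comp[OF C.diag_lin[OF h] E0_facts(1)] lin_comp[OF E0_facts(1) C.diag_lin[OF h]] _ t])
  fix v y assume v: "v :> H" and y: "y :> C.Tn n"
  have F: "(%z. counit H v *[C.Tn n] C.diag n z y) : lin K H (C.Tn n)"
  by(rule lin_smult_map[OF T counit_closed[OF v] bilin_left[OF C.diag_bilin y]])
  have "E0 n (C.diag (Suc n) h (C.cons n v y)) = sw (C.Tn n) (%x z. E0 n (C.cons n (x **[H] v) (C.diag n z y))) h"
  unfolding C.diag_Suc[OF h v y] by(rule lin_sw[OF T T E0_facts(1) C.cons_diag_bilin[OF v y] h])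
  also have "... = sw (C.Tn n) (%x z. counit H x *[C.Tn n] (counit H v *[C.Tn n] C.diag n z y)) h"
  by(rule sw_eq[OF T bilin_comp[OF C.cons_diag_bilin[OF v y] E0_facts(1)] h, symmetric])
  (use v y in \<open>simp add: E0_facts(2) C.diag_closed counit_mult counit_closed U.smult_assoc1\<close>)
  also have "... = counit H v *[C.Tn n] C.diag n h y" by(rule sw_counit(1)[OF T F h])
  also have "... = C.diag n h (E0 n (C.cons n v y))"
  unfolding E0_facts(2)[OF v y] lin_smult[OF C.diag_lin[OF h] counit_closed[OF v] y] ..
  finally show "E0 n (C.diag (Suc n) h (C.cons n v y)) = C.diag n h (E0 n (C.cons n v y))" .
 qed
 thus ?thesis using E0_facts(1) by(simp add: C.equivariant_def)
qed

text \<open>Comultiplication at the factor with index r; \<open>slotE\<close> likewise applies the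
  counit at index r. These are the equivariant operators that appear when coface or codegeneracy is
  moved past r rotations. The decrement of n accounts for the factor split off by
  \<open>at_tail\<close>.\<close>

fun slotP :: "nat => nat => ('k, 'h, 'k) tensor => ('k, 'h, 'k) tensor" where
 "slotP 0 n = P n"
| "slotP (Suc r) n = C.at_tail (Suc n) (slotP r (n - 1))"

fun slotE :: "nat => nat => ('k, 'h, 'k) tensor => ('k, 'h, 'k) tensor" where
 "slotE 0 n = E0 n"
| "slotE (Suc r) n = C.at_tail (n - 1) (slotE r (n - 1))"

lemma slotP_equivariant: "r <= n ==> C.equivariant (Suc n) (Suc (Suc n)) (slotP r n)"
proof(induction r arbitrary: n)
 case (Suc r)
 then obtain m where m: "n = Suc m" by(cases n) auto
 show ?case using C.equivariant_at_tail[OF Suc.IH[of m]] Suc.prems by(simp add: m)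
qed (simp add: P_equivariant)

lemma slotE_equivariant: "r <= n ==> C.equivariant (Suc n) n (slotE r n)"
proof(induction r arbitrary: n)
 case (Suc r)
 then obtain m where m: "n = Suc m" by(cases n) auto
 show ?case using C.equivariant_at_tail[OF Suc.IH[of m]] Suc.prems by(simp add: m)
qed (simp add: E0_equivariant)

lemma slotP_lin: "r <= n ==> slotP r n : lin K (C.Tn (Suc n)) (C.Tn (Suc (Suc n)))"
 using slotP_equivariant by(simp add: C.equivariant_def)

lemma slotE_lin: "r <= n ==> slotE r n : lin K (C.Tn (Suc n)) (C.Tn n)"
 using slotE_equivariant by(simp add: C.equivariant_def)

text \<open>Bilinearity of the summand is carried through the same induction, since the induction
  step has to move \<open>cons\<close> under the Sweedler sum.\<close>

lemma slotP_tprod: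
 assumes "r <= n" "length cs = Suc n" "cs :>* H" "m :> M"
 shows "slotP r n (C.tp cs m) = sw (C.Tn (Suc (Suc n))) (%a b. C.tp (take r cs @ a # b # drop (Suc r) cs) m) (cs ! r)
  & (%a b. C.tp (take r cs @ a # b # drop (Suc r) cs) m) : bilin K H H (C.Tn (Suc (Suc n)))"
 using assms(1-3)
proof(induction r arbitrary: n cs)
 case 0
 then obtain c cs' where "cs = c # cs'" by(cases cs) auto
 thus ?case using P_tprod[of c cs' n m] 0 assms(4) by simp
next
 case (Suc r)
 then obtain k where k: "n = Suc k" by(cases n) auto
 obtain c cs' where cs: "cs = c # cs'" using Suc.prems by(cases cs) auto
 have c: "c :> H" "length cs' = Suc k" "cs' :>* H" "r <= k" using Suc.prems cs k by auto
 let ?f = "%a b. C.tp (take r cs' @ a # b # drop (Suc r) cs') m"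
 note IH = Suc.IH[OF c(4,2,3)]
 have cr: "cs' ! r :> H" using c by(auto intro!: subsetD[OF c(3)])
 have e: "C.cons (Suc (Suc k)) c (?f a b) = C.tp (take (Suc r) cs @ a # b # drop (Suc (Suc r)) cs) m" if "a :> H" "b :> H" for a b
  using that c assms(4) set_take_subset[of r cs'] set_drop_subset[of "Suc r" cs'] unfolding cs
  by(simp add: C.T.tcons_tprod subset_trans[OF _ c(3)])
 note bil = bilin_comp[OF conjunct2[OF IH] C.T.tcons_lin[OF c(1)]]
 have "slotP (Suc r) n (C.tp cs m) = C.cons (Suc (Suc k)) c (slotP r k (C.tp cs' m))"
  using C.at_tail(2)[OF slotP_lin[OF c(4)] c(1) C.T.tprod_closed[OF c(2,3) assms(4)]] c assms(4)
  by(simp add: cs k C.T.tcons_tprod)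
 also have "... = sw (C.Tn (Suc (Suc n))) (%a b. C.cons (Suc (Suc k)) c (?f a b)) (cs' ! r)"
  unfolding conjunct1[OF IH] k by(rule lin_sw[OF C.T.mtens C.T.mtens C.T.tcons_lin[OF c(1)] conjunct2[OF IH] cr])
 also have "... = sw (C.Tn (Suc (Suc n))) (%a b. C.tp (take (Suc r) cs @ a # b # drop (Suc (Suc r)) cs) m) (cs ! Suc r)"
  using sw_eq[OF C.T.mtens bil cr e] by(simp add: cs k)
 finally show ?case using bilin_cong[OF hopf_facts(3,3) bil e] by(simp add: k)
qed

lemma slotE_tprod:
 assumes "r <= n" "length cs = Suc n" "cs :>* H" "m :> M"
 shows "slotE r n (C.tp cs m) = counit H (cs ! r) *[C.Tn n] C.tp (take r cs @ drop (Suc r) cs) m"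
 using assms(1-3)
proof(induction r arbitrary: n cs)
 case 0
 then obtain c cs' where cs: "cs = c # cs'" by(cases cs) auto
 show ?case using E0_facts(2)[of c "C.tp cs' m" n] 0 assms(4) by(simp add: cs C.T.tcons_tprod C.T.tprod_closed)
next
 case (Suc r)
 then obtain k where k: "n = Suc k" by(cases n) auto
 obtain c cs' where cs: "cs = c # cs'" using Suc.prems by(cases cs) auto
 have c: "c :> H" "length cs' = Suc k" "cs' :>* H" "r <= k" using Suc.prems cs k by auto
 have cr: "cs' ! r :> H" using c by(auto intro!: subsetD[OF c(3)])
 have s: "(take r cs' @ drop (Suc r) cs') :>* H" "length (take r cs' @ drop (Suc r) cs') = k"
  using c set_take_subset[of r cs'] set_drop_subset[of "Suc r" cs'] by auto
 have "slotE (Suc r) n (C.tp cs m) = C.cons k c (slotE r k (C.tp cs' m))"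
  using C.at_tail(2)[OF slotE_lin[OF c(4)] c(1) C.T.tprod_closed[OF c(2,3) assms(4)]] c assms(4)
  by(simp add: cs k C.T.tcons_tprod)
 also have "... = counit H (cs' ! r) *[C.Tn n] C.cons k c (C.tp (take r cs' @ drop (Suc r) cs') m)"
  unfolding Suc.IH[OF c(4,2,3)] k
  by(rule lin_smult[OF C.T.tcons_lin[OF c(1)] counit_closed[OF cr] C.T.tprod_closed[OF s(2,1) assms(4)]])
 finally show ?case using C.T.tcons_tprod[OF c(1) s(2,1) assms(4)] by(simp add: cs)
qed

end

section \<open>Moving comultiplication and counit past rotations\<close>

context hopf_pair begin

lemma sw_sigma_mult:
 assumes U: "module K U" and f: "f : bilin K H H U" and h: "h :> H"
 shows "sw U f (\<sigma> **[H] h) = sw U (%a b. f (\<sigma> **[H] a) (\<sigma> **[H] b)) h"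
proof -
 have 1: "(%a b. f (x **[H] a) (y **[H] b)) : bilin K H H U" if "x :> H" "y :> H" for x y
  by(rule bilin_lin1[OF bilin_lin2[OF f]]) (rule bilin_right[OF hopf_facts(4)], rule that)+
 have 2: "(%x y. f (x **[H] a) (y **[H] b)) : bilin K H H U" if "a :> H" "b :> H" for a b
  by(rule bilin_lin1[OF bilin_lin2[OF f]]) (rule bilin_left[OF hopf_facts(4)], rule that)+
 show ?thesis unfolding sw_mult[OF U f pair_facts(1) h]
  by(rule sw_group_like[OF U sw_outer[OF U 1 2 h] pair_facts(1,2)])
qed

lemma counit_sigma_mult: "h :> H ==> counit H (\<sigma> **[H] h) = counit H h"
 using counit_mult[OF pair_facts(1)] by(simp add: pair_facts(3) counit_closed)

lemma rot_pow_lin: "(C.rot n ^^ k) : lin K (C.Tn (Suc n)) (C.Tn (Suc n))"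
 by(rule lin_pow[OF C.rot_lin])

lemma map_sigma_closed: "cs :>* H ==> (map (monoid.mult H \<sigma>) cs) :>* H"
 using pair_facts(1) by auto

text \<open>After r rotations the factor of index r stands in front, so comultiplying the front is
  comultiplying slot r beforehand. The same r rotations suffice afterwards because only factors
  before that slot have been moved.\<close>

lemma P_rot:
 assumes r: "r <= n" and x: "x :> C.Tn (Suc n)"
 shows "P n ((C.rot n ^^ r) x) = (C.rot (Suc n) ^^ r) (slotP r n x)"
proof(rule C.T.tens_ext[OF C.T.mtens lin_comp[OF rot_pow_lin P_facts(1)] lin_comp[OF slotP_lin[OF r] rot_pow_lin] _ x])
 fix cs m assume cs: "length cs = Suc n" "cs :>* H" "m :> M"
 define p c q where "p = take r cs" and "c = cs ! r" and "q = drop (Suc r) cs"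
 have e: "cs = p @ c # q" "length p = r" using cs(1) r by(simp_all add: p_def c_def q_def id_take_nth_drop[symmetric])
 have cl: "c :> H" "p :>* H" "q :>* H" using cs(2) by(auto simp: e)
 let ?U = "C.Tn (Suc (Suc n))" and ?s = "map (monoid.mult H \<sigma>)"
 have ls: "length (q @ ?s p) = n" "(q @ ?s p) :>* H" using cs(1) cl map_sigma_closed[OF cl(2)] by(auto simp: e)
 note S = slotP_tprod[OF r cs]
 have "P n ((C.rot n ^^ r) (C.tp cs m)) = P n (C.tp (c # q @ ?s p) m)"
  using C.rot_pow_tprod[OF cs, of r] r by(simp add: e)
 also have "... = sw ?U (%a b. C.tp (a # b # q @ ?s p) m) c" by(rule P_tprod(1)[OF cl(1) ls cs(3)])
 also have "... = sw ?U (%a b. (C.rot (Suc n) ^^ r) (C.tp (take r cs @ a # b # drop (Suc r) cs) m)) (cs ! r)"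
  unfolding c_def[symmetric]
 proof(rule sw_eq[OF C.T.mtens bilin_comp[OF conjunct2[OF S] rot_pow_lin] cl(1)])
  fix a b assume "a :> H" "b :> H"
  thus "(C.rot (Suc n) ^^ r) (C.tp (take r cs @ a # b # drop (Suc r) cs) m) = C.tp (a # b # q @ ?s p) m"
  using C.rot_pow_tprod[of "p @ a # b # q" "Suc n" m r] cs(1,3) cl r by(simp add: e)
 qed
 also have "... = (C.rot (Suc n) ^^ r) (slotP r n (C.tp cs m))" unfolding conjunct1[OF S]
  by(rule lin_sw[OF C.T.mtens C.T.mtens rot_pow_lin conjunct2[OF S], symmetric]) (simp add: cl(1)[unfolded c_def])
 finally show "P n ((C.rot n ^^ r) (C.tp cs m)) = (C.rot (Suc n) ^^ r) (slotP r n (C.tp cs m))" .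
qed

text \<open>A full turn multiplies every factor by \<sigma>. Since \<sigma> is group-like,
  comultiplying \<sigma> c multiplies both legs of c by \<sigma>; the exponent grows by one together
  with the number of factors.\<close>

lemma P_full_rot:
 assumes x: "x :> C.Tn (Suc n)"
 shows "P n ((C.rot n ^^ Suc n) x) = (C.rot (Suc n) ^^ Suc (Suc n)) (P n x)"
proof(rule C.T.tens_ext[OF C.T.mtens lin_comp[OF rot_pow_lin P_facts(1)] lin_comp[OF P_facts(1) rot_pow_lin] _ x])
 fix cs m assume cs: "length cs = Suc n" "cs :>* H" "m :> M"
 then obtain c q where e: "cs = c # q" and cl: "c :> H" "length q = n" "q :>* H" by(cases cs) auto
 let ?U = "C.Tn (Suc (Suc n))" and ?s = "map (monoid.mult H \<sigma>)"
 note S = P_tprod[OF cl cs(3)] and S' = P_tprod[OF _ _ map_sigma_closed[OF cl(3)] cs(3)]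
 have "P n ((C.rot n ^^ Suc n) (C.tp cs m)) = P n (C.tp ((\<sigma> **[H] c) # ?s q) m)"
  unfolding C.rot_pow_tprod[OF cs order_refl] by(simp add: e cl(2))
 also have "... = sw ?U (%a b. C.tp (a # b # ?s q) m) (\<sigma> **[H] c)"
  by(rule S'(1)) (use cl pair_facts(1) in simp_all)
 also have "... = sw ?U (%a b. C.tp ((\<sigma> **[H] a) # (\<sigma> **[H] b) # ?s q) m) c"
  by(rule sw_sigma_mult[OF C.T.mtens S'(2) cl(1)]) (use cl pair_facts(1) in simp_all)
 also have "... = sw ?U (%a b. (C.rot (Suc n) ^^ Suc (Suc n)) (C.tp (a # b # q) m)) c"
 proof(rule sw_eq[OF C.T.mtens bilin_comp[OF S(2) rot_pow_lin] cl(1)])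
  fix a b assume ab: "a :> H" "b :> H"
  have *: "length (a # b # q) = Suc (Suc n)" "(a # b # q) :>* H" using ab cl by simp_all
  show "(C.rot (Suc n) ^^ Suc (Suc n)) (C.tp (a # b # q) m) = C.tp ((\<sigma> **[H] a) # (\<sigma> **[H] b) # ?s q) m"
  unfolding C.rot_pow_tprod[OF * cs(3) order_refl] by(simp add: cl(2))
 qed
 also have "... = (C.rot (Suc n) ^^ Suc (Suc n)) (P n (C.tp cs m))"
  unfolding e S(1) by(rule lin_sw[OF C.T.mtens C.T.mtens rot_pow_lin S(2) cl(1), symmetric])
 finally show "P n ((C.rot n ^^ Suc n) (C.tp cs m)) = (C.rot (Suc n) ^^ Suc (Suc n)) (P n (C.tp cs m))" .
qed

lemma P_compatible: "C.rot_compatible n (Suc n) (P n)"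
proof -
 have base: "\<exists>j R. C.equivariant (Suc n) (Suc (Suc n)) R & (ALL x:carrier (C.Tn (Suc n)). P n ((C.rot n ^^ r) x) = (C.rot (Suc n) ^^ j) (R x))"
  if r: "r <= n" for r
  by(rule exI[of _ r], rule exI[of _ "slotP r n"], rule conjI[OF slotP_equivariant[OF r]], rule ballI, rule P_rot[OF r])
 have full: "P n ((C.rot n ^^ Suc n) x) = (C.rot (Suc n) ^^ Suc (Suc n)) (P n x)" if "x :> C.Tn (Suc n)" for x
  by(rule P_full_rot[OF that])
 show ?thesis by(rule C.rot_compatibleI[OF P_equivariant full base])
qed

definition E :: "nat => ('k, 'h, 'k) tensor => ('k, 'h, 'k) tensor" where
 "E n = T_coalg_degen0 K H M n"

lemma E_facts:
 "E (Suc k) : lin K (C.Tn (Suc (Suc k))) (C.Tn (Suc k))"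
 "x :> C.Tn (Suc (Suc k)) ==> E (Suc k) x = slotE 1 (Suc k) x"
proof -
 have b: "(%v y. C.cons k v (E0 k y)) : bilin K H (C.Tn (Suc k)) (C.Tn (Suc k))"
  by(rule bilin_lin2[OF C.T.tcons_bilin E0_facts(1)])
 have eq: "counit H ((v # vs) ! 1) *[C.Tn (Suc k)] C.tp (hd (v # vs) # drop 2 (v # vs)) m = C.cons k v (E0 k (C.tp vs m))"
  if v: "v :> H" "length vs = Suc k" "vs :>* H" "m :> M" for v vs m
 proof -
  obtain w ws where w: "vs = w # ws" "w :> H" "length ws = k" "ws :>* H" using v by(cases vs) auto
  have "E0 k (C.tp vs m) = counit H w *[C.Tn k] C.tp ws m"
  using E0_facts(2)[of w "C.tp ws m" k] w v(4) by(simp add: C.T.tcons_tprod C.T.tprod_closed)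
  thus ?thesis
  using lin_smult[OF C.T.tcons_lin[OF v(1)] counit_closed[OF w(2)] C.T.tprod_closed[OF w(3,4) v(4)]] w v
  by(simp add: C.T.tcons_tprod)
 qed
 note S = C.T.split_first[OF C.T.mtens b, where f="%cs m. counit H (cs ! 1) *[C.Tn (Suc k)] C.tp (hd cs # drop 2 cs) m", OF eq]
 show l: "E (Suc k) : lin K (C.Tn (Suc (Suc k))) (C.Tn (Suc k))"
  unfolding E_def T_coalg_degen0_def by(rule S(2)) assumption+
 show "E (Suc k) x = slotE 1 (Suc k) x" if "x :> C.Tn (Suc (Suc k))"
 proof(rule C.T.tens_cons_ext[OF C.T.mtens l slotE_lin _ that])
  show "1 <= Suc k" by simp
  fix v y assume v: "v :> H" and y: "y :> C.Tn (Suc k)"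
  have s: "slotE 1 (Suc k) = C.at_tail k (E0 k)" by simp
  show "E (Suc k) (C.cons (Suc k) v y) = slotE 1 (Suc k) (C.cons (Suc k) v y)"
  unfolding s C.at_tail(2)[OF E0_facts(1) v y] unfolding E_def T_coalg_degen0_def
  by(rule S(3)) (assumption | rule v | rule y)+
 qed
qed

lemma E_tprod:
 assumes "c :> H" "d :> H" "length q = k" "q :>* H" "m :> M"
 shows "E (Suc k) (C.tp (c # d # q) m) = counit H d *[C.Tn (Suc k)] C.tp (c # q) m"
 using E_facts(2)[OF C.T.tprod_closed, of "c # d # q" k m] slotE_tprod[of 1 "Suc k" "c # d # q" m] assms by simp

text \<open>The codegeneracy removes index 1. After r \<le> k rotations that is the original index r
  + 1. After k + 1 rotations it is \<sigma> times the original first factor, which had been rotated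
  itself, so only k rotations remain after its removal; group-likeness makes its counit that of the
  unrotated factor. The last part is the full turn.\<close>

lemma E_rot:
 assumes x: "x :> C.Tn (Suc (Suc k))"
 shows "r <= k ==> E (Suc k) ((C.rot (Suc k) ^^ r) x) = (C.rot k ^^ r) (slotE (Suc r) (Suc k) x)"
  and "E (Suc k) ((C.rot (Suc k) ^^ Suc k) x) = (C.rot k ^^ k) (slotE 0 (Suc k) x)"
  and "E (Suc k) ((C.rot (Suc k) ^^ Suc (Suc k)) x) = (C.rot k ^^ Suc k) (E (Suc k) x)"
proof -
 let ?s = "map (monoid.mult H \<sigma>)"
 show "E (Suc k) ((C.rot (Suc k) ^^ r) x) = (C.rot k ^^ r) (slotE (Suc r) (Suc k) x)" if r: "r <= k"
 proof(rule C.T.tens_ext[OF C.T.mtens lin_comp[OF rot_pow_lin E_facts(1)] lin_comp[OF slotE_lin rot_pow_lin] _ x])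
  show "Suc r <= Suc k" using r by simp
  fix cs m assume cs: "length cs = Suc (Suc k)" "cs :>* H" "m :> M"
  define p c d q where "p = take r cs" and "c = cs ! r" and "d = cs ! Suc r" and "q = drop (Suc (Suc r)) cs"
  have e: "cs = p @ c # d # q" "length p = r" using cs(1) r
  by(simp_all add: p_def c_def d_def q_def Cons_nth_drop_Suc)
  have cl: "c :> H" "d :> H" "p :>* H" "q :>* H" using cs(2) by(auto simp: e)
  have s: "(q @ ?s p) :>* H" "length (q @ ?s p) = k" using cs(1) cl(4) map_sigma_closed[OF cl(3)] by(auto simp: e)
  have sp: "slotE (Suc r) (Suc k) (C.tp cs m) = counit H d *[C.Tn (Suc k)] C.tp (p @ c # q) m"
  using slotE_tprod[of "Suc r" "Suc k" cs m] cs r e(2) by(simp add: e(1) nth_append)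
  have pc: "length (p @ c # q) = Suc k" "(p @ c # q) :>* H" using cs(1) cl by(simp_all add: e)
  show "E (Suc k) ((C.rot (Suc k) ^^ r) (C.tp cs m)) = (C.rot k ^^ r) (slotE (Suc r) (Suc k) (C.tp cs m))"
  unfolding sp lin_smult[OF rot_pow_lin counit_closed[OF cl(2)] C.T.tprod_closed[OF pc cs(3)]]
  using C.rot_pow_tprod[OF cs, of r] C.rot_pow_tprod[OF pc cs(3), of r] r E_tprod[OF cl(1,2) s(2,1) cs(3)] e(2) by(simp add: e(1))
 qed
 show "E (Suc k) ((C.rot (Suc k) ^^ Suc k) x) = (C.rot k ^^ k) (slotE 0 (Suc k) x)"
 proof(rule C.T.tens_ext[OF C.T.mtens lin_comp[OF rot_pow_lin E_facts(1)] lin_comp[OF slotE_lin rot_pow_lin] _ x])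
  show "0 <= Suc k" by simp
  fix cs m assume cs: "length cs = Suc (Suc k)" "cs :>* H" "m :> M"
  then obtain c cs' where "cs = c # cs'" by(cases cs) auto
  then obtain q z where e: "cs = c # q @ [z]" using cs(1) by(cases cs' rule: rev_cases) auto
  have cl: "c :> H" "z :> H" "length q = k" "q :>* H" using cs by(simp_all add: e)
  have sp: "slotE 0 (Suc k) (C.tp cs m) = counit H c *[C.Tn (Suc k)] C.tp (q @ [z]) m"
  using slotE_tprod[of 0 "Suc k" cs m] cs by(simp add: e)
  have pc: "length (q @ [z]) = Suc k" "(q @ [z]) :>* H" using cl by simp_all
  have l: "(C.rot (Suc k) ^^ Suc k) (C.tp cs m) = C.tp (z # (\<sigma> **[H] c) # ?s q) m"
  unfolding C.rot_pow_tprod[OF cs le_SucI[OF order_refl]] by(simp add: e cl(3))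
  have r: "(C.rot k ^^ k) (C.tp (q @ [z]) m) = C.tp (z # ?s q) m"
  using C.rot_pow_tprod[OF pc cs(3), of k] by(simp add: cl(3))
  show "E (Suc k) ((C.rot (Suc k) ^^ Suc k) (C.tp cs m)) = (C.rot k ^^ k) (slotE 0 (Suc k) (C.tp cs m))"
  unfolding sp l lin_smult[OF rot_pow_lin counit_closed[OF cl(1)] C.T.tprod_closed[OF pc cs(3)]] r
  using E_tprod[of z "\<sigma> **[H] c" "?s q" k m] cl map_sigma_closed[OF cl(4)] cs(3) pair_facts(1) by(simp add: counit_sigma_mult)
 qed
 show "E (Suc k) ((C.rot (Suc k) ^^ Suc (Suc k)) x) = (C.rot k ^^ Suc k) (E (Suc k) x)"
 proof(rule C.T.tens_ext[OF C.T.mtens lin_comp[OF rot_pow_lin E_facts(1)] lin_comp[OF E_facts(1) rot_pow_lin] _ x])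
  fix cs m assume cs: "length cs = Suc (Suc k)" "cs :>* H" "m :> M"
  then obtain c d q where e: "cs = c # d # q" by(auto simp: length_Suc_conv)
  have cl: "c :> H" "d :> H" "length q = k" "q :>* H" using cs by(simp_all add: e)
  have pc: "length (c # q) = Suc k" "(c # q) :>* H" using cl by simp_all
  have l: "(C.rot (Suc k) ^^ Suc (Suc k)) (C.tp cs m) = C.tp ((\<sigma> **[H] c) # (\<sigma> **[H] d) # ?s q) m"
  unfolding C.rot_pow_tprod[OF cs order_refl] by(simp add: e cl(3))
  have r: "(C.rot k ^^ Suc k) (C.tp (c # q) m) = C.tp ((\<sigma> **[H] c) # ?s q) m"
  unfolding C.rot_pow_tprod[OF pc cs(3) order_refl] by(simp add: cl(3))
  have El: "E (Suc k) (C.tp cs m) = counit H d *[C.Tn (Suc k)] C.tp (c # q) m"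
  unfolding e by(rule E_tprod[OF cl cs(3)])
  show "E (Suc k) ((C.rot (Suc k) ^^ Suc (Suc k)) (C.tp cs m)) = (C.rot k ^^ Suc k) (E (Suc k) (C.tp cs m))"
  unfolding l El lin_smult[OF rot_pow_lin counit_closed[OF cl(2)] C.T.tprod_closed[OF pc cs(3)]] r
  using E_tprod[of "\<sigma> **[H] c" "\<sigma> **[H] d" "?s q" k m] cl map_sigma_closed[OF cl(4)] cs(3) pair_facts(1) by(simp add: counit_sigma_mult)
 qed
qed

lemma E_equivariant: "C.equivariant (Suc (Suc k)) (Suc k) (E (Suc k))"
proof -
 have "1 <= Suc k" by simp
 from slotE_equivariant[OF this]
 have *: "slotE 1 (Suc k) (C.diag (Suc (Suc k)) h y) = C.diag (Suc k) h (slotE 1 (Suc k) y)"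
  if "h :> H" "y :> C.Tn (Suc (Suc k))" for h y using that unfolding C.equivariant_def by blast
 have "E (Suc k) (C.diag (Suc (Suc k)) h y) = C.diag (Suc k) h (E (Suc k) y)"
  if h: "h :> H" and y: "y :> C.Tn (Suc (Suc k))" for h y
  unfolding E_facts(2)[OF y] E_facts(2)[OF C.diag_closed[OF h y]] by(rule *[OF h y])
 thus ?thesis unfolding C.equivariant_def using E_facts(1)[of k] by(intro conjI ballI)
qed

lemma E_compatible: "C.rot_compatible (Suc k) k (E (Suc k))"
proof -
 have base: "\<exists>j R. C.equivariant (Suc (Suc k)) (Suc k) R & (ALL x:carrier (C.Tn (Suc (Suc k))). E (Suc k) ((C.rot (Suc k) ^^ r) x) = (C.rot k ^^ j) (R x))"
  if r: "r <= Suc k" for r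
 proof(cases "r = Suc k")
  case True
  have e: "C.equivariant (Suc (Suc k)) (Suc k) (slotE 0 (Suc k))" by(rule slotE_equivariant) simp
  have "ALL x:carrier (C.Tn (Suc (Suc k))). E (Suc k) ((C.rot (Suc k) ^^ r) x) = (C.rot k ^^ k) (slotE 0 (Suc k) x)"
  unfolding True by(rule ballI) (rule E_rot(2))
  thus ?thesis by(intro exI[of _ k] exI[of _ "slotE 0 (Suc k)"] conjI[OF e])
 next
  case False
  hence r': "r <= k" using r by simp
  hence e: "C.equivariant (Suc (Suc k)) (Suc k) (slotE (Suc r) (Suc k))" by(intro slotE_equivariant) simp
  have "ALL x:carrier (C.Tn (Suc (Suc k))). E (Suc k) ((C.rot (Suc k) ^^ r) x) = (C.rot k ^^ r) (slotE (Suc r) (Suc k) x)"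
  by(rule ballI) (rule E_rot(1)[OF _ r'])
  thus ?thesis by(intro exI[of _ r] exI[of _ "slotE (Suc r) (Suc k)"] conjI[OF e])
 qed
 have full: "E (Suc k) ((C.rot (Suc k) ^^ Suc (Suc k)) x) = (C.rot k ^^ Suc k) (E (Suc k) x)"
  if "x :> C.Tn (Suc (Suc k))" for x by(rule E_rot(3)[OF that])
 show ?thesis by(rule C.rot_compatibleI[OF E_equivariant full base])
qed

section \<open>The operators of the para-cocyclic module in terms of rotations\<close>

abbreviation "TC \<equiv> T_coalg K H (monoid.mult H) M"
abbreviation "LC \<equiv> diag_act K H H (monoid.mult H) M"

lemma comp_TC: "comp TC n = C.Tn (Suc n)" by(simp add: T_coalg_def)

text \<open>The coaction is m \<mapsto> \<sigma> \<otimes> m, so the Sweedler sum in the cyclic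
  operator has a single term.\<close>

lemma cyc_TC: "cyc TC n : lin K (C.Tn (Suc n)) (C.Tn (Suc n))" "x :> C.Tn (Suc n) ==> cyc TC n x = C.rot n x"
proof -
 have eq: "C.tp (tl cs @ [\<sigma> **[H] hd cs]) m = sweedler K (C.Tn (Suc n)) (%x m0. C.tp (tl cs @ [x **[H] hd cs]) m0) (coact M m)"
  if cs: "length cs = Suc n" "cs :>* H" "m :> M" for cs m
 proof -
  obtain c q where e: "cs = c # q" "c :> H" "length q = n" "q :>* H" using cs by(cases cs) auto
  have "(%x m0. C.tp (q @ [x **[H] c]) m0) : bilin K H M (C.Tn (Suc n))"
  proof(rule bilinI)
  show "C.tp (q @ [x **[H] c]) : lin K M (C.Tn (Suc n))" if "x :> H" for x
  by(rule mlin2_2[OF C.T.tprod_mlin2]) (use e that in simp_all)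
  show "(%x. C.tp (q @ [x **[H] c]) m) : lin K H (C.Tn (Suc n))" if "m :> M" for m
  by(rule lin_comp[OF bilin_left[OF hopf_facts(4) e(2)] mlin_last[OF mlin2_1[OF C.T.tprod_mlin2 that] e(3,4)]])
  qed
  thus ?thesis using coact_sweedler[OF C.T.mtens _ cs(3)] by(simp add: e(1))
 qed
 note T = C.T.tlift_eq[OF C.T.mtens C.rot_mlin2 eq]
 have c: "cyc TC n = tlift K (C.Tn (Suc n)) (%cs m. sweedler K (C.Tn (Suc n)) (%x m0. C.tp (tl cs @ [x **[H] hd cs]) m0) (coact M m))"
  by(simp add: T_coalg_def T_coalg_cyc_def)
 show "cyc TC n : lin K (C.Tn (Suc n)) (C.Tn (Suc n))" unfolding c by(rule T(1))
 show "x :> C.Tn (Suc n) ==> cyc TC n x = C.rot n x" unfolding c C.rot_def by(rule T(2))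
qed

lemma pow_TC:
 assumes "x :> C.Tn (Suc n)"
 shows "int_pow_map (C.Tn (Suc n)) (cyc TC n) i x = C.rp n i x"
  and "(cyc TC n ^^ k) x = (C.rot n ^^ k) x" and "inv_into (carrier (C.Tn (Suc n))) (cyc TC n) x = C.unrot n x"
proof -
 note B = bij_pair_cong[OF C.rot_pair cyc_TC(2)]
 show "int_pow_map (C.Tn (Suc n)) (cyc TC n) i x = C.rp n i x"
  using bij_pair.int_pow_map_eq[OF B(1) refl assms] B(2)[OF _ assms] by simp
 show "(cyc TC n ^^ k) x = (C.rot n ^^ k) x" using B(3)[OF _ assms] by simp
 show "inv_into (carrier (C.Tn (Suc n))) (cyc TC n) x = C.unrot n x"
  by(rule bij_pair.inv_into_eq[OF B(1) assms])
qed

lemma face_TC: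
 assumes "x :> C.Tn (Suc n)"
 shows "face TC n j x = C.rp (Suc n) (- int j) (P n (C.rp n (int j) x))"
proof -
 have "face TC n j x = int_pow_map (C.Tn (Suc (Suc n))) (cyc TC (Suc n)) (- int j) (P n (int_pow_map (C.Tn (Suc n)) (cyc TC n) (int j) x))"
  by(simp add: T_coalg_def P_def)
 thus ?thesis
  by(simp only: pow_TC(1)[OF assms] pow_TC(1)[OF lin_cl[OF P_facts(1) C.rp_closed[OF assms]]])
qed

lemma degen_TC:
 assumes "x :> C.Tn (Suc (Suc k))"
 shows "degen TC (Suc k) j x = C.rp k (- int j) (E (Suc k) (C.rp (Suc k) (int j) x))"
proof -
 have "degen TC (Suc k) j x = int_pow_map (C.Tn (Suc k)) (cyc TC k) (- int j) (E (Suc k) (int_pow_map (C.Tn (Suc (Suc k))) (cyc TC (Suc k)) (int j) x))"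
  by(simp add: T_coalg_def E_def)
 thus ?thesis
  by(simp only: pow_TC(1)[OF assms] pow_TC(1)[OF lin_cl[OF E_facts(1) C.rp_closed[OF assms]]])
qed

sublocale TC: para_quot K Cocyclic H TC LC
proof(rule para_quot.intro)
 fix n j
 show "module K (comp TC n)" unfolding comp_TC by(rule C.T.mtens)
 show "face TC n j : lin K (comp TC n) (comp TC (face_deg Cocyclic n))"
  unfolding comp_TC face_deg.simps
  by(rule lin_cong[OF C.T.mtens lin_comp[OF lin_comp[OF C.rp_lin P_facts(1)] C.rp_lin]]) (simp add: face_TC)
 show "degen TC n j : lin K (comp TC n) (comp TC (degen_deg Cocyclic n))" if ok: "degen_ok Cocyclic n j"
 proof -
  obtain k where k: "n = Suc k" using ok by(cases n) auto
  show ?thesis unfolding comp_TC degen_deg.simps k diff_Suc_1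
  by(rule lin_cong[OF C.T.mtens lin_comp[OF lin_comp[OF C.rp_lin E_facts(1)] C.rp_lin]]) (simp add: degen_TC)
 qed
 show "cyc TC n : lin K (comp TC n) (comp TC n)" unfolding comp_TC by(rule cyc_TC)
 show "inv_into (el TC n) (cyc TC n) x :> comp TC n" if "x :> comp TC n" for x
  using that unfolding comp_TC by(simp add: pow_TC(3) lin_cl[OF C.unrot_lin])
 show "LC n h : lin K (comp TC n) (comp TC n)" if "h :> H" for h
  unfolding comp_TC C.diag_act_eq by(rule C.diag_lin[OF that])
 show "counit H h :> K" if "h :> H" for h by(rule counit_closed[OF that])
qed

lemma span_closed: "x : C.span n ==> x :> C.Tn (Suc n)"
 using submodule_mem(1)[OF C.T.mtens C.span_submodule] by blast

text \<open>Faces and degeneracies are \<open>P\<close> and \<open>E\<close> conjugated by powers of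
  the rotation, so closure under them combines \<open>span_compatible\<close> with
  \<open>span_rp\<close>.\<close>

lemma span_para: "para_submodule K Cocyclic H TC LC C.span" unfolding para_submodule_def
proof(intro conjI allI ballI impI)
 note rp = C.span_rp[THEN image_subset_iff[THEN iffD1], rule_format]
 fix n j
 show "submodule (C.span n) K (comp TC n)" unfolding comp_TC by(rule C.span_submodule)
 show "face TC n j ` C.span n <= C.span (face_deg Cocyclic n)"
 proof(rule image_subsetI)
  fix x assume "x : C.span n"
  thus "face TC n j x : C.span (face_deg Cocyclic n)"
  unfolding face_TC[OF span_closed[OF `x : C.span n`]] face_deg.simps
  by(intro rp[OF subsetD[OF C.span_compatible[OF P_compatible] imageI[OF rp]]])
 qed
 show "degen TC n j ` C.span n <= C.span (degen_deg Cocyclic n)" if ok: "degen_ok Cocyclic n j"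
 proof(rule image_subsetI)
  fix x assume x: "x : C.span n"
  obtain k where k: "n = Suc k" using ok by(cases n) auto
  show "degen TC n j x : C.span (degen_deg Cocyclic n)"
  using rp[OF subsetD[OF C.span_compatible[OF E_compatible] imageI[OF rp[OF x[unfolded k]]]]]
  unfolding k degen_TC[OF span_closed[OF x[unfolded k]]] by simp
 qed
 show "cyc TC n ` C.span n <= C.span n"
  using rp[of _ n 1] by(auto simp: cyc_TC(2) span_closed ipow_def)
 show "inv_into (el TC n) (cyc TC n) ` C.span n <= C.span n"
  using rp[of _ n "- 1"] by(auto simp: comp_TC pow_TC(3) span_closed ipow_def)
 show "LC n h ` C.span n <= C.span n" if "h :> H" for h
  unfolding C.diag_act_eq by(rule C.span_diag[OF that])
qed

text \<open>Minimality of J against the closed span. A linear map out of \<open>TC\<close> can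
  thereby be tested on commutators and twists instead of on all elements of J.\<close>

lemma J_span: "TC.J n <= C.span n"
proof(rule TC.J_least[OF span_para])
 fix n
 show "J_gens H TC LC n <= C.span n"
 proof
  fix z assume "z : J_gens H TC LC n"
  then obtain h i x y where *: "h :> H" "x :> C.Tn (Suc n)" "y :> C.Tn (Suc n)"
  "z = (LC n h (int_pow_map (C.Tn (Suc n)) (cyc TC n) i x) -[C.Tn (Suc n)] int_pow_map (C.Tn (Suc n)) (cyc TC n) i (LC n h x))
  +[C.Tn (Suc n)] ((cyc TC n ^^ Suc n) y -[C.Tn (Suc n)] y)" unfolding J_gens_def comp_TC by blast
  have "z = C.comm n h i x +[C.Tn (Suc n)] C.twist n y"
  unfolding *(4) C.comm_def C.twist_def C.rp_nat C.diag_act_eq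
  by(simp only: pow_TC *(1-3) C.diag_closed)
  hence "z : C.gens n" unfolding C.gens_def using *(1-3) by blast
  thus "z : C.span n" using C.gens_span by blast
 qed
qed

end

subsection \<open>The para-cyclic module of the algebra and the pairing\<close>

locale char_setting = hopf_pair K H \<sigma> \<delta>
 for K :: "'k ring" and H :: "('k, 'h) hopf" and \<sigma> :: 'h and \<delta> :: "'h => 'k" +
 fixes A :: "('k, 'a) module" and act :: "'h => 'a => 'a"
 assumes mod_alg: "module_algebra K H A act"
begin

lemma alg_facts:
 "ring A" "module K A" "monoid.mult A : bilin K A A A" "left_module K H A act"
 "h :> H ==> a :> A ==> b :> A ==> act h (a **[A] b) = sw A (%x y. act x a **[A] act y b) h"
 "h :> H ==> act h 1[A] = counit H h *[A] 1[A]"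
 using mod_alg by(simp_all add: module_algebra_def k_algebra_def)

sublocale A: hopf_act K H M A act
 by(intro hopf_act.intro hopf_alg_axioms hopf_act_axioms.intro pair_facts(6) alg_facts(4))

sublocale A: hopf_rot K H M A act \<sigma> u
 by unfold_locales (rule pair_facts(1) u_closed sigma_inverse)+

sublocale B: algebra_over K A
 by(intro algebra_over.intro tensor.intro algebra_over_axioms.intro hopf_facts(1) alg_facts)

abbreviation "An n \<equiv> tens K n A A"

text \<open>The pairing with the algebra elements fixed as a list. It is linear in the coalgebra
  tensor; \<alpha> arises by lifting it in the algebra elements.\<close>

definition \<beta> :: "nat => 'a list => ('k, 'h, 'k) tensor => ('k, 'a, 'k) tensor" where
 "\<beta> n as = tlift K (A.Tn n) (%cs m. A.tp (map2 act cs as) m)"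

lemma map2_act_closed: "cs :>* H ==> as :>* A ==> (map2 act cs as) :>* A"
 by(rule map2_closed[OF _ _ A.act_closed])

lemma \<beta>_mlin2:
 assumes "length as = n" "as :>* A"
 shows "mlin2 K n H M (A.Tn n) (%cs m. A.tp (map2 act cs as) m)"
proof(rule mlin2I)
 show "mlin K n H (A.Tn n) (%cs. A.tp (map2 act cs as) m)" if "m :> M" for m
  by(rule mlin_map2[OF mlin2_1[OF A.T.tprod_mlin2 that] assms(1)]) (rule bilin_left[OF A.act_facts(1)], use assms(2) in auto)
 show "A.tp (map2 act cs as) : lin K M (A.Tn n)" if "length cs = n" "cs :>* H" for cs
  by(rule mlin2_2[OF A.T.tprod_mlin2 _ map2_act_closed[OF that(2) assms(2)]]) (simp add: that(1) assms(1))
qed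

lemma \<beta>_lin: "length as = n ==> as :>* A ==> \<beta> n as : lin K (C.Tn n) (A.Tn n)"
 unfolding \<beta>_def by(rule C.T.tlift_lin[OF A.T.mtens \<beta>_mlin2])

lemma \<beta>_tprod:
 assumes "length as = n" "as :>* A" "length cs = n" "cs :>* H" "m :> M"
 shows "\<beta> n as (C.tp cs m) = A.tp (map2 act cs as) m"
 unfolding \<beta>_def by(rule C.T.tlift_tprod[OF A.T.mtens \<beta>_mlin2[OF assms(1,2)] assms(3-5)])

lemma \<beta>_mlin:
 assumes x: "x :> C.Tn n"
 shows "mlin K n A (A.Tn n) (%as. \<beta> n as x)" unfolding \<beta>_def
proof(rule C.T.tlift_param_mlin[OF A.T.mtens \<beta>_mlin2 _ alg_facts(2) x])
 fix cs m assume cs: "length cs = n" "cs :>* H" "m :> M"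
 show "mlin K n A (A.Tn n) (%as. A.tp (map2 act cs as) m)" unfolding map2_flip[of act cs]
  by(rule mlin_map2[OF mlin2_1[OF A.T.tprod_mlin2 cs(3)] cs(1)]) (rule bilin_right[OF A.act_facts(1)], use cs(2) in auto)
qed

lemma \<beta>_cons:
 assumes as: "length as = n" "as :>* A" and a: "a :> A" and c: "c :> H" and y: "y :> C.Tn n"
 shows "\<beta> (Suc n) (a # as) (C.cons n c y) = A.cons n (act c a) (\<beta> n as y)"
proof(rule C.T.tens_ext[OF A.T.mtens lin_comp[OF C.T.tcons_lin[OF c] \<beta>_lin] lin_comp[OF \<beta>_lin[OF as] A.T.tcons_lin[OF A.act_closed[OF c a]]] _ y])
 show "length (a # as) = Suc n" "(a # as) :>* A" using as a by simp_all
 fix cs m assume cs: "length cs = n" "cs :>* H" "m :> M"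
 show "\<beta> (Suc n) (a # as) (C.cons n c (C.tp cs m)) = A.cons n (act c a) (\<beta> n as (C.tp cs m))"
  unfolding C.T.tcons_tprod[OF c cs] \<beta>_tprod[OF as cs]
  using \<beta>_tprod[of "a # as" "Suc n" "c # cs" m] as a c cs
  A.T.tcons_tprod[OF A.act_closed[OF c a] _ map2_act_closed[OF cs(2) as(2)] cs(3), of n] by simp
qed

text \<open>Induction on the number of factors: both actions obey the recursion
  \<open>diag_Suc\<close>, and on the front factor the module axiom (x c) a = x (c a)
  applies.\<close>

lemma \<beta>_diag:
 assumes h: "h :> H" and x: "x :> C.Tn n" and as: "length as = n" "as :>* A"
 shows "\<beta> n as (C.diag n h x) = A.diag n h (\<beta> n as x)" using assms
proof(induction n arbitrary: h x as)
 case 0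
 hence as: "as = []" by simp
 show ?case unfolding as
 proof(rule C.T.tens_0_ext[OF A.T.mtens lin_comp[OF C.diag_lin \<beta>_lin] lin_comp[OF \<beta>_lin A.diag_lin] _ 0(2)])
  fix m assume m: "m :> M"
  show "\<beta> 0 [] (C.diag 0 h (C.tp [] m)) = A.diag 0 h (\<beta> 0 [] (C.tp [] m))"
  using \<beta>_tprod[of "[]" 0 "[]" m] \<beta>_tprod[of "[]" 0 "[]" "hact M h m"] m C.hact_closed[OF 0(1) m]
  by(simp add: C.diag_0[OF 0(1) m] A.diag_0[OF 0(1) m] del: k_sigma_delta_sel)
 qed (simp_all add: 0)
next
 case (Suc n)
 obtain a bs where as: "as = a # bs" using Suc.prems(3) by(cases as) auto
 have bs: "length bs = n" "bs :>* A" and a: "a :> A" using Suc.prems as by auto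
 note h = Suc.prems(1) and bl = \<beta>_lin[OF Suc.prems(3,4)]
 show ?case
 proof(rule C.T.tens_cons_ext[OF A.T.mtens lin_comp[OF C.diag_lin[OF h] bl] lin_comp[OF bl A.diag_lin[OF h]] _ Suc.prems(2)])
  fix c y assume c: "c :> H" and y: "y :> C.Tn n"
  have \<beta>y: "\<beta> n bs y :> A.Tn n" by(rule lin_cl[OF \<beta>_lin[OF bs] y])
  have "\<beta> (Suc n) as (C.diag (Suc n) h (C.cons n c y)) = sw (A.Tn (Suc n)) (%x z. \<beta> (Suc n) as (C.cons n (x **[H] c) (C.diag n z y))) h"
  unfolding C.diag_Suc[OF h c y] by(rule lin_sw[OF C.T.mtens A.T.mtens bl C.cons_diag_bilin[OF c y] h])
  also have "... = sw (A.Tn (Suc n)) (%x z. A.cons n (act x (act c a)) (A.diag n z (\<beta> n bs y))) h"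
  by(rule sw_eq[OF A.T.mtens A.cons_diag_bilin[OF A.act_closed[OF c a] \<beta>y] h])
  (simp add: as \<beta>_cons bs a c y C.diag_closed A.act_facts(5) Suc.IH)
  also have "... = A.diag (Suc n) h (\<beta> (Suc n) as (C.cons n c y))"
  unfolding as \<beta>_cons[OF bs a c y] by(rule A.diag_Suc[OF h A.act_closed[OF c a] \<beta>y, symmetric])
  finally show "\<beta> (Suc n) as (C.diag (Suc n) h (C.cons n c y)) = A.diag (Suc n) h (\<beta> (Suc n) as (C.cons n c y))" .
 qed
qed

abbreviation "\<alpha>T \<equiv> alpha_T K A act M"

lemma \<alpha>T_eq: "\<alpha>T n t x = tlift_list K (A.Tn (Suc n)) (%as. \<beta> (Suc n) as x) t"
 by(simp add: alpha_T_def \<beta>_def)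

lemma \<alpha>T_lin1: "x :> C.Tn (Suc n) ==> (%t. \<alpha>T n t x) : lin K (An n) (A.Tn (Suc n))"
 unfolding \<alpha>T_eq by(rule B.tlift_list_lin[OF A.T.mtens \<beta>_mlin])

lemma \<alpha>T_tprod: "length as = Suc n ==> as :>* A ==> x :> C.Tn (Suc n) ==> \<alpha>T n (tprod_list K A as) x = \<beta> (Suc n) as x"
 unfolding \<alpha>T_eq by(rule B.tlift_list_tprod[OF A.T.mtens \<beta>_mlin])

text \<open>The algebra tensor t is arbitrary, and linearity in the other argument is an instance of
  lifts that depend linearly on a parameter.\<close>

lemma \<alpha>T_lin2:
 assumes t: "t :> An n"
 shows "\<alpha>T n t : lin K (C.Tn (Suc n)) (A.Tn (Suc n))"
 unfolding \<alpha>T_eq[abs_def] tlift_list_def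
proof(rule B.tlift_param_lin[OF A.T.mtens _ _ C.T.mtens t])
 show "mlin2 K n A A (A.Tn (Suc n)) (%as a. \<beta> (Suc n) (as @ [a]) p)" if "p :> C.Tn (Suc n)" for p
  by(rule mlin2_snoc_iff[where f="%as. \<beta> (Suc n) as p", THEN iffD2, OF \<beta>_mlin[OF that]])
 show "(%p. \<beta> (Suc n) (vs @ [w]) p) : lin K (C.Tn (Suc n)) (A.Tn (Suc n))"
  if "length vs = n" "vs :>* A" "w :> A" for vs w by(rule \<beta>_lin) (use that in simp_all)
qed

lemma \<alpha>T_closed: "t :> An n ==> x :> C.Tn (Suc n) ==> \<alpha>T n t x :> A.Tn (Suc n)"
 by(rule lin_cl[OF \<alpha>T_lin2])

abbreviation "Cy \<equiv> Cyc K A"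

lemma cyc_pow_closed: "t :> An n ==> (cyc Cy n ^^ k) t :> An n"
 by(rule lin_cl[OF lin_pow[OF B.Cyc_cyc_lin]])

text \<open>Rotating the coalgebra factors pairs \<sigma> c, with c the former first factor, with
  the last algebra element z. Rotating z to the front instead pairs it with c; the rotation on the
  algebra side then supplies \<sigma> and moves the result to the end.\<close>

lemma \<alpha>T_rot:
 assumes t: "t :> An n" and x: "x :> C.Tn (Suc n)"
 shows "\<alpha>T n t (C.rot n x) = A.rot n (\<alpha>T n (cyc Cy n t) x)"
proof(rule B.tens_list_ext[OF A.T.mtens \<alpha>T_lin1[OF lin_cl[OF C.rot_lin x]] lin_comp[OF lin_comp[OF B.Cyc_cyc_lin \<alpha>T_lin1[OF x]] A.rot_lin] _ t])
 fix as :: "'a list" assume as: "length as = Suc n" "as :>* A"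
 then obtain bs z where e: "as = bs @ [z]" by(cases as rule: rev_cases) auto
 have bz: "length bs = n" "bs :>* A" "z :> A" using as by(simp_all add: e)
 have zb: "length (z # bs) = Suc n" "(z # bs) :>* A" using bz by simp_all
 have r: "cyc Cy n (tprod_list K A as) = tprod_list K A (z # bs)"
  using B.Cyc_tprod(3)[OF as] by(simp add: e B.rot_list_def)
 show "\<alpha>T n (tprod_list K A as) (C.rot n x) = A.rot n (\<alpha>T n (cyc Cy n (tprod_list K A as)) x)"
  unfolding r \<alpha>T_tprod[OF zb x] \<alpha>T_tprod[OF as lin_cl[OF C.rot_lin x]]
 proof(rule C.T.tens_ext[OF A.T.mtens lin_comp[OF C.rot_lin \<beta>_lin[OF as]] lin_comp[OF \<beta>_lin[OF zb] A.rot_lin] _ x])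
  fix cs m assume cs: "length cs = Suc n" "cs :>* H" "m :> M"
  then obtain c q where q: "cs = c # q" "c :> H" "length q = n" "q :>* H" by(cases cs) auto
  have sc: "\<sigma> **[H] c :> H" using q pair_facts(1) by simp
  have l: "length (map2 act q bs) = n" using q bz by simp
  have "\<beta> (Suc n) as (C.rot n (C.tp cs m)) = A.tp (map2 act (q @ [\<sigma> **[H] c]) as) m"
  unfolding q(1) C.rot_tprod[OF q(3,2,4) cs(3)] by(rule \<beta>_tprod[OF as]) (use q sc cs(3) in simp_all)
  also have "... = A.tp (map2 act q bs @ [act \<sigma> (act c z)]) m"
  using q(3) bz by(simp add: e A.act_facts(5)[OF pair_facts(1) q(2) bz(3)])
  also have "... = A.rot n (\<beta> (Suc n) (z # bs) (C.tp cs m))" unfolding \<beta>_tprod[OF zb cs]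
  using A.rot_tprod[OF l A.act_closed[OF q(2) bz(3)] map2_act_closed[OF q(4) bz(2)] cs(3)] by(simp add: q(1))
  finally show "\<beta> (Suc n) as (C.rot n (C.tp cs m)) = A.rot n (\<beta> (Suc n) (z # bs) (C.tp cs m))" .
 qed
qed

lemma \<alpha>T_diag:
 assumes t: "t :> An n" and h: "h :> H" and x: "x :> C.Tn (Suc n)"
 shows "\<alpha>T n t (C.diag (Suc n) h x) = A.diag (Suc n) h (\<alpha>T n t x)"
proof(rule B.tens_list_ext[OF A.T.mtens \<alpha>T_lin1[OF C.diag_closed[OF h x]] lin_comp[OF \<alpha>T_lin1[OF x] A.diag_lin[OF h]] _ t])
 fix as :: "'a list" assume as: "length as = Suc n" "as :>* A"
 show "\<alpha>T n (tprod_list K A as) (C.diag (Suc n) h x) = A.diag (Suc n) h (\<alpha>T n (tprod_list K A as) x)"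
  unfolding \<alpha>T_tprod[OF as x] \<alpha>T_tprod[OF as C.diag_closed[OF h x]] by(rule \<beta>_diag[OF h x as])
qed

definition f0 :: "nat => ('k, 'a, 'k) tensor => ('k, 'a, 'k) tensor" where
 "f0 n = T_alg_face0 K A M n"

definition d0 :: "nat => ('k, 'a, 'k) tensor => ('k, 'a, 'k) tensor" where
 "d0 n = T_alg_degen0 K A M n"

lemma f0_mlin2: "mlin2 K (Suc (Suc k)) A M (A.Tn (Suc k)) (%as m. A.tp ((as ! 0 **[A] as ! 1) # drop 2 as) m)"
proof(rule mlin2I)
 show "mlin K (Suc (Suc k)) A (A.Tn (Suc k)) (%as. A.tp ((as ! 0 **[A] as ! 1) # drop 2 as) m)" if "m :> M" for m
  using B.mlin_mult[OF _ mlin2_1[OF A.T.tprod_mlin2[of "Suc k"] that], of 0] by(simp add: numeral_2_eq_2)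
 show "A.tp ((as ! 0 **[A] as ! 1) # drop 2 as) : lin K M (A.Tn (Suc k))" if "length as = Suc (Suc k)" "as :>* A" for as
  by(rule mlin2_2[OF A.T.tprod_mlin2]) (use that in \<open>auto simp: length_Suc_conv\<close>)
qed

lemma f0_lin: "f0 (Suc k) : lin K (A.Tn (Suc (Suc k))) (A.Tn (Suc k))"
 unfolding f0_def T_alg_face0_def by(rule A.T.tlift_lin[OF A.T.mtens f0_mlin2])

lemma f0_tprod:
 "a :> A ==> b :> A ==> length as = k ==> as :>* A ==> m :> M ==>
  f0 (Suc k) (A.tp (a # b # as) m) = A.tp ((a **[A] b) # as) m"
 unfolding f0_def T_alg_face0_def using A.T.tlift_tprod[OF A.T.mtens f0_mlin2, of "a # b # as" k m] by simp

lemma d0_facts: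
 "d0 n : lin K (A.Tn (Suc n)) (A.Tn (Suc (Suc n)))"
 "a :> A ==> y :> A.Tn n ==> d0 n (A.cons n a y) = A.cons (Suc n) a (A.cons n 1[A] y)"
proof -
 have b: "(%a y. A.cons (Suc n) a (A.cons n 1[A] y)) : bilin K A (A.Tn n) (A.Tn (Suc (Suc n)))"
  by(rule bilin_lin2[OF A.T.tcons_bilin A.T.tcons_lin]) simp
 have eq: "A.tp (hd (v # vs) # 1[A] # tl (v # vs)) m = A.cons (Suc n) v (A.cons n 1[A] (A.tp vs m))"
  if "v :> A" "length vs = n" "vs :>* A" "m :> M" for v vs m
  using that by(simp add: A.T.tcons_tprod)
 note S = A.T.split_first[OF A.T.mtens b, where f="%as m. A.tp (hd as # 1[A] # tl as) m", OF eq]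
 show "d0 n : lin K (A.Tn (Suc n)) (A.Tn (Suc (Suc n)))"
  unfolding d0_def T_alg_degen0_def add_2_eq_Suc' by(rule S(2)) assumption+
 assume v: "a :> A" and y: "y :> A.Tn n"
 show "d0 n (A.cons n a y) = A.cons (Suc n) a (A.cons n 1[A] y)"
  unfolding d0_def T_alg_degen0_def add_2_eq_Suc' by(rule S(3)) (assumption | rule v | rule y)+
qed

text \<open>On the first two factors this is the axiom h (a b) =
  (\<open>h\<^sub>(\<^sub>1\<^sub>)\<close> a) (\<open>h\<^sub>(\<^sub>2\<^sub>)\<close> b), with
  the legs of h produced by \<open>P\<close> and the product by \<open>f0\<close>.\<close>

lemma \<alpha>T_face0:
 assumes t: "t :> An (Suc k)" and y: "y :> C.Tn (Suc k)"
 shows "f0 (Suc k) (\<alpha>T (Suc k) t (P k y)) = \<alpha>T k (face Cy (Suc k) 0 t) y"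
proof -
 have F: "face Cy (Suc k) 0 : lin K (An (Suc k)) (An k)" using B.Cyc_face_lin[of "Suc k" 0] by simp
 show ?thesis
 proof(rule B.tens_list_ext[OF A.T.mtens lin_comp[OF \<alpha>T_lin1[OF lin_cl[OF P_facts(1) y]] f0_lin] lin_comp[OF F \<alpha>T_lin1[OF y]] _ t])
  fix as :: "'a list" assume as: "length as = Suc (Suc k)" "as :>* A"
  then obtain a b r where e: "as = a # b # r" by(auto simp: length_Suc_conv)
  have ab: "a :> A" "b :> A" "length r = k" "r :>* A" using as by(simp_all add: e)
  have abr: "length ((a **[A] b) # r) = Suc k" "((a **[A] b) # r) :>* A" using ab by simp_all
  have fc: "face Cy (Suc k) 0 (tprod_list K A as) = tprod_list K A ((a **[A] b) # r)"
  using B.Cyc_tprod(1)[OF as, of 0] by(simp add: e B.face_list_def)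
  note bl = \<beta>_lin[OF as]
  show "f0 (Suc k) (\<alpha>T (Suc k) (tprod_list K A as) (P k y)) = \<alpha>T k (face Cy (Suc k) 0 (tprod_list K A as)) y"
  unfolding fc \<alpha>T_tprod[OF as lin_cl[OF P_facts(1) y]] \<alpha>T_tprod[OF abr y]
  proof(rule C.T.tens_ext[OF A.T.mtens lin_comp[OF lin_comp[OF P_facts(1) bl] f0_lin] \<beta>_lin[OF abr] _ y])
  fix cs m assume cs: "length cs = Suc k" "cs :>* H" "m :> M"
  then obtain c q where q: "cs = c # q" "c :> H" "length q = k" "q :>* H" by(cases cs) auto
  let ?r = "map2 act q r"
  have r: "length ?r = k" "?r :>* A" using q ab map2_act_closed[OF q(4) ab(4)] by auto
  note PT = P_tprod[OF q(2,3,4) cs(3)]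
  have G: "(%v. A.tp (v # ?r) m) : lin K A (A.Tn (Suc k))"
  by(rule mlin_head[OF mlin2_1[OF A.T.tprod_mlin2 cs(3)] r])
  have bi: "(%x z. act x a **[A] act z b) : bilin K H H A"
  by(rule bilin_lin1[OF bilin_lin2[OF alg_facts(3)]]) (rule bilin_left[OF A.act_facts(1)], rule ab)+
  have Fl: "(%w. f0 (Suc k) (\<beta> (Suc (Suc k)) as w)) : lin K (C.Tn (Suc (Suc k))) (A.Tn (Suc k))"
  by(rule lin_comp[OF bl f0_lin])
  have "f0 (Suc k) (\<beta> (Suc (Suc k)) as (P k (C.tp cs m))) = sw (A.Tn (Suc k)) (%x z. f0 (Suc k) (\<beta> (Suc (Suc k)) as (C.tp (x # z # q) m))) c"
  unfolding q(1) PT(1) by(rule lin_sw[OF C.T.mtens A.T.mtens Fl PT(2) q(2)])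
  also have "... = sw (A.Tn (Suc k)) (%x z. A.tp ((act x a **[A] act z b) # ?r) m) c"
  proof(rule sw_eq[OF A.T.mtens bilin_comp[OF bi G] q(2)])
  fix x z assume "x :> H" "z :> H"
  thus "A.tp ((act x a **[A] act z b) # ?r) m = f0 (Suc k) (\<beta> (Suc (Suc k)) as (C.tp (x # z # q) m))"
  using \<beta>_tprod[OF as, of "x # z # q" m] q cs(3) f0_tprod[OF A.act_closed A.act_closed r cs(3), of x a z b] ab by(simp add: e)
  qed
  also have "... = A.tp (act c (a **[A] b) # ?r) m"
  unfolding alg_facts(5)[OF q(2) ab(1,2)] by(rule lin_sw[OF alg_facts(2) A.T.mtens G bi q(2), symmetric])
  also have "... = \<beta> (Suc k) ((a **[A] b) # r) (C.tp cs m)"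
  unfolding \<beta>_tprod[OF abr cs] by(simp add: q(1))
  finally show "f0 (Suc k) (\<beta> (Suc (Suc k)) as (P k (C.tp cs m))) = \<beta> (Suc k) ((a **[A] b) # r) (C.tp cs m)" .
  qed
 qed
qed

text \<open>The inserted unit meets the factor d that \<open>E\<close> removes by the counit; the
  axiom d 1 = \<epsilon>(d) 1 matches the two.\<close>

lemma \<alpha>T_degen0:
 assumes t: "t :> An n" and y: "y :> C.Tn (Suc (Suc n))"
 shows "d0 n (\<alpha>T n t (E (Suc n) y)) = \<alpha>T (Suc n) (degen Cy n 0 t) y"
proof(rule B.tens_list_ext[OF A.T.mtens lin_comp[OF \<alpha>T_lin1[OF lin_cl[OF E_facts(1) y]] d0_facts(1)] lin_comp[OF B.Cyc_degen_lin[OF le0] \<alpha>T_lin1[OF y]] _ t])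
 fix as :: "'a list" assume as: "length as = Suc n" "as :>* A"
 then obtain a r where e: "as = a # r" by(cases as) auto
 have ar: "a :> A" "length r = n" "r :>* A" using as by(simp_all add: e)
 have a1: "length (a # 1[A] # r) = Suc (Suc n)" "(a # 1[A] # r) :>* A" using ar by simp_all
 have dc: "degen Cy n 0 (tprod_list K A as) = tprod_list K A (a # 1[A] # r)"
  using B.Cyc_tprod(2)[OF as, of 0] by(simp add: e B.degen_list_def)
 show "d0 n (\<alpha>T n (tprod_list K A as) (E (Suc n) y)) = \<alpha>T (Suc n) (degen Cy n 0 (tprod_list K A as)) y"
  unfolding dc \<alpha>T_tprod[OF as lin_cl[OF E_facts(1) y]] \<alpha>T_tprod[OF a1 y]
 proof(rule C.T.tens_ext[OF A.T.mtens lin_comp[OF lin_comp[OF E_facts(1) \<beta>_lin[OF as]] d0_facts(1)] \<beta>_lin[OF a1] _ y])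
  fix cs m assume cs: "length cs = Suc (Suc n)" "cs :>* H" "m :> M"
  then obtain c d q where q: "cs = c # d # q" by(auto simp: length_Suc_conv)
  have cl: "c :> H" "d :> H" "length q = n" "q :>* H" using cs by(simp_all add: q)
  let ?r = "map2 act q r"
  have r: "length ?r = n" "?r :>* A" using cl ar map2_act_closed[OF cl(4) ar(3)] by auto
  note rc = A.T.tprod_closed[OF r cs(3)]
  note ca = A.act_closed[OF cl(1) ar(1)] and dk = counit_closed[OF cl(2)]
  let ?L = "%w. d0 n (\<beta> (Suc n) as w)"
  have Ll: "?L : lin K (C.Tn (Suc n)) (A.Tn (Suc (Suc n)))" by(rule lin_comp[OF \<beta>_lin[OF as] d0_facts(1)])
  have cq: "length (c # q) = Suc n" "(c # q) :>* H" using cl by simp_all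
  have "?L (E (Suc n) (C.tp cs m)) = counit H d *[A.Tn (Suc (Suc n))] ?L (C.tp (c # q) m)"
  unfolding q E_tprod[OF cl cs(3)] by(rule lin_smult[OF Ll dk C.T.tprod_closed[OF cq cs(3)]])
  also have "?L (C.tp (c # q) m) = A.cons (Suc n) (act c a) (A.cons n 1[A] (A.tp ?r m))"
  unfolding \<beta>_tprod[OF as cq cs(3)] using d0_facts(2)[OF ca rc] A.T.tcons_tprod[OF ca r cs(3)] by(simp add: e)
  also have "counit H d *[A.Tn (Suc (Suc n))] ... = A.cons (Suc n) (act c a) (A.cons n (act d 1[A]) (A.tp ?r m))"
  unfolding alg_facts(6)[OF cl(2)]
  by(rule lin_smult[OF lin_comp[OF bilin_left[OF A.T.tcons_bilin rc] A.T.tcons_lin[OF ca]] dk, symmetric]) simp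
  also have "... = A.tp (act c a # act d 1[A] # ?r) m"
  using A.act_closed[OF cl(2) B.A.one_closed] ca r cs(3) by(simp add: A.T.tcons_tprod)
  also have "... = \<beta> (Suc (Suc n)) (a # 1[A] # r) (C.tp cs m)"
  unfolding \<beta>_tprod[OF a1 cs] by(simp add: q)
  finally show "?L (E (Suc n) (C.tp cs m)) = \<beta> (Suc (Suc n)) (a # 1[A] # r) (C.tp cs m)" .
 qed
qed

end

section \<open>The algebra side, and compatibility of the pairing with all operators\<close>

context char_setting begin

abbreviation "TA \<equiv> T_alg K H A act M"
abbreviation "LA \<equiv> diag_act K H A act M"

lemma comp_TA: "comp TA n = A.Tn (Suc n)" by(simp add: T_alg_def)

text \<open>The single term of the coaction puts \<open>S\<^sup>-\<^sup>1(\<sigma>)\<close> = u in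
  front of the last element. The cyclic operator of the algebra side is thus the inverse of its
  rotation by \<sigma>.\<close>

lemma cyc_TA: "cyc TA n : lin K (A.Tn (Suc n)) (A.Tn (Suc n))" "x :> A.Tn (Suc n) ==> cyc TA n x = A.unrot n x"
proof -
 have eq: "A.tp (act u (last as) # butlast as) m =
  sweedler K (A.Tn (Suc n)) (%x m0. A.tp (act (antipode_inv H x) (last as) # butlast as) m0) (coact M m)"
  if as: "length as = Suc n" "as :>* A" "m :> M" for as m
 proof -
  obtain r z where e: "as = r @ [z]" using as by(cases as rule: rev_cases) auto
  have rz: "z :> A" "length r = n" "r :>* A" using as by(simp_all add: e)
  have "(%x m0. A.tp (act (antipode_inv H x) z # r) m0) : bilin K H M (A.Tn (Suc n))"
  proof(rule bilinI)
  show "A.tp (act (antipode_inv H x) z # r) : lin K M (A.Tn (Suc n))" if "x :> H" for x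
  by(rule mlin2_2[OF A.T.tprod_mlin2]) (use rz A.act_closed[OF lin_cl[OF antipode_inv_lin that]] in simp_all)
  show "(%x. A.tp (act (antipode_inv H x) z # r) m) : lin K H (A.Tn (Suc n))" if "m :> M" for m
  by(rule lin_comp[OF lin_comp[OF antipode_inv_lin bilin_left[OF A.act_facts(1) rz(1)]] mlin_head[OF mlin2_1[OF A.T.tprod_mlin2 that] rz(2,3)]])
  qed
  thus ?thesis using coact_sweedler[OF A.T.mtens _ as(3)] by(simp add: e)
 qed
 note T = A.T.tlift_eq[OF A.T.mtens A.unrot_mlin2 eq]
 have c: "cyc TA n = tlift K (A.Tn (Suc n)) (%as m. sweedler K (A.Tn (Suc n)) (%x m0. A.tp (act (antipode_inv H x) (last as) # butlast as) m0) (coact M m))"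
  by(simp add: T_alg_def T_alg_cyc_def)
 show "cyc TA n : lin K (A.Tn (Suc n)) (A.Tn (Suc n))" unfolding c by(rule T(1))
 show "x :> A.Tn (Suc n) ==> cyc TA n x = A.unrot n x" unfolding c A.unrot_def by(rule T(2))
qed

text \<open>The sign of the exponent flips because \<open>cyc TA n\<close> acts as
  \<open>unrot\<close>. After the flip, faces and degeneracies are conjugated by rotations with the
  same exponents as on the coalgebra side.\<close>

lemma pow_TA:
 assumes "x :> A.Tn (Suc n)"
 shows "int_pow_map (A.Tn (Suc n)) (cyc TA n) i x = A.rp n (- i) x" and "inv_into (carrier (A.Tn (Suc n))) (cyc TA n) x = A.rot n x"
proof -
 note B = bij_pair_cong[OF bij_pair.swap[OF A.rot_pair] cyc_TA(2)]
 show "int_pow_map (A.Tn (Suc n)) (cyc TA n) i x = A.rp n (- i) x"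
  using bij_pair.int_pow_map_eq[OF B(1) refl assms] B(2)[OF _ assms] bij_pair.ipow_swap[OF A.rot_pair assms] by simp
 show "inv_into (carrier (A.Tn (Suc n))) (cyc TA n) x = A.rot n x"
  by(rule bij_pair.inv_into_eq[OF B(1) assms])
qed

lemma face_TA:
 assumes "x :> A.Tn (Suc (Suc k))"
 shows "face TA (Suc k) j x = A.rp k (- int j) (f0 (Suc k) (A.rp (Suc k) (int j) x))"
proof -
 have "face TA (Suc k) j x = int_pow_map (A.Tn (Suc k)) (cyc TA k) (int j) (f0 (Suc k) (int_pow_map (A.Tn (Suc (Suc k))) (cyc TA (Suc k)) (- int j) x))"
  by(simp add: T_alg_def f0_def)
 thus ?thesis
  by(simp only: pow_TA(1)[OF assms] minus_minus pow_TA(1)[OF lin_cl[OF f0_lin A.rp_closed[OF assms]]])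
qed

lemma degen_TA:
 assumes "x :> A.Tn (Suc n)"
 shows "degen TA n j x = A.rp (Suc n) (- int j) (d0 n (A.rp n (int j) x))"
proof -
 have "degen TA n j x = int_pow_map (A.Tn (Suc (Suc n))) (cyc TA (Suc n)) (int j) (d0 n (int_pow_map (A.Tn (Suc n)) (cyc TA n) (- int j) x))"
  by(simp add: T_alg_def d0_def)
 thus ?thesis
  by(simp only: pow_TA(1)[OF assms] minus_minus pow_TA(1)[OF lin_cl[OF d0_facts(1) A.rp_closed[OF assms]]])
qed

sublocale TA: para_quot K Cyclic H TA LA
proof(rule para_quot.intro)
 fix n j
 show "module K (comp TA n)" unfolding comp_TA by(rule A.T.mtens)
 show "face TA n j : lin K (comp TA n) (comp TA (face_deg Cyclic n))" if ok: "face_ok Cyclic n j"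
 proof -
  obtain k where k: "n = Suc k" using ok by(cases n) auto
  show ?thesis unfolding comp_TA face_deg.simps k diff_Suc_1
  by(rule lin_cong[OF A.T.mtens lin_comp[OF lin_comp[OF A.rp_lin f0_lin] A.rp_lin]]) (simp add: face_TA)
 qed
 show "degen TA n j : lin K (comp TA n) (comp TA (degen_deg Cyclic n))"
  unfolding comp_TA degen_deg.simps
  by(rule lin_cong[OF A.T.mtens lin_comp[OF lin_comp[OF A.rp_lin d0_facts(1)] A.rp_lin]]) (simp add: degen_TA)
 show "cyc TA n : lin K (comp TA n) (comp TA n)" unfolding comp_TA by(rule cyc_TA)
 show "inv_into (el TA n) (cyc TA n) x :> comp TA n" if "x :> comp TA n" for x
  using that unfolding comp_TA by(simp add: pow_TA(2) lin_cl[OF A.rot_lin])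
 show "LA n h : lin K (comp TA n) (comp TA n)" if "h :> H" for h
  unfolding comp_TA A.diag_act_eq by(rule A.diag_lin[OF that])
 show "counit H h :> K" if "h :> H" for h by(rule counit_closed[OF that])
qed

lemma cyc_period: "t :> An n ==> (cyc Cy n ^^ Suc n) t = t"
 by(rule cyclic_relD(10)[OF cyclicD(5)[OF B.Cyc_cyclic]]) (simp add: B.Cyc_sel(1))

text \<open>The cyclic operator of \<open>Cyc\<close> has finite order, so its n-th power serves as
  its inverse. This permits writing t as a power of \<open>cyc\<close> applied to some b, whose
  exponent can then be absorbed by a rotation.\<close>

lemma cyc_root:
 assumes "t :> An n"
 shows "\<exists>b\<in>carrier (An n). (cyc Cy n ^^ k) b = t"
proof(induction k)
 case 0
 thus ?case using assms by simp
next
 case (Suc k)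
 then obtain b where b: "b :> An n" "(cyc Cy n ^^ k) b = t" by blast
 have "(cyc Cy n ^^ Suc k) ((cyc Cy n ^^ n) b) = (cyc Cy n ^^ k) ((cyc Cy n ^^ Suc n) b)"
  by(simp add: funpow_swap1)
 hence "(cyc Cy n ^^ Suc k) ((cyc Cy n ^^ n) b) = t" unfolding cyc_period[OF b(1)] b(2) .
 thus ?case using cyc_pow_closed[OF b(1)] by blast
qed

lemma \<alpha>T_pow:
 assumes "t :> An n" "x :> C.Tn (Suc n)"
 shows "\<alpha>T n t (C.rp n (int k) x) = A.rp n (int k) (\<alpha>T n ((cyc Cy n ^^ k) t) x)"
 unfolding C.rp_nat A.rp_nat using assms(1)
proof(induction k arbitrary: t)
 case (Suc k)
 have c: "(C.rot n ^^ k) x :> C.Tn (Suc n)" by(rule lin_cl[OF rot_pow_lin assms(2)])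
 have "\<alpha>T n t ((C.rot n ^^ Suc k) x) = A.rot n (\<alpha>T n (cyc Cy n t) ((C.rot n ^^ k) x))"
  using \<alpha>T_rot[OF Suc.prems c] by simp
 also have "... = (A.rot n ^^ Suc k) (\<alpha>T n ((cyc Cy n ^^ Suc k) t) x)"
  using Suc.IH[OF lin_cl[OF B.Cyc_cyc_lin Suc.prems]] by(simp add: funpow_swap1)
 finally show ?case .
qed simp

text \<open>For negative exponents the rule for natural powers is applied to a root b of t and the
  rotation on the algebra side is cancelled. The element s is independent of x, as the comparison of
  two terms of a commutator requires.\<close>

lemma \<alpha>T_int_pow:
 assumes t: "t :> An n"
 shows "\<exists>s\<in>carrier (An n). ALL x:carrier (C.Tn (Suc n)). \<alpha>T n t (C.rp n i x) = A.rp n i (\<alpha>T n s x)"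
proof(cases "0 <= i")
 case True
 then obtain k where k: "i = int k" by(metis nonneg_int_cases)
 show ?thesis unfolding k by(rule bexI[of _ "(cyc Cy n ^^ k) t"], rule ballI, rule \<alpha>T_pow[OF t], assumption, rule cyc_pow_closed[OF t])
next
 case False
 then obtain k where k: "i = - int k" by(metis nonpos_int_cases le_cases)
 obtain b where b: "b :> An n" "(cyc Cy n ^^ k) b = t" using cyc_root[OF t] by blast
 have "\<alpha>T n t (C.rp n i x) = A.rp n i (\<alpha>T n b x)" if x: "x :> C.Tn (Suc n)" for x
 proof -
  note c = C.rp_closed[OF x, of "- int k"]
  have "\<alpha>T n b x = A.rp n (int k) (\<alpha>T n t (C.rp n (- int k) x))"
  using \<alpha>T_pow[OF b(1) c, of k] bij_pair.ipow_cancel(2)[OF C.rot_pair x] unfolding b(2) by simp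
  thus ?thesis using bij_pair.ipow_cancel(1)[OF A.rot_pair \<alpha>T_closed[OF t c]] by(simp add: k)
 qed
 thus ?thesis using b(1) by blast
qed

text \<open>With t the j-th cyclic image of b, the conjugating rotations on both sides cancel and
  the claim becomes the case j = 0 for b. It is transported back by
  \<partial>\<open>\<^sub>j\<close> \<open>cyc\<^sup>j\<close> = \<open>cyc\<^sup>j\<close>
  \<partial>\<open>\<^sub>0\<close> in \<open>Cyc\<close>.\<close>

lemma \<alpha>T_face:
 assumes t: "t :> An (Suc k)" and j: "j <= Suc k" and x: "x :> C.Tn (Suc k)"
 shows "face TA (Suc k) j (\<alpha>T (Suc k) t (face TC k j x)) = \<alpha>T k (face Cy (Suc k) j t) x"
proof -
 let ?n = "Suc k"
 obtain b where b: "b :> An ?n" "(cyc Cy ?n ^^ j) b = t" using cyc_root[OF t] by blast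
 define z where "z = P k (C.rp k (int j) x)"
 have z: "z :> C.Tn (Suc ?n)" unfolding z_def by(rule lin_cl[OF P_facts(1) C.rp_closed[OF x]])
 note w = C.rp_closed[OF z, of "- int j"]
 have b0: "face Cy ?n 0 b :> An k" using lin_cl[OF B.Cyc_face_lin[of ?n 0] b(1)] by simp
 have cf: "i <= ?n ==> face Cy ?n i ((cyc Cy ?n ^^ i) b) = (cyc Cy k ^^ i) (face Cy ?n 0 b)" for i
 proof(induction i)
  case (Suc i)
  thus ?case
  using cyclic_relD(6)[OF cyclicD(5)[OF B.Cyc_cyclic], of "(cyc Cy ?n ^^ i) b" ?n "Suc i"] cyc_pow_closed[OF b(1)]
  by(simp add: B.Cyc_sel(1))
 qed simp
 have "A.rp ?n (int j) (\<alpha>T ?n t (face TC k j x)) = \<alpha>T ?n b (C.rp ?n (int j) (C.rp ?n (- int j) z))"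
  unfolding face_TC[OF x] z_def[symmetric] using \<alpha>T_pow[OF b(1) w] b(2) by simp
 hence e: "A.rp ?n (int j) (\<alpha>T ?n t (face TC k j x)) = \<alpha>T ?n b z"
  unfolding bij_pair.ipow_cancel(2)[OF C.rot_pair z] .
 have tc: "face TC k j x :> C.Tn (Suc ?n)" unfolding face_TC[OF x] z_def[symmetric] by(rule w)
 have "face TA ?n j (\<alpha>T ?n t (face TC k j x)) = A.rp k (- int j) (f0 ?n (\<alpha>T ?n b z))"
  unfolding face_TA[OF \<alpha>T_closed[OF t tc]] e ..
 also have "f0 ?n (\<alpha>T ?n b z) = \<alpha>T k (face Cy ?n 0 b) (C.rp k (int j) x)"
  unfolding z_def by(rule \<alpha>T_face0[OF b(1) C.rp_closed[OF x]])
 also have "... = A.rp k (int j) (\<alpha>T k (face Cy ?n j t) x)"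
  unfolding \<alpha>T_pow[OF b0 x] cf[OF j, symmetric] b(2) ..
 finally show ?thesis
  using bij_pair.ipow_cancel(1)[OF A.rot_pair \<alpha>T_closed[OF _ x]] lin_cl[OF B.Cyc_face_lin[of ?n j] t] j by simp
qed

lemma \<alpha>T_degen:
 assumes t: "t :> An n" and j: "j <= n" and x: "x :> C.Tn (Suc (Suc n))"
 shows "degen TA n j (\<alpha>T n t (degen TC (Suc n) j x)) = \<alpha>T (Suc n) (degen Cy n j t) x"
proof -
 obtain b where b: "b :> An n" "(cyc Cy n ^^ j) b = t" using cyc_root[OF t] by blast
 define z where "z = E (Suc n) (C.rp (Suc n) (int j) x)"
 have z: "z :> C.Tn (Suc n)" unfolding z_def by(rule lin_cl[OF E_facts(1) C.rp_closed[OF x]])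
 note w = C.rp_closed[OF z, of "- int j"]
 have b0: "degen Cy n 0 b :> An (Suc n)" using lin_cl[OF B.Cyc_degen_lin[of 0 n] b(1)] by simp
 have cd: "i <= n ==> degen Cy n i ((cyc Cy n ^^ i) b) = (cyc Cy (Suc n) ^^ i) (degen Cy n 0 b)" for i
 proof(induction i)
  case (Suc i)
  thus ?case
  using cyclic_relD(8)[OF cyclicD(5)[OF B.Cyc_cyclic], of "(cyc Cy n ^^ i) b" n "Suc i"] cyc_pow_closed[OF b(1)]
  by(simp add: B.Cyc_sel(1))
 qed simp
 have "A.rp n (int j) (\<alpha>T n t (degen TC (Suc n) j x)) = \<alpha>T n b (C.rp n (int j) (C.rp n (- int j) z))"
  unfolding degen_TC[OF x] z_def[symmetric] using \<alpha>T_pow[OF b(1) w] b(2) by simp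
 hence e: "A.rp n (int j) (\<alpha>T n t (degen TC (Suc n) j x)) = \<alpha>T n b z"
  unfolding bij_pair.ipow_cancel(2)[OF C.rot_pair z] .
 have tc: "degen TC (Suc n) j x :> C.Tn (Suc n)" unfolding degen_TC[OF x] z_def[symmetric] by(rule w)
 have "degen TA n j (\<alpha>T n t (degen TC (Suc n) j x)) = A.rp (Suc n) (- int j) (d0 n (\<alpha>T n b z))"
  unfolding degen_TA[OF \<alpha>T_closed[OF t tc]] e ..
 also have "d0 n (\<alpha>T n b z) = \<alpha>T (Suc n) (degen Cy n 0 b) (C.rp (Suc n) (int j) x)"
  unfolding z_def by(rule \<alpha>T_degen0[OF b(1) C.rp_closed[OF x]])
 also have "... = A.rp (Suc n) (int j) (\<alpha>T (Suc n) (degen Cy n j t) x)"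
  unfolding \<alpha>T_pow[OF b0 x] cd[OF j, symmetric] b(2) ..
 finally show ?thesis
  using bij_pair.ipow_cancel(1)[OF A.rot_pair \<alpha>T_closed[OF lin_cl[OF B.Cyc_degen_lin[OF j] t] x]] by simp
qed

text \<open>In the cyclic operator of \<open>diag_hom\<close> the rotation on the coalgebra side
  becomes a rotation on the algebra side, which the outer \<open>unrot\<close> undoes.\<close>

lemma \<alpha>T_cyc:
 assumes t: "t :> An n" and x: "x :> C.Tn (Suc n)"
 shows "cyc TA n (\<alpha>T n t (cyc TC n x)) = \<alpha>T n (cyc Cy n t) x"
proof -
 have c: "\<alpha>T n (cyc Cy n t) x :> A.Tn (Suc n)" by(rule \<alpha>T_closed[OF lin_cl[OF B.Cyc_cyc_lin t] x])
 show ?thesis unfolding cyc_TC(2)[OF x] \<alpha>T_rot[OF t x] cyc_TA(2)[OF lin_cl[OF A.rot_lin c]]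
  by(rule bij_pair.gf[OF A.rot_pair c])
qed

text \<open>By \<open>J_span\<close> only commutators and twists have to be treated. Commutators go
  to commutators by \<open>\<alpha>T_int_pow\<close> and equivariance. A twist goes to a twist since
  \<open>cyc\<close> has period n + 1 on \<open>Cyc\<close>.\<close>

lemma \<alpha>T_J:
 assumes t: "t :> An n"
 shows "\<alpha>T n t ` TC.J n <= TA.J n"
proof -
 interpret U: module K "A.Tn (Suc n)" by(rule A.T.mtens)
 note J = TA.J_submodule[of n, unfolded comp_TA] and al = \<alpha>T_lin2[OF t]
 have "\<alpha>T n t ` C.span n <= TA.J n"
 proof(rule C.span_image[OF al A.T.mtens J])
  fix h i x assume h: "h :> H" and x: "x :> C.Tn (Suc n)"
  obtain s where s: "s :> An n" "!!x. x :> C.Tn (Suc n) ==> \<alpha>T n t (C.rp n i x) = A.rp n i (\<alpha>T n s x)"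
  using \<alpha>T_int_pow[OF t] by blast
  have sx: "\<alpha>T n s x :> A.Tn (Suc n)" by(rule \<alpha>T_closed[OF s(1) x])
  have "\<alpha>T n t (C.comm n h i x) = A.diag (Suc n) h (A.rp n i (\<alpha>T n s x)) -[A.Tn (Suc n)] A.rp n i (A.diag (Suc n) h (\<alpha>T n s x))"
  unfolding C.comm_def lin_minus[OF C.T.mtens A.T.mtens al C.diag_closed[OF h C.rp_closed[OF x]] C.rp_closed[OF C.diag_closed[OF h x]]]
  \<alpha>T_diag[OF t h C.rp_closed[OF x]] s(2)[OF x] s(2)[OF C.diag_closed[OF h x]] \<alpha>T_diag[OF s(1) h x] ..
  thus "\<alpha>T n t (C.comm n h i x) : TA.J n"
  using TA.J_commutator[OF h, of "\<alpha>T n s x" n "- i"] sx A.diag_closed[OF h sx]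
  unfolding comp_TA A.diag_act_eq by(simp only: pow_TA(1) minus_minus)
 next
  fix x assume x: "x :> C.Tn (Suc n)"
  let ?y = "\<alpha>T n t x" and ?N = "int (Suc n)"
  have y: "?y :> A.Tn (Suc n)" by(rule \<alpha>T_closed[OF t x])
  note ry = A.rp_closed[OF y, of ?N]
  have tw: "\<alpha>T n t (C.twist n x) = A.rp n ?N ?y -[A.Tn (Suc n)] ?y"
  unfolding C.twist_def lin_minus[OF C.T.mtens A.T.mtens al C.rp_closed[OF x] x] \<alpha>T_pow[OF t x] cyc_period[OF t] ..
  \<comment> \<open>J on the algebra side contains \<open>cyc\<close> to the power n + 1 minus the
    identity, which is an inverse full turn. Evaluating it at the full turn of \<open>?y\<close>
    gives the wanted difference up to sign.\<close>
  have "(cyc TA n ^^ Suc n) (A.rp n ?N ?y) = A.rp n (- ?N) (A.rp n ?N ?y)"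
  using pow_TA(1)[OF ry, of ?N] by(simp add: int_pow_map_def del: funpow.simps of_nat_Suc)
  hence "(cyc TA n ^^ Suc n) (A.rp n ?N ?y) = ?y" unfolding bij_pair.ipow_cancel(1)[OF A.rot_pair y] .
  hence "?y -[A.Tn (Suc n)] A.rp n ?N ?y : TA.J n"
  using TA.J_power[OF H.one_closed, of "A.rp n ?N ?y" n] ry unfolding comp_TA by simp
  hence "-[A.Tn (Suc n)] (?y -[A.Tn (Suc n)] A.rp n ?N ?y) : TA.J n" by(rule submodule_mem(3)[OF A.T.mtens J])
  thus "\<alpha>T n t (C.twist n x) : TA.J n"
  unfolding tw using y ry by(simp add: a_minus_def U.minus_add U.a_comm)
 qed
 thus ?thesis using J_span[of n] by blast
qed

end

section \<open>Descent to the quotients and the characteristic morphism\<close>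

lemma lin_factor:
 assumes T: "module K T" and Y: "module K Y" and p: "p : lin K T X" and surj: "carrier X = p ` carrier T"
  and g: "g : lin K T Y" and eq: "!!x. x :> T ==> f (p x) = g x"
 shows "f : lin K X Y"
proof -
 interpret T: module K T by fact
 show ?thesis
 proof(rule lin_mapsI)
  show "f x :> Y" if "x :> X" for x using that lin_cl[OF g] by(auto simp: surj eq)
  show "f (x +[X] y) = f x +[Y] f y" if "x :> X" "y :> X" for x y
  using that by(auto simp: surj eq lin_add[OF g] lin_add[OF p, symmetric])
  show "f (c *[X] x) = c *[Y] f x" if "c :> K" "x :> X" for c x
  using that by(auto simp: surj eq lin_smult[OF g] lin_smult[OF p, symmetric])
 qed
qed

text \<open>Under the adjunction between \<open>\<otimes>\<close> and \<open>Hom\<close>, the characteristic morphism is the transpose of \<open>t \<circ> \<alpha>\<close>.\<close>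

lemma transpose_hom:
 fixes K :: "'k ring"
 assumes K: "cring K" and Cy: "cyc_mod K Cyclic Cy" and X: "cyc_mod K Cocyclic X" and Y: "cyc_mod K Cyclic Y"
  and \<alpha>: "\<alpha> : cmod_hom K Cyclic Cy (diag_hom K X Y)" and t: "t : cmod_hom K Cyclic Y (const_cmod K)"
 shows "(%n x. \<lambda>a\<in>el Cy n. t n (\<alpha> n a x)) : cmod_hom K Cocyclic X (dual_cmod K Cy)" (is "?\<gamma> : _")
proof -
 note MX = cyclicD(1)[OF X] and MY = cyclicD(1)[OF Y] and MC = cyclicD(1)[OF Cy] and MS = module_self[OF K]
 have \<alpha>c: "\<alpha> n a :> hom_module K (comp X n) (comp Y n)" if "a :> comp Cy n" for n a
  using cmod_closed[OF \<alpha> that] by(simp add: dh_sel)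
 have \<alpha>l: "\<alpha> n a : lin K (comp X n) (comp Y n)" if "a :> comp Cy n" for n a
  using \<alpha>c[OF that] by(simp add: hom_carrier)
 have \<alpha>l': "(%a. \<alpha> n a x) : lin K (comp Cy n) (comp Y n)" if "x :> comp X n" for n x
  using lin_comp[OF cmod_homD(1)[OF \<alpha>, unfolded dh_sel] hom_eval_lin[OF that]] .
 have tl: "t n : lin K (comp Y n) (self_module K)" for n using cmod_homD(1)[OF t] by simp
 have \<gamma>c: "?\<gamma> n x :> hom_module K (comp Cy n) (self_module K)" if "x :> comp X n" for n x
  by(rule restrict_hom[OF MC lin_comp[OF \<alpha>l'[OF that] tl]])
 have MD: "module K (hom_module K (comp Cy n) (self_module K))" for n by(rule module_hom[OF MC MS])
 show ?thesis
 proof(rule cmod_homI)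
  fix n
  interpret XM: module K "comp X n" by(rule MX)
  interpret D: module K "hom_module K (comp Cy n) (self_module K)" by(rule MD)
  show "?\<gamma> n : lin K (comp X n) (comp (dual_cmod K Cy) n)" unfolding dual_sel
  proof(rule lin_mapsI)
  fix x y assume xy: "x :> comp X n" "y :> comp X n"
  show "?\<gamma> n (x +[comp X n] y) = ?\<gamma> n x +[hom_module K (comp Cy n) (self_module K)] ?\<gamma> n y"
  proof(rule hom_eqI[OF \<gamma>c[OF XM.a_closed[OF xy]] D.a_closed[OF \<gamma>c[OF xy(1)] \<gamma>c[OF xy(2)]]])
  fix a assume a: "a :> comp Cy n"
  show "?\<gamma> n (x +[comp X n] y) a = (?\<gamma> n x +[hom_module K (comp Cy n) (self_module K)] ?\<gamma> n y) a"
  unfolding hom_add[OF a] using a lin_add[OF lin_comp[OF \<alpha>l[OF a] tl] xy] by simp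
  qed
  next
  fix c x assume c: "c :> K" and x: "x :> comp X n"
  show "?\<gamma> n (c *[comp X n] x) = c *[hom_module K (comp Cy n) (self_module K)] ?\<gamma> n x"
  proof(rule hom_eqI[OF \<gamma>c[OF XM.smult_closed[OF c x]] D.smult_closed[OF c \<gamma>c[OF x]]])
  fix a assume a: "a :> comp Cy n"
  show "?\<gamma> n (c *[comp X n] x) a = (c *[hom_module K (comp Cy n) (self_module K)] ?\<gamma> n x) a"
  unfolding hom_smult[OF a] using a lin_smult[OF lin_comp[OF \<alpha>l[OF a] tl] c x] by simp
  qed
  qed (rule \<gamma>c)
 next
  fix n j x assume j: "face_ok Cocyclic n j" and x: "x :> comp X n"
  have "t (Suc n) (\<alpha> (Suc n) a (face X n j x)) = ?\<gamma> n x (face Cy (Suc n) j a)" if a: "a :> comp Cy (Suc n)" for a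
  proof -
  have ok: "face_ok Cyclic (Suc n) j" using j by simp
  have fx: "face X n j x :> comp X (Suc n)" using lin_cl[OF cyclicD(2)[OF X j] x] by simp
  have "\<alpha> n (face Cy (Suc n) j a) x = face Y (Suc n) j (\<alpha> (Suc n) a (face X n j x))"
  using fun_cong[OF cmod_homD(2)[OF \<alpha> ok a], of x] x by(simp add: dh_sel)
  thus ?thesis
  using cmod_homD(2)[OF t ok lin_cl[OF \<alpha>l[OF a] fx]] lin_cl[OF cyclicD(2)[OF Cy ok] a] by simp
  qed
  thus "?\<gamma> (face_deg Cocyclic n) (face X n j x) = face (dual_cmod K Cy) n j (?\<gamma> n x)"
  unfolding dual_sel face_deg.simps by(intro restrict_ext)
 next
  fix n j x assume j: "degen_ok Cocyclic n j" and x: "x :> comp X n"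
  obtain m where m: "n = Suc m" using j by(cases n) auto
  have "t m (\<alpha> m a (degen X n j x)) = ?\<gamma> n x (degen Cy m j a)" if a: "a :> comp Cy m" for a
  proof -
  have ok: "degen_ok Cyclic m j" using j m by simp
  have fx: "degen X n j x :> comp X m" using lin_cl[OF cyclicD(3)[OF X j] x] by(simp add: m)
  have "\<alpha> n (degen Cy m j a) x = degen Y m j (\<alpha> m a (degen X n j x))"
  using fun_cong[OF cmod_homD(3)[OF \<alpha> ok a], of x] x by(simp add: dh_sel m)
  thus ?thesis
  using cmod_homD(3)[OF t ok lin_cl[OF \<alpha>l[OF a] fx]] lin_cl[OF cyclicD(3)[OF Cy ok] a] by(simp add: m)
  qed
  thus "?\<gamma> (degen_deg Cocyclic n) (degen X n j x) = degen (dual_cmod K Cy) n j (?\<gamma> n x)"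
  unfolding dual_sel degen_deg.simps m diff_Suc_1 by(intro restrict_ext)
 next
  fix n x assume x: "x :> comp X n"
  have "t n (\<alpha> n a (cyc X n x)) = ?\<gamma> n x (cyc Cy n a)" if a: "a :> comp Cy n" for a
  proof -
  have fx: "cyc X n x :> comp X n" by(rule lin_cl[OF cyclicD(4)[OF X] x])
  have "\<alpha> n (cyc Cy n a) x = cyc Y n (\<alpha> n a (cyc X n x))"
  using fun_cong[OF cmod_homD(4)[OF \<alpha> a], of x] x by(simp add: dh_sel)
  thus ?thesis
  using cmod_homD(4)[OF t lin_cl[OF \<alpha>l[OF a] fx]] lin_cl[OF cyclicD(4)[OF Cy] a] by simp
  qed
  thus "?\<gamma> n (cyc X n x) = cyc (dual_cmod K Cy) n (?\<gamma> n x)"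
  unfolding dual_sel by(intro restrict_ext)
 qed
qed

text \<open>In degree 0 a step relates only morphisms that agree on the carriers, so a class
  consists of versions of one morphism. This makes the choices in \<open>trace_functional\<close>
  harmless.\<close>

lemma yext_ok_refl_YHom:
 assumes "e : Ext K v 0 X Y"
 shows "\<exists>f. YHom f : e" and "g : e ==> \<exists>f. g = YHom f & yext_ok K v 0 X Y g"
  and "YHom f : e ==> YHom f' : e ==> x :> comp X n ==> f n x = f' n x"
proof -
 let ?S = "{e. yext_ok K v 0 X Y e}" and ?R = "{(e, e'). e : {e. yext_ok K v 0 X Y e} & e' : {e. yext_ok K v 0 X Y e} & yext_step K v X Y e e'}"
 obtain g0 where g0: "yext_ok K v 0 X Y g0" "e = yext_equiv K v 0 X Y `` {g0}"
  using assms by(auto simp: Ext_def quotient_def)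
 have hom: "\<exists>f. g = YHom f" if "yext_ok K v 0 X Y g" for g using that by(cases g) auto
 have mem: "yext_ok K v 0 X Y g & (g0, g) : (?R \<union> ?R\<inverse>)\<^sup>*" if "g : e" for g
  using that by(auto simp: g0(2) yext_equiv_def Let_def)
 show "\<exists>f. YHom f : e" using hom[OF g0(1)] g0 by(auto simp: yext_equiv_def Let_def)
 show "\<exists>f. g = YHom f & yext_ok K v 0 X Y g" if "g : e" using hom mem[OF that] by blast
 obtain h where h: "g0 = YHom h" using hom[OF g0(1)] by blast
 \<comment> \<open>Agreement with h is preserved along the zigzag, in whichever direction a step is
   taken.\<close>
 have agree: "\<exists>f. g = YHom f & (ALL n. ALL x:el X n. h n x = f n x)" if "(g0, g) : (?R \<union> ?R\<inverse>)\<^sup>*" for g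
  using that
 proof(induction rule: rtrancl_induct)
  case base
  thus ?case using h by blast
 next
  case (step y z)
  obtain f where f: "y = YHom f" "ALL n. ALL x:el X n. h n x = f n x" using step.IH by blast
  have "yext_ok K v 0 X Y z" and s: "yext_step K v X Y y z \<or> yext_step K v X Y z y" using step.hyps(2) by auto
  then obtain f' where f': "z = YHom f'" using hom by blast
  show ?case using f f' s by auto
 qed
 show "f n x = f' n x" if "YHom f : e" "YHom f' : e" "x :> comp X n"
  using agree[OF conjunct2[OF mem[OF that(1)]]] agree[OF conjunct2[OF mem[OF that(2)]]] that(3) by auto
qed

context char_setting begin

abbreviation "XC \<equiv> C_coalg K H H (monoid.mult H) M"
abbreviation "YA \<equiv> C_alg K H A act M"

lemma XC_eq: "XC = TC.HQ" and YA_eq: "YA = TA.HQ" by(simp_all add: C_coalg_def C_alg_def)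

abbreviation "\<alpha>C \<equiv> alpha K H H (monoid.mult H) A act act M"

lemma \<alpha>C_cls:
 assumes t: "t :> An n" and x: "x :> C.Tn (Suc n)"
 shows "\<alpha>C n t (TC.cls n x) = TA.cls n (\<alpha>T n t x)"
proof -
 have c: "TC.cls n x :> comp XC n" unfolding XC_eq TC.carrier_HQ comp_TC using x by blast
 have "induced (comp (Q_quot K Cyclic H TA LA) n) (TA.Z n) (induced (comp TA n) (TA.J n) (\<alpha>T n t)) (TC.cls n x) = TA.cls n (\<alpha>T n t x)"
 proof(rule induced_cls[OF TC.para_quot_axioms TA.para_quot_axioms])
  show "\<alpha>T n t : lin K (comp TC n) (comp TA n)" unfolding comp_TC comp_TA by(rule \<alpha>T_lin2[OF t])
  show "\<alpha>T n t ` TC.J n <= TA.J n" by(rule \<alpha>T_J[OF t])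
  show "\<alpha>T n t (LC n h x) = LA n h (\<alpha>T n t x)" if "h :> H" "x :> comp TC n" for h x
  using that \<alpha>T_diag[OF t] unfolding comp_TC C.diag_act_eq A.diag_act_eq by simp
  show "x :> comp TC n" unfolding comp_TC by(rule x)
 qed
 thus ?thesis using c by(simp add: alpha_def Let_def)
qed

text \<open>Exposes the extensionality of \<alpha>, so that equality in \<open>hom_module\<close>
  can be checked on the carrier.\<close>

lemma \<alpha>C_restrict: "\<alpha>C n t = restrict (\<alpha>C n t) (el XC n)"
 by(simp add: alpha_def Let_def)

lemma XC_E:
 assumes "S :> comp XC n"
 obtains x where "x :> C.Tn (Suc n)" "S = TC.cls n x"
 using assms unfolding XC_eq TC.carrier_HQ comp_TC by blast

lemma cls_TA_lin: "TA.cls n : lin K (A.Tn (Suc n)) (comp YA n)"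
 using TA.cls_lin[of n] unfolding YA_eq comp_TA .

lemma cls_TC_lin: "TC.cls n : lin K (C.Tn (Suc n)) (comp XC n)"
 using TC.cls_lin[of n] unfolding XC_eq comp_TC .

text \<open>Everything is evaluated on classes of representatives, where the compatibilities of
  \<open>\<alpha>T\<close> apply. The hypotheses X and Y are what turn the operators of the
  quotients into operators on representatives.\<close>

lemma \<alpha>C_hom:
 assumes X: "cyc_mod K Cocyclic XC" and Y: "cyc_mod K Cyclic YA"
 shows "\<alpha>C : cmod_hom K Cyclic Cy (diag_hom K XC YA)"
proof -
 note MX = cyclicD(1)[OF X] and MY = cyclicD(1)[OF Y]
 have lin: "\<alpha>C n t : lin K (comp XC n) (comp YA n)" if t: "t :> An n" for n t
  by(rule lin_factor[OF C.T.mtens MY cls_TC_lin _ lin_comp[OF \<alpha>T_lin2[OF t] cls_TA_lin] \<alpha>C_cls[OF t]])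
  (simp add: XC_eq TC.carrier_HQ comp_TC)
 have hom: "\<alpha>C n t :> hom_module K (comp XC n) (comp YA n)" if t: "t :> An n" for n t
  by(subst \<alpha>C_restrict) (rule restrict_hom[OF MX lin[OF t]])
 show ?thesis
 proof(rule cmod_homI)
  fix n
  interpret D: module K "hom_module K (comp XC n) (comp YA n)" by(rule module_hom[OF MX MY])
  interpret N: module K "An n" by(rule B.mtens)
  show "\<alpha>C n : lin K (comp Cy n) (comp (diag_hom K XC YA) n)" unfolding B.Cyc_sel(1) dh_sel
  proof(rule lin_mapsI)
  fix s t assume st: "s :> An n" "t :> An n"
  show "\<alpha>C n (s +[An n] t) = \<alpha>C n s +[hom_module K (comp XC n) (comp YA n)] \<alpha>C n t"
  proof(rule hom_eqI[OF hom[OF N.a_closed[OF st]] D.a_closed[OF hom[OF st(1)] hom[OF st(2)]]])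
  fix S assume S: "S :> comp XC n"
  then obtain x where x: "x :> C.Tn (Suc n)" "S = TC.cls n x" by(rule XC_E)
  show "\<alpha>C n (s +[An n] t) S = (\<alpha>C n s +[hom_module K (comp XC n) (comp YA n)] \<alpha>C n t) S"
  unfolding x(2) hom_add[OF S[unfolded x(2)]] \<alpha>C_cls[OF st(1) x(1)] \<alpha>C_cls[OF st(2) x(1)] \<alpha>C_cls[OF N.a_closed[OF st] x(1)]
  by(rule lin_add[OF lin_comp[OF \<alpha>T_lin1[OF x(1)] cls_TA_lin] st])
  qed
  next
  fix c t assume c: "c :> K" and t: "t :> An n"
  show "\<alpha>C n (c *[An n] t) = c *[hom_module K (comp XC n) (comp YA n)] \<alpha>C n t"
  proof(rule hom_eqI[OF hom[OF N.smult_closed[OF c t]] D.smult_closed[OF c hom[OF t]]])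
  fix S assume S: "S :> comp XC n"
  then obtain x where x: "x :> C.Tn (Suc n)" "S = TC.cls n x" by(rule XC_E)
  show "\<alpha>C n (c *[An n] t) S = (c *[hom_module K (comp XC n) (comp YA n)] \<alpha>C n t) S"
  unfolding x(2) hom_smult[OF S[unfolded x(2)]] \<alpha>C_cls[OF t x(1)] \<alpha>C_cls[OF N.smult_closed[OF c t] x(1)]
  by(rule lin_smult[OF lin_comp[OF \<alpha>T_lin1[OF x(1)] cls_TA_lin] c t])
  qed
  qed (rule hom)
 next
  fix n j t assume ok: "face_ok Cyclic n j" and t: "t :> comp Cy n"
  obtain k where k: "n = Suc k" "j <= Suc k" using ok by(cases n) auto
  have ok': "face_ok Cocyclic k j" "face_ok Cyclic (Suc k) j" using k by simp_all
  have t': "t :> An (Suc k)" using t by(simp add: B.Cyc_sel(1) k)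
  have ft: "face Cy (Suc k) j t :> An k" using lin_cl[OF B.Cyc_face_lin[of "Suc k" j] t'] k by simp
  have "\<alpha>C k (face Cy (Suc k) j t) S = face YA (Suc k) j (\<alpha>C (Suc k) t (face XC k j S))" if "S :> comp XC k" for S
  proof -
  obtain x where x: "x :> C.Tn (Suc k)" "S = TC.cls k x" using `S :> comp XC k` by(rule XC_E)
  have x': "x :> comp TC k" using x(1) unfolding comp_TC .
  have fx: "face TC k j x :> C.Tn (Suc (Suc k))"
  using lin_cl[OF TC.T_face[OF ok'(1)] x'] by(simp add: comp_TC)
  have y: "\<alpha>T (Suc k) t (face TC k j x) :> comp TA (Suc k)" unfolding comp_TA by(rule \<alpha>T_closed[OF t' fx])
  have f1: "face XC k j (TC.cls k x) = TC.cls (Suc k) (face TC k j x)"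
  using TC.cls_face[OF X[unfolded XC_eq] x' ok'(1)] unfolding XC_eq by simp
  have f2: "face YA (Suc k) j (TA.cls (Suc k) y) = TA.cls k (face TA (Suc k) j y)" if "y :> comp TA (Suc k)" for y
  using TA.cls_face[OF Y[unfolded YA_eq] that ok'(2)] unfolding YA_eq by simp
  show ?thesis
  unfolding x(2) f1 \<alpha>C_cls[OF t' fx] f2[OF y] \<alpha>C_cls[OF ft x(1)] \<alpha>T_face[OF t' k(2) x(1)] ..
  qed
  thus "\<alpha>C (face_deg Cyclic n) (face Cy n j t) = face (diag_hom K XC YA) n j (\<alpha>C n t)"
  unfolding k(1) face_deg.simps diff_Suc_1 dh_sel by(subst \<alpha>C_restrict) (rule restrict_ext)
 next
  fix n j t assume ok: "degen_ok Cyclic n j" and t: "t :> comp Cy n"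
  have ok': "degen_ok Cocyclic (Suc n) j" "j <= n" using ok by simp_all
  have t': "t :> An n" using t by(simp add: B.Cyc_sel(1))
  have ft: "degen Cy n j t :> An (Suc n)" by(rule lin_cl[OF B.Cyc_degen_lin[OF ok'(2)] t'])
  have "\<alpha>C (Suc n) (degen Cy n j t) S = degen YA n j (\<alpha>C n t (degen XC (Suc n) j S))" if "S :> comp XC (Suc n)" for S
  proof -
  obtain x where x: "x :> C.Tn (Suc (Suc n))" "S = TC.cls (Suc n) x" using `S :> comp XC (Suc n)` by(rule XC_E)
  have x': "x :> comp TC (Suc n)" using x(1) unfolding comp_TC .
  have fx: "degen TC (Suc n) j x :> C.Tn (Suc n)"
  using lin_cl[OF TC.T_degen[OF ok'(1)] x'] by(simp add: comp_TC)
  have y: "\<alpha>T n t (degen TC (Suc n) j x) :> comp TA n" unfolding comp_TA by(rule \<alpha>T_closed[OF t' fx])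
  have f1: "degen XC (Suc n) j (TC.cls (Suc n) x) = TC.cls n (degen TC (Suc n) j x)"
  using TC.cls_degen[OF X[unfolded XC_eq] x' ok'(1)] unfolding XC_eq by simp
  have f2: "degen YA n j (TA.cls n y) = TA.cls (Suc n) (degen TA n j y)" if "y :> comp TA n" for y
  using TA.cls_degen[OF Y[unfolded YA_eq] that ok] unfolding YA_eq by simp
  show ?thesis
  unfolding x(2) f1 \<alpha>C_cls[OF t' fx] f2[OF y] \<alpha>C_cls[OF ft x(1)] \<alpha>T_degen[OF t' ok'(2) x(1)] ..
  qed
  thus "\<alpha>C (degen_deg Cyclic n) (degen Cy n j t) = degen (diag_hom K XC YA) n j (\<alpha>C n t)"
  unfolding degen_deg.simps dh_sel by(subst \<alpha>C_restrict) (rule restrict_ext)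
 next
  fix n t assume t: "t :> comp Cy n"
  have t': "t :> An n" using t by(simp add: B.Cyc_sel(1))
  have "\<alpha>C n (cyc Cy n t) S = cyc YA n (\<alpha>C n t (cyc XC n S))" if "S :> comp XC n" for S
  proof -
  obtain x where x: "x :> C.Tn (Suc n)" "S = TC.cls n x" using `S :> comp XC n` by(rule XC_E)
  have x': "x :> comp TC n" using x(1) unfolding comp_TC .
  have fx: "cyc TC n x :> C.Tn (Suc n)" by(rule lin_cl[OF cyc_TC(1) x(1)])
  have y: "\<alpha>T n t (cyc TC n x) :> comp TA n" unfolding comp_TA by(rule \<alpha>T_closed[OF t' fx])
  have f1: "cyc XC n (TC.cls n x) = TC.cls n (cyc TC n x)"
  using TC.cls_cyc[OF X[unfolded XC_eq] x'] unfolding XC_eq by simp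
  have f2: "cyc YA n (TA.cls n y) = TA.cls n (cyc TA n y)" if "y :> comp TA n" for y
  using TA.cls_cyc[OF Y[unfolded YA_eq] that] unfolding YA_eq by simp
  show ?thesis
  unfolding x(2) f1 \<alpha>C_cls[OF t' fx] f2[OF y] \<alpha>C_cls[OF lin_cl[OF B.Cyc_cyc_lin t'] x(1)] \<alpha>T_cyc[OF t' x(1)] ..
  qed
  thus "\<alpha>C n (cyc Cy n t) = cyc (diag_hom K XC YA) n (\<alpha>C n t)"
  unfolding dh_sel by(subst \<alpha>C_restrict) (rule restrict_ext)
 qed
qed

lemma foldl_mult_closed: "a :> A ==> bs :>* A ==> foldl (monoid.mult A) a bs :> A"
 by(induction bs arbitrary: a) simp_all

text \<open>The faces of the constant module are identities, so t does not change under the zeroth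
  face; each application multiplies the first two elements.\<close>

lemma trace_collapse:
 assumes Y: "cyc_mod K Cyclic YA" and t: "t : cmod_hom K Cyclic YA (const_cmod K)"
  and a: "a :> A" and bs: "bs :>* A"
 shows "t (length bs) (TA.cls (length bs) (A.tp (a # bs) 1[K])) = t 0 (TA.cls 0 (A.tp [foldl (monoid.mult A) a bs] 1[K]))"
 using a bs
proof(induction bs arbitrary: a)
 case (Cons b bs)
 let ?k = "length bs"
 have ab: "a :> A" "b :> A" "bs :>* A" using Cons.prems by simp_all
 have one: "1[K] :> M" by simp
 have x: "A.tp (a # b # bs) 1[K] :> A.Tn (Suc (Suc ?k))" by(rule A.T.tprod_closed) (use ab in simp_all)
 have ok: "face_ok Cyclic (Suc ?k) 0" by simp
 have f: "face TA (Suc ?k) 0 (A.tp (a # b # bs) 1[K]) = A.tp ((a **[A] b) # bs) 1[K]"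
  using face_TA[OF x, of 0] f0_tprod[OF ab(1,2) refl ab(3) one] by simp
 have "face YA (Suc ?k) 0 (TA.cls (Suc ?k) (A.tp (a # b # bs) 1[K])) = TA.cls ?k (A.tp ((a **[A] b) # bs) 1[K])"
  using TA.cls_face[OF Y[unfolded YA_eq] _ ok] x unfolding YA_eq f[symmetric] by(simp add: comp_TA)
 hence "t (Suc ?k) (TA.cls (Suc ?k) (A.tp (a # b # bs) 1[K])) = t ?k (TA.cls ?k (A.tp ((a **[A] b) # bs) 1[K]))"
  using cmod_homD(2)[OF t ok lin_cl[OF cls_TA_lin x]] by simp
 thus ?case using Cons.IH[of "a **[A] b"] ab by simp
qed simp

text \<open>Modulo coinvariants, \<open>h \<otimes> w = 1 \<otimes> S(h) w\<close>.\<close>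

lemma cls_cons:
 assumes h: "h :> H" and w: "w :> C.Tn n"
 shows "TC.cls n (C.cons n h w) = TC.cls n (C.cons n 1[H] (C.diag n (antipode H h) w))"
proof -
 note T = C.T.mtens and one = H.one_closed
 interpret U: module K "C.Tn (Suc n)" by(rule T)
 have S: "antipode H z :> H" if "z :> H" for z by(rule lin_cl[OF hopf_facts(7) that])
 have Dl: "(%z. C.diag n z w) : lin K H (C.Tn n)" by(rule bilin_left[OF C.diag_bilin w])
 \<comment> \<open>For x, y, z the three legs of h this is \<open>h\<^sub>(\<^sub>1\<^sub>)\<close>
   \<otimes> \<open>h\<^sub>(\<^sub>2\<^sub>)\<close> S(\<open>h\<^sub>(\<^sub>3\<^sub>)\<close>) w.
   Grouping the last two legs collapses it to h \<otimes> w, grouping the first two exhibits a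
   diagonal action of the first leg.\<close>
 let ?f = "%x y z. C.cons n x (C.diag n (y **[H] antipode H z) w)"
 have f1: "?f x : bilin K H H (C.Tn (Suc n))" if x: "x :> H" for x
  by(rule bilin_comp[OF bilin_lin2[OF hopf_facts(4,7)] lin_comp[OF Dl C.T.tcons_lin[OF x]]])
 have f2: "(%x. ?f x y z) : lin K H (C.Tn (Suc n))" if "y :> H" "z :> H" for y z
  by(rule bilin_left[OF C.T.tcons_bilin C.diag_closed[OF _ w]]) (use that S in simp)
 have cb: "(%x y. counit H y *[C.Tn (Suc n)] C.cons n x w) : bilin K H H (C.Tn (Suc n))"
 proof(rule bilinI)
  show "(%y. counit H y *[C.Tn (Suc n)] C.cons n x w) : lin K H (C.Tn (Suc n))" if "x :> H" for x
  by(rule lin_smult_left[OF T hopf_facts(6) bilin_closed[OF C.T.tcons_bilin that w]])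
  show "(%x. counit H y *[C.Tn (Suc n)] C.cons n x w) : lin K H (C.Tn (Suc n))" if "y :> H" for y
  by(rule lin_smult_map[OF T counit_closed[OF that] bilin_left[OF C.T.tcons_bilin w]])
 qed
 have db: "(%x y. C.diag (Suc n) x (C.cons n 1[H] (C.diag n (antipode H y) w))) : bilin K H H (C.Tn (Suc n))"
  by(rule bilin_lin2[OF C.diag_bilin lin_comp[OF lin_comp[OF hopf_facts(7) Dl] C.T.tcons_lin[OF one]]])
 have "sw (C.Tn (Suc n)) (%x y. C.diag (Suc n) x (C.cons n 1[H] (C.diag n (antipode H y) w))) h =
  sw (C.Tn (Suc n)) (%x y. sw (C.Tn (Suc n)) (%a b. ?f a b y) x) h"
 proof(rule sw_eq[OF T db h, symmetric])
  fix x y assume xy: "x :> H" "y :> H"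
  note dy = C.diag_closed[OF S[OF xy(2)] w]
  show "C.diag (Suc n) x (C.cons n 1[H] (C.diag n (antipode H y) w)) = sw (C.Tn (Suc n)) (%a b. ?f a b y) x"
  unfolding C.diag_Suc[OF xy(1) one dy]
  by(rule sw_eq[OF T C.cons_diag_bilin[OF one dy] xy(1), symmetric]) (simp add: C.diag_mult S xy w)
 qed
 also have "... = sw (C.Tn (Suc n)) (%x y. sw (C.Tn (Suc n)) (?f x) y) h"
  by(rule sw_coassoc[OF T f1 f2 h, symmetric])
 also have "... = sw (C.Tn (Suc n)) (%x y. counit H y *[C.Tn (Suc n)] C.cons n x w) h"
 proof(rule sw_eq[OF T cb h])
  fix x y assume xy: "x :> H" "y :> H"
  show "counit H y *[C.Tn (Suc n)] C.cons n x w = sw (C.Tn (Suc n)) (?f x) y"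
  using sw_antipode[OF T lin_comp[OF Dl C.T.tcons_lin[OF xy(1)]] xy(2)] by(simp add: C.diag_one[OF w])
 qed
 also have "... = C.cons n h w" by(rule sw_counit(2)[OF T bilin_left[OF C.T.tcons_bilin w] h])
 finally have e: "C.cons n h w = sw (C.Tn (Suc n)) (%x y. C.diag (Suc n) x (C.cons n 1[H] (C.diag n (antipode H y) w))) h" by(rule sym)
 note XM = TC.module_HQ[of n, folded XC_eq]
 let ?F = "%y. TC.cls n (C.cons n 1[H] (C.diag n (antipode H y) w))"
 have F: "?F : lin K H (comp XC n)"
  by(rule lin_comp[OF lin_comp[OF lin_comp[OF hopf_facts(7) Dl] C.T.tcons_lin[OF one]] cls_TC_lin])
 have "TC.cls n (C.cons n h w) = sw (comp XC n) (%x y. TC.cls n (C.diag (Suc n) x (C.cons n 1[H] (C.diag n (antipode H y) w)))) h"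
  by(subst e) (rule lin_sw[OF T XM cls_TC_lin db h])
 \<comment> \<open>In the coinvariants the diagonal action of the first leg becomes its counit, and
   the counit axiom leaves h in the antipode.\<close>
 also have "... = sw (comp XC n) (%x y. counit H x *[comp XC n] ?F y) h"
 proof(rule sw_eq[OF XM bilin_comp[OF db cls_TC_lin] h, symmetric])
  fix x y assume xy: "x :> H" "y :> H"
  have "C.cons n 1[H] (C.diag n (antipode H y) w) :> comp TC n"
  unfolding comp_TC by(rule lin_cl[OF C.T.tcons_lin[OF one] C.diag_closed[OF S[OF xy(2)] w]])
  from TC.cls_act[OF xy(1) this]
  show "TC.cls n (C.diag (Suc n) x (C.cons n 1[H] (C.diag n (antipode H y) w))) = counit H x *[comp XC n] ?F y"
  unfolding C.diag_act_eq XC_eq .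
 qed
 also have "... = ?F h" by(rule sw_counit(1)[OF XM F h])
 finally show ?thesis .
qed

text \<open>By \<open>cls_cons\<close> every class of h \<otimes> w is one with first factor 1, so
  two morphisms agreeing on such classes agree everywhere. This pins down the object that
  \<open>char_morphism\<close> selects.\<close>

lemma cocyclic_hom_unique:
 assumes \<gamma>: "\<gamma> : cmod_hom K Cocyclic XC (dual_cmod K Cy)" and \<gamma>': "\<gamma>' : cmod_hom K Cocyclic XC (dual_cmod K Cy)"
  and eq: "!!hs as. hs :>* H ==> as :>* A ==> length as = Suc (length hs) ==>
  \<gamma> (length hs) (TC.cls (length hs) (C.tp (1[H] # hs) 1[K])) (tprod_list K A as) =
  \<gamma>' (length hs) (TC.cls (length hs) (C.tp (1[H] # hs) 1[K])) (tprod_list K A as)"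
  and S: "S :> comp XC n" and a: "a :> An n"
 shows "\<gamma> n S a = \<gamma>' n S a"
proof -
 have MS: "module K (self_module K)" by(rule module_self[OF K.is_cring])
 have lin: "g n S : lin K (An n) (self_module K)" if "g : cmod_hom K Cocyclic XC (dual_cmod K Cy)" for g
  using cmod_closed[OF that S] by(simp add: dual_sel hom_carrier B.Cyc_sel(1))
 show ?thesis
 proof(rule B.tens_list_ext[OF MS lin[OF \<gamma>] lin[OF \<gamma>'] _ a])
  fix as :: "'a list" assume as: "length as = Suc n" "as :>* A"
  let ?a = "tprod_list K A as"
  have ac: "?a :> comp Cy n" unfolding B.Cyc_sel(1) by(rule B.tprod_list_closed[OF as])
  obtain x where x: "x :> C.Tn (Suc n)" "S = TC.cls n x" using S by(rule XC_E)
  have gl: "(%x. g n (TC.cls n x) ?a) : lin K (C.Tn (Suc n)) (self_module K)"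
  if "g : cmod_hom K Cocyclic XC (dual_cmod K Cy)" for g
  using lin_comp[OF lin_comp[OF cls_TC_lin cmod_homD(1)[OF that, unfolded dual_sel]] hom_eval_lin[OF ac]] .
  note l1 = lin_comp[OF C.T.tcons_lin[OF H.one_closed] gl]
  have unit: "\<gamma> n (TC.cls n (C.cons n 1[H] w)) ?a = \<gamma>' n (TC.cls n (C.cons n 1[H] w)) ?a" if w: "w :> C.Tn n" for w
  proof(rule C.T.tens_ext[OF MS l1[OF \<gamma>] l1[OF \<gamma>'] _ w])
  fix hs m assume hs: "length hs = n" "hs :>* H" "m :> M"
  have one: "1[K] :> M" and m: "m :> K" using hs(3) by simp_all
  have t1: "C.tp hs 1[K] :> C.Tn n" by(rule C.T.tprod_closed[OF hs(1,2) one])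
  \<comment> \<open>The coefficient module is one-dimensional, so the scalar m is pulled out and the
    hypothesis at 1 applies.\<close>
  have tm: "C.tp hs m = m *[C.Tn n] C.tp hs 1[K]"
  using lin_smult[OF mlin2_2[OF C.T.tprod_mlin2 hs(1,2)] m one] m by simp
  show "\<gamma> n (TC.cls n (C.cons n 1[H] (C.tp hs m))) ?a = \<gamma>' n (TC.cls n (C.cons n 1[H] (C.tp hs m))) ?a"
  unfolding tm lin_smult[OF l1[OF \<gamma>] m t1] lin_smult[OF l1[OF \<gamma>'] m t1]
  using eq[OF hs(2) as(2)] as(1) hs(1) C.T.tcons_tprod[OF H.one_closed hs(1,2) one] by simp
  qed
  show "\<gamma> n S ?a = \<gamma>' n S ?a" unfolding x(2)
  proof(rule C.T.tens_cons_ext[OF MS gl[OF \<gamma>] gl[OF \<gamma>'] _ x(1)])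
  fix h w assume h: "h :> H" and w: "w :> C.Tn n"
  show "\<gamma> n (TC.cls n (C.cons n h w)) ?a = \<gamma>' n (TC.cls n (C.cons n h w)) ?a"
  unfolding cls_cons[OF h w] by(rule unit[OF C.diag_closed[OF lin_cl[OF hopf_facts(7) h] w]])
  qed
 qed
qed

text \<open>The transpose of t \<circ> \<alpha> satisfies the specification, so the choice operator
  returns something that satisfies it as well. Uniqueness then identifies the chosen morphism with
  the transpose.\<close>

lemma char_morphism_eq:
 assumes X: "cyc_mod K Cocyclic XC" and \<tau>: "\<tau> : Ext K Cyclic 0 YA (const_cmod K)" and t: "YHom t : \<tau>"
 shows "char_morphism K H A act M \<tau> : cmod_hom K Cocyclic XC (dual_cmod K Cy)"
  and "S :> comp XC n ==> a :> comp Cy n ==> char_morphism K H A act M \<tau> n S a = t n (\<alpha>C n a S)"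
proof -
 have Y: "cyc_mod K Cyclic YA" and th: "t : cmod_hom K Cyclic YA (const_cmod K)"
  using yext_ok_refl_YHom(2)[OF \<tau> t] by auto
 note \<alpha> = \<alpha>C_hom[OF X Y]
 let ?tr = "trace_functional K H A act M \<tau>"
 let ?\<gamma>0 = "%n x. \<lambda>a\<in>el Cy n. t n (\<alpha>C n a x)"
 have \<gamma>0: "?\<gamma>0 : cmod_hom K Cocyclic XC (dual_cmod K Cy)"
  by(rule transpose_hom[OF K.is_cring B.Cyc_cyclic X Y \<alpha> th])
 have one: "1[K] :> M" by simp
 \<comment> \<open>All morphisms in \<tau> agree with t on the carrier, so the choice in
   \<open>trace_functional\<close> has one possible value.\<close>
 have tr: "?tr c = t 0 (TA.cls 0 (A.tp [c] 1[K]))" if "c :> A" for c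
 proof -
  have "TA.cls 0 (A.tp [c] 1[K]) :> comp YA 0"
  by(rule lin_cl[OF cls_TA_lin A.T.tprod_closed[OF _ _ one]]) (use that in simp_all)
  thus ?thesis
  unfolding trace_functional_def using t yext_ok_refl_YHom(3)[OF \<tau>] by(intro some_equality) auto
 qed
 let ?spec = "%\<gamma>. \<gamma> : cmod_hom K Cocyclic XC (dual_cmod K Cy) \<and>
  (ALL hs as. hs :>* H & as :>* A & length as = Suc (length hs) -->
  \<gamma> (length hs) (TC.cls (length hs) (C.tp (1[H] # hs) 1[K])) (tprod_list K A as)
  = ?tr (foldl (monoid.mult A) (hd as) (map2 act hs (tl as))))"
 have s0: "?spec ?\<gamma>0"
 proof(rule conjI[OF \<gamma>0], intro allI impI)
  fix hs as assume *: "hs :>* H & as :>* A & length as = Suc (length hs)"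
  then obtain c bs where e: "as = c # bs" by(cases as) auto
  have cb: "c :> A" "length bs = length hs" "bs :>* A" "hs :>* H" using * by(simp_all add: e)
  have as: "length as = Suc (length hs)" "as :>* A" using * by simp_all
  have hs1: "length (1[H] # hs) = Suc (length hs)" "(1[H] # hs) :>* H" using cb by simp_all
  note tpc = C.T.tprod_closed[OF hs1 one]
  let ?r = "map2 act hs bs"
  have r: "?r :>* A" by(rule map2_act_closed[OF cb(4,3)])
  have lr: "length ?r = length hs" using cb(2) by simp
  have ac: "tprod_list K A as :> comp Cy (length hs)" unfolding B.Cyc_sel(1) by(rule B.tprod_list_closed[OF as])
  \<comment> \<open>The leading 1 of the coalgebra tensor acts trivially on the first algebra
    element; this is why the formula for \<gamma> begins with an untouched element.\<close>
  have "\<alpha>T (length hs) (tprod_list K A as) (C.tp (1[H] # hs) 1[K]) = A.tp (c # ?r) 1[K]"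
  unfolding \<alpha>T_tprod[OF as tpc] \<beta>_tprod[OF as hs1 one] by(simp add: e A.act_facts(3)[OF cb(1)])
  hence "?\<gamma>0 (length hs) (TC.cls (length hs) (C.tp (1[H] # hs) 1[K])) (tprod_list K A as) =
  t (length hs) (TA.cls (length hs) (A.tp (c # ?r) 1[K]))"
  using ac \<alpha>C_cls[OF ac[unfolded B.Cyc_sel(1)] tpc] by simp
  also have "... = t 0 (TA.cls 0 (A.tp [foldl (monoid.mult A) c ?r] 1[K]))"
  using trace_collapse[OF Y th cb(1) r] unfolding lr .
  also have "... = ?tr (foldl (monoid.mult A) (hd as) (map2 act hs (tl as)))"
  using tr[OF foldl_mult_closed[OF cb(1) r]] by(simp add: e)
  finally show "?\<gamma>0 (length hs) (TC.cls (length hs) (C.tp (1[H] # hs) 1[K])) (tprod_list K A as) = ..." .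
 qed
 have sc: "?spec (char_morphism K H A act M \<tau>)"
  unfolding char_morphism_def by(rule someI[where P="?spec", OF s0])
 thus c: "char_morphism K H A act M \<tau> : cmod_hom K Cocyclic XC (dual_cmod K Cy)" by(rule conjunct1)
 show "char_morphism K H A act M \<tau> n S a = t n (\<alpha>C n a S)" if S: "S :> comp XC n" and a: "a :> comp Cy n"
 proof -
  have "char_morphism K H A act M \<tau> n S a = ?\<gamma>0 n S a"
  proof(rule cocyclic_hom_unique[OF c \<gamma>0 _ S a[unfolded B.Cyc_sel(1)]])
  fix hs as assume "hs :>* H" "as :>* A" "length as = Suc (length hs)"
  hence i: "hs :>* H & as :>* A & length as = Suc (length hs)" by simp
  show "char_morphism K H A act M \<tau> (length hs) (TC.cls (length hs) (C.tp (1[H] # hs) 1[K])) (tprod_list K A as) =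
  ?\<gamma>0 (length hs) (TC.cls (length hs) (C.tp (1[H] # hs) 1[K])) (tprod_list K A as)"
  using conjunct2[OF sc, rule_format, OF i] conjunct2[OF s0, rule_format, OF i]
  by(rule trans[OF _ sym])
  qed
  thus ?thesis using a by simp
 qed
qed

end

theorem theorem2p10:
  fixes K :: "'k ring" and H :: "('k, 'h) hopf" and A :: "('k, 'a) module"
    and act :: "'h \<Rightarrow> 'a \<Rightarrow> 'a" and \<sigma> :: 'h and \<delta> :: "'h \<Rightarrow> 'k"
    and \<tau> :: "('k, ('k, 'a, 'k) tensor set set, 'k, 'w) yext set"
    and \<xi> :: "('k, 'k, ('k, 'h, 'k) tensor set set, 'e) yext set"
    and p :: nat
  defines "M \<equiv> k_sigma_delta K H \<sigma> \<delta>"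
  assumes "hopf_algebra K H"
    and "bij_betw (antipode H) (carrier H) (carrier H)"
    and "modular_pair_in_involution K H \<sigma> \<delta>"
    and "module_algebra K H A act"
    and "\<tau> \<in> HC_Hopf_alg K H A act M 0"
    and "\<xi> \<in> HC_Hopf_coalg K H H (mult H) M p"
    and "inj \<iota>" and "inj \<kappa>"
  shows "char_map \<iota> K H A act M \<tau> p \<xi> = cup \<kappa> K H H (mult H) A act act M p 0 \<xi> \<tau>"
proof -
 interpret char_setting K H \<sigma> \<delta> A act
  by(intro char_setting.intro hopf_pair.intro hopf_alg.intro hopf_pair_axioms.intro char_setting_axioms.intro assms(2-5))
 have \<tau>: "\<tau> : Ext K Cyclic 0 YA (const_cmod K)" using assms(6) by(simp add: HC_Hopf_alg_def M_def)
 have \<xi>: "\<xi> : Ext K Cocyclic p (const_cmod K) XC" using assms(7) by(simp add: HC_Hopf_coalg_def M_def)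
 have ok: "yext_ok K Cocyclic p (const_cmod K) XC e" if "e : \<xi>" for e
  using \<xi> that by(auto simp: Ext_def quotient_def yext_equiv_def Let_def)
 have eq: "HC_class K A p (yext_relabel \<iota> (char_map_rep K H A act M \<tau> e)) =
  HC_class K A (p + 0) (yext_relabel \<kappa> (cup_rep K H H (mult H) A act act M e f))"
  if e: "e : \<xi>" and f: "f : \<tau>" for e f
 proof -
  obtain t where t: "f = YHom t" "yext_ok K Cyclic 0 YA (const_cmod K) f" using yext_ok_refl_YHom(2)[OF \<tau> f] by blast
  have Y: "cyc_mod K Cyclic YA" and th: "t : cmod_hom K Cyclic YA (const_cmod K)" using t by auto
  \<comment> \<open>For p = 0 and for p > 0 alike, an admissible representative of \<xi> carries the
    statement that its coefficient object is cocyclic.\<close>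
  have X: "cyc_mod K Cocyclic XC" using ok[OF e] by(cases e) auto
  note c = char_morphism_eq[OF X \<tau> f[unfolded t(1)]]
  show ?thesis unfolding HC_class_def char_map_rep_def cup_rep_def Let_def t(1) M_def add_0_right
  by(rule representatives_equivalent[OF hopf_facts(1) B.Cyc_cyclic X Y \<alpha>C_hom[OF X Y] th c ok[OF e] assms(8,9)])
 qed
 \<comment> \<open>The union over \<tau> in \<open>cup\<close> is constant; that \<tau> is inhabited
   makes it equal to its common value rather than empty.\<close>
 obtain f where f: "f : \<tau>" using yext_ok_refl_YHom(1)[OF \<tau>] by blast
 have "(\<Union>f\<in>\<tau>. HC_class K A (p + 0) (yext_relabel \<kappa> (cup_rep K H H (mult H) A act act M e f))) =
  HC_class K A p (yext_relabel \<iota> (char_map_rep K H A act M \<tau> e))" if e: "e : \<xi>" for e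
 proof -
  have "(\<Union>f\<in>\<tau>. HC_class K A (p + 0) (yext_relabel \<kappa> (cup_rep K H H (mult H) A act act M e f))) =
  (\<Union>f\<in>\<tau>. HC_class K A p (yext_relabel \<iota> (char_map_rep K H A act M \<tau> e)))"
  by(rule SUP_cong[OF refl], rule eq[OF e, symmetric])
  thus ?thesis using f by auto
 qed
 thus ?thesis unfolding char_map_def cup_def by(intro SUP_cong[OF refl]) (rule sym)
qed

end
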